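(* Let $w\in C^2([-2,2])$, $\eta>0$, $\mu>0$, $f\in L^2(-1,1)$ and $0<\beta\le\alpha\le2\beta$. Let $$E_1(v)=\alpha\,\sharp(S_v)+\beta\,\sharp(S_{\dot v}\setminus S_v)+\int_{-1}^1\big(\eta|\ddot v|^2-fv\big)\,dx+\mu\int_{-1}^1|v-w|^2\,dx,$$ $$K=\{v\in\mathbf{H}^2(-2,2):\ v\ge w\text{ on }[-1,1],\ v=w\text{ on }(-2,-1)\cup(1,2)\}.$$ Every minimizer $u$ of $E_1$ over $K$ satisfies the variational inequality $$u\in K,\qquad \int_{(-1,1)\setminus(S_u\cup S_{\dot u})}\big(\eta u''''+\mu(u-w)-f/2\big)\,(u-v)\le0\qquad\forall v\in K,$$ together with the following conditions. Bilateral conditions away from contact: (a) $\ddot u^+=\ddot u^-=0$ and $\dddot u^+=\dddot u^-=0$ on $(S_u\setminus\{\pm1\})\cap\{u^+>w\}\cap\{u^->w\}$; (b) $\ddot u^+=\ddot u^-=[\dddot u]=0$ on $\big(S_{\dot u}\setminus(S_u\cup\{\pm1\})\big)\cap\{u^+>w\}\cap\{u^->w\}$; (c) $\ddot u\in H^2\big((-1,1)\setminus\{u^+=w\text{ or }u^-=w\}\big)$ and $\eta(\ddot u)''+\mu(u-w)=f/2$ in $\mathcal{D}'\big((-1,1)\setminus\{u^+=w\text{ or }u^-=w\}\big)$; (d) $\ddot u^+(-1)=\dddot u^+(-1)=0$ if $-1\notin S_{\dot u}\setminus S_u$ and $u^+(-1)>w(-1)$; $\ddot u^-(1)=\dddot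 u^-(1)=0$ if $1\notin S_{\dot u}\setminus S_u$ and $u^-(1)>w(1)$; (e) $\ddot u^+(-1)=0$ if $-1\in S_{\dot u}\setminus S_u$ and $u^+(-1)>w(-1)$; $\ddot u^-(1)=0$ if $1\in S_{\dot u}\setminus S_u$ and $u^-(1)>w(1)$; (f) if $\alpha=\beta$, then: $\dddot u^+=\dddot u^-=0$ on $\big((S_u\cup S_{\dot u})\setminus\{\pm1\}\big)\cap\{u^+>w\}\cap\{u^->w\}$; $\dddot u^+(-1)=0$ if $-1\in S_u\cup S_{\dot u}$ and $u^+(-1)>w(-1)$; $\dddot u^-(1)=0$ if $1\in S_u\cup S_{\dot u}$ and $u^-(1)>w(1)$. Unilateral conditions at contact: (g) $\ddot u^+\ge0$ on $\big((S_u\cup S_{\dot u})\setminus\{1\}\big)\cap\{u^+=w\}$; (h) $\ddot u^-\ge0$ on $\big((S_u\cup S_{\dot u})\setminus\{-1\}\big)\cap\{u^-=w\}$.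
   Context: $\mathbf{H}^2(-2,2)$ is the set of functions $v:(-2,2)\to\mathbb{R}$ that are piecewise $H^2$, i.e. made of finitely many $H^2$ pieces: there is a finite partition $-2=s_0<\dots<s_n=2$ with $v\in H^2(s_{i-1},s_i)$ for each $i$. $\dot v$ is the absolutely continuous part of the distributional derivative $v'$, $\ddot v$ is the absolutely continuous part of $(\dot v)'$, and $\dddot v$ is the absolutely continuous part of $(\ddot v)'$; $S_v$ and $S_{\dot v}$ are the sets of discontinuity points of $v$ and $\dot v$ in $(-2,2)$ (possibly including the points $\pm1$); $\sharp$ is the counting measure. Superscripts $+$ and $-$ denote right and left limits, and $[z]=z^+-z^-$. The constraint "$v\ge w$ on $[-1,1]$" means: $v(x)\ge w(x)$ for $x\in[-1,1]\setminus S_v$; $v^+(x)\ge w(x)$ for $x\in S_v\cup\{-1\}$; $v^-(x)\ge w(x)$ for $x\in S_v\cup\{1\}$. In the variational inequality $u''''$ is the fourth distributional derivative of $u$ on the open set $(-1,1)\setminus(S_u\cup S_{\dot u})$; the expression $\eta u''''+\mu(u-w)-f/2$ is a measure on that set and the integral is with respect to this measure, with either one-sided value of $v$ allowed at its jump points. Conditions (d)–(f) at $\pm1$ and (g), (h) involve only the indicated one-sided traces.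
   Formalization: In (c), ü∈H² of the non-contact set is taken to mean ü and its second weak derivative are in L² of the whole set, while the first weak derivative is in L² of each connected component; its square integrability over the whole set can fail when contact points accumulate at ±1. *)

theory Defs
  imports "HOL-Analysis.Analysis"
begin

text \<open>
  Elements of the function spaces are Lebesgue classes.  A class is given by any of its
  representatives \<open>real \<Rightarrow> real\<close> (values outside the domain are irrelevant), and every notion below
  is invariant under changes on null sets; in particular limits and discontinuities are essential
  ones, so that for a piecewise continuous representative they are its ordinary one-sided limits
  and jumps.
\<close>

section \<open>Essential limits\<close>

definition ess_at :: "real \<Rightarrow> real filter"
  where "ess_at x = inf (at x) (ae_filter lebesgue)"

definition ess_at_right :: "real \<Rightarrow> real filter"
  where "ess_at_right x = inf (at_right x) (ae_filter lebesgue)"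

definition ess_at_left :: "real \<Rightarrow> real filter"
  where "ess_at_left x = inf (at_left x) (ae_filter lebesgue)"

definition has_rtrace :: "(real \<Rightarrow> real) \<Rightarrow> real \<Rightarrow> real \<Rightarrow> bool"
  where "has_rtrace v x l \<longleftrightarrow> (v \<longlongrightarrow> l) (ess_at_right x)"

definition has_ltrace :: "(real \<Rightarrow> real) \<Rightarrow> real \<Rightarrow> real \<Rightarrow> bool"
  where "has_ltrace v x l \<longleftrightarrow> (v \<longlongrightarrow> l) (ess_at_left x)"

text \<open>
  The values \<open>v\<^sup>+(x)\<close>, \<open>v\<^sup>-(x)\<close>, and the value at \<open>x\<close> of the continuous representative; used only
  for functions for which the limits in question exist.
\<close>

definition rtrace :: "(real \<Rightarrow> real) \<Rightarrow> real \<Rightarrow> real"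
  where "rtrace v x = Lim (ess_at_right x) v"

definition ltrace :: "(real \<Rightarrow> real) \<Rightarrow> real \<Rightarrow> real"
  where "ltrace v x = Lim (ess_at_left x) v"

definition ess_value :: "(real \<Rightarrow> real) \<Rightarrow> real \<Rightarrow> real"
  where "ess_value v x = Lim (ess_at x) v"

definition disc :: "(real \<Rightarrow> real) \<Rightarrow> real set"
  where "disc v = {x \<in> {-2<..<2}. \<not> (\<exists>l. (v \<longlongrightarrow> l) (ess_at x))}"


section \<open>Distributional derivatives and Sobolev functions\<close>

definition test_fun :: "real set \<Rightarrow> (real \<Rightarrow> real) \<Rightarrow> bool"
  where "test_fun U \<phi> \<longleftrightarrow>
    (\<forall>n x. (deriv ^^ n) \<phi> field_differentiable at x) \<and>
    (\<exists>C. compact C \<and> C \<subseteq> U \<and> (\<forall>x. x \<notin> C \<longrightarrow> \<phi> x = 0))"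

definition L2_on :: "real set \<Rightarrow> (real \<Rightarrow> real) \<Rightarrow> bool"
  where "L2_on U v \<longleftrightarrow>
    set_borel_measurable lebesgue U v \<and> set_integrable lebesgue U (\<lambda>x. (v x)\<^sup>2)"

definition loc_integrable_on :: "real set \<Rightarrow> (real \<Rightarrow> real) \<Rightarrow> bool"
  where "loc_integrable_on U v \<longleftrightarrow> (\<forall>C. compact C \<and> C \<subseteq> U \<longrightarrow> set_integrable lebesgue C v)"

definition weak_deriv :: "real set \<Rightarrow> (real \<Rightarrow> real) \<Rightarrow> (real \<Rightarrow> real) \<Rightarrow> bool"
  where "weak_deriv U v g \<longleftrightarrow> loc_integrable_on U v \<and> loc_integrable_on U g \<and>
    (\<forall>\<phi>. test_fun U \<phi> \<longrightarrow>
      (LINT x:U|lebesgue. v x * deriv \<phi> x) = - (LINT x:U|lebesgue. g x * \<phi> x))"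

text \<open>
  \<open>H\<^sup>2(U)\<close> for open \<open>U\<close>.  On an interval this is verbatim the usual definition
  \<open>v, v', v'' \<in> L\<^sup>2(U)\<close>.  On a bounded open set it is the Sobolev space defined by
  \<open>v, v'' \<in> L\<^sup>2(U)\<close> (the \<open>W\<^sup>l\<^sub>p = L\<^sup>l\<^sub>p \<inter> L\<^sub>p\<close> convention of Maz'ya and Burenkov), since then
  \<open>v'\<close> is automatically square integrable on every component.  Only if \<open>U\<close> has infinitely many
  components is this weaker than the convention that also asks for \<open>v' \<in> L\<^sup>2(U)\<close>.  The set
  on which a minimizer detaches from the obstacle can have infinitely many components,
  accumulating at \<open>-1\<close> or \<open>1\<close>, and there the third derivative of a minimizer need not be square
  integrable over the whole set, because the obstacle is only \<open>C\<^sup>2\<close>.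
\<close>

definition H2_on :: "real set \<Rightarrow> (real \<Rightarrow> real) \<Rightarrow> bool"
  where "H2_on U v \<longleftrightarrow> (\<exists>g h. weak_deriv U v g \<and> weak_deriv U g h \<and>
    L2_on U v \<and> (\<forall>I \<in> components U. L2_on I g) \<and> L2_on U h)"

definition piecewise_H2 :: "(real \<Rightarrow> real) \<Rightarrow> bool"
  where "piecewise_H2 v \<longleftrightarrow> (\<exists>(n::nat) s. s 0 = -2 \<and> s n = 2 \<and>
    (\<forall>i<n. s i < s (Suc i) \<and> H2_on {s i<..<s (Suc i)} v))"

definition C2_on_Icc :: "real \<Rightarrow> real \<Rightarrow> (real \<Rightarrow> real) \<Rightarrow> bool"
  where "C2_on_Icc a b w \<longleftrightarrow> (\<exists>w' w''.
    (\<forall>x\<in>{a..b}. (w has_real_derivative w' x) (at x within {a..b})) \<and>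
    (\<forall>x\<in>{a..b}. (w' has_real_derivative w'' x) (at x within {a..b})) \<and>
    continuous_on {a..b} w'')"


section \<open>Signed Radon measures\<close>

text \<open>
  A signed Radon measure on an open set \<open>U\<close> is written as the difference \<open>M - N\<close> of two Borel
  measures that are finite on compact subsets of \<open>U\<close>; what \<open>M\<close> and \<open>N\<close> do outside \<open>U\<close> is irrelevant.
\<close>

definition radon_on :: "real set \<Rightarrow> real measure \<Rightarrow> bool"
  where "radon_on U M \<longleftrightarrow> sets M = sets borel \<and>
    (\<forall>C. compact C \<and> C \<subseteq> U \<longrightarrow> emeasure M C < \<infinity>)"

definition singular_on :: "real set \<Rightarrow> real measure \<Rightarrow> real measure \<Rightarrow> bool"
  where "singular_on U M N \<longleftrightarrow>
    (\<exists>Z \<in> sets borel. emeasure M (U \<inter> Z) = 0 \<and> emeasure N (U - Z) = 0)"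

text \<open>
  \<open>\<integral>\<^sub>U h d(M - N)\<close> for mutually singular \<open>M\<close>, \<open>N\<close>, as positive part minus negative part
  (\<^term>\<open>ennreal\<close> sends negative reals to \<open>0\<close>).  The masses may be infinite near the boundary of
  \<open>U\<close>, so the value \<open>-\<infinity>\<close> can occur.  As \<open>\<infinity> - \<infinity> = \<infinity>\<close> in \<^typ>\<open>ereal\<close>, the statement that the
  integral is \<open>\<le> 0\<close> entails that the positive part is finite, i.e. that the integral is well
  defined.
\<close>

definition signed_integral ::
    "real set \<Rightarrow> real measure \<Rightarrow> real measure \<Rightarrow> (real \<Rightarrow> real) \<Rightarrow> ereal"
  where "signed_integral U M N h =
    enn2ereal ((\<integral>\<^sup>+x\<in>U. ennreal (h x) \<partial>M) + (\<integral>\<^sup>+x\<in>U. ennreal (- h x) \<partial>N)) -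
    enn2ereal ((\<integral>\<^sup>+x\<in>U. ennreal (- h x) \<partial>M) + (\<integral>\<^sup>+x\<in>U. ennreal (h x) \<partial>N))"

text \<open>
  The distributional derivative of \<open>v\<close> on \<open>U\<close> is a signed Radon measure
  \<open>g dx + (M - N)\<close>, with \<open>M\<close> and \<open>N\<close> singular to Lebesgue measure.
\<close>

definition ac_part_on :: "real set \<Rightarrow> (real \<Rightarrow> real) \<Rightarrow> (real \<Rightarrow> real) \<Rightarrow> bool"
  where "ac_part_on U v g \<longleftrightarrow> loc_integrable_on U v \<and> loc_integrable_on U g \<and>
    (\<exists>M N. radon_on U M \<and> radon_on U N \<and>
      singular_on U lborel M \<and> singular_on U lborel N \<and>
      (\<forall>\<phi>. test_fun U \<phi> \<longrightarrow>
        - (LINT x:U|lebesgue. v x * deriv \<phi> x) =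
          (LINT x:U|lebesgue. g x * \<phi> x) + (LINT x:U|M. \<phi> x) - (LINT x:U|N. \<phi> x)))"

text \<open>
  The absolutely continuous part of \<open>v'\<close>, taken on every open subset of \<open>(-2,2)\<close> on which \<open>v'\<close>
  is a measure.  The localisation matters for the third derivative: the derivative of the second
  one need not be a measure on all of \<open>(-2,2)\<close>, e.g. where the function coincides with \<open>w\<close>.
  The function is determined up to null sets wherever \<open>v'\<close> is a measure.
\<close>

definition ac_deriv :: "(real \<Rightarrow> real) \<Rightarrow> real \<Rightarrow> real"
  where "ac_deriv v = (SOME g. \<forall>U. open U \<and> U \<subseteq> {-2<..<2} \<and> (\<exists>h. ac_part_on U v h)
    \<longrightarrow> ac_part_on U v g)"

abbreviation D1 :: "(real \<Rightarrow> real) \<Rightarrow> real \<Rightarrow> real"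
  where "D1 v \<equiv> ac_deriv v"

abbreviation D2 :: "(real \<Rightarrow> real) \<Rightarrow> real \<Rightarrow> real"
  where "D2 v \<equiv> ac_deriv (ac_deriv v)"

abbreviation D3 :: "(real \<Rightarrow> real) \<Rightarrow> real \<Rightarrow> real"
  where "D3 v \<equiv> ac_deriv (ac_deriv (ac_deriv v))"


section \<open>The obstacle problem\<close>

definition E1 ::
    "real \<Rightarrow> real \<Rightarrow> real \<Rightarrow> real \<Rightarrow> (real \<Rightarrow> real) \<Rightarrow> (real \<Rightarrow> real) \<Rightarrow> (real \<Rightarrow> real) \<Rightarrow> real"
  where "E1 \<alpha> \<beta> \<eta> \<mu> f w v =
    \<alpha> * real (card (disc v)) + \<beta> * real (card (disc (D1 v) - disc v)) +
    (LINT x:{-1<..<1}|lebesgue. \<eta> * (D2 v x)\<^sup>2 - f x * v x) +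
    \<mu> * (LINT x:{-1<..<1}|lebesgue. (v x - w x)\<^sup>2)"

definition above_obstacle :: "(real \<Rightarrow> real) \<Rightarrow> (real \<Rightarrow> real) \<Rightarrow> bool"
  where "above_obstacle w v \<longleftrightarrow>
    (\<forall>x \<in> {-1..1} - disc v. ess_value v x \<ge> w x) \<and>
    (\<forall>x \<in> disc v \<union> {-1}. rtrace v x \<ge> w x) \<and>
    (\<forall>x \<in> disc v \<union> {1}. ltrace v x \<ge> w x)"

definition K :: "(real \<Rightarrow> real) \<Rightarrow> (real \<Rightarrow> real) set"
  where "K w = {v. piecewise_H2 v \<and> above_obstacle w v \<and>
    (AE x in lebesgue. x \<in> {-2<..<-1} \<union> {1<..<2} \<longrightarrow> v x = w x)}"

text \<open>
  On \<open>\<Omega>\<close>, the distribution \<open>\<eta> u'''' + \<mu> (u - w) - f/2\<close> is the signed Radon measure \<open>M - N\<close>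
  (in its Jordan decomposition), and its integral against \<open>u - v\<close> is nonpositive whichever of the
  one-sided values of \<open>v\<close> is used at each point (the choice only matters at the jumps of \<open>v\<close>).
  Since \<open>u\<close> does not jump on \<open>\<Omega>\<close>, \<open>ess_value u\<close> is its continuous representative there.
\<close>

definition variational_inequality ::
    "real \<Rightarrow> real \<Rightarrow> (real \<Rightarrow> real) \<Rightarrow> (real \<Rightarrow> real) \<Rightarrow> (real \<Rightarrow> real) \<Rightarrow> bool"
  where "variational_inequality \<eta> \<mu> f w u \<longleftrightarrow>
    (let \<Omega> = {-1<..<1} - (disc u \<union> disc (D1 u)) in
      \<exists>M N. radon_on \<Omega> M \<and> radon_on \<Omega> N \<and> singular_on \<Omega> M N \<and>
        (\<forall>\<phi>. test_fun \<Omega> \<phi> \<longrightarrow>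
          (LINT x:\<Omega>|lebesgue. \<eta> * u x * (deriv ^^ 4) \<phi> x + (\<mu> * (u x - w x) - f x / 2) * \<phi> x) =
          (LINT x:\<Omega>|M. \<phi> x) - (LINT x:\<Omega>|N. \<phi> x)) \<and>
        (\<forall>v \<in> K w. \<forall>v'. (\<forall>x\<in>\<Omega>. v' x = rtrace v x \<or> v' x = ltrace v x) \<longrightarrow>
          signed_integral \<Omega> M N (\<lambda>x. ess_value u x - v' x) \<le> 0))"

definition noncontact :: "(real \<Rightarrow> real) \<Rightarrow> (real \<Rightarrow> real) \<Rightarrow> real set"
  where "noncontact w u = {-1<..<1} - {x. rtrace u x = w x \<or> ltrace u x = w x}"

end

theory Submission
  imports Defs
begin

text \<open>
  For \<open>x \<in> [-1,1]\<close> and \<open>\<theta> \<in> L\<^sup>2(-1,1)\<close> the competitor \<open>u + t\<psi>\<close> is used, where \<open>\<psi>'' = \<theta>\<close> off \<open>x\<close> and \<open>\<psi>\<close>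
  may jump at \<open>x\<close> in value and slope; it vanishes outside \<open>(-1,1)\<close> and pays no additional jump
  energy when \<open>u\<close> already jumps at \<open>x\<close> appropriately.  Integrating by parts twice, minimality says
  that \<open>g\<^sub>x(s) = g(s) - K\<^sub>2(x) - K\<^sub>1(x) (s - x)\<close> has a nonnegative integral against every admissible \<open>\<theta>\<close>, where
  \<open>g = \<eta> u'' + K\<^sub>2\<close>, \<open>K\<^sub>2' = K\<^sub>1\<close> and \<open>K\<^sub>1' = \<mu> (u - w) - f/2\<close>.

  Off the contact set both signs of \<open>t\<close> are allowed, so \<open>g\<^sub>x\<close> is orthogonal to all \<open>\<theta>\<close> satisfying the
  linear constraints that keep the jump energy: it is \<open>0\<close>, linear, or affine, and this is the
  equation together with the natural boundary conditions.  In general hat functions \<open>\<psi> \<ge> 0\<close>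
  show that \<open>g\<close> is convex on \<open>(-1,1)\<close>.  Hence \<open>u''\<close> has one-sided limits even at contact points,
  where a bump \<open>\<theta>\<close> around a jump point shows that they are nonnegative, and \<open>\<eta> u'''' + \<mu> (u - w) - f/2\<close>
  is a positive measure, the distributional derivative of the monotone function \<open>g'\<close>, carried by the
  contact set; there \<open>u = w \<le> v\<close>.  At \<open>\<plusminus>1\<close> the function \<open>u\<close> matches \<open>w\<close> to first order from
  outside, so a jump of the slope in contact makes \<open>u - w\<close> grow linearly and the slope is free.
\<close>

section \<open>Test functions\<close>

text \<open>A minimizer is only piecewise \<open>H^2\<close>: \<open>u''\<close> is an L2 class
  without traces, and no fourth derivative is available. The lower-order term is therefore
  integrated up to the level of \<open>u''\<close>, so that every condition becomes an
  almost-everywhere statement about the L2 function \<open>g\<close>; traces appear only after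
  \<open>g\<close> has been identified with a continuous function. The affine function subtracted in
  \<open>gx\<close> is the Taylor polynomial of \<open>K2\<close> at x, left over by the jumps of
  the competitor. A jump costs a fixed amount whatever its size, so only competitors that jump where
  \<open>u\<close> already pays enough can be compared: value and slope are free where the value
  jumps, only the slope where the slope alone jumps, unless \<alpha> = \<beta>. The slope jump is
  minus the integral of \<theta> and the value jump is its first moment about x, so each freedom
  removes one linear constraint on \<theta>; this is all that distinguishes the equation from (a)
  and (b). Since \<open>ac_deriv\<close> is defined by choice and all notions are essential ones,
  uniqueness of the absolutely continuous part has to come before any computation.\<close>

definition smooth :: "(real \<Rightarrow> real) \<Rightarrow> bool"
  where "smooth f \<longleftrightarrow> (\<forall>n x. (deriv ^^ n) f field_differentiable at x)"

lemma smooth_deriv: "smooth f \<Longrightarrow> smooth (deriv f)"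
  unfolding smooth_def by (metis funpow_Suc_right comp_apply)

lemma smooth_has_deriv: "smooth f \<Longrightarrow> (f has_real_derivative deriv f x) (at x)"
  unfolding smooth_def by (metis funpow_0 field_differentiable_derivI)

lemma smooth_continuous: "smooth f \<Longrightarrow> continuous_on S f"
  by (meson DERIV_continuous_on has_field_derivative_at_within smooth_has_deriv)

text \<open>If every member of a class has a derivative in the class, then iterating
  \<open>deriv\<close> never leaves it. Exhibiting such a class replaces a formula for the n-th
  derivative in the smoothness proofs below.\<close>

lemma smooth_coinduct:
  assumes "P f" and "\<And>f. P f \<Longrightarrow> (\<exists>g. P g \<and> (\<forall>x. (f has_real_derivative g x) (at x)))"
  shows "smooth f"
proof -
  have D: "P (deriv f)" if "P f" for f
  proof -
    obtain g where g: "P g" "\<forall>x. (f has_real_derivative g x) (at x)"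
      using assms(2) \<open>P f\<close> by blast
    then have "deriv f = g" by (auto intro!: ext DERIV_imp_deriv)
    with g show ?thesis by simp
  qed
  have "P ((deriv ^^ n) f)" for n
    by (induction n) (auto intro: D assms(1))
  then show ?thesis
    unfolding smooth_def using assms(2) field_differentiable_def by blast
qed

lemma smooth_antideriv:
  assumes "smooth g" "\<And>x. (f has_real_derivative g x) (at x)"
  shows "smooth f"
proof (rule smooth_coinduct[where P = "\<lambda>h. h = f \<or> smooth h"])
  fix h assume "h = f \<or> smooth h"
  then show "\<exists>g. (g = f \<or> smooth g) \<and> (\<forall>x. (h has_real_derivative g x) (at x))"
    using assms smooth_deriv smooth_has_deriv by blast
qed auto

lemma smooth_affine: "smooth f \<Longrightarrow> smooth (\<lambda>x. c * f (a * x + b))"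
proof (rule smooth_coinduct[where P = "\<lambda>h. \<exists>c f. smooth f \<and> h = (\<lambda>x. c * f (a * x + b))"])
  fix h assume "\<exists>c f. smooth f \<and> h = (\<lambda>x. c * f (a * x + b))"
  then obtain c f where f: "smooth f" "h = (\<lambda>x. c * f (a * x + b))" by blast
  have "(h has_real_derivative (c * a) * deriv f (a * x + b)) (at x)" for x
  proof -
    have 1: "((\<lambda>x. a * x + b) has_real_derivative a) (at x)"
      by (auto intro!: derivative_eq_intros)
    show ?thesis
      unfolding f(2) using DERIV_cmult[OF DERIV_chain2[OF smooth_has_deriv[OF f(1)] 1], of c]
      by (simp add: mult_ac)
  qed
  then show "\<exists>g. (\<exists>c f. smooth f \<and> g = (\<lambda>x. c * f (a * x + b))) \<and>
      (\<forall>x. (h has_real_derivative g x) (at x))"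
    using smooth_deriv[OF f(1)] by blast
qed blast

text \<open>The Leibniz rule turns a product into a sum of products, so products alone are not a
  class closed under differentiation; the algebra generated by the smooth functions is.\<close>

inductive smooth_alg :: "(real \<Rightarrow> real) \<Rightarrow> bool" where
  base: "smooth f \<Longrightarrow> smooth_alg f"
| add: "smooth_alg f \<Longrightarrow> smooth_alg g \<Longrightarrow> smooth_alg (\<lambda>x. f x + g x)"
| mult: "smooth_alg f \<Longrightarrow> smooth_alg g \<Longrightarrow> smooth_alg (\<lambda>x. f x * g x)"

lemma smooth_alg_deriv:
  "smooth_alg f \<Longrightarrow> \<exists>g. smooth_alg g \<and> (\<forall>x. (f has_real_derivative g x) (at x))"
proof (induction rule: smooth_alg.induct)
  case (base f)
  then show ?case using smooth_alg.base smooth_deriv smooth_has_deriv by blast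
next
  case (add f g)
  then obtain f' g' where "smooth_alg f'" "\<forall>x. (f has_real_derivative f' x) (at x)"
    "smooth_alg g'" "\<forall>x. (g has_real_derivative g' x) (at x)" by blast
  then show ?case
    by (intro exI[of _ "\<lambda>x. f' x + g' x"]) (auto intro: smooth_alg.add DERIV_add)
next
  case (mult f g)
  then obtain f' g' where *: "smooth_alg f'" "\<And>x. (f has_real_derivative f' x) (at x)"
    "smooth_alg g'" "\<And>x. (g has_real_derivative g' x) (at x)" by blast
  show ?case
    by (intro exI[of _ "\<lambda>x. f' x * g x + g' x * f x"] conjI allI smooth_alg.add smooth_alg.mult
        * DERIV_mult mult.hyps)
qed

lemma smooth_alg_smooth: "smooth_alg f \<Longrightarrow> smooth f"
  by (rule smooth_coinduct[where P = smooth_alg]) (auto intro: smooth_alg_deriv)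

lemma smooth_add: "smooth f \<Longrightarrow> smooth g \<Longrightarrow> smooth (\<lambda>x. f x + g x)"
  and smooth_mult: "smooth f \<Longrightarrow> smooth g \<Longrightarrow> smooth (\<lambda>x. f x * g x)"
  by (auto intro: smooth_alg_smooth smooth_alg.intros)

lemma smooth_cmult: "smooth f \<Longrightarrow> smooth (\<lambda>x. c * f x)"
  using smooth_affine[of f c 1 0] by simp

text \<open>The polynomial factor in 1/x makes the family closed under differentiation;
  \<open>exp_bump 1\<close> is the classical function exp(-1/x), flat at 0.\<close>

definition exp_bump :: "real poly \<Rightarrow> real \<Rightarrow> real"
  where "exp_bump p x = (if x > 0 then poly p (1 / x) * exp (- 1 / x) else 0)"

lemma poly_exp_tendsto_0:
  "((\<lambda>x. poly p (1 / x) * exp (- 1 / x)) \<longlongrightarrow> 0) (at_right (0::real))"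
proof -
  have *: "((\<lambda>y. poly p y * exp (- y)) \<longlongrightarrow> 0) at_top" for p :: "real poly"
  proof (induction p)
    case (pCons a p)
    have 1: "((\<lambda>y. y ^ 1 / exp y) \<longlongrightarrow> 0) (at_top :: real filter)"
      by (rule tendsto_power_div_exp_0)
    have mon: "((\<lambda>y. y ^ n / exp y) \<longlongrightarrow> 0) (at_top :: real filter)" for n
      by (rule tendsto_power_div_exp_0)
    have "((\<lambda>y. \<Sum>i\<le>degree (pCons a p). coeff (pCons a p) i * (y ^ i / exp y)) \<longlongrightarrow>
        (\<Sum>i\<le>degree (pCons a p). coeff (pCons a p) i * 0)) at_top"
      by (intro tendsto_sum tendsto_mult tendsto_const mon)
    then show ?case
      by (simp add: poly_altdef exp_minus divide_inverse sum_distrib_right mult.assoc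
          del: coeff_pCons_Suc degree_pCons_eq_if)
  qed auto
  have "filterlim (\<lambda>x::real. 1 / x) at_top (at_right 0)"
    by (simp add: divide_inverse filterlim_inverse_at_top_right)
  from filterlim_compose[OF *[of p] this] show ?thesis by simp
qed

lemma exp_bump_deriv:
  "(exp_bump p has_real_derivative exp_bump (monom 1 2 * (p - pderiv p)) x) (at x)"
proof (cases x "0::real" rule: linorder_cases)
  case less
  have "(exp_bump p has_real_derivative 0) (at x)"
    by (rule has_field_derivative_transform_within_open[where f = "\<lambda>_. 0" and S = "{..<0}"])
      (use less in \<open>auto simp: exp_bump_def\<close>)
  then show ?thesis using less by (simp add: exp_bump_def)
next
  case equal
  have "((\<lambda>h. (exp_bump p (0 + h) - exp_bump p 0) / h) \<longlongrightarrow> 0) (at 0)"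
  proof (rule filterlim_split_at_real)
    show "((\<lambda>h. (exp_bump p (0 + h) - exp_bump p 0) / h) \<longlongrightarrow> 0) (at_left 0)"
      by (rule tendsto_eventually, rule eventually_at_leftI[of "-1"]) (auto simp: exp_bump_def)
    show "((\<lambda>h. (exp_bump p (0 + h) - exp_bump p 0) / h) \<longlongrightarrow> 0) (at_right 0)"
    \<comment> \<open>Dividing by x multiplies the polynomial in 1/x by the monomial X, so the
      difference quotient at 0 is of the same type and tends to 0.\<close>
    proof (rule Lim_transform_eventually[OF poly_exp_tendsto_0[of "monom 1 1 * p"]])
      show "\<forall>\<^sub>F x in at_right 0. poly (monom 1 1 * p) (1 / x) * exp (- 1 / x) =
          (exp_bump p (0 + x) - exp_bump p 0) / x"
        by (rule eventually_at_rightI[of 0 1]) (simp_all add: exp_bump_def poly_monom)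
    qed
  qed
  then show ?thesis
    using equal by (simp add: DERIV_def exp_bump_def)
next
  case greater
  have 1: "((\<lambda>x::real. 1 / x) has_real_derivative - (1 / x\<^sup>2)) (at x)"
    "((\<lambda>x::real. - 1 / x) has_real_derivative 1 / x\<^sup>2) (at x)"
    using greater by (auto intro!: derivative_eq_intros simp: power2_eq_square)
  have "((\<lambda>x. poly p (1 / x) * exp (- 1 / x)) has_real_derivative
      poly (pderiv p) (1 / x) * - (1 / x\<^sup>2) * exp (- 1 / x) +
      (exp (- 1 / x) * (1 / x\<^sup>2)) * poly p (1 / x)) (at x)"
    by (intro DERIV_mult DERIV_chain2[OF poly_DERIV 1(1)] DERIV_chain2[OF DERIV_exp 1(2)])
  moreover have "poly (pderiv p) (1 / x) * - (1 / x\<^sup>2) * exp (- 1 / x) +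
      (exp (- 1 / x) * (1 / x\<^sup>2)) * poly p (1 / x) =
      (1 / x)\<^sup>2 * (poly p (1 / x) - poly (pderiv p) (1 / x)) * exp (- 1 / x)"
    unfolding power_one_over by algebra
  ultimately have "((\<lambda>x. poly p (1 / x) * exp (- 1 / x)) has_real_derivative
      exp_bump (monom 1 2 * (p - pderiv p)) x) (at x)"
    using greater by (simp only: exp_bump_def poly_mult poly_diff poly_monom if_True mult_1)
  then show ?thesis
    by (rule has_field_derivative_transform_within_open[where S = "{0<..}"])
      (use greater in \<open>auto simp: exp_bump_def\<close>)
qed

lemma smooth_exp_bump: "smooth (exp_bump p)"
  by (rule smooth_coinduct[where P = "\<lambda>f. \<exists>p. f = exp_bump p"]) (use exp_bump_deriv in blast)+

lemma test_fun_iff: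
  "test_fun U \<phi> \<longleftrightarrow> smooth \<phi> \<and> (\<exists>C. compact C \<and> C \<subseteq> U \<and> (\<forall>x. x \<notin> C \<longrightarrow> \<phi> x = 0))"
  by (simp add: test_fun_def smooth_def)

lemma test_fun_smooth: "test_fun U \<phi> \<Longrightarrow> smooth \<phi>"
  by (simp add: test_fun_iff)

lemma test_fun_mono: "test_fun U \<phi> \<Longrightarrow> U \<subseteq> V \<Longrightarrow> test_fun V \<phi>"
  unfolding test_fun_def by blast

lemma deriv_zero_outside:
  fixes \<phi> :: "real \<Rightarrow> real"
  assumes "closed C" "\<forall>x. x \<notin> C \<longrightarrow> \<phi> x = 0" "x \<notin> C"
  shows "deriv \<phi> x = 0"
proof -
  have "(\<phi> has_real_derivative 0) (at x)"
    by (rule has_field_derivative_transform_within_open[where f = "\<lambda>_. 0" and S = "- C"])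
      (use assms in auto)
  then show ?thesis by (rule DERIV_imp_deriv)
qed

lemma test_fun_deriv: "test_fun U \<phi> \<Longrightarrow> test_fun U (deriv \<phi>)"
  unfolding test_fun_iff using deriv_zero_outside[OF compact_imp_closed] smooth_deriv by blast

lemma test_fun_eq_0: "test_fun U \<phi> \<Longrightarrow> x \<notin> U \<Longrightarrow> \<phi> x = 0"
  unfolding test_fun_def by blast

lemma test_fun_add: "test_fun U \<phi> \<Longrightarrow> test_fun U \<psi> \<Longrightarrow> test_fun U (\<lambda>x. \<phi> x + \<psi> x)"
proof -
  assume "test_fun U \<phi>" "test_fun U \<psi>"
  then obtain C D where "compact C" "C \<subseteq> U" "\<forall>x. x \<notin> C \<longrightarrow> \<phi> x = 0" "smooth \<phi>"
    "compact D" "D \<subseteq> U" "\<forall>x. x \<notin> D \<longrightarrow> \<psi> x = 0" "smooth \<psi>"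
    unfolding test_fun_iff by blast
  then show ?thesis
    unfolding test_fun_iff by (intro conjI exI[of _ "C \<union> D"]) (auto intro: smooth_add)
qed

lemma test_fun_cmult: "test_fun U \<phi> \<Longrightarrow> test_fun U (\<lambda>x. c * \<phi> x)"
  unfolding test_fun_iff using smooth_cmult[of \<phi> c] by (metis mult_zero_right)

text \<open>The scaling by \<open>n\<close> does not move the support: each factor exp(-1/(n y))
  tends to 1, so for fixed c and d the bumps approach the indicator of the open interval while
  staying between 0 and 1.\<close>

definition bump :: "real \<Rightarrow> real \<Rightarrow> real \<Rightarrow> real \<Rightarrow> real"
  where "bump c d n x = exp_bump 1 (n * (x - c)) * exp_bump 1 (n * (d - x))"

lemma bump_nonzero_iff: "n > 0 \<Longrightarrow> bump c d n x \<noteq> 0 \<longleftrightarrow> c < x \<and> x < d"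
  by (auto simp: bump_def exp_bump_def zero_less_mult_iff)

lemma bump_bounds: "0 \<le> bump c d n x" "bump c d n x \<le> 1"
  by (auto simp: bump_def exp_bump_def intro!: mult_le_one)

lemma test_fun_bump:
  assumes "n > 0" "{c..d} \<subseteq> U"
  shows "test_fun U (bump c d n)"
proof -
  have "smooth (\<lambda>x. exp_bump 1 (n * (x - c)))" "smooth (\<lambda>x. exp_bump 1 (n * (d - x)))"
    using smooth_affine[OF smooth_exp_bump, of 1 1 n "- n * c"]
      smooth_affine[OF smooth_exp_bump, of 1 1 "- n" "n * d"] by (simp_all add: algebra_simps)
  then have "smooth (bump c d n)"
    unfolding bump_def[abs_def] by (rule smooth_mult)
  moreover have "\<forall>x. x \<notin> {c..d} \<longrightarrow> bump c d n x = 0"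
    using bump_nonzero_iff[OF assms(1), of c d] by (meson atLeastAtMost_iff less_imp_le)
  ultimately show ?thesis
    unfolding test_fun_iff using assms(2) compact_Icc by blast
qed

lemma bump_tendsto: "(\<lambda>n. bump c d (real (Suc n)) x) \<longlonglongrightarrow> indicator {c<..<d} x"
proof (cases "c < x \<and> x < d")
  case True
  have "(\<lambda>n. exp (- 1 / (real (Suc n) * (x - c))) * exp (- 1 / (real (Suc n) * (d - x)))) \<longlonglongrightarrow>
      exp 0 * exp 0"
  proof (intro tendsto_mult tendsto_exp)
    have "(\<lambda>n. (- 1 / (x - c)) * inverse (real (Suc n))) \<longlonglongrightarrow> (- 1 / (x - c)) * 0"
      "(\<lambda>n. (- 1 / (d - x)) * inverse (real (Suc n))) \<longlonglongrightarrow> (- 1 / (d - x)) * 0"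
      by (intro tendsto_mult tendsto_const LIMSEQ_inverse_real_of_nat)+
    then show "(\<lambda>n. - 1 / (real (Suc n) * (x - c))) \<longlonglongrightarrow> 0"
      "(\<lambda>n. - 1 / (real (Suc n) * (d - x))) \<longlonglongrightarrow> 0"
      by (simp_all add: field_simps)
  qed
  then show ?thesis
    using True by (simp add: bump_def exp_bump_def)
next
  case False
  then have "bump c d (real (Suc n)) x = 0" for n
    using bump_nonzero_iff[of "real (Suc n)" c d x] by auto
  then show ?thesis using False by simp
qed

section \<open>Uniqueness of the absolutely continuous part\<close>

lemma borel_measurable_finer:
  fixes f :: "real \<Rightarrow> real"
  assumes "sets borel \<subseteq> sets M" "space M = UNIV" "f \<in> borel_measurable borel"
  shows "f \<in> borel_measurable M"
  using assms by (auto simp: measurable_def)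

text \<open>Dominated convergence along the bumps. Only Borel sets are asked to be measurable in
  \<open>M\<close>, so the same lemma serves Lebesgue measure and the Radon measures of a
  decomposition.\<close>

lemma set_integral_bump_tendsto:
  fixes f :: "real \<Rightarrow> real"
  assumes M: "sets borel \<subseteq> sets M" "space M = UNIV"
    and f: "set_integrable M {c..d} f" and U: "{c..d} \<subseteq> U" "c \<le> d"
  shows "(\<lambda>n. LINT x:U|M. f x * bump c d (real (Suc n)) x) \<longlonglongrightarrow> (LINT x:{c<..<d}|M. f x)"
proof -
  have m: "bump c d (real (Suc n)) \<in> borel_measurable M" for n
    using M test_fun_smooth[OF test_fun_bump[OF _ U(1), of "real (Suc n)"]]
    by (intro borel_measurable_finer[OF M] borel_measurable_continuous_onI smooth_continuous) auto
  have s: "{c<..<d} \<in> sets M" "{c..d} \<in> sets M"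
    using M(1) by auto
  have eq: "indicat_real U x *\<^sub>R (f x * bump c d (real (Suc n)) x) =
      (indicator {c..d} x *\<^sub>R f x) * bump c d (real (Suc n)) x" for n x
  proof (cases "c < x \<and> x < d")
    case True
    then have "x \<in> U" using U by auto
    with True show ?thesis by simp
  next
    case False
    then have "bump c d (real (Suc n)) x = 0" using bump_nonzero_iff[of "real (Suc n)" c d x] by auto
    then show ?thesis by simp
  qed
  have ind: "indicat_real {c<..<d} x *\<^sub>R f x = (indicator {c..d} x *\<^sub>R f x) * indicator {c<..<d} x" for x
    by (auto simp: indicator_def)
  show ?thesis
    unfolding set_lebesgue_integral_def eq ind
  proof (rule integral_dominated_convergence[where w = "\<lambda>x. \<bar>indicator {c..d} x *\<^sub>R f x\<bar>"])
    show "integrable M (\<lambda>x. \<bar>indicat_real {c..d} x *\<^sub>R f x\<bar>)"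
      using f unfolding set_integrable_def by (rule integrable_abs)
    show "(\<lambda>x. indicat_real {c..d} x *\<^sub>R f x * bump c d (real (Suc n)) x) \<in> borel_measurable M" for n
      using f m[of n] unfolding set_integrable_def by measurable
    show "(\<lambda>x. indicat_real {c..d} x *\<^sub>R f x * indicator {c<..<d} x) \<in> borel_measurable M"
      using f s unfolding set_integrable_def by measurable
    show "AE x in M. (\<lambda>n. indicat_real {c..d} x *\<^sub>R f x * bump c d (real (Suc n)) x)
        \<longlonglongrightarrow> indicat_real {c..d} x *\<^sub>R f x * indicator {c<..<d} x"
      by (intro AE_I2 tendsto_mult tendsto_const bump_tendsto)
    show "AE x in M. norm (indicat_real {c..d} x *\<^sub>R f x * bump c d (real (Suc n)) x)
        \<le> \<bar>indicat_real {c..d} x *\<^sub>R f x\<bar>" for n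
      using bump_bounds[of c d "real (Suc n)"]
      by (intro AE_I2) (auto simp: abs_mult mult_left_le)
  qed
qed

text \<open>Countable additivity in the form of a series, for the union step of a Dynkin argument in
  which several such set functions are added and subtracted.\<close>

lemma set_integral_sums:
  fixes f :: "real \<Rightarrow> real"
  assumes A: "\<And>i::nat. A i \<in> sets M" "disjoint_family A" and J: "J \<in> sets M"
    and f: "set_integrable M J f"
  shows "(\<lambda>i. LINT x:A i \<inter> J|M. f x) sums (LINT x:(\<Union>i. A i) \<inter> J|M. f x)"
proof -
  have 1: "(\<Union>i. A i) \<inter> J = (\<Union>n. \<Union>i<n. A i \<inter> J)" by fastforce
  have "(\<lambda>n. LINT x:(\<Union>i<n. A i \<inter> J)|M. f x) \<longlonglongrightarrow> (LINT x:(\<Union>n. \<Union>i<n. A i \<inter> J)|M. f x)"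
    by (rule set_integral_cont_up)
      (use A J in \<open>auto simp: incseq_def intro!: set_integrable_subset[OF f]\<close>, fastforce+)
  moreover have "(LINT x:(\<Union>i<n. A i \<inter> J)|M. f x) = (\<Sum>i<n. LINT x:A i \<inter> J|M. f x)" for n
    by (rule set_integral_finite_Union)
      (use A J in \<open>auto simp: disjoint_family_on_def intro!: set_integrable_subset[OF f]\<close>)
  ultimately show ?thesis
    unfolding sums_def 1 by simp
qed

lemma radon_on_subset: "radon_on U M \<Longrightarrow> V \<subseteq> U \<Longrightarrow> radon_on V M"
  unfolding radon_on_def by blast

lemma radon_set_integrable:
  assumes "radon_on U M" "A \<subseteq> C" "compact C" "C \<subseteq> U" "A \<in> sets borel"
  shows "set_integrable M A (\<lambda>x. 1::real)"
proof -
  have "emeasure M A \<le> emeasure M C"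
    using assms by (intro emeasure_mono) (auto simp: radon_on_def borel_compact)
  also have "\<dots> < \<infinity>" using assms by (auto simp: radon_on_def)
  finally show ?thesis
    using assms by (auto simp: set_integrable_def radon_on_def)
qed

lemma radon_space: "radon_on U M \<Longrightarrow> space M = UNIV"
  unfolding radon_on_def by (metis sets_eq_imp_space_eq space_borel)

lemma AE_open_local:
  assumes "open U" "\<And>p q. p < q \<Longrightarrow> {p..q} \<subseteq> U \<Longrightarrow> AE x in lebesgue. x \<in> {p<..<q} \<longrightarrow> P x"
  shows "AE x in lebesgue. x \<in> U \<longrightarrow> P (x::real)"
proof -
  define T where "T = {(p, q). p \<in> \<rat> \<and> q \<in> \<rat> \<and> p < q \<and> {p..q::real} \<subseteq> U}"
  have "T \<subseteq> \<rat> \<times> \<rat>" by (auto simp: T_def)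
  then have "countable T"
    using countable_rat countable_SIGMA countable_subset by (metis (no_types, lifting))
  then have "AE x in lebesgue. \<forall>(p, q) \<in> T. x \<in> {p<..<q} \<longrightarrow> P x"
    using assms(2) by (subst AE_ball_countable) (auto simp: T_def)
  moreover have "\<exists>(p, q) \<in> T. x \<in> {p<..<q}" if x: "x \<in> U" for x
  proof -
    obtain e where e: "e > 0" "\<And>y. \<bar>y - x\<bar> < e \<Longrightarrow> y \<in> U"
      using \<open>open U\<close> x unfolding open_dist dist_real_def by blast
    obtain p q where "p \<in> \<rat>" "x - e < p" "p < x" "q \<in> \<rat>" "x < q" "q < x + e"
      by (meson Rats_dense_in_real diff_less_eq e(1) less_add_same_cancel1)
    then have "(p, q) \<in> T" "x \<in> {p<..<q}"
      unfolding T_def using e(2) by (auto simp: subset_iff intro!: e(2))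
    then show ?thesis by blast
  qed
  ultimately show ?thesis
    by (elim AE_mp) (rule AE_I2, blast)
qed

lemma sigma_finite_lebesgue: "sigma_finite_measure (lebesgue :: real measure)"
proof
  obtain A :: "real set set" where "countable A" "A \<subseteq> sets lborel" "\<Union>A = space lborel"
    "\<forall>a\<in>A. emeasure lborel a \<noteq> \<infinity>"
    using lborel.sigma_finite_countable by blast
  then show "\<exists>A::real set set. countable A \<and> A \<subseteq> sets lebesgue \<and> \<Union>A = space lebesgue \<and>
      (\<forall>a\<in>A. emeasure lebesgue a \<noteq> \<infinity>)"
    by (intro exI[of _ A]) auto
qed

text \<open>A Lebesgue set is a Borel set up to a null set, so Borel sets suffice to conclude that a
  density vanishes.\<close>

lemma AE_zero_of_borel_integrals:
  fixes f :: "real \<Rightarrow> real"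
  assumes f: "set_integrable lebesgue J f" and J: "J \<in> sets borel"
    and z: "\<And>A. A \<in> sets borel \<Longrightarrow> (LINT x:A \<inter> J|lebesgue. f x) = 0"
  shows "AE x in lebesgue. x \<in> J \<longrightarrow> f x = 0"
proof -
  have "AE x in lebesgue. indicator J x *\<^sub>R f x = 0"
  proof (rule sigma_finite_measure.density_zero[OF sigma_finite_lebesgue])
    show "integrable lebesgue (\<lambda>x. indicat_real J x *\<^sub>R f x)"
      using f by (simp add: set_integrable_def)
    fix A :: "real set" assume "A \<in> sets lebesgue"
    then obtain S N N' where A: "A = S \<union> N" "N \<subseteq> N'" "N' \<in> null_sets lborel" "S \<in> sets lborel"
      by (meson sets_completionE)
    have "AE x in lebesgue. x \<notin> N'"
      using A(3) by (intro AE_not_in null_sets_completionI)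
    then have "(LINT x|lebesgue. indicator A x *\<^sub>R (indicat_real J x *\<^sub>R f x)) =
        (LINT x|lebesgue. indicator (S \<inter> J) x *\<^sub>R f x)"
    proof (intro integral_cong_AE)
      have m: "(\<lambda>x. indicat_real J x *\<^sub>R f x) \<in> borel_measurable lebesgue"
        using f by (auto simp: set_integrable_def)
      show "(\<lambda>x. indicator A x *\<^sub>R (indicat_real J x *\<^sub>R f x)) \<in> borel_measurable lebesgue"
        using m \<open>A \<in> sets lebesgue\<close> by measurable
      have "(\<lambda>x. indicator S x *\<^sub>R (indicat_real J x *\<^sub>R f x)) \<in> borel_measurable lebesgue"
        using A(4) by (intro borel_measurable_scaleR m borel_measurable_indicator) auto
      then show "(\<lambda>x. indicator (S \<inter> J) x *\<^sub>R f x) \<in> borel_measurable lebesgue"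
        by (simp add: indicator_inter_arith mult.assoc)
      from \<open>AE x in lebesgue. x \<notin> N'\<close>
      show "AE x in lebesgue. indicator A x *\<^sub>R (indicat_real J x *\<^sub>R f x) = indicator (S \<inter> J) x *\<^sub>R f x"
        by eventually_elim (use A in \<open>auto simp: indicator_def\<close>)
    qed
    also have "\<dots> = 0"
      using z[of S] A(4) by (simp add: set_lebesgue_integral_def)
    finally show "(LINT x:A|lebesgue. indicator J x *\<^sub>R f x) = 0"
      by (simp add: set_lebesgue_integral_def)
  qed
  then show ?thesis by (rule AE_mp[OF _ AE_I2]) auto
qed

text \<open>On a bounded interval the combination is a finite signed set function. It vanishes on
  open intervals because bumps approach their indicators, hence on all Borel sets by a Dynkin
  argument, and off a null set that carries the singular measures only the density is left. Four
  measures appear because two decompositions, each a difference, are going to be subtracted.\<close>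

lemma weak_star_unique:
  fixes f :: "real \<Rightarrow> real"
  assumes "open U" and f: "loc_integrable_on U f"
    and rad: "radon_on U M1" "radon_on U N1" "radon_on U M2" "radon_on U N2"
    and sing: "singular_on U lborel M1" "singular_on U lborel N1"
      "singular_on U lborel M2" "singular_on U lborel N2"
    and z: "\<And>\<phi>. test_fun U \<phi> \<Longrightarrow> (LINT x:U|lebesgue. f x * \<phi> x) +
      (LINT x:U|M1. \<phi> x) - (LINT x:U|N1. \<phi> x) - (LINT x:U|M2. \<phi> x) + (LINT x:U|N2. \<phi> x) = 0"
  shows "AE x in lebesgue. x \<in> U \<longrightarrow> f x = 0"
proof (rule AE_open_local[OF \<open>open U\<close>])
  fix p q :: real assume pq: "p < q" "{p..q} \<subseteq> U"
  define J where "J = {p<..<q}"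
  have J: "J \<in> sets borel" "J \<subseteq> {p..q}" by (auto simp: J_def)
  \<comment> \<open>All five measures involved are finite on the bounded interval, or integrable
    against it in the case of the density, so \<open>\<nu>\<close> is real-valued and no difference
    of infinities arises.\<close>
  define \<nu> where "\<nu> A = (LINT x:A \<inter> J|lebesgue. f x) + (LINT x:A \<inter> J|M1. 1) -
      (LINT x:A \<inter> J|N1. 1) - (LINT x:A \<inter> J|M2. 1) + (LINT x:A \<inter> J|N2. 1::real)" for A
  have fI: "set_integrable lebesgue {p..q} f"
    using f pq by (auto simp: loc_integrable_on_def)
  have fJ: "set_integrable lebesgue J f"
    by (rule set_integrable_subset[OF fI]) (use J in auto)
  have rJ: "set_integrable M J (\<lambda>x. 1::real)" if "radon_on U M" for M
    using radon_set_integrable[OF that J(2) _ pq(2)] J by auto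
  have sets: "sets M = sets borel" if "radon_on U M" for M
    using that by (auto simp: radon_on_def)
  have basic: "\<nu> {c<..<d} = 0" for c d
  proof -
    define c' where "c' = max c p"
    define d' where "d' = min d q"
    have eq: "{c<..<d} \<inter> J = {c'<..<d'}" by (auto simp: J_def c'_def d'_def)
    show ?thesis
    proof (cases "c' \<le> d'")
      case False
      then have "{c<..<d} \<inter> J = {}" unfolding eq by auto
      then show ?thesis by (simp add: \<nu>_def set_lebesgue_integral_def)
    next
      case True
      have sub: "{c'..d'} \<subseteq> {p..q}" "{c'..d'} \<subseteq> U"
        using pq by (auto simp: c'_def d'_def)
      have L: "(\<lambda>n. LINT x:U|lebesgue. f x * bump c' d' (real (Suc n)) x)
          \<longlonglongrightarrow> (LINT x:{c'<..<d'}|lebesgue. f x)"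
        by (rule set_integral_bump_tendsto[OF _ _ set_integrable_subset[OF fI] sub(2) True])
          (use sub in auto)
      have R: "(\<lambda>n. LINT x:U|M. bump c' d' (real (Suc n)) x)
          \<longlonglongrightarrow> (LINT x:{c'<..<d'}|M. 1)" if "radon_on U M" for M
        using set_integral_bump_tendsto[of M c' d' "\<lambda>_. 1" U] sub(2) True that
          sets[OF that] radon_space[OF that] radon_set_integrable[OF that, of "{c'..d'}" "{c'..d'}"]
        by simp
      have "(\<lambda>n. (LINT x:U|lebesgue. f x * bump c' d' (real (Suc n)) x) +
          (LINT x:U|M1. bump c' d' (real (Suc n)) x) - (LINT x:U|N1. bump c' d' (real (Suc n)) x) -
          (LINT x:U|M2. bump c' d' (real (Suc n)) x) + (LINT x:U|N2. bump c' d' (real (Suc n)) x))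
          \<longlonglongrightarrow> \<nu> {c<..<d}"
        unfolding \<nu>_def eq by (intro tendsto_add tendsto_diff L R rad)
      moreover have "test_fun U (bump c' d' (real (Suc n)))" for n
        by (rule test_fun_bump[OF _ sub(2)]) simp
      ultimately show ?thesis
        using z by (simp add: LIMSEQ_const_iff)
    qed
  qed
  have \<nu>0: "\<nu> A = 0" if "A \<in> sets borel" for A
  proof -
    have gen: "sets borel = sigma_sets UNIV (range (\<lambda>(a, b). {a<..<b::real}))"
    proof -
      have "(\<lambda>(a, b). box a b) = (\<lambda>(a, b). {a<..<b::real})" by (simp add: fun_eq_iff)
      then have "borel = sigma UNIV (range (\<lambda>(a, b). {a<..<b::real}))"
        using borel_eq_box[where 'a = real] by simp
      then have "sets borel = sets (sigma UNIV (range (\<lambda>(a, b). {a<..<b::real})))" by (rule arg_cong)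
      also have "\<dots> = sigma_sets UNIV (range (\<lambda>(a, b). {a<..<b::real}))"
        by (rule sets_measure_of) simp
      finally show ?thesis .
    qed
    have st: "Int_stable (range (\<lambda>(a, b). {a<..<b::real}))"
    proof (rule Int_stableI_image)
      fix i j :: "real \<times> real"
      show "\<exists>k\<in>UNIV. (case i of (a, b) \<Rightarrow> {a<..<b}) \<inter> (case j of (a, b) \<Rightarrow> {a<..<b}) =
          (case k of (a, b) \<Rightarrow> {a<..<b})"
        by (rule bexI[of _ "(max (fst i) (fst j), min (snd i) (snd j))"])
          (auto simp: split_beta)
    qed
    have subset_Pow: "range (\<lambda>(a, b). {a<..<b::real}) \<subseteq> Pow UNIV" by simp
    have "A \<in> sigma_sets UNIV (range (\<lambda>(a, b). {a<..<b::real}))"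
      using that gen by simp
    then show ?thesis
    proof (induction rule: sigma_sets_induct_disjoint[OF st subset_Pow, consumes 1, case_names basic empty compl union])
      case (basic A) then show ?case using \<open>\<And>c d. \<nu> {c<..<d} = 0\<close> by auto
    next
      case empty then show ?case by (simp add: \<nu>_def set_lebesgue_integral_def)
    next
      case (compl A)
      then have A: "A \<in> sets borel" using gen by simp
      have d: "(LINT x:(UNIV - A) \<inter> J|M. h x) = (LINT x:J|M. h x) - (LINT x:A \<inter> J|M. h x)"
        if "sets borel \<subseteq> sets M" "set_integrable M J h" for M and h :: "real \<Rightarrow> real"
      proof -
        have "(LINT x:(A \<inter> J) \<union> ((UNIV - A) \<inter> J)|M. h x) =
            (LINT x:A \<inter> J|M. h x) + (LINT x:(UNIV - A) \<inter> J|M. h x)"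
          using that A J by (intro set_integral_Un set_integrable_subset[OF that(2)]) auto
        moreover have "(A \<inter> J) \<union> ((UNIV - A) \<inter> J) = J" by auto
        ultimately show ?thesis by simp
      qed
      have "\<nu> (UNIV - A) = \<nu> UNIV - \<nu> A"
      proof -
        have dl: "(LINT x:(UNIV - A) \<inter> J|lebesgue. f x) = (LINT x:J|lebesgue. f x) - (LINT x:A \<inter> J|lebesgue. f x)"
          by (rule d[OF _ fJ]) auto
        have dr: "(LINT x:(UNIV - A) \<inter> J|M. 1) = (LINT x:J|M. 1::real) - (LINT x:A \<inter> J|M. 1)"
          if "radon_on U M" for M
          by (rule d[OF _ rJ[OF that]]) (simp add: sets[OF that])
        show ?thesis
          unfolding \<nu>_def dl dr[OF rad(1)] dr[OF rad(2)] dr[OF rad(3)] dr[OF rad(4)] by simp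
      qed
      moreover have "\<nu> UNIV = \<nu> J" by (simp add: \<nu>_def)
      ultimately show ?case using basic[of p q] compl by (simp add: J_def)
    next
      case (union A)
      then have A: "A i \<in> sets borel" for i using gen by auto
      have "(\<lambda>i. \<nu> (A i)) sums \<nu> (\<Union>i. A i)"
        unfolding \<nu>_def
        by (intro sums_add sums_diff set_integral_sums union fJ rJ rad) (auto simp: sets rad A J)
      then show ?case
        using union.IH by (simp add: sums_0 sums_iff)
    qed
  qed
  from sing obtain Z1 Z2 Z3 Z4 where
    Z: "Z1 \<in> sets borel" "Z2 \<in> sets borel" "Z3 \<in> sets borel" "Z4 \<in> sets borel"
      "emeasure lborel (U \<inter> Z1) = 0" "emeasure lborel (U \<inter> Z2) = 0"
      "emeasure lborel (U \<inter> Z3) = 0" "emeasure lborel (U \<inter> Z4) = 0"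
      "emeasure M1 (U - Z1) = 0" "emeasure N1 (U - Z2) = 0"
      "emeasure M2 (U - Z3) = 0" "emeasure N2 (U - Z4) = 0"
    unfolding singular_on_def by metis
  define Z where "Z = Z1 \<union> Z2 \<union> Z3 \<union> Z4"
  have Ub: "U \<in> sets borel" using \<open>open U\<close> by simp
  have "(LINT x:A \<inter> J|lebesgue. f x) = 0" if A: "A \<in> sets borel" for A
  proof -
    \<comment> \<open>Within U the set \<open>Z\<close> carries all four singular measures but is
      Lebesgue null: removing it leaves only the density and does not change its integral.\<close>
    have B: "A - Z \<in> sets borel" using A Z by (auto simp: Z_def)
    have n: "(LINT x:(A - Z) \<inter> J|M. 1::real) = 0"
      if "sets M = sets borel" "emeasure M (U - Y) = 0" "Y \<subseteq> Z" "Y \<in> sets borel" for M Y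
    proof -
      have "U - Y \<in> null_sets M" using that Ub by (auto simp: null_sets_def)
      moreover have "(A - Z) \<inter> J \<subseteq> U - Y" using that J pq by auto
      ultimately have "(A - Z) \<inter> J \<in> null_sets M"
        using B J that null_sets_subset by blast
      then have "AE x in M. indicat_real ((A - Z) \<inter> J) x *\<^sub>R 1 = (0::real)"
        by (rule AE_mp[OF AE_not_in]) (simp add: indicator_def)
      then show ?thesis
        unfolding set_lebesgue_integral_def by (rule integral_eq_zero_AE)
    qed
    have 0: "(LINT x:(A - Z) \<inter> J|lebesgue. f x) = 0"
      using \<nu>0[OF B] n[OF sets[OF rad(1)] Z(9)] n[OF sets[OF rad(2)] Z(10)]
        n[OF sets[OF rad(3)] Z(11)] n[OF sets[OF rad(4)] Z(12)] Z(1-4)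
      by (simp add: \<nu>_def Z_def subset_iff)
    have "U \<inter> Z = (U \<inter> Z1) \<union> (U \<inter> Z2) \<union> (U \<inter> Z3) \<union> (U \<inter> Z4)" by (auto simp: Z_def)
    moreover have "U \<inter> Z1 \<in> null_sets lborel" "U \<inter> Z2 \<in> null_sets lborel"
      "U \<inter> Z3 \<in> null_sets lborel" "U \<inter> Z4 \<in> null_sets lborel"
      using Z Ub by (auto simp: null_sets_def)
    ultimately have "U \<inter> Z \<in> null_sets lborel" by auto
    then have "AE x in lebesgue. x \<notin> U \<inter> Z"
      by (intro AE_not_in null_sets_completionI)
    then have ae: "AE x in lebesgue. x \<in> (A - Z) \<inter> J \<longleftrightarrow> x \<in> A \<inter> J"
      by (rule AE_mp[OF _ AE_I2]) (use J pq in auto)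
    have "(LINT x:A \<inter> J|lebesgue. f x) = (LINT x:(A - Z) \<inter> J|lebesgue. f x)"
    proof (rule set_integral_cong_set[OF _ _ ae])
      have m: "set_borel_measurable lebesgue (B \<inter> J) f" if "B \<in> sets borel" for B
      proof -
        have "set_integrable lebesgue (B \<inter> J) f"
          by (rule set_integrable_subset[OF fJ]) (use that J in auto)
        then show ?thesis
          unfolding set_integrable_def set_borel_measurable_def by (rule borel_measurable_integrable)
      qed
      show "set_borel_measurable lebesgue (A \<inter> J) f" "set_borel_measurable lebesgue ((A - Z) \<inter> J) f"
        using m[OF A] m[OF B] by auto
    qed
    then show ?thesis using 0 by simp
  qed
  then show "AE x in lebesgue. x \<in> {p<..<q} \<longrightarrow> f x = 0"
    using AE_zero_of_borel_integrals[OF fJ J(1)] by (simp add: J_def)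
qed

lemma set_integral_zero_outside:
  fixes f :: "real \<Rightarrow> real"
  assumes "V \<subseteq> U" "\<And>x. x \<in> U - V \<Longrightarrow> f x = 0"
  shows "(LINT x:U|M. f x) = (LINT x:V|M. f x)"
  unfolding set_lebesgue_integral_def
  by (rule Bochner_Integration.integral_cong) (use assms in \<open>auto simp: indicator_def\<close>)

section \<open>Locality, uniqueness and gluing of the absolutely continuous part\<close>

lemma loc_integrable_on_subset: "loc_integrable_on U v \<Longrightarrow> V \<subseteq> U \<Longrightarrow> loc_integrable_on V v"
  unfolding loc_integrable_on_def by blast

lemma set_integrable_cong_lebesgue:
  fixes f g :: "real \<Rightarrow> real"
  assumes "set_integrable lebesgue A f" "AE x in lebesgue. x \<in> A \<longrightarrow> f x = g x"
  shows "set_integrable lebesgue A g"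
proof -
  obtain N where N: "N \<in> null_sets lebesgue" "{x. \<not> (x \<in> A \<longrightarrow> f x = g x)} \<subseteq> N"
    using assms(2) by (auto simp: eventually_ae_filter)
  then show ?thesis
    by (intro absolutely_integrable_spike[OF assms(1)]) (auto simp: negligible_iff_null_sets)
qed

lemma set_integral_cong_lebesgue:
  fixes f g :: "real \<Rightarrow> real"
  assumes "AE x in lebesgue. x \<in> A \<longrightarrow> f x = g x"
  shows "(LINT x:A|lebesgue. f x) = (LINT x:A|lebesgue. g x)"
proof (cases "set_integrable lebesgue A f")
  case True
  then have "set_integrable lebesgue A g" using assms by (rule set_integrable_cong_lebesgue)
  with True show ?thesis
    unfolding set_lebesgue_integral_def set_integrable_def
  proof (intro integral_cong_AE)
    show "AE x in lebesgue. indicat_real A x *\<^sub>R f x = indicat_real A x *\<^sub>R g x"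
      using assms by eventually_elim (auto simp: indicator_def)
  qed auto
next
  case False
  moreover have "\<not> set_integrable lebesgue A g"
  proof
    assume "set_integrable lebesgue A g"
    moreover have "AE x in lebesgue. x \<in> A \<longrightarrow> g x = f x"
      using assms by eventually_elim simp
    ultimately have "set_integrable lebesgue A f"
      by (rule set_integrable_cong_lebesgue)
    then show False using False by blast
  qed
  ultimately show ?thesis
    unfolding set_lebesgue_integral_def set_integrable_def by (simp add: not_integrable_integral_eq)
qed

lemma loc_integrable_on_cong:
  assumes "loc_integrable_on U f" "AE x in lebesgue. x \<in> U \<longrightarrow> f x = g x"
  shows "loc_integrable_on U g"
  unfolding loc_integrable_on_def
proof (intro allI impI)
  fix C assume C: "compact C \<and> C \<subseteq> U"
  show "set_integrable lebesgue C g"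
  proof (rule set_integrable_cong_lebesgue[of _ f])
    show "set_integrable lebesgue C f" using C assms(1) by (simp add: loc_integrable_on_def)
    show "AE x in lebesgue. x \<in> C \<longrightarrow> f x = g x"
      using assms(2) by eventually_elim (use C in auto)
  qed
qed

definition ac_split :: "real set \<Rightarrow> (real \<Rightarrow> real) \<Rightarrow> (real \<Rightarrow> real) \<Rightarrow> real measure \<Rightarrow> real measure \<Rightarrow> bool"
  where "ac_split U v g M N \<longleftrightarrow> radon_on U M \<and> radon_on U N \<and>
      singular_on U lborel M \<and> singular_on U lborel N \<and>
      (\<forall>\<phi>. test_fun U \<phi> \<longrightarrow>
        - (LINT x:U|lebesgue. v x * deriv \<phi> x) =
          (LINT x:U|lebesgue. g x * \<phi> x) + (LINT x:U|M. \<phi> x) - (LINT x:U|N. \<phi> x))"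

lemma ac_part_on_iff:
  "ac_part_on U v g \<longleftrightarrow> loc_integrable_on U v \<and> loc_integrable_on U g \<and> (\<exists>M N. ac_split U v g M N)"
  unfolding ac_part_on_def ac_split_def ..

lemma ac_splitD:
  assumes "ac_split U v g M N"
  shows "radon_on U M" "radon_on U N" "singular_on U lborel M" "singular_on U lborel N"
    and "test_fun U \<phi> \<Longrightarrow> - (LINT x:U|lebesgue. v x * deriv \<phi> x) =
      (LINT x:U|lebesgue. g x * \<phi> x) + (LINT x:U|M. \<phi> x) - (LINT x:U|N. \<phi> x)"
  using assms unfolding ac_split_def by simp_all

lemma ac_part_on_cong:
  assumes "ac_part_on U v g" "AE x in lebesgue. x \<in> U \<longrightarrow> v x = v' x"
    "AE x in lebesgue. x \<in> U \<longrightarrow> g x = g' x"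
  shows "ac_part_on U v' g'"
proof -
  have 1: "(LINT x:U|lebesgue. v x * \<phi> x) = (LINT x:U|lebesgue. v' x * \<phi> x)" for \<phi>
    using assms(2) by (intro set_integral_cong_lebesgue, eventually_elim) auto
  have 2: "(LINT x:U|lebesgue. g x * \<phi> x) = (LINT x:U|lebesgue. g' x * \<phi> x)" for \<phi>
    using assms(3) by (intro set_integral_cong_lebesgue, eventually_elim) auto
  show ?thesis
    using assms loc_integrable_on_cong unfolding ac_part_on_def 1 2 by blast
qed

lemma weak_deriv_cong:
  assumes "weak_deriv U v g" "AE x in lebesgue. x \<in> U \<longrightarrow> v x = v' x"
    "AE x in lebesgue. x \<in> U \<longrightarrow> g x = g' x"
  shows "weak_deriv U v' g'"
proof -
  have 1: "(LINT x:U|lebesgue. v x * \<phi> x) = (LINT x:U|lebesgue. v' x * \<phi> x)" for \<phi>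
    using assms(2) by (intro set_integral_cong_lebesgue, eventually_elim) auto
  have 2: "(LINT x:U|lebesgue. g x * \<phi> x) = (LINT x:U|lebesgue. g' x * \<phi> x)" for \<phi>
    using assms(3) by (intro set_integral_cong_lebesgue, eventually_elim) auto
  show ?thesis
    using assms loc_integrable_on_cong unfolding weak_deriv_def 1 2 by blast
qed

lemma radon_on_null_measure: "radon_on U (null_measure borel)"
  by (auto simp: radon_on_def)

lemma singular_on_null_measure: "singular_on U M (null_measure borel)"
  unfolding singular_on_def by (intro bexI[of _ "{}"]) auto

lemma weak_deriv_imp_ac_part:
  assumes "weak_deriv U v g"
  shows "ac_part_on U v g"
  unfolding ac_part_on_def
proof (intro conjI exI)
  show "loc_integrable_on U v" "loc_integrable_on U g" using assms by (auto simp: weak_deriv_def)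
  show "\<forall>\<phi>. test_fun U \<phi> \<longrightarrow> - (LINT x:U|lebesgue. v x * deriv \<phi> x) =
    (LINT x:U|lebesgue. g x * \<phi> x) + (LINT x:U|null_measure borel. \<phi> x) - (LINT x:U|null_measure borel. \<phi> x)"
    using assms by (auto simp: weak_deriv_def)
qed (rule radon_on_null_measure singular_on_null_measure)+

lemma ac_part_on_subset:
  assumes "ac_part_on U v g" "V \<subseteq> U" "open V" "open U"
  shows "ac_part_on V v g"
proof -
  have *: "(LINT x:U|M. f x * \<phi> x) = (LINT x:V|M. f x * \<phi> x)"
    if "test_fun V \<phi>" for M :: "real measure" and \<phi> f
    by (rule set_integral_zero_outside[OF assms(2)]) (simp add: test_fun_eq_0[OF that])
  have **: "(LINT x:U|M. \<phi> x) = (LINT x:V|M. \<phi> x)"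
    if "test_fun V \<phi>" for M :: "real measure" and \<phi>
    by (rule set_integral_zero_outside[OF assms(2)]) (simp add: test_fun_eq_0[OF that])
  obtain M N where "ac_split U v g M N"
    using assms(1) unfolding ac_part_on_iff by blast
  note MN = ac_splitD(1-4)[OF this] and eq = ac_splitD(5)[OF this]
  have s: "singular_on V lborel M" if sM: "singular_on U lborel M" "radon_on U M" for M
  proof -
    obtain Z where Z: "Z \<in> sets borel" "emeasure lborel (U \<inter> Z) = 0" "emeasure M (U - Z) = 0"
      using sM(1) unfolding singular_on_def by blast
    have "sets M = sets borel" using sM(2) by (simp add: radon_on_def)
    moreover have "U \<in> sets borel" "U \<inter> Z \<in> sets lborel" using assms(4) Z(1) by auto
    ultimately have "U - Z \<in> sets M" "U \<inter> Z \<in> sets lborel" using Z(1) by auto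
    moreover have "V \<inter> Z \<subseteq> U \<inter> Z" "V - Z \<subseteq> U - Z" using assms(2) by auto
    ultimately have "emeasure lborel (V \<inter> Z) \<le> 0" "emeasure M (V - Z) \<le> 0"
      using emeasure_mono[of "V \<inter> Z" "U \<inter> Z" lborel] emeasure_mono[of "V - Z" "U - Z" M] Z(2,3)
      by metis+
    then show ?thesis unfolding singular_on_def using Z by (intro bexI[of _ Z]) auto
  qed
  have V: "- (LINT x:V|lebesgue. v x * deriv \<phi> x) =
      (LINT x:V|lebesgue. g x * \<phi> x) + (LINT x:V|M. \<phi> x) - (LINT x:V|N. \<phi> x)"
    if "test_fun V \<phi>" for \<phi>
    using eq[OF test_fun_mono[OF that assms(2)]]
    unfolding *[OF that, of lebesgue g] *[OF test_fun_deriv[OF that], of lebesgue v] **[OF that] .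
  have "loc_integrable_on V v" "loc_integrable_on V g"
    using assms(1,2) loc_integrable_on_subset unfolding ac_part_on_iff by blast+
  moreover have "ac_split V v g M N"
    unfolding ac_split_def
    by (intro conjI allI impI radon_on_subset[OF MN(1) assms(2)]
      radon_on_subset[OF MN(2) assms(2)] s[OF MN(3,1)] s[OF MN(4,2)] V)
  ultimately show ?thesis
    unfolding ac_part_on_iff by blast
qed

lemma set_integrable_mult_test_fun:
  assumes g: "loc_integrable_on U g" and \<phi>: "test_fun U \<phi>"
  shows "set_integrable lebesgue U (\<lambda>x. g x * \<phi> x)"
proof -
  obtain C where C: "compact C" "C \<subseteq> U" "\<forall>x. x \<notin> C \<longrightarrow> \<phi> x = 0"
    using \<phi> by (auto simp: test_fun_def)
  have cont: "continuous_on S \<phi>" for S by (rule smooth_continuous[OF test_fun_smooth[OF \<phi>]])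
  obtain B where B: "\<And>x. x \<in> C \<Longrightarrow> \<bar>\<phi> x\<bar> \<le> B"
    using compact_imp_bounded[OF compact_continuous_image[OF cont C(1)]]
    by (auto simp: bounded_iff)
  have gC: "integrable lebesgue (\<lambda>x. indicator C x *\<^sub>R g x)"
    using g C by (auto simp: loc_integrable_on_def set_integrable_def)
  have "integrable lebesgue (\<lambda>x. (indicator C x *\<^sub>R g x) * \<phi> x)"
  proof (rule Bochner_Integration.integrable_bound[where f = "\<lambda>x. B *\<^sub>R (indicator C x *\<^sub>R g x)"])
    show "integrable lebesgue (\<lambda>x. B *\<^sub>R (indicat_real C x *\<^sub>R g x))" using gC by simp
    have "\<phi> \<in> borel_measurable lebesgue"
      using borel_measurable_continuous_onI[OF cont] by (intro measurable_completion) simp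
    then show "(\<lambda>x. (indicat_real C x *\<^sub>R g x) * \<phi> x) \<in> borel_measurable lebesgue"
      using gC by measurable
    show "AE x in lebesgue. norm ((indicat_real C x *\<^sub>R g x) * \<phi> x) \<le> norm (B *\<^sub>R (indicat_real C x *\<^sub>R g x))"
    proof (rule AE_I2)
      fix x
      show "norm ((indicat_real C x *\<^sub>R g x) * \<phi> x) \<le> norm (B *\<^sub>R (indicat_real C x *\<^sub>R g x))"
      proof (cases "x \<in> C")
        case True
        have "\<bar>\<phi> x\<bar> \<le> \<bar>B\<bar>" using B[OF True] by linarith
        then have "\<bar>\<phi> x\<bar> * \<bar>g x\<bar> \<le> \<bar>B\<bar> * \<bar>g x\<bar>" by (rule mult_right_mono) simp
        then show ?thesis using True by (simp add: abs_mult mult.commute)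
      qed simp
    qed
  qed
  moreover have "(indicator C x *\<^sub>R g x) * \<phi> x = indicat_real U x *\<^sub>R (g x * \<phi> x)" for x
    using C by (cases "x \<in> C") (auto simp: indicator_def)
  ultimately show ?thesis by (simp only: set_integrable_def)
qed

text \<open>Subtracting the two decompositions leaves the difference of the densities and four
  singular measures, the situation of \<open>weak_star_unique\<close>.\<close>

lemma ac_part_on_unique:
  assumes "open U" "ac_part_on U v g" "ac_part_on U v h"
  shows "AE x in lebesgue. x \<in> U \<longrightarrow> g x = h x"
proof -
  obtain M1 N1 M2 N2 where MN: "ac_split U v g M1 N1" "ac_split U v h M2 N2"
    using assms(2,3) unfolding ac_part_on_iff by blast
  note 1 = ac_splitD(1-4)[OF MN(1)] and eq1 = ac_splitD(5)[OF MN(1)]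
    and 2 = ac_splitD(1-4)[OF MN(2)] and eq2 = ac_splitD(5)[OF MN(2)]
  have gh: "loc_integrable_on U g" "loc_integrable_on U h"
    using assms by (auto simp: ac_part_on_def)
  have "AE x in lebesgue. x \<in> U \<longrightarrow> g x - h x = 0"
  proof (rule weak_star_unique[OF \<open>open U\<close> _ 1(1,2) 2(1,2) 1(3,4) 2(3,4)])
    show "loc_integrable_on U (\<lambda>x. g x - h x)"
      using gh by (auto simp: loc_integrable_on_def)
    fix \<phi> assume \<phi>: "test_fun U \<phi>"
    have "(LINT x:U|lebesgue. (g x - h x) * \<phi> x) =
        (LINT x:U|lebesgue. g x * \<phi> x) - (LINT x:U|lebesgue. h x * \<phi> x)"
      using set_integral_diff[OF set_integrable_mult_test_fun[OF gh(1) \<phi>] set_integrable_mult_test_fun[OF gh(2) \<phi>]]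
      by (simp add: left_diff_distrib)
    then show "(LINT x:U|lebesgue. (g x - h x) * \<phi> x) + (LINT x:U|M1. \<phi> x) - (LINT x:U|N1. \<phi> x) -
        (LINT x:U|M2. \<phi> x) + (LINT x:U|N2. \<phi> x) = 0"
      using eq1[OF \<phi>] eq2[OF \<phi>] by simp
  qed
  then show ?thesis by eventually_elim simp
qed

text \<open>\<^const>\<open>ac_deriv\<close> asks for one function that serves all open sets at once; it is glued from the
  countably many intervals with rational end points.\<close>

lemma ac_deriv_ex:
  "\<exists>g. \<forall>U. open U \<and> U \<subseteq> {-2<..<2} \<and> (\<exists>h. ac_part_on U v h) \<longrightarrow> ac_part_on U v g"
proof -
  define I where "I n = (case from_nat n :: rat \<times> rat of (p, q) \<Rightarrow> {of_rat p<..<of_rat q :: real})" for n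
  define good where "good n \<longleftrightarrow> (\<exists>h. ac_part_on (I n) v h)" for n
  obtain h where h: "\<And>n. good n \<Longrightarrow> ac_part_on (I n) v (h n)"
  proof -
    have "\<forall>n. \<exists>h. good n \<longrightarrow> ac_part_on (I n) v h" unfolding good_def by blast
    then show ?thesis using that by metis
  qed
  have oI: "open (I n)" for n by (auto simp: I_def split: prod.splits)
  \<comment> \<open>Any rule of selection works: where two good intervals overlap, their densities
    agree almost everywhere, and there are only countably many intervals.\<close>
  define g where "g x = h (LEAST n. good n \<and> x \<in> I n) x" for x
  have "ac_part_on U v g" if U: "open U" "ac_part_on U v k" for U k
  proof -
    have AEk: "AE x in lebesgue. \<forall>n. good n \<longrightarrow> x \<in> I n \<inter> U \<longrightarrow> h n x = k x"
    proof (subst AE_all_countable, intro allI)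
      fix n
      have "AE x in lebesgue. x \<in> I n \<inter> U \<longrightarrow> h n x = k x" if "good n"
        by (rule ac_part_on_unique[of _ v])
          (use U oI h[OF that] in \<open>auto intro: ac_part_on_subset\<close>)
      then show "AE x in lebesgue. good n \<longrightarrow> x \<in> I n \<inter> U \<longrightarrow> h n x = k x"
        by (cases "good n") auto
    qed
    have cover: "\<exists>n. good n \<and> x \<in> I n" if x: "x \<in> U" for x
    proof -
      obtain e where e: "e > 0" "\<And>y. \<bar>y - x\<bar> < e \<Longrightarrow> y \<in> U"
        using \<open>open U\<close> x unfolding open_dist dist_real_def by blast
      obtain p q where "x - e < of_rat p" "of_rat p < x" "x < of_rat q" "of_rat q < x + e"
        by (meson of_rat_dense diff_less_eq e(1) less_add_same_cancel1)
      moreover have "I (to_nat (p, q)) = {of_rat p<..<of_rat q}" by (simp add: I_def)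
      ultimately have "I (to_nat (p, q)) \<subseteq> U" "x \<in> I (to_nat (p, q))"
        using e(2) by auto
      then show ?thesis
        unfolding good_def using ac_part_on_subset U oI by blast
    qed
    from AEk have "AE x in lebesgue. x \<in> U \<longrightarrow> k x = g x"
    proof eventually_elim
      case (elim x)
      show ?case
      proof
        assume x: "x \<in> U"
        have "good (LEAST n. good n \<and> x \<in> I n) \<and> x \<in> I (LEAST n. good n \<and> x \<in> I n)"
          by (rule LeastI_ex[OF cover[OF x]])
        then show "k x = g x" using elim x by (simp add: g_def)
      qed
    qed
    then show ?thesis by (rule ac_part_on_cong[OF U(2), rotated]) simp
  qed
  then show ?thesis by blast
qed

text \<open>The access to the choice in \<open>ac_deriv\<close>: one absolutely continuous part,
  however found, determines the chosen function on that open set up to a null set.\<close>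

lemma ac_deriv_eq:
  assumes "open U" "U \<subseteq> {-2<..<2}" "ac_part_on U v g"
  shows "AE x in lebesgue. x \<in> U \<longrightarrow> ac_deriv v x = g x"
proof -
  have "ac_part_on U v (ac_deriv v)"
    using someI_ex[OF ac_deriv_ex[of v]] assms unfolding ac_deriv_def by blast
  then show ?thesis using ac_part_on_unique[OF assms(1)] assms(3) by blast
qed

section \<open>Primitives and integration by parts\<close>

lemma pair_sigma_finite_lebesgue: "pair_sigma_finite (lebesgue :: real measure) (lebesgue :: real measure)"
  by (intro pair_sigma_finite.intro sigma_finite_lebesgue)

lemma integrable_tensor:
  fixes p q :: "real \<Rightarrow> real"
  assumes p: "integrable lebesgue p" and q: "integrable lebesgue q"
  shows "integrable (lebesgue \<Otimes>\<^sub>M lebesgue) (\<lambda>(x, y). p x * q y)"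
proof -
  interpret pair_sigma_finite "lebesgue :: real measure" "lebesgue :: real measure"
    by (rule pair_sigma_finite_lebesgue)
  have [measurable]: "p \<in> borel_measurable lebesgue" "q \<in> borel_measurable lebesgue"
    using p q by auto
  show ?thesis
  proof (rule Fubini_integrable)
    show "(\<lambda>(x, y). p x * q y) \<in> borel_measurable (lebesgue \<Otimes>\<^sub>M lebesgue)"
      by measurable
    show "integrable lebesgue (\<lambda>x. LINT y|lebesgue. norm (case (x, y) of (x, y) \<Rightarrow> p x * q y))"
      using p by (simp add: abs_mult)
    show "AE x in lebesgue. integrable lebesgue (\<lambda>y. case (x, y) of (x, y) \<Rightarrow> p x * q y)"
      using q by simp
  qed
qed

lemma triangle_measurable:
  "{z :: real \<times> real. snd z \<le> fst z} \<in> sets (lebesgue \<Otimes>\<^sub>M lebesgue)"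
proof -
  have "closed {z :: real \<times> real. snd z \<le> fst z}"
    by (intro closed_Collect_le continuous_intros)
  then have "{z :: real \<times> real. snd z \<le> fst z} \<in> sets (borel \<Otimes>\<^sub>M borel)"
    unfolding borel_prod by (rule borel_closed)
  moreover have "sets (borel \<Otimes>\<^sub>M borel :: (real \<times> real) measure) \<subseteq> sets (lebesgue \<Otimes>\<^sub>M lebesgue)"
  proof -
    have "id \<in> measurable (lebesgue \<Otimes>\<^sub>M lebesgue) (borel \<Otimes>\<^sub>M borel :: (real \<times> real) measure)"
      unfolding id_def
      by (subst measurable_pair_iff)
        (auto simp: comp_def intro!: measurable_compose[OF measurable_fst] measurable_compose[OF measurable_snd]
          measurable_completion)
    from measurable_sets[OF this] show ?thesis
      by (auto simp: space_pair_measure)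
  qed
  ultimately show ?thesis by blast
qed

text \<open>Fubini for p(x) q(y), with the plane cut along the diagonal into the parts y \<le> x and
  x < y. Integrability is enough, so densities that are merely L1 can be integrated by
  parts.\<close>

lemma lebesgue_by_parts:
  fixes p q :: "real \<Rightarrow> real"
  assumes p: "integrable lebesgue p" and q: "integrable lebesgue q"
  shows "(LINT x|lebesgue. p x * (LINT y:{..x}|lebesgue. q y)) +
    (LINT y|lebesgue. (LINT x:{..<y}|lebesgue. p x) * q y) =
    (LINT x|lebesgue. p x) * (LINT x|lebesgue. q x)"
proof -
  interpret pair_sigma_finite "lebesgue :: real measure" "lebesgue :: real measure"
    by (rule pair_sigma_finite_lebesgue)
  let ?T = "{z :: real \<times> real. snd z \<le> fst z}"
  have t: "integrable (lebesgue \<Otimes>\<^sub>M lebesgue) (\<lambda>(x, y). p x * q y)"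
    by (rule integrable_tensor[OF p q])
  have 1: "integrable (lebesgue \<Otimes>\<^sub>M lebesgue) (\<lambda>z. indicat_real ?T z *\<^sub>R (case z of (x, y) \<Rightarrow> p x * q y))"
    by (rule integrable_mult_indicator[OF triangle_measurable t])
  have "- ?T \<in> sets (lebesgue \<Otimes>\<^sub>M lebesgue)"
    using sets.compl_sets[OF triangle_measurable] by (simp add: space_pair_measure Compl_eq_Diff_UNIV)
  then have 2: "integrable (lebesgue \<Otimes>\<^sub>M lebesgue) (\<lambda>z. indicat_real (- ?T) z *\<^sub>R (case z of (x, y) \<Rightarrow> p x * q y))"
    by (rule integrable_mult_indicator[OF _ t])
  have "(LINT x|lebesgue. p x * (LINT y:{..x}|lebesgue. q y)) =
      (LINT x|lebesgue. LINT y|lebesgue. indicat_real ?T (x, y) *\<^sub>R (p x * q y))"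
  proof (rule Bochner_Integration.integral_cong[OF refl])
    fix x
    have "(LINT y|lebesgue. indicat_real ?T (x, y) *\<^sub>R (p x * q y)) =
        (LINT y|lebesgue. p x * (indicator {..x} y *\<^sub>R q y))"
      by (rule Bochner_Integration.integral_cong) (auto simp: indicator_def)
    then show "p x * (LINT y:{..x}|lebesgue. q y) = (LINT y|lebesgue. indicat_real ?T (x, y) *\<^sub>R (p x * q y))"
      by (simp add: set_lebesgue_integral_def)
  qed
  also have "\<dots> = (LINT z|(lebesgue \<Otimes>\<^sub>M lebesgue). indicat_real ?T z *\<^sub>R (case z of (x, y) \<Rightarrow> p x * q y))"
    using integral_fst'[OF 1] by simp
  finally have A: "(LINT x|lebesgue. p x * (LINT y:{..x}|lebesgue. q y)) = \<dots>" .
  have "(LINT y|lebesgue. (LINT x:{..<y}|lebesgue. p x) * q y) =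
      (LINT y|lebesgue. LINT x|lebesgue. indicat_real (- ?T) (x, y) *\<^sub>R (p x * q y))"
  proof (rule Bochner_Integration.integral_cong[OF refl])
    fix y
    have "(LINT x|lebesgue. indicat_real (- ?T) (x, y) *\<^sub>R (p x * q y)) =
        (LINT x|lebesgue. (indicator {..<y} x *\<^sub>R p x) * q y)"
      by (rule Bochner_Integration.integral_cong) (auto simp: indicator_def)
    then show "(LINT x:{..<y}|lebesgue. p x) * q y = (LINT x|lebesgue. indicat_real (- ?T) (x, y) *\<^sub>R (p x * q y))"
      by (simp add: set_lebesgue_integral_def)
  qed
  also have "\<dots> = (LINT z|(lebesgue \<Otimes>\<^sub>M lebesgue). indicat_real (- ?T) z *\<^sub>R (case z of (x, y) \<Rightarrow> p x * q y))"
    using integral_snd[of "\<lambda>x y. indicat_real (- ?T) (x, y) *\<^sub>R (p x * q y)"] 2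
    by (simp add: case_prod_unfold)
  finally have B: "(LINT y|lebesgue. (LINT x:{..<y}|lebesgue. p x) * q y) = \<dots>" .
  have "(LINT z|(lebesgue \<Otimes>\<^sub>M lebesgue). indicat_real ?T z *\<^sub>R (case z of (x, y) \<Rightarrow> p x * q y)) +
      (LINT z|(lebesgue \<Otimes>\<^sub>M lebesgue). indicat_real (- ?T) z *\<^sub>R (case z of (x, y) \<Rightarrow> p x * q y)) =
      (LINT z|(lebesgue \<Otimes>\<^sub>M lebesgue). (case z of (x, y) \<Rightarrow> p x * q y))"
    unfolding Bochner_Integration.integral_add[OF 1 2, symmetric]
    by (rule Bochner_Integration.integral_cong[OF refl]) (auto simp: indicator_def)
  also have "\<dots> = (LINT x|lebesgue. p x) * (LINT x|lebesgue. q x)"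
    using integral_fst'[OF t] by simp
  finally show ?thesis unfolding A B .
qed

definition prim :: "(real \<Rightarrow> real) \<Rightarrow> real \<Rightarrow> real"
  where "prim f x = integral {-2..x} f"

abbreviation AI :: "(real \<Rightarrow> real) \<Rightarrow> bool"
  where "AI f \<equiv> f absolutely_integrable_on {-2..2}"

lemma AI_integrable: "AI f \<Longrightarrow> f integrable_on {-2..2}"
  by (rule set_lebesgue_integral_eq_integral(1))

lemma AI_sub: "AI f \<Longrightarrow> -2 \<le> a \<Longrightarrow> b \<le> 2 \<Longrightarrow> f absolutely_integrable_on {a..b}"
  by (rule absolutely_integrable_on_subinterval) auto

lemma AI_integrable_sub: "AI f \<Longrightarrow> -2 \<le> a \<Longrightarrow> b \<le> 2 \<Longrightarrow> f integrable_on {a..b}"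
  using AI_sub set_lebesgue_integral_eq_integral(1) by blast

lemma LINT_Icc:
  fixes f :: "real \<Rightarrow> real"
  assumes "f absolutely_integrable_on {a..b}"
  shows "(LINT x:{a..b}|lebesgue. f x) = integral {a..b} f"
  by (rule set_lebesgue_integral_eq_integral(2)[OF assms])

lemma AE_not_finite: "finite S \<Longrightarrow> AE x in lebesgue. x \<notin> (S :: real set)"
  by (intro AE_not_in) (simp add: negligible_iff_null_sets[symmetric] negligible_finite)

lemma LINT_Ioo:
  fixes f :: "real \<Rightarrow> real"
  shows "(LINT x:{a<..<b}|lebesgue. f x) = (LINT x:{a..b}|lebesgue. f x)"
proof -
  have "AE x in lebesgue. x \<notin> {a, b}" by (rule AE_not_finite) simp
  then have "AE x in lebesgue. indicat_real {a<..<b} x *\<^sub>R f x = indicator {a..b} x *\<^sub>R f x"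
    by eventually_elim (auto simp: indicator_def)
  then have "(LINT x:UNIV|lebesgue. indicat_real {a<..<b} x *\<^sub>R f x) = (LINT x:UNIV|lebesgue. indicator {a..b} x *\<^sub>R f x)"
    by (intro set_integral_cong_lebesgue) simp
  then show ?thesis by (simp add: set_lebesgue_integral_def)
qed

lemma prim_diff:
  assumes "AI f" "-2 \<le> a" "a \<le> b" "b \<le> 2"
  shows "prim f b - prim f a = integral {a..b} f"
  using Henstock_Kurzweil_Integration.integral_combine[of "-2" a b f] AI_integrable_sub[OF assms(1), of "-2" b] assms
  by (simp add: prim_def)

lemma prim_m2 [simp]: "prim f (-2) = 0"
  by (simp add: prim_def)

lemma prim_cont: "AI f \<Longrightarrow> continuous_on {-2..2} (prim f)"
  unfolding prim_def[abs_def] by (rule indefinite_integral_continuous_1[OF AI_integrable])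

lemma AI_cont: "continuous_on {-2..2} f \<Longrightarrow> AI f"
  by (rule absolutely_integrable_continuous_real)

lemma AI_mult:
  assumes "AI f" "continuous_on {-2..2} g"
  shows "AI (\<lambda>x. g x * f x)"
proof (rule absolutely_integrable_bounded_measurable_product_real)
  show "g \<in> borel_measurable (lebesgue_on {-2..2})"
    by (rule continuous_imp_measurable_on_sets_lebesgue[OF assms(2)]) simp
  show "bounded (g ` {-2..2})"
    by (rule compact_imp_bounded[OF compact_continuous_image[OF assms(2)]]) simp
qed (use assms in auto)

lemma prim_cong: "(\<And>t. -2 \<le> t \<Longrightarrow> t \<le> x \<Longrightarrow> f t = g t) \<Longrightarrow> prim f x = prim g x"
  unfolding prim_def by (rule Henstock_Kurzweil_Integration.integral_cong) auto

lemma prim_linear: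
  assumes "AI f" "AI g" "-2 \<le> x" "x \<le> 2"
  shows "prim (\<lambda>t. a * f t + b * g t) x = a * prim f x + b * prim g x"
proof -
  have "f integrable_on {-2..x}" "g integrable_on {-2..x}"
    using AI_integrable_sub[OF assms(1), of "-2" x] AI_integrable_sub[OF assms(2), of "-2" x] assms by auto
  then have "((\<lambda>t. a * f t + b * g t) has_integral a * integral {-2..x} f + b * integral {-2..x} g) {-2..x}"
    by (intro has_integral_add has_integral_mult_right integrable_integral)
  then show ?thesis unfolding prim_def by (rule integral_unique)
qed

text \<open>Both functions are cut off outside [-2,2], so that integrals over half lines become
  primitives; the missing end point of an open half line is null.\<close>

lemma prim_by_parts:
  assumes p: "AI p" and q: "AI q"
  shows "integral {-2..2} (\<lambda>x. p x * prim q x) =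
    prim p 2 * prim q 2 - integral {-2..2} (\<lambda>x. prim p x * q x)"
proof -
  define p' where "p' x = indicator {-2..2} x *\<^sub>R p x" for x
  define q' where "q' x = indicator {-2..2} x *\<^sub>R q x" for x
  have i: "integrable lebesgue p'" "integrable lebesgue q'"
    using p q by (simp_all add: p'_def[abs_def] q'_def[abs_def] set_integrable_def)
  have le: "(LINT y:{..x}|lebesgue. q' y) = prim q x" if "x \<in> {-2..2}" for x
  proof -
    have "(LINT y:{..x}|lebesgue. q' y) = (LINT y:{-2..x}|lebesgue. q y)"
      unfolding set_lebesgue_integral_def
      by (rule Bochner_Integration.integral_cong) (use that in \<open>auto simp: q'_def indicator_def\<close>)
    also have "\<dots> = prim q x"
      unfolding prim_def by (rule LINT_Icc[OF AI_sub[OF q]]) (use that in auto)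
    finally show ?thesis .
  qed
  have lt: "(LINT y:{..<x}|lebesgue. p' y) = prim p x" if "x \<in> {-2..2}" for x
  proof -
    have "(LINT y:{..<x}|lebesgue. p' y) = (LINT y:{..x}|lebesgue. p' y)"
    proof -
      have "AE y in lebesgue. y \<notin> {x}" by (rule AE_not_finite) simp
      then have "AE y in lebesgue. indicat_real {..<x} y *\<^sub>R p' y = indicator {..x} y *\<^sub>R p' y"
        by eventually_elim (auto simp: indicator_def)
      then have "(LINT y:UNIV|lebesgue. indicat_real {..<x} y *\<^sub>R p' y) = (LINT y:UNIV|lebesgue. indicator {..x} y *\<^sub>R p' y)"
        by (intro set_integral_cong_lebesgue) simp
      then show ?thesis by (simp add: set_lebesgue_integral_def)
    qed
    also have "\<dots> = (LINT y:{-2..x}|lebesgue. p y)"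
      unfolding set_lebesgue_integral_def
      by (rule Bochner_Integration.integral_cong) (use that in \<open>auto simp: p'_def indicator_def\<close>)
    also have "\<dots> = prim p x"
      unfolding prim_def by (rule LINT_Icc[OF AI_sub[OF p]]) (use that in auto)
    finally show ?thesis .
  qed
  have "(LINT x|lebesgue. p' x * (LINT y:{..x}|lebesgue. q' y)) = (LINT x:{-2..2}|lebesgue. prim q x * p x)"
    unfolding set_lebesgue_integral_def
    by (rule Bochner_Integration.integral_cong)
      (use le in \<open>auto simp: p'_def indicator_def set_lebesgue_integral_def\<close>)
  also have "\<dots> = integral {-2..2} (\<lambda>x. prim q x * p x)"
    by (rule LINT_Icc[OF AI_mult[OF p prim_cont[OF q]]])
  finally have 1: "(LINT x|lebesgue. p' x * (LINT y:{..x}|lebesgue. q' y)) = \<dots>" .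
  have "(LINT x|lebesgue. (LINT y:{..<x}|lebesgue. p' y) * q' x) = (LINT x:{-2..2}|lebesgue. prim p x * q x)"
    unfolding set_lebesgue_integral_def
    by (rule Bochner_Integration.integral_cong)
      (use lt in \<open>auto simp: q'_def indicator_def set_lebesgue_integral_def\<close>)
  also have "\<dots> = integral {-2..2} (\<lambda>x. prim p x * q x)"
    by (rule LINT_Icc[OF AI_mult[OF q prim_cont[OF p]]])
  finally have 2: "(LINT x|lebesgue. (LINT y:{..<x}|lebesgue. p' y) * q' x) = \<dots>" .
  have "(LINT x|lebesgue. p' x) = prim p 2" "(LINT x|lebesgue. q' x) = prim q 2"
    unfolding prim_def LINT_Icc[OF p, symmetric] LINT_Icc[OF q, symmetric]
    by (simp_all add: set_lebesgue_integral_def p'_def[abs_def] q'_def[abs_def])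
  then show ?thesis
    using lebesgue_by_parts[OF i] unfolding 1 2 by (simp add: mult.commute)
qed

lemma prim_deriv:
  assumes "\<And>x. (f has_real_derivative f' x) (at x)" "-2 \<le> x"
  shows "prim f' x = f x - f (-2)"
proof -
  have "(f' has_integral f x - f (-2)) {-2..x}"
    by (rule fundamental_theorem_of_calculus)
      (use assms in \<open>auto simp flip: has_real_derivative_iff_has_vector_derivative
        intro: has_field_derivative_at_within\<close>)
  then show ?thesis by (simp add: prim_def integral_unique)
qed

text \<open>The strict inequality makes the function left-continuous: its value at a jump point is
  the left limit, and the right limit exceeds it by \<open>J\<close>. All representatives below
  follow this convention.\<close>

definition stepf :: "(real \<Rightarrow> real) \<Rightarrow> real set \<Rightarrow> real \<Rightarrow> real"
  where "stepf J S x = (\<Sum>s\<in>S. if s < x then J s else 0)"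

lemma AI_indicator_mult:
  assumes "AI q" "s \<in> {-2..2}"
  shows "AI (\<lambda>x. (if s < x then c else 0) * q x)"
    and "integral {-2..2} (\<lambda>x. (if s < x then c else 0) * q x) = c * (prim q 2 - prim q s)"
proof -
  have 1: "(\<lambda>x. c * q x) absolutely_integrable_on {s..2}"
    using AI_sub[OF assms(1), of s 2] assms(2) by auto
  have 2: "negligible {s}" by simp
  have "(\<lambda>x. if x \<in> {s..2} then c * q x else 0) absolutely_integrable_on UNIV"
    using 1 by (subst absolutely_integrable_restrict_UNIV)
  then have "(\<lambda>x. if x \<in> {s..2} then c * q x else 0) absolutely_integrable_on {-2..2}"
    by (rule set_integrable_subset) auto
  then show "AI (\<lambda>x. (if s < x then c else 0) * q x)"
    by (rule absolutely_integrable_spike[OF _ 2]) (use assms(2) in auto)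
  have "integral {-2..2} (\<lambda>x. (if s < x then c else 0) * q x) = integral {-2..2} (\<lambda>x. if x \<in> {s..2} then c * q x else 0)"
    by (rule integral_spike[OF 2]) (use assms(2) in auto)
  also have "\<dots> = integral {s..2} (\<lambda>x. c * q x)"
  proof -
    have "{s..2} \<inter> {-2..2} = {s..2}" using assms(2) by auto
    then show ?thesis using integral_restrict_Int[of "{-2..2}" "{s..2}" "\<lambda>x. c * q x"] by metis
  qed
  also have "\<dots> = c * (prim q 2 - prim q s)"
    using prim_diff[OF assms(1), of s 2] assms(2) by simp
  finally show "integral {-2..2} (\<lambda>x. (if s < x then c else 0) * q x) = c * (prim q 2 - prim q s)" .
qed

lemma AI_stepf_mult:
  assumes "AI q" "finite S" "S \<subseteq> {-2..2}"
  shows "AI (\<lambda>x. stepf J S x * q x)"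
    and "integral {-2..2} (\<lambda>x. stepf J S x * q x) = (\<Sum>s\<in>S. J s * (prim q 2 - prim q s))"
proof -
  have 1: "AI (\<lambda>x. (if s < x then J s else 0) * q x)"
    "integral {-2..2} (\<lambda>x. (if s < x then J s else 0) * q x) = J s * (prim q 2 - prim q s)" if "s \<in> S" for s
    using AI_indicator_mult[OF assms(1)] assms(3) that by auto
  show "AI (\<lambda>x. stepf J S x * q x)"
    unfolding stepf_def sum_distrib_right by (rule absolutely_integrable_sum[OF assms(2)]) (rule 1)
  show "integral {-2..2} (\<lambda>x. stepf J S x * q x) = (\<Sum>s\<in>S. J s * (prim q 2 - prim q s))"
    unfolding stepf_def sum_distrib_right
    by (subst Henstock_Kurzweil_Integration.integral_sum[OF assms(2)])
      (use 1 AI_integrable in auto)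
qed

text \<open>A step at s contributes J s (prim q 2 - prim q s). The terms at 2 combine with the
  boundary term of the absolutely continuous part into v(2) prim q 2, and the terms at the jump
  points remain.\<close>

lemma step_by_parts:
  assumes q: "AI q" and v': "AI v'" and S: "finite S" "S \<subseteq> {-2<..<2}"
    and v: "\<And>x. x \<in> {-2..2} \<Longrightarrow> v x = c + prim v' x + stepf J S x"
  shows "AI (\<lambda>x. v x * q x)"
    and "integral {-2..2} (\<lambda>x. v x * q x) =
      v 2 * prim q 2 - integral {-2..2} (\<lambda>x. v' x * prim q x) - (\<Sum>s\<in>S. J s * prim q s)"
proof -
  have S': "finite S" "S \<subseteq> {-2..2}" using S by auto
  have eq: "v x * q x = (c + prim v' x) * q x + stepf J S x * q x" if "x \<in> {-2..2}" for x
    using v[OF that] by (simp add: algebra_simps)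
  have 1: "AI (\<lambda>x. prim v' x * q x)" by (rule AI_mult[OF q prim_cont[OF v']])
  have 2: "AI (\<lambda>x. (c + prim v' x) * q x)"
    by (intro AI_mult[OF q] continuous_intros prim_cont[OF v'])
  have 3: "AI (\<lambda>x. (c + prim v' x) * q x + stepf J S x * q x)"
    by (intro set_integral_add(1) 2 AI_stepf_mult(1)[OF q S'])
  show "AI (\<lambda>x. v x * q x)"
    by (rule absolutely_integrable_spike[OF 3, of "{}"]) (use eq in auto)
  have "integral {-2..2} (\<lambda>x. v x * q x) = integral {-2..2} (\<lambda>x. (c * q x + prim v' x * q x) + stepf J S x * q x)"
    by (rule Henstock_Kurzweil_Integration.integral_cong) (use eq in \<open>auto simp: algebra_simps\<close>)
  also have "\<dots> = (c * prim q 2 + integral {-2..2} (\<lambda>x. prim v' x * q x)) + (\<Sum>s\<in>S. J s * (prim q 2 - prim q s))"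
  proof -
    have "((\<lambda>x. (c * q x + prim v' x * q x) + stepf J S x * q x) has_integral
        (c * integral {-2..2} q + integral {-2..2} (\<lambda>x. prim v' x * q x)) + integral {-2..2} (\<lambda>x. stepf J S x * q x)) {-2..2}"
      by (intro has_integral_add has_integral_mult_right integrable_integral AI_integrable q 1 AI_stepf_mult(1)[OF q S'])
    then show ?thesis
      unfolding AI_stepf_mult(2)[OF q S'] prim_def[of q 2] by (rule integral_unique)
  qed
  also have "integral {-2..2} (\<lambda>x. prim v' x * q x) = prim v' 2 * prim q 2 - integral {-2..2} (\<lambda>x. v' x * prim q x)"
    using prim_by_parts[OF v' q] by simp
  also have "(\<Sum>s\<in>S. J s * (prim q 2 - prim q s)) = stepf J S 2 * prim q 2 - (\<Sum>s\<in>S. J s * prim q s)"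
  proof -
    have "stepf J S 2 = (\<Sum>s\<in>S. J s)"
      unfolding stepf_def by (rule sum.cong) (use S(2) in auto)
    then show ?thesis by (simp add: right_diff_distrib sum_subtractf sum_distrib_right)
  qed
  finally show "integral {-2..2} (\<lambda>x. v x * q x) =
      v 2 * prim q 2 - integral {-2..2} (\<lambda>x. v' x * prim q x) - (\<Sum>s\<in>S. J s * prim q s)"
    using v[of 2] by (simp add: algebra_simps)
qed

section \<open>Square integrable functions and weak derivatives\<close>

lemma AE_lebesgueD:
  assumes "AE x in lebesgue. P (x :: real)"
  shows "\<exists>N. negligible N \<and> (\<forall>x. x \<notin> N \<longrightarrow> P x)"
proof -
  from assms obtain N where N: "N \<in> null_sets lebesgue" "{x \<in> space lebesgue. \<not> P x} \<subseteq> N"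
    unfolding eventually_ae_filter by blast
  show ?thesis
    by (rule exI[of _ N]) (use N in \<open>auto simp: negligible_iff_null_sets\<close>)
qed

lemma L2_on_cong:
  assumes "L2_on U f" "AE x in lebesgue. x \<in> U \<longrightarrow> f x = g x"
  shows "L2_on U g"
  unfolding L2_on_def
proof
  have ae: "AE x in lebesgue. indicator U x *\<^sub>R f x = indicator U x *\<^sub>R g x"
    using assms(2) by eventually_elim (auto simp: indicator_def)
  obtain N where N: "negligible N" "\<forall>x. x \<notin> N \<longrightarrow> indicator U x *\<^sub>R f x = indicat_real U x *\<^sub>R g x"
    using AE_lebesgueD[OF ae] by blast
  have "(\<lambda>x. indicator U x *\<^sub>R f x) measurable_on UNIV"
    using assms(1) unfolding L2_on_def set_borel_measurable_def
    by (simp add: measurable_on_iff_borel_measurable lebesgue_on_UNIV_eq)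
  then have "(\<lambda>x. indicator U x *\<^sub>R g x) measurable_on UNIV"
    by (rule measurable_on_spike[OF _ N(1)]) (metis N(2) DiffD2)
  then show "set_borel_measurable lebesgue U g"
    unfolding set_borel_measurable_def
    by (simp add: measurable_on_iff_borel_measurable lebesgue_on_UNIV_eq)
  show "set_integrable lebesgue U (\<lambda>x. (g x)\<^sup>2)"
  proof (rule set_integrable_cong_lebesgue)
    show "set_integrable lebesgue U (\<lambda>x. (f x)\<^sup>2)" using assms(1) by (simp add: L2_on_def)
    show "AE x in lebesgue. x \<in> U \<longrightarrow> (f x)\<^sup>2 = (g x)\<^sup>2"
      using assms(2) by eventually_elim simp
  qed
qed

lemma L2_on_mult:
  assumes "L2_on U f" "L2_on U g"
  shows "set_integrable lebesgue U (\<lambda>x. f x * g x)"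
proof -
  have [measurable]: "(\<lambda>x. indicator U x *\<^sub>R f x) \<in> borel_measurable lebesgue"
    "(\<lambda>x. indicator U x *\<^sub>R g x) \<in> borel_measurable lebesgue"
    using assms by (auto simp: L2_on_def set_borel_measurable_def)
  have i: "integrable lebesgue (\<lambda>x. indicator U x *\<^sub>R (f x)\<^sup>2 + indicator U x *\<^sub>R (g x)\<^sup>2)"
    using assms by (intro Bochner_Integration.integrable_add) (auto simp: L2_on_def set_integrable_def)
  have "integrable lebesgue (\<lambda>x. (indicator U x *\<^sub>R f x) * (indicator U x *\<^sub>R g x))"
  proof (rule Bochner_Integration.integrable_bound[OF i])
    show "AE x in lebesgue. norm ((indicator U x *\<^sub>R f x) * (indicator U x *\<^sub>R g x))
        \<le> norm (indicator U x *\<^sub>R (f x)\<^sup>2 + indicator U x *\<^sub>R (g x)\<^sup>2)"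
    proof (rule AE_I2)
      fix x
      have "0 \<le> (\<bar>f x\<bar> - \<bar>g x\<bar>)\<^sup>2" "0 \<le> \<bar>f x\<bar> * \<bar>g x\<bar>" by simp_all
      then have "2 * (\<bar>f x\<bar> * \<bar>g x\<bar>) \<le> (f x)\<^sup>2 + (g x)\<^sup>2"
        by (simp add: power2_diff)
      with \<open>0 \<le> \<bar>f x\<bar> * \<bar>g x\<bar>\<close> have "\<bar>f x\<bar> * \<bar>g x\<bar> \<le> (f x)\<^sup>2 + (g x)\<^sup>2"
        by linarith
      then show "norm ((indicator U x *\<^sub>R f x) * (indicator U x *\<^sub>R g x))
        \<le> norm (indicator U x *\<^sub>R (f x)\<^sup>2 + indicator U x *\<^sub>R (g x)\<^sup>2)"
        by (auto simp: indicator_def abs_mult)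
    qed
  qed measurable
  moreover have "(\<lambda>x. (indicator U x *\<^sub>R f x) * (indicator U x *\<^sub>R g x)) = (\<lambda>x. indicat_real U x *\<^sub>R (f x * g x))"
    by (auto simp: indicator_def)
  ultimately show ?thesis by (simp only: set_integrable_def)
qed

lemma L2_on_linear:
  assumes f: "L2_on U f" and g: "L2_on U g"
  shows "L2_on U (\<lambda>x. a * f x + b * g x)"
  unfolding L2_on_def
proof
  have [measurable]: "(\<lambda>x. indicator U x *\<^sub>R f x) \<in> borel_measurable lebesgue"
    "(\<lambda>x. indicator U x *\<^sub>R g x) \<in> borel_measurable lebesgue"
    using assms by (auto simp: L2_on_def set_borel_measurable_def)
  have "(\<lambda>x. a * (indicator U x *\<^sub>R f x) + b * (indicator U x *\<^sub>R g x)) \<in> borel_measurable lebesgue"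
    by measurable
  then show "set_borel_measurable lebesgue U (\<lambda>x. a * f x + b * g x)"
    unfolding set_borel_measurable_def by (simp add: algebra_simps)
  have "set_integrable lebesgue U (\<lambda>x. a\<^sup>2 * (f x * f x) + (2 * a * b) * (f x * g x) + b\<^sup>2 * (g x * g x))"
    by (intro set_integral_add(1) set_integrable_mult_right L2_on_mult f g)
  then show "set_integrable lebesgue U (\<lambda>x. (a * f x + b * g x)\<^sup>2)"
    by (simp add: power2_eq_square algebra_simps)
qed

lemma L2_on_bounded:
  assumes m: "f absolutely_integrable_on U" and U: "U \<in> lmeasurable" and B: "\<And>x. x \<in> U \<Longrightarrow> \<bar>f x\<bar> \<le> B"
  shows "L2_on U f"
  unfolding L2_on_def
proof
  have [measurable]: "(\<lambda>x. indicator U x *\<^sub>R f x) \<in> borel_measurable lebesgue"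
    using m by (simp add: set_integrable_def)
  then show "set_borel_measurable lebesgue U f" by (simp add: set_borel_measurable_def)
  have "integrable lebesgue (\<lambda>x. (indicator U x *\<^sub>R f x) * (indicator U x *\<^sub>R f x))"
  proof (rule Bochner_Integration.integrable_bound[of _ "\<lambda>x. indicator U x *\<^sub>R (B * f x)"])
    show "integrable lebesgue (\<lambda>x. indicator U x *\<^sub>R (B * f x))"
      using set_integrable_mult_right[of B lebesgue U f] m by (simp add: set_integrable_def)
    show "AE x in lebesgue. norm ((indicator U x *\<^sub>R f x) * (indicator U x *\<^sub>R f x)) \<le> norm (indicat_real U x *\<^sub>R (B * f x))"
    proof (rule AE_I2)
      fix x
      show "norm ((indicator U x *\<^sub>R f x) * (indicator U x *\<^sub>R f x)) \<le> norm (indicat_real U x *\<^sub>R (B * f x))"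
      proof (cases "x \<in> U")
        case True
        have "\<bar>f x\<bar> * \<bar>f x\<bar> \<le> \<bar>B\<bar> * \<bar>f x\<bar>" using B[OF True] by (intro mult_right_mono) auto
        then show ?thesis using True by (simp add: abs_mult)
      qed simp
    qed
  qed measurable
  moreover have "(\<lambda>x. (indicator U x *\<^sub>R f x) * (indicator U x *\<^sub>R f x)) = (\<lambda>x. indicat_real U x *\<^sub>R (f x)\<^sup>2)"
    by (auto simp: indicator_def power2_eq_square)
  ultimately show "set_integrable lebesgue U (\<lambda>x. (f x)\<^sup>2)" by (simp only: set_integrable_def)
qed

lemma L2_on_subset:
  assumes "L2_on U f" "V \<subseteq> U" "V \<in> sets lebesgue"
  shows "L2_on V f"
  unfolding L2_on_def
proof
  have [measurable]: "(\<lambda>x. indicator U x *\<^sub>R f x) \<in> borel_measurable lebesgue" "V \<in> sets lebesgue"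
    using assms by (auto simp: L2_on_def set_borel_measurable_def)
  have "(\<lambda>x. indicator V x *\<^sub>R (indicat_real U x *\<^sub>R f x)) \<in> borel_measurable lebesgue"
    by measurable
  moreover have "(\<lambda>x. indicator V x *\<^sub>R (indicat_real U x *\<^sub>R f x)) = (\<lambda>x. indicator V x *\<^sub>R f x)"
    using assms(2) by (auto simp: indicator_def fun_eq_iff)
  ultimately show "set_borel_measurable lebesgue V f" by (simp only: set_borel_measurable_def)
  show "set_integrable lebesgue V (\<lambda>x. (f x)\<^sup>2)"
    by (rule set_integrable_subset[of _ U]) (use assms in \<open>auto simp: L2_on_def\<close>)
qed

lemma L2_on_const: "U \<in> lmeasurable \<Longrightarrow> L2_on U (\<lambda>_. c)"
  by (rule L2_on_bounded[where B = "\<bar>c\<bar>"])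
    (auto simp: set_integrable_def fmeasurable_def)

lemma L2_on_integrable: "L2_on U f \<Longrightarrow> U \<in> lmeasurable \<Longrightarrow> f absolutely_integrable_on U"
  using L2_on_mult[of U f "\<lambda>_. 1"] L2_on_const by auto

lemma L2_on_Ioo_Icc: "L2_on {a<..<b} f \<Longrightarrow> f absolutely_integrable_on {a..b}"
  using L2_on_integrable[of "{a<..<b}" f] absolutely_integrable_on_Icc_iff_Ioo by auto

lemma L2_on_zero_extend:
  assumes "L2_on U f" "U \<subseteq> V"
  shows "L2_on V (\<lambda>x. indicator U x * f x)"
proof -
  have "(\<lambda>x. indicat_real V x *\<^sub>R (indicator U x * f x)) = (\<lambda>x. indicator U x *\<^sub>R f x)"
    "(\<lambda>x. indicat_real V x *\<^sub>R (indicator U x * f x)\<^sup>2) = (\<lambda>x. indicator U x *\<^sub>R (f x)\<^sup>2)"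
    using assms(2) by (auto simp: indicator_def fun_eq_iff)
  then show ?thesis
    using assms(1) unfolding L2_on_def set_borel_measurable_def set_integrable_def by simp
qed

lemma L2_on_sum:
  assumes "finite I" "\<And>i. i \<in> I \<Longrightarrow> L2_on U (f i)" "U \<in> lmeasurable"
  shows "L2_on U (\<lambda>x. \<Sum>i\<in>I. f i x)"
  using assms(1,2)
proof (induction I)
  case empty
  then show ?case using L2_on_const[OF assms(3), of 0] by simp
next
  case (insert i I)
  then show ?case using L2_on_linear[of U "f i" "\<lambda>x. \<Sum>i\<in>I. f i x" 1 1] by simp
qed

text \<open>The zero integral is what makes the primitive vanish again to the right of the
  support.\<close>

lemma test_fun_antideriv:
  assumes \<psi>: "test_fun {a<..<b} \<psi>" and z: "(LINT x:{a<..<b}|lebesgue. \<psi> x) = 0"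
  shows "\<exists>\<Psi>. test_fun {a<..<b} \<Psi> \<and> deriv \<Psi> = \<psi>"
proof (cases "\<exists>x. \<psi> x \<noteq> 0")
  case False
  then have "\<psi> = (\<lambda>_. 0)" by auto
  moreover have "deriv (\<lambda>_. 0 :: real) = (\<lambda>_. 0 :: real)" by auto
  ultimately show ?thesis using \<psi> by metis
next
  case True
  obtain C where C: "compact C" "C \<subseteq> {a<..<b}" "\<forall>x. x \<notin> C \<longrightarrow> \<psi> x = 0"
    using \<psi> by (auto simp: test_fun_def)
  with True have ne: "C \<noteq> {}" by auto
  obtain p where p: "p \<in> C" "\<And>x. x \<in> C \<Longrightarrow> p \<le> x" using compact_attains_inf[OF C(1) ne] by blast
  obtain q where q: "q \<in> C" "\<And>x. x \<in> C \<Longrightarrow> x \<le> q" using compact_attains_sup[OF C(1) ne] by blast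
  have pq: "a < p" "q < b" "p \<le> q" using p q C by auto
  have z0: "\<psi> x = 0" if "x < p \<or> q < x" for x
    using that p(2)[of x] q(2)[of x] C(3) by force
  have cont: "continuous_on S \<psi>" for S by (rule smooth_continuous[OF test_fun_smooth[OF \<psi>]])
  define \<Psi> where "\<Psi> x = integral {a..x} \<psi>" for x
  have lo: "\<Psi> x = 0" if "x \<le> p" for x
  proof -
    have "integral {a..x} \<psi> = integral {a..x} (\<lambda>_. 0)"
      by (rule integral_spike[of "{p}"]) (use that z0 in auto)
    then show ?thesis by (simp add: \<Psi>_def)
  qed
  have all: "integral {a..b} \<psi> = 0"
    using z unfolding LINT_Ioo by (subst (asm) LINT_Icc) (auto intro: absolutely_integrable_continuous_real cont)
  have hi: "\<Psi> x = 0" if "q \<le> x" for x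
  proof (cases "x \<le> b")
    case True
    have "integral {a..x} \<psi> + integral {x..b} \<psi> = integral {a..b} \<psi>"
      by (rule Henstock_Kurzweil_Integration.integral_combine) (use True that pq cont in \<open>auto intro: integrable_continuous_real\<close>)
    moreover have "integral {x..b} \<psi> = integral {x..b} (\<lambda>_. 0)"
      by (rule integral_spike[of "{q}"]) (use that z0 in auto)
    ultimately show ?thesis using all by (simp add: \<Psi>_def)
  next
    case False
    have "integral {a..b} \<psi> + integral {b..x} \<psi> = integral {a..x} \<psi>"
      by (rule Henstock_Kurzweil_Integration.integral_combine) (use False that pq cont in \<open>auto intro: integrable_continuous_real\<close>)
    moreover have "integral {b..x} \<psi> = integral {b..x} (\<lambda>_. 0)"
      by (rule integral_spike[of "{q}"]) (use that False pq z0 in auto)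
    ultimately show ?thesis using all by (simp add: \<Psi>_def)
  qed
  have D: "(\<Psi> has_real_derivative \<psi> x) (at x)" for x
  proof (cases "x < p")
    case True
    have "(\<Psi> has_real_derivative 0) (at x)"
      by (rule has_field_derivative_transform_within_open[where f = "\<lambda>_. 0" and S = "{..<p}"])
        (use True lo in auto)
    then show ?thesis using z0 True by simp
  next
    case False
    have "(\<Psi> has_real_derivative \<psi> x) (at x within {a..x + 1})"
      unfolding \<Psi>_def[abs_def]
      by (rule integral_has_real_derivative) (use False pq cont in auto)
    moreover have "at x within {a..x + 1} = at x"
    proof (rule at_within_open_subset)
      show "x \<in> {a<..<x + 1}" "open {a<..<x + 1}" "{a<..<x + 1} \<subseteq> {a..x + 1}" using False pq by auto
    qed
    ultimately show ?thesis by metis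
  qed
  have sm: "smooth \<Psi>" using smooth_antideriv[of \<psi> \<Psi>] test_fun_smooth[OF \<psi>] D by blast
  have out: "\<forall>x. x \<notin> {p..q} \<longrightarrow> \<Psi> x = 0"
  proof (intro allI impI)
    fix x assume "x \<notin> {p..q}"
    then have "x \<le> p \<or> q \<le> x" by (meson atLeastAtMost_iff linear)
    then show "\<Psi> x = 0" using lo[of x] hi[of x] by blast
  qed
  have "{p..q} \<subseteq> {a<..<b}" using pq by auto
  then have "test_fun {a<..<b} \<Psi>"
    unfolding test_fun_iff using sm out compact_Icc[of p q] by blast
  moreover have "deriv \<Psi> = \<psi>" by (rule ext, rule DERIV_imp_deriv, rule D)
  ultimately show ?thesis by blast
qed

text \<open>The fundamental lemma of the calculus of variations, as the case of four zero
  measures.\<close>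

lemma loc_integrable_zero_AE:
  assumes "open U" "loc_integrable_on U f" "\<And>\<phi>. test_fun U \<phi> \<Longrightarrow> (LINT x:U|lebesgue. f x * \<phi> x) = 0"
  shows "AE x in lebesgue. x \<in> U \<longrightarrow> f x = 0"
  by (rule weak_star_unique[OF assms(1,2) radon_on_null_measure radon_on_null_measure radon_on_null_measure
        radon_on_null_measure singular_on_null_measure singular_on_null_measure singular_on_null_measure
        singular_on_null_measure])
    (simp add: assms(3))

lemma AI_loc_integrable: "AI g \<Longrightarrow> U \<subseteq> {-2..2} \<Longrightarrow> loc_integrable_on U g"
  unfolding loc_integrable_on_def
  by (auto intro!: set_integrable_subset[of _ "{-2..2}"] simp: borel_compact)

lemma loc_integrable_diff:
  "loc_integrable_on U f \<Longrightarrow> loc_integrable_on U g \<Longrightarrow> loc_integrable_on U (\<lambda>x. f x - g x)"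
  unfolding loc_integrable_on_def by (auto intro: set_integral_diff(1))

lemma test_fun_bounds:
  assumes "test_fun U \<phi>" "U \<subseteq> {-2<..<2}"
  shows "\<phi> (-2) = 0" "\<phi> 2 = 0" "-2 \<le> x \<Longrightarrow> prim (deriv \<phi>) x = \<phi> x"
proof -
  show 0: "\<phi> (-2) = 0" "\<phi> 2 = 0"
    by (rule test_fun_eq_0[OF assms(1)], use assms(2) in force)+
  show "-2 \<le> x \<Longrightarrow> prim (deriv \<phi>) x = \<phi> x"
    using prim_deriv[OF smooth_has_deriv[OF test_fun_smooth[OF assms(1)]]] 0 by simp
qed

lemma AI_test_fun: "test_fun U \<phi> \<Longrightarrow> AI \<phi>"
  by (intro AI_cont smooth_continuous test_fun_smooth)

lemma LINT_test_eq_integral: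
  assumes "test_fun U \<phi>" "U \<subseteq> {-2<..<2}" "AI (\<lambda>x. f x * \<phi> x)"
  shows "(LINT x:U|lebesgue. f x * \<phi> x) = integral {-2..2} (\<lambda>x. f x * \<phi> x)"
proof -
  have "(LINT x:U|lebesgue. f x * \<phi> x) = (LINT x:{-2..2}|lebesgue. f x * \<phi> x)"
    by (rule set_integral_zero_outside[symmetric]) (use assms(2) test_fun_eq_0[OF assms(1)] in auto)
  then show ?thesis using LINT_Icc[OF assms(3)] by simp
qed

lemma weak_deriv_prim:
  assumes g: "AI g" and U: "U \<subseteq> {-2<..<2}"
  shows "weak_deriv U (prim g) g"
  unfolding weak_deriv_def
proof (intro conjI allI impI)
  have U': "U \<subseteq> {-2..2}" using U by force
  show "loc_integrable_on U (prim g)" "loc_integrable_on U g"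
    by (intro AI_loc_integrable AI_cont prim_cont g U')+
  fix \<phi> assume \<phi>: "test_fun U \<phi>"
  note d\<phi> = test_fun_deriv[OF \<phi>]
  have "(LINT x:U|lebesgue. prim g x * deriv \<phi> x) = integral {-2..2} (\<lambda>x. prim g x * deriv \<phi> x)"
    by (rule LINT_test_eq_integral[OF d\<phi> U]) (intro AI_mult AI_test_fun[OF d\<phi>] prim_cont g)
  also have "\<dots> = integral {-2..2} (\<lambda>x. deriv \<phi> x * prim g x)" by (simp add: mult.commute)
  also have "\<dots> = prim (deriv \<phi>) 2 * prim g 2 - integral {-2..2} (\<lambda>x. prim (deriv \<phi>) x * g x)"
    by (rule prim_by_parts[OF AI_test_fun[OF d\<phi>] g])
  also have "\<dots> = - integral {-2..2} (\<lambda>x. g x * \<phi> x)"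
  proof -
    have "integral {-2..2} (\<lambda>x. prim (deriv \<phi>) x * g x) = integral {-2..2} (\<lambda>x. g x * \<phi> x)"
      by (rule Henstock_Kurzweil_Integration.integral_cong) (use test_fun_bounds(3)[OF \<phi> U] in auto)
    then show ?thesis using test_fun_bounds[OF \<phi> U] by simp
  qed
  also have "integral {-2..2} (\<lambda>x. g x * \<phi> x) = (LINT x:U|lebesgue. g x * \<phi> x)"
  proof (rule LINT_test_eq_integral[OF \<phi> U, symmetric])
    show "AI (\<lambda>x. g x * \<phi> x)"
      using AI_mult[OF g smooth_continuous[OF test_fun_smooth[OF \<phi>]]] by (simp add: mult.commute)
  qed
  finally show "(LINT x:U|lebesgue. prim g x * deriv \<phi> x) = - (LINT x:U|lebesgue. g x * \<phi> x)" .
qed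

text \<open>The du Bois-Reymond argument: subtracting from a test function the multiple of a fixed
  bump with the same integral leaves a test function of integral zero, which is a derivative and is
  therefore annihilated by z.\<close>

lemma weak_deriv_const_AE:
  assumes z: "loc_integrable_on {a<..<b} z" and ab: "a < b"
    and 0: "\<And>\<phi>. test_fun {a<..<b} \<phi> \<Longrightarrow> (LINT x:{a<..<b}|lebesgue. z x * deriv \<phi> x) = 0"
  shows "\<exists>c. AE x in lebesgue. x \<in> {a<..<b} \<longrightarrow> z x = c"
proof -
  define a' where "a' = (2 * a + b) / 3"
  define b' where "b' = (a + 2 * b) / 3"
  have ab': "a < a'" "a' < b'" "b' < b" using ab by (auto simp: a'_def b'_def)
  define \<rho> where "\<rho> = bump a' b' 1"
  have \<rho>: "test_fun {a<..<b} \<rho>" unfolding \<rho>_def by (rule test_fun_bump) (use ab' in auto)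
  have one: "loc_integrable_on {a<..<b} (\<lambda>_. 1)"
    by (auto simp: loc_integrable_on_def intro: absolutely_integrable_on_const lmeasurable_compact)
  have int1: "set_integrable lebesgue {a<..<b} \<phi>" if "test_fun {a<..<b} \<phi>" for \<phi>
    using set_integrable_mult_test_fun[OF one that] by simp
  have intz: "set_integrable lebesgue {a<..<b} (\<lambda>x. z x * \<phi> x)" if "test_fun {a<..<b} \<phi>" for \<phi>
    by (rule set_integrable_mult_test_fun[OF z that])
  define I where "I = (LINT x:{a<..<b}|lebesgue. \<rho> x)"
  have "I \<noteq> 0"
  proof
    assume "I = 0"
    have i: "integrable lebesgue (\<lambda>x. indicator {a<..<b} x *\<^sub>R \<rho> x)"
      using int1[OF \<rho>] by (simp add: set_integrable_def)
    have "AE x in lebesgue. indicator {a<..<b} x *\<^sub>R \<rho> x = 0"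
      using integral_nonneg_eq_0_iff_AE[OF i] \<open>I = 0\<close> bump_bounds(1)[of a' b' 1]
      by (simp add: I_def set_lebesgue_integral_def \<rho>_def)
    then have "AE x in lebesgue. x \<notin> {a'<..<b'}"
    proof eventually_elim
      case (elim x)
      then show ?case using ab' bump_nonzero_iff[of 1 a' b' x] by (auto simp: indicator_def \<rho>_def)
    qed
    then have "{a'<..<b'} \<in> null_sets lebesgue"
      by (simp add: AE_iff_null_sets)
    then show False using ab' by (simp add: negligible_iff_null_sets[symmetric] open_not_negligible)
  qed
  \<comment> \<open>The only candidate for the constant is the mean of z weighted by
    \<open>\<rho>\<close>.\<close>
  define c where "c = (LINT x:{a<..<b}|lebesgue. z x * \<rho> x) / I"
  have "AE x in lebesgue. x \<in> {a<..<b} \<longrightarrow> z x - c = 0"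
  proof (rule loc_integrable_zero_AE)
    have "loc_integrable_on {a<..<b} (\<lambda>_. c)"
      by (auto simp: loc_integrable_on_def intro: absolutely_integrable_on_const lmeasurable_compact)
    then show "loc_integrable_on {a<..<b} (\<lambda>x. z x - c)" by (rule loc_integrable_diff[OF z])
    fix \<phi> assume \<phi>: "test_fun {a<..<b} \<phi>"
    define J where "J = (LINT x:{a<..<b}|lebesgue. \<phi> x)"
    define \<psi> where "\<psi> x = \<phi> x + (- J / I) * \<rho> x" for x
    have \<psi>: "test_fun {a<..<b} \<psi>"
      unfolding \<psi>_def[abs_def] by (intro test_fun_add test_fun_cmult \<phi> \<rho>)
    have "(LINT x:{a<..<b}|lebesgue. \<psi> x) = J + (- J / I) * I"
    proof -
      have "(LINT x:{a<..<b}|lebesgue. \<psi> x) = J + (LINT x:{a<..<b}|lebesgue. (- J / I) * \<rho> x)"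
        unfolding \<psi>_def J_def
        by (rule set_integral_add(2)[OF int1[OF \<phi>] set_integrable_mult_right]) (rule int1[OF \<rho>])
      also have "(LINT x:{a<..<b}|lebesgue. (- J / I) * \<rho> x) = (- J / I) * I"
        unfolding I_def by (rule set_integral_mult_right)
      finally show ?thesis .
    qed
    then have "(LINT x:{a<..<b}|lebesgue. \<psi> x) = 0" using \<open>I \<noteq> 0\<close> by simp
    then obtain \<Psi> where "test_fun {a<..<b} \<Psi>" "deriv \<Psi> = \<psi>"
      using test_fun_antideriv[OF \<psi>] by blast
    then have "(LINT x:{a<..<b}|lebesgue. z x * \<psi> x) = 0" using 0 by metis
    moreover have "(LINT x:{a<..<b}|lebesgue. z x * \<psi> x) =
        (LINT x:{a<..<b}|lebesgue. z x * \<phi> x) + (- J / I) * (LINT x:{a<..<b}|lebesgue. z x * \<rho> x)"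
    proof -
      have "(LINT x:{a<..<b}|lebesgue. z x * \<psi> x) = (LINT x:{a<..<b}|lebesgue. z x * \<phi> x + (- J / I) * (z x * \<rho> x))"
        by (simp add: \<psi>_def algebra_simps)
      also have "\<dots> = (LINT x:{a<..<b}|lebesgue. z x * \<phi> x) + (LINT x:{a<..<b}|lebesgue. (- J / I) * (z x * \<rho> x))"
        by (rule set_integral_add(2)[OF intz[OF \<phi>] set_integrable_mult_right]) (rule intz[OF \<rho>])
      also have "(LINT x:{a<..<b}|lebesgue. (- J / I) * (z x * \<rho> x)) = (- J / I) * (LINT x:{a<..<b}|lebesgue. z x * \<rho> x)"
        by (rule set_integral_mult_right)
      finally show ?thesis .
    qed
    ultimately have "(LINT x:{a<..<b}|lebesgue. z x * \<phi> x) = c * J"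
      using \<open>I \<noteq> 0\<close> by (simp add: c_def field_simps)
    moreover have "(LINT x:{a<..<b}|lebesgue. (z x - c) * \<phi> x) = (LINT x:{a<..<b}|lebesgue. z x * \<phi> x) - c * J"
    proof -
      have "(LINT x:{a<..<b}|lebesgue. (z x - c) * \<phi> x) = (LINT x:{a<..<b}|lebesgue. z x * \<phi> x - c * \<phi> x)"
        by (simp add: algebra_simps)
      also have "\<dots> = (LINT x:{a<..<b}|lebesgue. z x * \<phi> x) - (LINT x:{a<..<b}|lebesgue. c * \<phi> x)"
        by (rule set_integral_diff(2)[OF intz[OF \<phi>] set_integrable_mult_right]) (rule int1[OF \<phi>])
      finally show ?thesis by (simp add: J_def)
    qed
    ultimately show "(LINT x:{a<..<b}|lebesgue. (z x - c) * \<phi> x) = 0" by simp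
  qed simp
  then have "AE x in lebesgue. x \<in> {a<..<b} \<longrightarrow> z x = c" by eventually_elim simp
  then show ?thesis by blast
qed

lemma weak_deriv_imp_prim:
  assumes w: "weak_deriv {a<..<b} v g" and g: "AI g" and ab: "-2 \<le> a" "a < b" "b \<le> 2"
  shows "\<exists>c. AE x in lebesgue. x \<in> {a<..<b} \<longrightarrow> v x = c + prim g x"
proof -
  have sub: "{a<..<b} \<subseteq> {-2<..<2}" using ab by auto
  have p: "weak_deriv {a<..<b} (prim g) g" by (rule weak_deriv_prim[OF g sub])
  have "\<exists>c. AE x in lebesgue. x \<in> {a<..<b} \<longrightarrow> v x - prim g x = c"
  proof (rule weak_deriv_const_AE[OF _ ab(2)])
    show "loc_integrable_on {a<..<b} (\<lambda>x. v x - prim g x)"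
      using w p by (intro loc_integrable_diff) (auto simp: weak_deriv_def)
    fix \<phi> assume \<phi>: "test_fun {a<..<b} \<phi>"
    have i: "set_integrable lebesgue {a<..<b} (\<lambda>x. v x * deriv \<phi> x)"
      "set_integrable lebesgue {a<..<b} (\<lambda>x. prim g x * deriv \<phi> x)"
      using w p by (auto intro!: set_integrable_mult_test_fun test_fun_deriv[OF \<phi>] simp: weak_deriv_def)
    have "(LINT x:{a<..<b}|lebesgue. (v x - prim g x) * deriv \<phi> x) =
        (LINT x:{a<..<b}|lebesgue. v x * deriv \<phi> x) - (LINT x:{a<..<b}|lebesgue. prim g x * deriv \<phi> x)"
      unfolding left_diff_distrib by (rule set_integral_diff(2)[OF i])
    also have "\<dots> = 0" using w p \<phi> by (simp add: weak_deriv_def)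
    finally show "(LINT x:{a<..<b}|lebesgue. (v x - prim g x) * deriv \<phi> x) = 0" .
  qed
  then obtain c where "AE x in lebesgue. x \<in> {a<..<b} \<longrightarrow> v x - prim g x = c" by blast
  then have "AE x in lebesgue. x \<in> {a<..<b} \<longrightarrow> v x = c + prim g x" by eventually_elim auto
  then show ?thesis by blast
qed

section \<open>Piecewise \<open>H\<^sup>2\<close> functions\<close>

text \<open>Left-continuous representatives \<open>v0\<close>, \<open>v1\<close> of a piecewise \<open>H\<^sup>2\<close> function and of its first derivative,
  with jumps \<open>J0\<close>, \<open>J1\<close> (right minus left limit); \<open>v2\<close> represents the second derivative.\<close>

definition rep where
  "rep S J0 J1 v0 v1 v2 \<longleftrightarrow> finite S \<and> S \<subseteq> {-2<..<2} \<and> (\<forall>s. s \<notin> S \<longrightarrow> J0 s = 0 \<and> J1 s = 0) \<and>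
    L2_on {-2<..<2} v2 \<and>
    (\<exists>c. \<forall>x\<in>{-2..2}. v1 x = c + prim v2 x + stepf J1 S x) \<and>
    (\<exists>c. \<forall>x\<in>{-2..2}. v0 x = c + prim v1 x + stepf J0 S x)"

lemma stepf_superset:
  assumes "finite T" "S \<subseteq> T" "\<And>s. s \<notin> S \<Longrightarrow> J s = 0"
  shows "stepf J T x = stepf J S x"
  unfolding stepf_def by (rule sum.mono_neutral_right) (use assms in auto)

lemma stepf_linear: "stepf (\<lambda>s. a * J s + b * L s) S x = a * stepf J S x + b * stepf L S x"
  unfolding stepf_def sum_distrib_left sum.distrib[symmetric] by (rule sum.cong) auto

text \<open>Points with zero jumps may be added, so that two functions with different jump sets
  share one finite set and can be combined linearly.\<close>

lemma rep_superset:
  assumes "rep S J0 J1 v0 v1 v2" "finite T" "S \<subseteq> T" "T \<subseteq> {-2<..<2}"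
  shows "rep T J0 J1 v0 v1 v2"
proof -
  have "stepf J0 T = stepf J0 S" "stepf J1 T = stepf J1 S"
    using stepf_superset[OF assms(2,3)] assms(1) unfolding rep_def by blast+
  with assms show ?thesis unfolding rep_def by simp blast
qed

lemma rep_AI:
  assumes "rep S J0 J1 v0 v1 v2"
  shows "AI v2" "AI v1" "AI v0"
proof -
  have S: "finite S" "S \<subseteq> {-2<..<2}" using assms by (simp_all add: rep_def)
  have one: "AI (\<lambda>_. 1)" by (rule AI_cont) simp
  show 2: "AI v2" using assms unfolding rep_def by (intro L2_on_Ioo_Icc) simp
  obtain c where c: "\<forall>x\<in>{-2..2}. v1 x = c + prim v2 x + stepf J1 S x" using assms by (auto simp: rep_def)
  show 1: "AI v1" using step_by_parts(1)[OF one 2 S, of v1] c by simp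
  obtain d where d: "\<forall>x\<in>{-2..2}. v0 x = d + prim v1 x + stepf J0 S x" using assms by (auto simp: rep_def)
  show "AI v0" using step_by_parts(1)[OF one 1 S, of v0] d by simp
qed

lemma rep_by_parts:
  assumes "rep S J0 J1 v0 v1 v2" "AI q"
  shows "integral {-2..2} (\<lambda>x. v0 x * q x) =
      v0 2 * prim q 2 - integral {-2..2} (\<lambda>x. v1 x * prim q x) - (\<Sum>s\<in>S. J0 s * prim q s)"
    and "integral {-2..2} (\<lambda>x. v1 x * q x) =
      v1 2 * prim q 2 - integral {-2..2} (\<lambda>x. v2 x * prim q x) - (\<Sum>s\<in>S. J1 s * prim q s)"
    and "AI (\<lambda>x. v0 x * q x)" and "AI (\<lambda>x. v1 x * q x)"
proof -
  have S: "finite S" "S \<subseteq> {-2<..<2}" using assms by (simp_all add: rep_def)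
  note AI = rep_AI[OF assms(1)]
  obtain c where c: "\<forall>x\<in>{-2..2}. v1 x = c + prim v2 x + stepf J1 S x" using assms by (auto simp: rep_def)
  obtain d where d: "\<forall>x\<in>{-2..2}. v0 x = d + prim v1 x + stepf J0 S x" using assms by (auto simp: rep_def)
  show "integral {-2..2} (\<lambda>x. v0 x * q x) =
      v0 2 * prim q 2 - integral {-2..2} (\<lambda>x. v1 x * prim q x) - (\<Sum>s\<in>S. J0 s * prim q s)"
    "AI (\<lambda>x. v0 x * q x)"
    using step_by_parts[OF assms(2) AI(2) S, of v0] d by auto
  show "integral {-2..2} (\<lambda>x. v1 x * q x) =
      v1 2 * prim q 2 - integral {-2..2} (\<lambda>x. v2 x * prim q x) - (\<Sum>s\<in>S. J1 s * prim q s)"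
    "AI (\<lambda>x. v1 x * q x)"
    using step_by_parts[OF assms(2) AI(1) S, of v1] c by auto
qed

lemma rep_linear:
  assumes v: "rep S J0 J1 v0 v1 v2" and w: "rep S L0 L1 w0 w1 w2"
  shows "rep S (\<lambda>s. a * J0 s + b * L0 s) (\<lambda>s. a * J1 s + b * L1 s)
    (\<lambda>x. a * v0 x + b * w0 x) (\<lambda>x. a * v1 x + b * w1 x) (\<lambda>x. a * v2 x + b * w2 x)"
proof -
  obtain c d where c: "\<forall>x\<in>{-2..2}. v1 x = c + prim v2 x + stepf J1 S x"
    and d: "\<forall>x\<in>{-2..2}. v0 x = d + prim v1 x + stepf J0 S x" using v by (auto simp: rep_def)
  obtain c' d' where c': "\<forall>x\<in>{-2..2}. w1 x = c' + prim w2 x + stepf L1 S x"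
    and d': "\<forall>x\<in>{-2..2}. w0 x = d' + prim w1 x + stepf L0 S x" using w by (auto simp: rep_def)
  have e1: "\<exists>c. \<forall>x\<in>{-2..2}. a * v1 x + b * w1 x = c + prim (\<lambda>x. a * v2 x + b * w2 x) x +
      stepf (\<lambda>s. a * J1 s + b * L1 s) S x"
    by (rule exI[of _ "a * c + b * c'"])
      (use c c' prim_linear[OF rep_AI(1)[OF v] rep_AI(1)[OF w]] in \<open>simp add: stepf_linear algebra_simps\<close>)
  have e0: "\<exists>c. \<forall>x\<in>{-2..2}. a * v0 x + b * w0 x = c + prim (\<lambda>x. a * v1 x + b * w1 x) x +
      stepf (\<lambda>s. a * J0 s + b * L0 s) S x"
    by (rule exI[of _ "a * d + b * d'"])
      (use d d' prim_linear[OF rep_AI(2)[OF v] rep_AI(2)[OF w]] in \<open>simp add: stepf_linear algebra_simps\<close>)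
  have l2: "L2_on {-2<..<2} (\<lambda>x. a * v2 x + b * w2 x)"
    using v w by (intro L2_on_linear) (simp_all add: rep_def)
  have S: "finite S" "S \<subseteq> {-2<..<2}"
    "\<forall>s. s \<notin> S \<longrightarrow> a * J0 s + b * L0 s = 0 \<and> a * J1 s + b * L1 s = 0"
    using v w by (simp_all add: rep_def)
  show ?thesis
    unfolding rep_def by (intro conjI S l2 e1 e0)
qed

lemma stepf_bounded: "\<bar>stepf J S x\<bar> \<le> (\<Sum>s\<in>S. \<bar>J s\<bar>)"
  unfolding stepf_def by (rule order.trans[OF sum_abs]) (rule sum_mono, simp)

lemma prim_bounded:
  assumes "AI f"
  shows "\<exists>B. \<forall>x\<in>{-2..2}. \<bar>prim f x\<bar> \<le> B"
  using compact_imp_bounded[OF compact_continuous_image[OF prim_cont[OF assms]]]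
  by (auto simp: bounded_iff)

lemma rep_bounded:
  assumes "rep S J0 J1 v0 v1 v2"
  shows "\<exists>B. \<forall>x\<in>{-2..2}. \<bar>v0 x\<bar> \<le> B" "\<exists>B. \<forall>x\<in>{-2..2}. \<bar>v1 x\<bar> \<le> B"
proof -
  have *: "\<exists>B. \<forall>x\<in>{-2..2}. \<bar>v x\<bar> \<le> B" if f: "AI f" and v: "\<forall>x\<in>{-2..2}. v x = c + prim f x + stepf J S x" for f v c J
  proof -
    obtain B where B: "\<forall>x\<in>{-2..2}. \<bar>prim f x\<bar> \<le> B" using prim_bounded[OF f] by blast
    have "\<bar>v x\<bar> \<le> \<bar>c\<bar> + B + (\<Sum>s\<in>S. \<bar>J s\<bar>)" if "x \<in> {-2..2}" for x
    proof -
      have "v x = c + prim f x + stepf J S x" "\<bar>prim f x\<bar> \<le> B" using v B that by blast+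
      then show ?thesis using stepf_bounded[of J S x] by linarith
    qed
    then show ?thesis by blast
  qed
  show "\<exists>B. \<forall>x\<in>{-2..2}. \<bar>v0 x\<bar> \<le> B" "\<exists>B. \<forall>x\<in>{-2..2}. \<bar>v1 x\<bar> \<le> B"
    using assms *[OF rep_AI(2)[OF assms]] *[OF rep_AI(1)[OF assms]] unfolding rep_def by blast+
qed

lemma AI_bounded_L2:
  assumes "AI f" "\<forall>x\<in>{-2..2}. \<bar>f x\<bar> \<le> B" "U \<subseteq> {-2<..<2}" "open U"
  shows "L2_on U f"
proof (rule L2_on_subset[OF _ assms(3)])
  show "L2_on {-2<..<2} f"
    by (rule L2_on_bounded[where B = B])
      (use assms in \<open>auto simp: absolutely_integrable_on_Icc_iff_Ioo[symmetric]\<close>)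
  show "U \<in> sets lebesgue" using assms(4) by auto
qed

lemma rep_L2:
  assumes "rep S J0 J1 v0 v1 v2" "U \<subseteq> {-2<..<2}" "open U"
  shows "L2_on U v0" "L2_on U v1" "L2_on U v2"
proof -
  show "L2_on U v0" "L2_on U v1"
    using rep_bounded[OF assms(1)] rep_AI[OF assms(1)] AI_bounded_L2[OF _ _ assms(2,3)] by metis+
  show "L2_on U v2"
    using L2_on_subset[of "{-2<..<2}" v2 U] assms by (auto simp: rep_def)
qed

lemma weak_deriv_linear:
  assumes "weak_deriv U f g" "weak_deriv U f' g'"
  shows "weak_deriv U (\<lambda>x. a * f x + b * f' x) (\<lambda>x. a * g x + b * g' x)"
proof -
  have li: "loc_integrable_on U f" "loc_integrable_on U g" "loc_integrable_on U f'" "loc_integrable_on U g'"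
    using assms by (simp_all add: weak_deriv_def)
  have comb: "loc_integrable_on U (\<lambda>x. a * p x + b * q x)"
    if "loc_integrable_on U p" "loc_integrable_on U q" for p q
    using that unfolding loc_integrable_on_def by (auto intro!: set_integral_add(1) set_integrable_mult_right)
  have I: "(LINT x:U|lebesgue. (a * p x + b * q x) * \<phi> x) =
      a * (LINT x:U|lebesgue. p x * \<phi> x) + b * (LINT x:U|lebesgue. q x * \<phi> x)"
    if pq: "loc_integrable_on U p" "loc_integrable_on U q" and \<phi>: "test_fun U \<phi>" for p q \<phi>
  proof -
    have i: "set_integrable lebesgue U (\<lambda>x. a * (p x * \<phi> x))" "set_integrable lebesgue U (\<lambda>x. b * (q x * \<phi> x))"
      by (intro set_integrable_mult_right set_integrable_mult_test_fun[OF _ \<phi>] pq)+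
    have "(LINT x:U|lebesgue. (a * p x + b * q x) * \<phi> x) = (LINT x:U|lebesgue. a * (p x * \<phi> x) + b * (q x * \<phi> x))"
      by (simp add: algebra_simps)
    also have "\<dots> = (LINT x:U|lebesgue. a * (p x * \<phi> x)) + (LINT x:U|lebesgue. b * (q x * \<phi> x))"
      by (rule set_integral_add(2)[OF i])
    finally show ?thesis unfolding set_integral_mult_right .
  qed
  show ?thesis
    unfolding weak_deriv_def
  proof (intro conjI allI impI comb li)
    fix \<phi> assume \<phi>: "test_fun U \<phi>"
    have "(LINT x:U|lebesgue. f x * deriv \<phi> x) = - (LINT x:U|lebesgue. g x * \<phi> x)"
      "(LINT x:U|lebesgue. f' x * deriv \<phi> x) = - (LINT x:U|lebesgue. g' x * \<phi> x)"
      using assms \<phi> by (simp_all add: weak_deriv_def)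
    then show "(LINT x:U|lebesgue. (a * f x + b * f' x) * deriv \<phi> x) = - (LINT x:U|lebesgue. (a * g x + b * g' x) * \<phi> x)"
      unfolding I[OF li(1,3) test_fun_deriv[OF \<phi>]] I[OF li(2,4) \<phi>] by (simp add: algebra_simps)
  qed
qed

lemma weak_deriv_const:
  assumes "U \<subseteq> {-2<..<2}"
  shows "weak_deriv U (\<lambda>_. c) (\<lambda>_. 0)"
  unfolding weak_deriv_def
proof (intro conjI allI impI)
  show "loc_integrable_on U (\<lambda>_. c)" "loc_integrable_on U (\<lambda>_. 0)"
    by (auto simp: loc_integrable_on_def intro: absolutely_integrable_on_const lmeasurable_compact)
  fix \<phi> assume \<phi>: "test_fun U \<phi>"
  have "(LINT x:U|lebesgue. c * deriv \<phi> x) = integral {-2..2} (\<lambda>x. c * deriv \<phi> x)"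
    by (rule LINT_test_eq_integral[OF test_fun_deriv[OF \<phi>] assms])
      (intro set_integrable_mult_right AI_test_fun[OF test_fun_deriv[OF \<phi>]])
  also have "\<dots> = c * prim (deriv \<phi>) 2" by (simp add: prim_def)
  also have "\<dots> = 0" using test_fun_bounds[OF \<phi> assms] by simp
  finally show "(LINT x:U|lebesgue. c * deriv \<phi> x) = - (LINT x:U|lebesgue. 0 * \<phi> x)"
    by simp
qed

lemma weak_deriv_const_prim:
  assumes "AI g" "U \<subseteq> {-2<..<2}" "AE x in lebesgue. x \<in> U \<longrightarrow> v x = c + prim g x"
  shows "weak_deriv U v g"
proof (rule weak_deriv_cong[OF weak_deriv_linear[OF weak_deriv_const[OF assms(2), of c] weak_deriv_prim[OF assms(1,2)], of 1 1]])
  show "AE x in lebesgue. x \<in> U \<longrightarrow> 1 * c + 1 * prim g x = v x"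
    using assms(3) by eventually_elim simp
qed simp

text \<open>Between jump points the steps to the left add up to a constant. The piece is closed on
  the right because the representatives are left-continuous.\<close>

lemma rep_piece:
  assumes "rep S J0 J1 v0 v1 v2" "-2 \<le> a" "b \<le> 2" "S \<inter> {a<..<b} = {}"
  shows "\<exists>c. \<forall>x\<in>{a<..b}. v0 x = c + prim v1 x" "\<exists>c. \<forall>x\<in>{a<..b}. v1 x = c + prim v2 x"
proof -
  have *: "stepf J S x = (\<Sum>s\<in>S. if s \<le> a then J s else 0)" if "x \<in> {a<..b}" for J x
    unfolding stepf_def
  proof (rule sum.cong[OF refl])
    fix s assume "s \<in> S"
    then have "s \<le> a \<or> b \<le> s" using assms(4) by force
    then show "(if s < x then J s else 0) = (if s \<le> a then J s else 0)" using that by auto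
  qed
  obtain c where c: "\<forall>x\<in>{-2..2}. v1 x = c + prim v2 x + stepf J1 S x" using assms by (auto simp: rep_def)
  obtain d where d: "\<forall>x\<in>{-2..2}. v0 x = d + prim v1 x + stepf J0 S x" using assms by (auto simp: rep_def)
  show "\<exists>c. \<forall>x\<in>{a<..b}. v0 x = c + prim v1 x"
    by (rule exI[of _ "d + (\<Sum>s\<in>S. if s \<le> a then J0 s else 0)"]) (use d * assms in auto)
  show "\<exists>c. \<forall>x\<in>{a<..b}. v1 x = c + prim v2 x"
    by (rule exI[of _ "c + (\<Sum>s\<in>S. if s \<le> a then J1 s else 0)"]) (use c * assms in auto)
qed

lemma rep_weak_deriv:
  assumes "rep S J0 J1 v0 v1 v2" "-2 \<le> a" "b \<le> 2" "S \<inter> {a<..<b} = {}"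
  shows "weak_deriv {a<..<b} v0 v1" "weak_deriv {a<..<b} v1 v2"
proof -
  obtain c d where "\<forall>x\<in>{a<..b}. v0 x = c + prim v1 x" "\<forall>x\<in>{a<..b}. v1 x = d + prim v2 x"
    using rep_piece[OF assms] by blast
  then have "AE x in lebesgue. x \<in> {a<..<b} \<longrightarrow> v0 x = c + prim v1 x"
    "AE x in lebesgue. x \<in> {a<..<b} \<longrightarrow> v1 x = d + prim v2 x"
    by (intro AE_I2, simp)+
  moreover have "{a<..<b} \<subseteq> {-2<..<2}" using assms by auto
  ultimately show "weak_deriv {a<..<b} v0 v1" "weak_deriv {a<..<b} v1 v2"
    using weak_deriv_const_prim rep_AI[OF assms(1)] by blast+
qed

definition prep where
  "prep v S J0 J1 v0 v1 v2 \<longleftrightarrow> rep S J0 J1 v0 v1 v2 \<and> (AE x in lebesgue. x \<in> {-2<..<2} \<longrightarrow> v x = v0 x)"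

text \<open>The jump points and the two end points, sorted, form the required partition.\<close>

lemma prep_imp_piecewise_H2:
  assumes "prep v S J0 J1 v0 v1 v2"
  shows "piecewise_H2 v"
proof -
  have r: "rep S J0 J1 v0 v1 v2" and ae: "AE x in lebesgue. x \<in> {-2<..<2} \<longrightarrow> v x = v0 x"
    using assms by (simp_all add: prep_def)
  have S: "finite S" "S \<subseteq> {-2<..<2}" using r by (simp_all add: rep_def)
  define xs where "xs = sorted_list_of_set (S \<union> {-2, 2})"
  define n where "n = length xs - 1"
  have set: "set xs = S \<union> {-2, 2}" unfolding xs_def by (rule set_sorted_list_of_set) (use S in simp)
  have so: "sorted_wrt (<) xs" unfolding xs_def by (rule strict_sorted_list_of_set)
  have ne: "xs \<noteq> []" using set by auto
  have len: "length xs = Suc n" using ne by (simp add: n_def)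
  have less: "xs ! i < xs ! j \<longleftrightarrow> i < j" if "i < length xs" "j < length xs" for i j
    using sorted_wrt_nth_less[OF so, of i j] sorted_wrt_nth_less[OF so, of j i] that
    by (cases i j rule: linorder_cases) auto
  have range: "-2 \<le> xs ! i \<and> xs ! i \<le> 2" if "i < length xs" for i
    using nth_mem[OF that] set S by auto
  obtain i0 where i0: "i0 < length xs" "xs ! i0 = -2" using set by (metis Un_iff in_set_conv_nth insertI1)
  obtain i1 where i1: "i1 < length xs" "xs ! i1 = 2" using set by (metis Un_iff in_set_conv_nth insertI1 insertI2)
  have z: "xs ! 0 = -2"
    using less[of 0 i0] range[of 0] i0 ne by (cases "i0 = 0") auto
  have l: "xs ! n = 2"
    using less[of i1 n] range[of n] i1 len by (cases "i1 = n") auto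
  have "\<forall>i<n. xs ! i < xs ! Suc i \<and> H2_on {xs ! i<..<xs ! Suc i} v"
  proof (intro allI impI)
    fix i assume i: "i < n"
    let ?a = "xs ! i" and ?b = "xs ! Suc i"
    have ab: "?a < ?b" "-2 \<le> ?a" "?b \<le> 2" using less[of i "Suc i"] range[of i] range[of "Suc i"] i len by auto
    have "S \<inter> {?a<..<?b} = {}"
    proof (rule ccontr)
      assume "S \<inter> {?a<..<?b} \<noteq> {}"
      then obtain s where s: "s \<in> S" "?a < s" "s < ?b" by auto
      then obtain j where j: "j < length xs" "xs ! j = s" using set by (metis UnI1 in_set_conv_nth)
      then show False using less[of i j] less[of j "Suc i"] s i len by auto
    qed
    note w = rep_weak_deriv[OF r ab(2,3) this]
    have sub: "{?a<..<?b} \<subseteq> {-2<..<2}" using ab by auto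
    have ae': "AE x in lebesgue. x \<in> {?a<..<?b} \<longrightarrow> v0 x = v x"
      using ae by eventually_elim (use sub in auto)
    have comp: "components {?a<..<?b} = {{?a<..<?b}}"
      using ab(1) by (simp add: components_eq_sing_iff)
    have "H2_on {?a<..<?b} v"
      unfolding H2_on_def comp
    proof (intro exI conjI)
      show "weak_deriv {?a<..<?b} v v1" by (rule weak_deriv_cong[OF w(1) ae']) simp
      show "weak_deriv {?a<..<?b} v1 v2" by (rule w(2))
      show "L2_on {?a<..<?b} v" by (rule L2_on_cong[OF rep_L2(1)[OF r sub] ae']) simp
      show "\<forall>I\<in>{{?a<..<?b}}. L2_on I v1" using rep_L2(2)[OF r sub] by simp
      show "L2_on {?a<..<?b} v2" using rep_L2(3)[OF r sub] by simp
    qed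
    then show "?a < ?b \<and> H2_on {?a<..<?b} v" using ab by blast
  qed
  then show ?thesis
    unfolding piecewise_H2_def using z l by (intro exI[of _ n] exI[of _ "\<lambda>i. xs ! i"]) blast
qed

section \<open>From a partition into H^2 pieces to a representation with jumps\<close>

lemma AE_ball_finite_nat:
  assumes "\<And>i. i < (n::nat) \<Longrightarrow> AE x in M. P i x"
  shows "AE x in M. \<forall>i<n. P i x"
proof -
  have "AE x in M. \<forall>i. i < n \<longrightarrow> P i x"
    by (subst AE_all_countable) (use assms in auto)
  then show ?thesis by simp
qed

text \<open>On each piece the function is a constant plus a primitive taken over the whole domain;
  only the constants differ from piece to piece, and their differences are the jumps. The argument
  runs first for the slope and then for the function itself.\<close>

lemma piecewise_H2_imp_prep:
  assumes "piecewise_H2 v"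
  shows "\<exists>S J0 J1 v0 v1 v2. prep v S J0 J1 v0 v1 v2"
proof -
  obtain n s where s: "s 0 = -2" "s n = 2" "\<And>i. i < n \<Longrightarrow> s i < s (Suc i)"
    and H: "\<And>i. i < n \<Longrightarrow> H2_on {s i<..<s (Suc i)} v"
    using assms unfolding piecewise_H2_def by blast
  define I where "I i = {s i<..<s (Suc i)}" for i
  have mono: "s i < s j" if "i < j" "j \<le> n" for i j
    using that
  proof (induction j)
    case (Suc j)
    then show ?case using s(3)[of j] by (cases "i = j") (auto intro: less_trans)
  qed simp
  have rng: "-2 \<le> s i" "s i \<le> 2" if "i \<le> n" for i
    using mono[of 0 i] mono[of i n] s that by (cases "i = 0"; cases "i = n"; force)+
  have n: "0 < n" using s by (cases n) auto
  define S where "S = s ` {1..<n}"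
  have S: "finite S" "S \<subseteq> {-2<..<2}"
    using mono[of 0] mono[of _ n] s by (auto simp: S_def)
  have inj: "inj_on s {1..<n}"
    by (rule inj_onI) (metis atLeastLessThan_iff less_imp_le less_irrefl linorder_neqE_nat mono)
  have glue: "\<exists>c J. (\<forall>t. t \<notin> S \<longrightarrow> J t = 0) \<and>
      (AE x in lebesgue. \<forall>i<n. x \<in> I i \<longrightarrow> f i x = c + prim F x + stepf J S x)"
    if hyp: "\<And>i. i < n \<Longrightarrow> \<exists>c. AE x in lebesgue. x \<in> I i \<longrightarrow> f i x = c + prim F x" for f F
  proof -
    have "\<forall>i. \<exists>c. i < n \<longrightarrow> (AE x in lebesgue. x \<in> I i \<longrightarrow> f i x = c + prim F x)" using hyp by blast
    then obtain a where a: "\<And>i. i < n \<Longrightarrow> AE x in lebesgue. x \<in> I i \<longrightarrow> f i x = a i + prim F x" by metis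
    define k where "k = the_inv_into {1..<n} s"
    have k: "k (s j) = j" if "j \<in> {1..<n}" for j
      unfolding k_def by (rule the_inv_into_f_f[OF inj that])
    \<comment> \<open>\<open>k\<close> inverts the enumeration of the partition points, so the jump
      at point number j is the constant of the piece to its right minus that of the piece to its
      left; summing the steps telescopes.\<close>
    define J where "J t = (if t \<in> S then a (k t) - a (k t - 1) else 0)" for t
    have st: "stepf J S x = a i - a 0" if i: "i < n" and x: "x \<in> I i" for i x
    proof -
      have "stepf J S x = (\<Sum>j\<in>{1..<n}. if s j < x then J (s j) else 0)"
        unfolding stepf_def S_def by (rule sum.reindex[OF inj, unfolded comp_def])
      also have "\<dots> = (\<Sum>j\<in>{1..<n}. if j \<in> {1..i} then a j - a (j - 1) else 0)"
      proof (rule sum.cong[OF refl])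
        fix j assume j: "j \<in> {1..<n}"
        have "s j < x \<longleftrightarrow> j \<le> i"
        proof
          assume "s j < x"
          then have "s j < s (Suc i)" using x by (auto simp: I_def)
          then show "j \<le> i" using mono[of "Suc i" j] j by (metis atLeastLessThan_iff less_imp_le less_irrefl not_less_eq_eq order_less_trans Suc_leI linorder_neqE_nat not_le)
        next
          assume "j \<le> i"
          then have "s j \<le> s i" using mono[of j i] i by (cases "j = i") auto
          then show "s j < x" using x by (auto simp: I_def)
        qed
        moreover have "J (s j) = a j - a (j - 1)" using j k[OF j] by (auto simp: J_def S_def)
        ultimately show "(if s j < x then J (s j) else 0) = (if j \<in> {1..i} then a j - a (j - 1) else 0)"
          using j by auto
      qed
      also have "\<dots> = (\<Sum>j\<in>{1..<n} \<inter> {1..i}. a j - a (j - 1))"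
        by (rule sum.inter_restrict[symmetric]) simp
      also have "{1..<n} \<inter> {1..i} = {1..i}" using i by auto
      also have "(\<Sum>j\<in>{1..i}. a j - a (j - 1)) = a i - a 0"
        by (induction i) auto
      finally show ?thesis .
    qed
    have "AE x in lebesgue. \<forall>i<n. x \<in> I i \<longrightarrow> f i x = a 0 + prim F x + stepf J S x"
    proof (rule AE_ball_finite_nat)
      fix i assume i: "i < n"
      show "AE x in lebesgue. x \<in> I i \<longrightarrow> f i x = a 0 + prim F x + stepf J S x"
        using a[OF i] by eventually_elim (use st[OF i] in auto)
    qed
    moreover have "\<forall>t. t \<notin> S \<longrightarrow> J t = 0" by (simp add: J_def)
    ultimately show ?thesis by blast
  qed
  have "\<forall>i. \<exists>g h. i < n \<longrightarrow> weak_deriv (I i) v g \<and> weak_deriv (I i) g h \<and> L2_on (I i) h"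
    using H unfolding H2_on_def I_def by blast
  then obtain g h where gh: "\<And>i. i < n \<Longrightarrow> weak_deriv (I i) v (g i)" "\<And>i. i < n \<Longrightarrow> weak_deriv (I i) (g i) (h i)"
    "\<And>i. i < n \<Longrightarrow> L2_on (I i) (h i)" by metis
  have Isub: "I i \<subseteq> {-2<..<2}" if "i < n" for i
    using rng[of i] rng[of "Suc i"] that by (auto simp: I_def)
  define v2 where "v2 x = (\<Sum>i\<in>{..<n}. indicator (I i) x * h i x)" for x
  have v2: "L2_on {-2<..<2} v2"
    unfolding v2_def[abs_def] by (intro L2_on_sum L2_on_zero_extend gh Isub) auto
  have v2_eq: "v2 x = h i x" if i: "i < n" and x: "x \<in> I i" for i x
  proof -
    have "v2 x = (\<Sum>j\<in>{..<n}. if j = i then h i x else 0)"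
      unfolding v2_def
    proof (rule sum.cong[OF refl])
      fix j assume j: "j \<in> {..<n}"
      have "x \<notin> I j" if "j \<noteq> i"
      proof -
        have "s (Suc j) \<le> s i \<or> s (Suc i) \<le> s j"
          using that i j mono[of "Suc j" i] mono[of "Suc i" j]
          by (metis Suc_leI lessThan_iff less_imp_le linorder_neqE_nat order_le_less)
        then show ?thesis using x by (auto simp: I_def)
      qed
      then show "indicator (I j) x * h j x = (if j = i then h i x else 0)" using x by auto
    qed
    then show ?thesis using i by simp
  qed
  have AI2: "AI v2" by (rule L2_on_Ioo_Icc[OF v2])
  have "\<exists>c. AE x in lebesgue. x \<in> I i \<longrightarrow> g i x = c + prim v2 x" if i: "i < n" for i
    unfolding I_def
  proof (rule weak_deriv_imp_prim)
    show "weak_deriv {s i<..<s (Suc i)} (g i) v2"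
      by (rule weak_deriv_cong[OF gh(2)[OF i, unfolded I_def]]) (use v2_eq[OF i] in \<open>auto simp: I_def\<close>)
  qed (use rng[of i] rng[of "Suc i"] s(3)[OF i] i AI2 in auto)
  from glue[OF this] obtain c1 J1 where J1: "\<forall>t. t \<notin> S \<longrightarrow> J1 t = 0"
    "AE x in lebesgue. \<forall>i<n. x \<in> I i \<longrightarrow> g i x = c1 + prim v2 x + stepf J1 S x" by blast
  define v1 where "v1 x = c1 + prim v2 x + stepf J1 S x" for x
  have AI1: "AI v1"
    using step_by_parts(1)[OF AI_cont[OF continuous_on_const[of _ 1]] AI2 S, of v1 c1 J1] by (simp add: v1_def[abs_def])
  have "\<exists>c. AE x in lebesgue. x \<in> I i \<longrightarrow> v x = c + prim v1 x" if i: "i < n" for i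
    unfolding I_def
  proof (rule weak_deriv_imp_prim)
    show "weak_deriv {s i<..<s (Suc i)} v v1"
    proof (rule weak_deriv_cong[OF gh(1)[OF i, unfolded I_def]])
      show "AE x in lebesgue. x \<in> {s i<..<s (Suc i)} \<longrightarrow> g i x = v1 x"
        using J1(2) by eventually_elim (use i in \<open>auto simp: I_def v1_def\<close>)
    qed simp
  qed (use rng[of i] rng[of "Suc i"] s(3)[OF i] i AI1 in auto)
  from glue[OF this] obtain c0 J0 where J0: "\<forall>t. t \<notin> S \<longrightarrow> J0 t = 0"
    "AE x in lebesgue. \<forall>i<n. x \<in> I i \<longrightarrow> v x = c0 + prim v1 x + stepf J0 S x" by blast
  define v0 where "v0 x = c0 + prim v1 x + stepf J0 S x" for x
  have r: "rep S J0 J1 v0 v1 v2"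
    unfolding rep_def
  proof (intro conjI S v2)
    show "\<forall>t. t \<notin> S \<longrightarrow> J0 t = 0 \<and> J1 t = 0" using J0 J1 by blast
    show "\<exists>c. \<forall>x\<in>{-2..2}. v1 x = c + prim v2 x + stepf J1 S x" using v1_def by blast
    show "\<exists>c. \<forall>x\<in>{-2..2}. v0 x = c + prim v1 x + stepf J0 S x" using v0_def by blast
  qed
  have cover: "\<exists>i<n. x \<in> I i" if x: "x \<in> {-2<..<2}" "x \<notin> S" for x
  proof -
    define k where "k = (LEAST k. x \<le> s k)"
    have k: "x \<le> s k" unfolding k_def by (rule LeastI[of _ n]) (use x s in auto)
    have kn: "k \<le> n" unfolding k_def by (rule Least_le) (use x s in auto)
    have k0: "k \<noteq> 0" using k x s by (cases k) auto
    then obtain i where i: "k = Suc i" by (cases k) auto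
    have "s i < x" using not_less_Least[of i "\<lambda>k. x \<le> s k"] i by (simp add: k_def[symmetric])
    moreover have "x \<noteq> s k"
    proof
      assume "x = s k"
      then show False using x s kn k0 by (cases "k = n") (auto simp: S_def)
    qed
    ultimately have "x \<in> I i" "i < n" using k kn i by (auto simp: I_def)
    then show ?thesis by blast
  qed
  have "AE x in lebesgue. x \<in> {-2<..<2} \<longrightarrow> v x = v0 x"
    using J0(2) AE_not_finite[OF S(1)]
  proof eventually_elim
    case (elim x)
    then show ?case using cover[of x] by (auto simp: v0_def)
  qed
  then show ?thesis using r unfolding prep_def by blast
qed

section \<open>Derivatives and traces\<close>

text \<open>A measure has no negative masses, so only the positive part of the jumps is kept; the
  negative part is \<open>atoms\<close> applied to the negated jumps.\<close>

definition atoms :: "real set \<Rightarrow> (real \<Rightarrow> real) \<Rightarrow> real measure"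
  where "atoms S J = distr (point_measure S (\<lambda>s. ennreal (max 0 (J s)))) borel (\<lambda>x. x)"

lemma sets_atoms: "sets (atoms S J) = sets borel"
  by (simp add: atoms_def)

lemma emeasure_atoms:
  assumes "A \<in> sets borel" "finite S"
  shows "emeasure (atoms S J) A = (\<Sum>s\<in>A \<inter> S. ennreal (max 0 (J s)))"
proof -
  have m: "(\<lambda>x. x) \<in> measurable (point_measure S (\<lambda>s. ennreal (max 0 (J s)))) borel"
    by (simp add: measurable_def sets_point_measure space_point_measure)
  have "emeasure (atoms S J) A = emeasure (point_measure S (\<lambda>s. ennreal (max 0 (J s)))) ((\<lambda>x. x) -` A \<inter> S)"
    unfolding atoms_def by (subst emeasure_distr[OF m assms(1)]) (simp add: space_point_measure)
  also have "(\<lambda>x. x) -` A \<inter> S = A \<inter> S" by simp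
  also have "emeasure (point_measure S (\<lambda>s. ennreal (max 0 (J s)))) (A \<inter> S) = (\<Sum>s\<in>A \<inter> S. ennreal (max 0 (J s)))"
    by (rule emeasure_point_measure_finite[OF assms(2)]) simp
  finally show ?thesis .
qed

lemma integral_atoms:
  assumes "finite S" "f \<in> borel_measurable borel"
  shows "integral\<^sup>L (atoms S J) f = (\<Sum>s\<in>S. max 0 (J s) * f s)"
proof -
  have m: "(\<lambda>x. x) \<in> measurable (point_measure S (\<lambda>s. ennreal (max 0 (J s)))) borel"
    by (simp add: measurable_def sets_point_measure space_point_measure)
  have "integral\<^sup>L (atoms S J) f = (LINT x|point_measure S (\<lambda>s. ennreal (max 0 (J s))). f x)"
    unfolding atoms_def by (rule integral_distr[OF m assms(2)])
  also have "\<dots> = (\<Sum>s\<in>S. max 0 (J s) * f s)"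
    by (subst lebesgue_integral_point_measure_finite[OF assms(1)]) simp_all
  finally show ?thesis .
qed

lemma radon_on_atoms:
  assumes "finite S"
  shows "radon_on U (atoms S J)"
  unfolding radon_on_def
proof (intro conjI allI impI)
  fix C :: "real set" assume "compact C \<and> C \<subseteq> U"
  then have "C \<in> sets borel" by (simp add: borel_compact)
  then show "emeasure (atoms S J) C < \<infinity>"
    using emeasure_atoms[OF \<open>C \<in> sets borel\<close> assms] assms by (simp add: less_top)
qed (rule sets_atoms)

lemma singular_on_atoms:
  assumes "finite S" "open U"
  shows "singular_on U lborel (atoms S J)"
  unfolding singular_on_def
proof (rule bexI[of _ S])
  show S: "S \<in> sets borel" using assms(1) by (intro borel_closed finite_imp_closed)
  have "finite (U \<inter> S)" using assms(1) by simp
  then have "emeasure lborel (U \<inter> S) = 0" by (rule emeasure_lborel_countable[OF countable_finite])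
  moreover have "U - S \<in> sets borel" using assms(2) S by auto
  moreover have "(U - S) \<inter> S = {}" by blast
  ultimately have "emeasure lborel (U \<inter> S) = 0" "emeasure (atoms S J) (U - S) = 0"
    using emeasure_atoms[OF _ assms(1), of "U - S" J] by simp_all
  then show "emeasure lborel (U \<inter> S) = 0 \<and> emeasure (atoms S J) (U - S) = 0" by blast
qed

text \<open>Integration by parts against the derivative of a test function: the boundary terms
  vanish and the jump terms become point masses, which are singular to Lebesgue measure.\<close>

lemma ac_part_of_parts:
  assumes S: "finite S" "S \<subseteq> {-2<..<2}" and AI: "AI v" "AI v'"
    and parts: "\<And>q. AI q \<Longrightarrow> integral {-2..2} (\<lambda>x. v x * q x) =
      v 2 * prim q 2 - integral {-2..2} (\<lambda>x. v' x * prim q x) - (\<Sum>s\<in>S. J s * prim q s)"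
    "\<And>q. AI q \<Longrightarrow> AI (\<lambda>x. v x * q x)"
  shows "ac_part_on {-2<..<2} v v'"
  unfolding ac_part_on_iff
proof (intro conjI exI)
  have sub: "{-2<..<2} \<subseteq> {-2..2::real}" by auto
  show "loc_integrable_on {-2<..<2} v" "loc_integrable_on {-2<..<2} v'"
    by (rule AI_loc_integrable[OF _ sub], rule AI)+
  show "ac_split {-2<..<2} v v' (atoms S J) (atoms S (\<lambda>s. - J s))"
    unfolding ac_split_def
  proof (intro conjI allI impI radon_on_atoms singular_on_atoms S(1) open_greaterThanLessThan)
    fix \<phi> assume \<phi>: "test_fun {-2<..<2} \<phi>"
    note d\<phi> = test_fun_deriv[OF \<phi>]
    have AId: "AI (deriv \<phi>)" by (rule AI_test_fun[OF d\<phi>])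
    have "(LINT x:{-2<..<2}|lebesgue. v x * deriv \<phi> x) = integral {-2..2} (\<lambda>x. v x * deriv \<phi> x)"
      by (rule LINT_test_eq_integral[OF d\<phi> order_refl parts(2)[OF AId]])
    also have "\<dots> = - integral {-2..2} (\<lambda>x. v' x * \<phi> x) - (\<Sum>s\<in>S. J s * \<phi> s)"
    proof -
      have "integral {-2..2} (\<lambda>x. v' x * prim (deriv \<phi>) x) = integral {-2..2} (\<lambda>x. v' x * \<phi> x)"
        by (rule Henstock_Kurzweil_Integration.integral_cong) (use test_fun_bounds(3)[OF \<phi> order_refl] in simp)
      moreover have "(\<Sum>s\<in>S. J s * prim (deriv \<phi>) s) = (\<Sum>s\<in>S. J s * \<phi> s)"
        by (rule sum.cong[OF refl]) (use test_fun_bounds(3)[OF \<phi> order_refl] S(2) in force)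
      ultimately show ?thesis
        using parts(1)[OF AId] test_fun_bounds[OF \<phi> order_refl] by simp
    qed
    also have "integral {-2..2} (\<lambda>x. v' x * \<phi> x) = (LINT x:{-2<..<2}|lebesgue. v' x * \<phi> x)"
    proof (rule LINT_test_eq_integral[OF \<phi> order_refl, symmetric])
      show "AI (\<lambda>x. v' x * \<phi> x)"
        using AI_mult[OF AI(2) smooth_continuous[OF test_fun_smooth[OF \<phi>]]] by (simp add: mult.commute)
    qed
    finally have L: "- (LINT x:{-2<..<2}|lebesgue. v x * deriv \<phi> x) =
        (LINT x:{-2<..<2}|lebesgue. v' x * \<phi> x) + (\<Sum>s\<in>S. J s * \<phi> s)" by simp
    have m: "(\<lambda>x. indicat_real {-2<..<2} x *\<^sub>R \<phi> x) \<in> borel_measurable borel"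
      using borel_measurable_continuous_onI[OF smooth_continuous[OF test_fun_smooth[OF \<phi>]]] by measurable
    have A: "(LINT x:{-2<..<2}|atoms S K. \<phi> x) = (\<Sum>s\<in>S. max 0 (K s) * \<phi> s)" for K
      unfolding set_lebesgue_integral_def integral_atoms[OF S(1) m]
      by (rule sum.cong[OF refl]) (use S(2) in \<open>auto simp: indicator_def\<close>)
    have "(\<Sum>s\<in>S. J s * \<phi> s) = (\<Sum>s\<in>S. max 0 (J s) * \<phi> s) - (\<Sum>s\<in>S. max 0 (- J s) * \<phi> s)"
      unfolding sum_subtractf[symmetric] by (rule sum.cong[OF refl]) (simp add: max_def left_diff_distrib)
    then show "- (LINT x:{-2<..<2}|lebesgue. v x * deriv \<phi> x) = (LINT x:{-2<..<2}|lebesgue. v' x * \<phi> x) +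
        (LINT x:{-2<..<2}|atoms S J. \<phi> x) - (LINT x:{-2<..<2}|atoms S (\<lambda>s. - J s). \<phi> x)"
      unfolding L A by simp
  qed
qed

text \<open>The function \<open>D1 v\<close> is known only up to a null set, so for the second
  derivative the decomposition of the derivative of \<open>v1\<close> is transferred along
  almost-everywhere equality before uniqueness is applied again.\<close>

lemma prep_D:
  assumes "prep v S J0 J1 v0 v1 v2"
  shows "AE x in lebesgue. x \<in> {-2<..<2} \<longrightarrow> D1 v x = v1 x"
    and "AE x in lebesgue. x \<in> {-2<..<2} \<longrightarrow> D2 v x = v2 x"
proof -
  have r: "rep S J0 J1 v0 v1 v2" and ae: "AE x in lebesgue. x \<in> {-2<..<2} \<longrightarrow> v0 x = v x"
    using assms unfolding prep_def by (simp_all add: eq_commute)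
  have S: "finite S" "S \<subseteq> {-2<..<2}" using r by (simp_all add: rep_def)
  have 0: "ac_part_on {-2<..<2} v0 v1"
    by (rule ac_part_of_parts[OF S rep_AI(3,2)[OF r] rep_by_parts(1,3)[OF r]])
  have "ac_part_on {-2<..<2} v v1"
    by (rule ac_part_on_cong[OF 0 ae]) simp
  then show 1: "AE x in lebesgue. x \<in> {-2<..<2} \<longrightarrow> D1 v x = v1 x"
    by (rule ac_deriv_eq[rotated 2]) auto
  have 2: "ac_part_on {-2<..<2} v1 v2"
    by (rule ac_part_of_parts[OF S rep_AI(2,1)[OF r] rep_by_parts(2,4)[OF r]])
  have "AE x in lebesgue. x \<in> {-2<..<2} \<longrightarrow> v1 x = D1 v x" using 1 by eventually_elim simp
  then have "ac_part_on {-2<..<2} (D1 v) v2"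
    by (rule ac_part_on_cong[OF 2]) simp
  then show "AE x in lebesgue. x \<in> {-2<..<2} \<longrightarrow> D2 v x = v2 x"
    by (rule ac_deriv_eq[rotated 2]) auto
qed

section \<open>Essential one-sided limits and discontinuities\<close>

lemma Ioo_not_AE_empty:
  assumes "a < (b::real)" "AE x in lebesgue. x \<notin> {a<..<b}"
  shows False
proof -
  have "{a<..<b} \<in> null_sets lebesgue"
    using assms(2) by (simp add: AE_iff_null_sets)
  then show False
    using assms(1) by (simp add: negligible_iff_null_sets[symmetric] open_not_negligible)
qed

text \<open>An interval to the right of x is not null, so a property that holds almost everywhere
  holds at some of its points. This is what makes limits along the essential filter unique.\<close>

lemma ess_at_right_nontrivial: "ess_at_right x \<noteq> bot"
proof
  assume "ess_at_right x = bot"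
  then have "eventually (\<lambda>_. False) (ess_at_right x)" by simp
  then obtain P Q where P: "eventually P (at_right x)" and Q: "AE y in lebesgue. Q y"
    and PQ: "\<forall>y. P y \<and> Q y \<longrightarrow> False"
    unfolding ess_at_right_def eventually_inf by blast
  obtain b where b: "b > x" "\<forall>y>x. y < b \<longrightarrow> P y"
    using P unfolding eventually_at_right_field by blast
  have "AE y in lebesgue. y \<notin> {x<..<b}"
    using Q by eventually_elim (use b PQ in auto)
  then show False using Ioo_not_AE_empty[OF b(1)] by blast
qed

lemma ess_at_left_nontrivial: "ess_at_left x \<noteq> bot"
proof
  assume "ess_at_left x = bot"
  then have "eventually (\<lambda>_. False) (ess_at_left x)" by simp
  then obtain P Q where P: "eventually P (at_left x)" and Q: "AE y in lebesgue. Q y"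
    and PQ: "\<forall>y. P y \<and> Q y \<longrightarrow> False"
    unfolding ess_at_left_def eventually_inf by blast
  obtain b where b: "b < x" "\<forall>y>b. y < x \<longrightarrow> P y"
    using P unfolding eventually_at_left_field by blast
  have "AE y in lebesgue. y \<notin> {b<..<x}"
    using Q by eventually_elim (use b PQ in auto)
  then show False using Ioo_not_AE_empty[OF b(1)] by blast
qed

lemma has_rtraceI:
  assumes "x < b" "AE y in lebesgue. y \<in> {x<..<b} \<longrightarrow> f y = v y" "(f \<longlongrightarrow> l) (at_right x)"
  shows "has_rtrace v x l"
  unfolding has_rtrace_def
proof (rule Lim_transform_eventually)
  show "(f \<longlongrightarrow> l) (ess_at_right x)"
    unfolding ess_at_right_def by (rule tendsto_mono[OF inf_le1 assms(3)])
  have "eventually (\<lambda>y. y \<in> {x<..<b}) (at_right x)"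
    by (rule eventually_at_rightI[OF _ assms(1)]) simp
  then show "\<forall>\<^sub>F y in ess_at_right x. f y = v y"
    unfolding ess_at_right_def eventually_inf using assms(2) by blast
qed

lemma has_ltraceI:
  assumes "b < x" "AE y in lebesgue. y \<in> {b<..<x} \<longrightarrow> f y = v y" "(f \<longlongrightarrow> l) (at_left x)"
  shows "has_ltrace v x l"
  unfolding has_ltrace_def
proof (rule Lim_transform_eventually)
  show "(f \<longlongrightarrow> l) (ess_at_left x)"
    unfolding ess_at_left_def by (rule tendsto_mono[OF inf_le1 assms(3)])
  have "eventually (\<lambda>y. y \<in> {b<..<x}) (at_left x)"
    by (rule eventually_at_leftI[OF _ assms(1)]) simp
  then show "\<forall>\<^sub>F y in ess_at_left x. f y = v y"
    unfolding ess_at_left_def eventually_inf using assms(2) by blast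
qed

lemma has_rtrace_imp_rtrace: "has_rtrace v x l \<Longrightarrow> rtrace v x = l"
  unfolding has_rtrace_def rtrace_def by (rule tendsto_Lim[OF ess_at_right_nontrivial])

lemma has_ltrace_imp_ltrace: "has_ltrace v x l \<Longrightarrow> ltrace v x = l"
  unfolding has_ltrace_def ltrace_def by (rule tendsto_Lim[OF ess_at_left_nontrivial])

lemma tendsto_ess_at_iff: "(v \<longlongrightarrow> l) (ess_at x) \<longleftrightarrow> has_ltrace v x l \<and> has_rtrace v x l"
proof -
  have "ess_at x = sup (ess_at_left x) (ess_at_right x)"
    unfolding ess_at_def ess_at_left_def ess_at_right_def at_eq_sup_left_right inf_sup_distrib2 ..
  then show ?thesis
    by (simp add: has_ltrace_def has_rtrace_def filterlim_def filtermap_sup)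
qed

lemma ess_at_nontrivial: "ess_at x \<noteq> bot"
proof -
  have "ess_at x = sup (ess_at_left x) (ess_at_right x)"
    unfolding ess_at_def ess_at_left_def ess_at_right_def at_eq_sup_left_right inf_sup_distrib2 ..
  then show ?thesis using ess_at_left_nontrivial by simp
qed

lemma stepf_tendsto:
  assumes "finite S" "\<And>s. s \<notin> S \<Longrightarrow> J s = 0"
  shows "(stepf J S \<longlongrightarrow> stepf J S x + J x) (at_right x)" "(stepf J S \<longlongrightarrow> stepf J S x) (at_left x)"
proof -
  have r: "((\<lambda>y. if s < y then J s else 0) \<longlongrightarrow> (if s \<le> x then J s else 0)) (at_right x)" for s
  proof (cases "s \<le> x")
    case True
    have "\<forall>\<^sub>F y in at_right x. (if s < y then J s else 0) = J s"
      using eventually_at_right_less[of x] by eventually_elim (use True in auto)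
    then show ?thesis using True by (simp add: tendsto_eventually)
  next
    case False
    then have "\<forall>\<^sub>F y in at_right x. (if s < y then J s else 0) = 0"
      by (intro eventually_at_rightI[of x s]) auto
    then show ?thesis using False by (simp add: tendsto_eventually)
  qed
  have l: "((\<lambda>y. if s < y then J s else 0) \<longlongrightarrow> (if s < x then J s else 0)) (at_left x)" for s
  proof (cases "s < x")
    case True
    then have "\<forall>\<^sub>F y in at_left x. (if s < y then J s else 0) = J s"
      by (intro eventually_at_leftI[of s x]) auto
    then show ?thesis using True by (simp add: tendsto_eventually)
  next
    case False
    then have "\<forall>\<^sub>F y in at_left x. (if s < y then J s else 0) = 0"
      by (intro eventually_at_leftI[of "x - 1" x]) auto
    then show ?thesis using False by (simp add: tendsto_eventually)
  qed
  have "(stepf J S \<longlongrightarrow> (\<Sum>s\<in>S. if s \<le> x then J s else 0)) (at_right x)"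
    unfolding stepf_def[abs_def] by (rule tendsto_sum) (rule r)
  moreover have "(\<Sum>s\<in>S. if s \<le> x then J s else 0) = stepf J S x + J x"
  proof -
    have "(\<Sum>s\<in>S. if s \<le> x then J s else 0) = (\<Sum>s\<in>S. (if s < x then J s else 0) + (if s = x then J s else 0))"
      by (rule sum.cong) auto
    also have "\<dots> = stepf J S x + (\<Sum>s\<in>S. if s = x then J s else 0)"
      by (simp add: sum.distrib stepf_def)
    also have "(\<Sum>s\<in>S. if s = x then J s else 0) = J x"
      using assms by (cases "x \<in> S") (auto simp: sum.delta' sum.delta)
    finally show ?thesis .
  qed
  ultimately show "(stepf J S \<longlongrightarrow> stepf J S x + J x) (at_right x)" by simp
  show "(stepf J S \<longlongrightarrow> stepf J S x) (at_left x)"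
    unfolding stepf_def[abs_def] by (rule tendsto_sum) (rule l)
qed

lemma prim_tendsto:
  assumes "AI f"
  shows "-2 \<le> x \<Longrightarrow> x < 2 \<Longrightarrow> (prim f \<longlongrightarrow> prim f x) (at_right x)"
    and "-2 < x \<Longrightarrow> x \<le> 2 \<Longrightarrow> (prim f \<longlongrightarrow> prim f x) (at_left x)"
proof -
  show "(prim f \<longlongrightarrow> prim f x) (at_right x)" if "-2 \<le> x" "x < 2"
    by (rule continuous_on_Icc_at_rightD[of x 2])
      (use that in \<open>auto intro: continuous_on_subset[OF prim_cont[OF assms]]\<close>)
  show "(prim f \<longlongrightarrow> prim f x) (at_left x)" if "-2 < x" "x \<le> 2"
    by (rule continuous_on_Icc_at_leftD[of "-2" x])
      (use that in \<open>auto intro: continuous_on_subset[OF prim_cont[OF assms]]\<close>)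
qed

lemma step_prim_tendsto:
  assumes "AI f" "finite S" "\<And>s. s \<notin> S \<Longrightarrow> J s = 0" "\<forall>x\<in>{-2..2}. v x = c + prim f x + stepf J S x"
  shows "-2 \<le> x \<Longrightarrow> x < 2 \<Longrightarrow> (v \<longlongrightarrow> v x + J x) (at_right x)"
    and "-2 < x \<Longrightarrow> x \<le> 2 \<Longrightarrow> (v \<longlongrightarrow> v x) (at_left x)"
proof -
  show "(v \<longlongrightarrow> v x + J x) (at_right x)" if x: "-2 \<le> x" "x < 2"
  proof (rule Lim_transform_eventually)
    show "((\<lambda>y. c + prim f y + stepf J S y) \<longlongrightarrow> v x + J x) (at_right x)"
      using tendsto_add[OF tendsto_add[OF tendsto_const[of c] prim_tendsto(1)[OF assms(1) x]]
          stepf_tendsto(1)[of S J x]] assms(2-4) x by (simp add: add.assoc)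
    show "\<forall>\<^sub>F y in at_right x. c + prim f y + stepf J S y = v y"
      by (rule eventually_at_rightI[OF _ x(2)]) (use assms(4) x in auto)
  qed
  show "(v \<longlongrightarrow> v x) (at_left x)" if x: "-2 < x" "x \<le> 2"
  proof (rule Lim_transform_eventually)
    show "((\<lambda>y. c + prim f y + stepf J S y) \<longlongrightarrow> v x) (at_left x)"
      using tendsto_add[OF tendsto_add[OF tendsto_const[of c] prim_tendsto(2)[OF assms(1) x]]
          stepf_tendsto(2)[of S J x]] assms(2-4) x by (simp add: add.assoc)
    show "\<forall>\<^sub>F y in at_left x. c + prim f y + stepf J S y = v y"
      by (rule eventually_at_leftI[OF _ x(1)]) (use assms(4) x in auto)
  qed
qed

lemma rep_tendsto:
  assumes "rep S J0 J1 v0 v1 v2"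
  shows "-2 \<le> x \<Longrightarrow> x < 2 \<Longrightarrow> (v0 \<longlongrightarrow> v0 x + J0 x) (at_right x)"
    and "-2 < x \<Longrightarrow> x \<le> 2 \<Longrightarrow> (v0 \<longlongrightarrow> v0 x) (at_left x)"
    and "-2 \<le> x \<Longrightarrow> x < 2 \<Longrightarrow> (v1 \<longlongrightarrow> v1 x + J1 x) (at_right x)"
    and "-2 < x \<Longrightarrow> x \<le> 2 \<Longrightarrow> (v1 \<longlongrightarrow> v1 x) (at_left x)"
proof -
  obtain c d where c: "\<forall>x\<in>{-2..2}. v1 x = c + prim v2 x + stepf J1 S x"
    and d: "\<forall>x\<in>{-2..2}. v0 x = d + prim v1 x + stepf J0 S x" using assms by (auto simp: rep_def)
  have S: "finite S" "\<And>s. s \<notin> S \<Longrightarrow> J0 s = 0" "\<And>s. s \<notin> S \<Longrightarrow> J1 s = 0"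
    using assms by (simp_all add: rep_def)
  show "-2 \<le> x \<Longrightarrow> x < 2 \<Longrightarrow> (v0 \<longlongrightarrow> v0 x + J0 x) (at_right x)"
    "-2 < x \<Longrightarrow> x \<le> 2 \<Longrightarrow> (v0 \<longlongrightarrow> v0 x) (at_left x)"
    using step_prim_tendsto[OF rep_AI(2)[OF assms] S(1,2) d] by blast+
  show "-2 \<le> x \<Longrightarrow> x < 2 \<Longrightarrow> (v1 \<longlongrightarrow> v1 x + J1 x) (at_right x)"
    "-2 < x \<Longrightarrow> x \<le> 2 \<Longrightarrow> (v1 \<longlongrightarrow> v1 x) (at_left x)"
    using step_prim_tendsto[OF rep_AI(1)[OF assms] S(1,3) c] by blast+
qed

lemma AE_traces:
  assumes ae: "AE y in lebesgue. y \<in> {-2<..<2} \<longrightarrow> v y = f y"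
    and r: "-2 \<le> x \<Longrightarrow> x < 2 \<Longrightarrow> (f \<longlongrightarrow> f x + J x) (at_right x)"
    and l: "-2 < x \<Longrightarrow> x \<le> 2 \<Longrightarrow> (f \<longlongrightarrow> f x) (at_left x)"
  shows "-2 \<le> x \<Longrightarrow> x < 2 \<Longrightarrow> has_rtrace v x (f x + J x)"
    and "-2 < x \<Longrightarrow> x \<le> 2 \<Longrightarrow> has_ltrace v x (f x)"
proof -
  show "has_rtrace v x (f x + J x)" if x: "-2 \<le> x" "x < 2"
  proof (rule has_rtraceI[OF x(2) _ r[OF x]])
    show "AE y in lebesgue. y \<in> {x<..<2} \<longrightarrow> f y = v y"
      using ae by eventually_elim (use x in auto)
  qed
  show "has_ltrace v x (f x)" if x: "-2 < x" "x \<le> 2"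
  proof (rule has_ltraceI[OF x(1) _ l[OF x]])
    show "AE y in lebesgue. y \<in> {-2<..<x} \<longrightarrow> f y = v y"
      using ae by eventually_elim (use x in auto)
  qed
qed

lemma disc_eq:
  assumes "\<And>x. -2 < x \<Longrightarrow> x < 2 \<Longrightarrow> has_rtrace v x (f x + J x)"
    and "\<And>x. -2 < x \<Longrightarrow> x < 2 \<Longrightarrow> has_ltrace v x (f x)"
  shows "disc v = {x \<in> {-2<..<2}. J x \<noteq> 0}"
proof -
  have "(\<exists>l. (v \<longlongrightarrow> l) (ess_at x)) \<longleftrightarrow> J x = 0" if x: "x \<in> {-2<..<2}" for x
  proof
    assume "\<exists>l. (v \<longlongrightarrow> l) (ess_at x)"
    then obtain l where "has_ltrace v x l" "has_rtrace v x l" unfolding tendsto_ess_at_iff by blast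
    then have "l = rtrace v x" "l = ltrace v x"
      using has_rtrace_imp_rtrace has_ltrace_imp_ltrace by metis+
    then show "J x = 0"
      using has_rtrace_imp_rtrace[OF assms(1)] has_ltrace_imp_ltrace[OF assms(2)] x by auto
  next
    assume "J x = 0"
    then show "\<exists>l. (v \<longlongrightarrow> l) (ess_at x)"
      unfolding tendsto_ess_at_iff using assms[of x] x by auto
  qed
  then show ?thesis unfolding disc_def by blast
qed

lemma prep_traces:
  assumes "prep v S J0 J1 v0 v1 v2"
  shows "-2 \<le> x \<Longrightarrow> x < 2 \<Longrightarrow> has_rtrace v x (v0 x + J0 x)"
    and "-2 < x \<Longrightarrow> x \<le> 2 \<Longrightarrow> has_ltrace v x (v0 x)"
    and "-2 \<le> x \<Longrightarrow> x < 2 \<Longrightarrow> has_rtrace (D1 v) x (v1 x + J1 x)"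
    and "-2 < x \<Longrightarrow> x \<le> 2 \<Longrightarrow> has_ltrace (D1 v) x (v1 x)"
proof -
  have r: "rep S J0 J1 v0 v1 v2" and ae: "AE x in lebesgue. x \<in> {-2<..<2} \<longrightarrow> v x = v0 x"
    using assms unfolding prep_def by simp_all
  show "-2 \<le> x \<Longrightarrow> x < 2 \<Longrightarrow> has_rtrace v x (v0 x + J0 x)"
    "-2 < x \<Longrightarrow> x \<le> 2 \<Longrightarrow> has_ltrace v x (v0 x)"
    using AE_traces[of v v0 x J0, OF ae rep_tendsto(1)[OF r] rep_tendsto(2)[OF r]] by auto
  show "-2 \<le> x \<Longrightarrow> x < 2 \<Longrightarrow> has_rtrace (D1 v) x (v1 x + J1 x)"
    "-2 < x \<Longrightarrow> x \<le> 2 \<Longrightarrow> has_ltrace (D1 v) x (v1 x)"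
    using AE_traces[of "D1 v" v1 x J1, OF prep_D(1)[OF assms] rep_tendsto(3)[OF r] rep_tendsto(4)[OF r]] by auto
qed

lemma prep_values:
  assumes "prep v S J0 J1 v0 v1 v2"
  shows "disc v = {x. J0 x \<noteq> 0}" "disc (D1 v) = {x. J1 x \<noteq> 0}"
    and "-2 \<le> x \<Longrightarrow> x < 2 \<Longrightarrow> rtrace v x = v0 x + J0 x"
    and "-2 < x \<Longrightarrow> x \<le> 2 \<Longrightarrow> ltrace v x = v0 x"
    and "-2 < x \<Longrightarrow> x < 2 \<Longrightarrow> x \<notin> disc v \<Longrightarrow> ess_value v x = v0 x"
proof -
  have J: "J0 x = 0" "J1 x = 0" if "x \<notin> {-2<..<2}" for x
    using that assms unfolding prep_def rep_def by blast+
  have "disc v = {x \<in> {-2<..<2}. J0 x \<noteq> 0}"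
    by (rule disc_eq[of v v0 J0]) (use prep_traces(1,2)[OF assms] in auto)
  then show d: "disc v = {x. J0 x \<noteq> 0}" using J(1) by blast
  have "disc (D1 v) = {x \<in> {-2<..<2}. J1 x \<noteq> 0}"
    by (rule disc_eq[of "D1 v" v1 J1]) (use prep_traces(3,4)[OF assms] in auto)
  then show "disc (D1 v) = {x. J1 x \<noteq> 0}" using J(2) by blast
  show "-2 \<le> x \<Longrightarrow> x < 2 \<Longrightarrow> rtrace v x = v0 x + J0 x"
    by (rule has_rtrace_imp_rtrace[OF prep_traces(1)[OF assms]])
  show "-2 < x \<Longrightarrow> x \<le> 2 \<Longrightarrow> ltrace v x = v0 x"
    by (rule has_ltrace_imp_ltrace[OF prep_traces(2)[OF assms]])
  assume x: "-2 < x" "x < 2" "x \<notin> disc v"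
  then have "J0 x = 0" using d by blast
  then have "(v \<longlongrightarrow> v0 x) (ess_at x)"
    unfolding tendsto_ess_at_iff using prep_traces(1,2)[OF assms, of x] x by auto
  then show "ess_value v x = v0 x"
    unfolding ess_value_def by (rule tendsto_Lim[OF ess_at_nontrivial])
qed

section \<open>The obstacle constraint in terms of representatives\<close>

lemma ess_right_le:
  fixes f g :: "real \<Rightarrow> real"
  assumes "(f \<longlongrightarrow> l) (at_right x)" "(g \<longlongrightarrow> m) (at_right x)" "x < b"
    "AE y in lebesgue. y \<in> {x<..<b} \<longrightarrow> f y \<le> g y"
  shows "l \<le> m"
proof (rule tendsto_le[OF ess_at_right_nontrivial])
  show "(f \<longlongrightarrow> l) (ess_at_right x)" "(g \<longlongrightarrow> m) (ess_at_right x)"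
    unfolding ess_at_right_def by (rule tendsto_mono[OF inf_le1], fact assms)+
  have "eventually (\<lambda>y. y \<in> {x<..<b}) (at_right x)"
    by (rule eventually_at_rightI[OF _ assms(3)]) simp
  then show "\<forall>\<^sub>F y in ess_at_right x. f y \<le> g y"
    unfolding ess_at_right_def eventually_inf using assms(4) by blast
qed

lemma ess_left_le:
  fixes f g :: "real \<Rightarrow> real"
  assumes "(f \<longlongrightarrow> l) (at_left x)" "(g \<longlongrightarrow> m) (at_left x)" "b < x"
    "AE y in lebesgue. y \<in> {b<..<x} \<longrightarrow> f y \<le> g y"
  shows "l \<le> m"
proof (rule tendsto_le[OF ess_at_left_nontrivial])
  show "(f \<longlongrightarrow> l) (ess_at_left x)" "(g \<longlongrightarrow> m) (ess_at_left x)"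
    unfolding ess_at_left_def by (rule tendsto_mono[OF inf_le1], fact assms)+
  have "eventually (\<lambda>y. y \<in> {b<..<x}) (at_left x)"
    by (rule eventually_at_leftI[OF _ assms(3)]) simp
  then show "\<forall>\<^sub>F y in ess_at_left x. f y \<le> g y"
    unfolding ess_at_left_def eventually_inf using assms(4) by blast
qed

lemma cont_Icc_tendsto:
  assumes "continuous_on {-2..2} (w :: real \<Rightarrow> real)"
  shows "-2 \<le> x \<Longrightarrow> x < 2 \<Longrightarrow> (w \<longlongrightarrow> w x) (at_right x)"
    and "-2 < x \<Longrightarrow> x \<le> 2 \<Longrightarrow> (w \<longlongrightarrow> w x) (at_left x)"
proof -
  show "(w \<longlongrightarrow> w x) (at_right x)" if "-2 \<le> x" "x < 2"
    by (rule continuous_on_Icc_at_rightD[of x 2])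
      (use that in \<open>auto intro: continuous_on_subset[OF assms]\<close>)
  show "(w \<longlongrightarrow> w x) (at_left x)" if "-2 < x" "x \<le> 2"
    by (rule continuous_on_Icc_at_leftD[of "-2" x])
      (use that in \<open>auto intro: continuous_on_subset[OF assms]\<close>)
qed

lemma one_sided_eq:
  fixes v w J :: "real \<Rightarrow> real"
  assumes w: "continuous_on {-2..2} w" and ab: "-2 \<le> a" "b \<le> 2"
    and eq: "AE y in lebesgue. y \<in> {a<..<b} \<longrightarrow> v y = w y"
    and r: "\<And>x. -2 \<le> x \<Longrightarrow> x < 2 \<Longrightarrow> (v \<longlongrightarrow> v x + J x) (at_right x)"
    and l: "\<And>x. -2 < x \<Longrightarrow> x \<le> 2 \<Longrightarrow> (v \<longlongrightarrow> v x) (at_left x)"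
  shows "a \<le> x \<Longrightarrow> x < b \<Longrightarrow> v x + J x = w x" and "a < x \<Longrightarrow> x \<le> b \<Longrightarrow> v x = w x"
proof -
  have le: "AE y in lebesgue. y \<in> {a<..<b} \<longrightarrow> v y \<le> w y" "AE y in lebesgue. y \<in> {a<..<b} \<longrightarrow> w y \<le> v y"
    using eq by (eventually_elim, simp)+
  show "v x + J x = w x" if x: "a \<le> x" "x < b"
  proof (rule antisym)
    have sub: "AE y in lebesgue. y \<in> {x<..<b} \<longrightarrow> v y \<le> w y" "AE y in lebesgue. y \<in> {x<..<b} \<longrightarrow> w y \<le> v y"
      using le(1) by (eventually_elim, use x in auto) (use le(2) in eventually_elim, use x in auto)
    show "v x + J x \<le> w x"
      by (rule ess_right_le[OF r cont_Icc_tendsto(1)[OF w] x(2) sub(1)]) (use x ab in auto)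
    show "w x \<le> v x + J x"
      by (rule ess_right_le[OF cont_Icc_tendsto(1)[OF w] r x(2) sub(2)]) (use x ab in auto)
  qed
  show "v x = w x" if x: "a < x" "x \<le> b"
  proof (rule antisym)
    have sub: "AE y in lebesgue. y \<in> {a<..<x} \<longrightarrow> v y \<le> w y" "AE y in lebesgue. y \<in> {a<..<x} \<longrightarrow> w y \<le> v y"
      using le(1) by (eventually_elim, use x in auto) (use le(2) in eventually_elim, use x in auto)
    show "v x \<le> w x"
      by (rule ess_left_le[OF l cont_Icc_tendsto(2)[OF w] x(1) sub(1)]) (use x ab in auto)
    show "w x \<le> v x"
      by (rule ess_left_le[OF cont_Icc_tendsto(2)[OF w] l x(1) sub(2)]) (use x ab in auto)
  qed
qed

lemma prep_ge:
  assumes "prep v S J0 J1 v0 v1 v2" "continuous_on {-2..2} w"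
    "AE x in lebesgue. x \<in> {-2<..<2} \<longrightarrow> w x \<le> v0 x"
  shows "-2 \<le> x \<Longrightarrow> x < 2 \<Longrightarrow> w x \<le> v0 x + J0 x" and "-2 < x \<Longrightarrow> x \<le> 2 \<Longrightarrow> w x \<le> v0 x"
proof -
  have r: "rep S J0 J1 v0 v1 v2" using assms(1) by (simp add: prep_def)
  show "w x \<le> v0 x + J0 x" if x: "-2 \<le> x" "x < 2"
  proof (rule ess_right_le[OF cont_Icc_tendsto(1)[OF assms(2) x] rep_tendsto(1)[OF r x] x(2)])
    show "AE y in lebesgue. y \<in> {x<..<2} \<longrightarrow> w y \<le> v0 y"
      using assms(3) by eventually_elim (use x in auto)
  qed
  show "w x \<le> v0 x" if x: "-2 < x" "x \<le> 2"
  proof (rule ess_left_le[OF cont_Icc_tendsto(2)[OF assms(2) x] rep_tendsto(2)[OF r x] x(1)])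
    show "AE y in lebesgue. y \<in> {-2<..<x} \<longrightarrow> w y \<le> v0 y"
      using assms(3) by eventually_elim (use x in auto)
  qed
qed

text \<open>The clauses at jump points, at continuity points and at the ends all follow from one
  almost-everywhere inequality by taking one-sided limits. Conversely almost every point is a
  continuity point, and outside [-1,1] the inequality holds because v = w there.\<close>

lemma prep_K_iff:
  assumes p: "prep v S J0 J1 v0 v1 v2" and w: "continuous_on {-2..2} w"
  shows "v \<in> K w \<longleftrightarrow> (AE x in lebesgue. x \<in> {-2<..<2} \<longrightarrow> w x \<le> v0 x) \<and>
    (AE x in lebesgue. x \<in> {-2<..<-1} \<union> {1<..<2} \<longrightarrow> v x = w x)"
proof
  have ae: "AE x in lebesgue. x \<in> {-2<..<2} \<longrightarrow> v x = v0 x" and S: "finite S"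
    using p by (simp_all add: prep_def rep_def)
  note val = prep_values[OF p]
  {
    assume "v \<in> K w"
    then have ab: "above_obstacle w v" and o: "AE x in lebesgue. x \<in> {-2<..<-1} \<union> {1<..<2} \<longrightarrow> v x = w x"
      by (simp_all add: K_def)
    have dS: "disc v \<subseteq> S" using p unfolding val(1) prep_def rep_def by blast
    have "AE x in lebesgue. x \<notin> S \<union> {-1, 1}" by (rule AE_not_finite) (use S in simp)
    with o ae have "AE x in lebesgue. x \<in> {-2<..<2} \<longrightarrow> w x \<le> v0 x"
    proof eventually_elim
      case (elim x)
      show ?case
      proof
        assume x: "x \<in> {-2<..<2}"
        then consider "x \<in> {-2<..<-1} \<union> {1<..<2}" | "x \<in> {-1<..<1}" using elim(3) by force
        then show "w x \<le> v0 x"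
        proof cases
          case 1 then show ?thesis using elim x by simp
        next
          case 2
          then have "x \<in> {-1..1} - disc v" using elim dS by auto
          then have "w x \<le> ess_value v x" using ab unfolding above_obstacle_def by blast
          moreover have "x \<notin> disc v" using elim(3) dS by blast
          ultimately show ?thesis using val(5)[of x] x by simp
        qed
      qed
    qed
    with o show "(AE x in lebesgue. x \<in> {-2<..<2} \<longrightarrow> w x \<le> v0 x) \<and>
      (AE x in lebesgue. x \<in> {-2<..<-1} \<union> {1<..<2} \<longrightarrow> v x = w x)" by blast
  }
  assume A: "(AE x in lebesgue. x \<in> {-2<..<2} \<longrightarrow> w x \<le> v0 x) \<and>
      (AE x in lebesgue. x \<in> {-2<..<-1} \<union> {1<..<2} \<longrightarrow> v x = w x)"
  note ge = prep_ge[OF p w conjunct1[OF A]]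
  have d2: "disc v \<subseteq> {-2<..<2}" by (auto simp: disc_def)
  have "above_obstacle w v"
    unfolding above_obstacle_def
  proof (intro conjI ballI)
    fix x assume "x \<in> {-1..1} - disc v"
    then show "w x \<le> ess_value v x" using val(5)[of x] ge(2)[of x] by auto
  next
    fix x assume "x \<in> disc v \<union> {-1}"
    then show "w x \<le> rtrace v x" using val(3)[of x] ge(1)[of x] d2 by auto
  next
    fix x assume "x \<in> disc v \<union> {1}"
    then show "w x \<le> ltrace v x" using val(4)[of x] ge(2)[of x] d2 by auto
  qed
  then show "v \<in> K w" unfolding K_def using A prep_imp_piecewise_H2[OF p] by blast
qed

section \<open>The first variation\<close>

definition jcost :: "real \<Rightarrow> real \<Rightarrow> 'a set \<Rightarrow> 'a set \<Rightarrow> real"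
  where "jcost a b A B = a * real (card A) + b * real (card (B - A))"

text \<open>The jump cost is a sum over points, each paying a for a value jump and otherwise b for a
  slope jump; a competitor altered at a single point needs to be compared only there.\<close>

lemma jcost_split:
  assumes "finite A" "finite B"
  shows "jcost a b A B = jcost a b (A - {x}) (B - {x}) + (if x \<in> A then a else if x \<in> B then b else 0)"
proof -
  have 1: "real (card A) = real (card (A - {x})) + (if x \<in> A then 1 else 0)"
    using card_Suc_Diff1[OF assms(1), of x] by auto
  have "finite (B - A)" using assms by simp
  then have "real (card (B - A)) = real (card (B - A - {x})) + (if x \<in> B - A then 1 else 0)"
    using card_Suc_Diff1[of "B - A" x] by auto
  moreover have "B - {x} - (A - {x}) = B - A - {x}" by blast
  ultimately have 2: "real (card (B - A)) = real (card (B - {x} - (A - {x}))) + (if x \<in> B - A then 1 else 0)" by simp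
  show ?thesis unfolding jcost_def 1 2 by (auto simp: algebra_simps)
qed

lemma jcost_le:
  assumes "finite A" "finite B" "finite A'" "finite B'" "A - {x} = A' - {x}" "B - {x} = B' - {x}"
    and "(if x \<in> A' then a else if x \<in> B' then b else 0) \<le> (if x \<in> A then a else if x \<in> B then b else (0::real))"
  shows "jcost a b A' B' \<le> jcost a b A B"
  using jcost_split[OF assms(1,2), of a b x] jcost_split[OF assms(3,4), of a b x] assms(5-7) by simp

lemma quadratic_nonneg_imp:
  assumes "t0 > 0" "\<And>t. 0 < t \<Longrightarrow> t < t0 \<Longrightarrow> 0 \<le> t * A + t\<^sup>2 * (Q::real)"
  shows "0 \<le> A"
proof (rule ccontr)
  assume "\<not> 0 \<le> A"
  then have A: "A < 0" by simp
  \<comment> \<open>The second term keeps t |Q| below -A/2; the 1 added to |Q| keeps the denominator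
    positive when Q = 0.\<close>
  define t where "t = min (t0 / 2) (- A / (2 * (\<bar>Q\<bar> + 1)))"
  have t: "0 < t" "t < t0" using assms(1) A by (auto simp: t_def field_simps)
  have "t \<le> - A / (2 * (\<bar>Q\<bar> + 1))" by (simp add: t_def)
  then have "t * (2 * (\<bar>Q\<bar> + 1)) \<le> - A" by (rule iffD1[OF pos_le_divide_eq, rotated]) simp
  then have "A + t * \<bar>Q\<bar> \<le> A / 2 - t" by (simp add: algebra_simps)
  then have "A + t * \<bar>Q\<bar> < 0" using A t by linarith
  moreover have "t * Q \<le> t * \<bar>Q\<bar>" using t by simp
  ultimately have "A + t * Q < 0" by linarith
  then have "t * (A + t * Q) < 0" using t by (simp add: mult_pos_neg)
  then show False using assms(2)[OF t] by (simp add: algebra_simps power2_eq_square)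
qed

lemma LINT_quadratic:
  fixes a b c :: "real \<Rightarrow> real"
  assumes "set_integrable M A a" "set_integrable M A b" "set_integrable M A c"
  shows "(LINT x:A|M. a x + t * b x + s * c x) = (LINT x:A|M. a x) + t * (LINT x:A|M. b x) + s * (LINT x:A|M. c x)"
proof -
  have 1: "set_integrable M A (\<lambda>x. t * b x)" "set_integrable M A (\<lambda>x. s * c x)"
    using assms by (intro set_integrable_mult_right; simp)+
  have "(LINT x:A|M. a x + t * b x + s * c x) = (LINT x:A|M. a x + t * b x) + (LINT x:A|M. s * c x)"
    by (rule set_integral_add(2)[OF set_integral_add(1)[OF assms(1) 1(1)] 1(2)])
  also have "(LINT x:A|M. a x + t * b x) = (LINT x:A|M. a x) + (LINT x:A|M. t * b x)"
    by (rule set_integral_add(2)[OF assms(1) 1(1)])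
  finally show ?thesis unfolding set_integral_mult_right .
qed

text \<open>The representation is fixed together with the minimizer, so that jump conditions on
  \<open>u\<close> and on its slope become conditions on \<open>J0\<close> and
  \<open>J1\<close>.\<close>

locale obstacle =
  fixes w w' f u :: "real \<Rightarrow> real" and \<alpha> \<beta> \<eta> \<mu> :: real
    and S :: "real set" and J0 J1 u0 u1 u2 :: "real \<Rightarrow> real"
  assumes w_deriv: "\<And>x. x \<in> {-2..2} \<Longrightarrow> (w has_real_derivative w' x) (at x within {-2..2})"
    and w'_cont: "continuous_on {-2..2} w'"
    and pos: "\<eta> > 0" "\<mu> > 0" "0 < \<beta>" "\<beta> \<le> \<alpha>"
    and f: "L2_on {-1<..<1} f"
    and uK: "u \<in> K w" and u_min: "\<And>v. v \<in> K w \<Longrightarrow> E1 \<alpha> \<beta> \<eta> \<mu> f w u \<le> E1 \<alpha> \<beta> \<eta> \<mu> f w v"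
    and u_prep: "prep u S J0 J1 u0 u1 u2"
begin

lemma u_rep: "rep S J0 J1 u0 u1 u2" and u_ae: "AE x in lebesgue. x \<in> {-2<..<2} \<longrightarrow> u x = u0 x"
  using u_prep by (simp_all add: prep_def)

lemma w_cont: "continuous_on {-2..2} w"
  by (rule DERIV_continuous_on[OF w_deriv])

lemma w_ge: "AE x in lebesgue. x \<in> {-2<..<2} \<longrightarrow> w x \<le> u0 x"
  and u_outer: "AE x in lebesgue. x \<in> {-2<..<-1} \<union> {1<..<2} \<longrightarrow> u x = w x"
  using prep_K_iff[OF u_prep w_cont] uK by blast+

text \<open>The Euler equation on \<open>(-1,1)\<close> is \<open>\<eta> u'''' + k = 0\<close>; integrated twice it says that the function
  \<open>g\<close> defined below is affine.\<close>

definition k :: "real \<Rightarrow> real"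
  where "k x = (if x \<in> {-1<..<1} then \<mu> * (u0 x - w x) - f x / 2 else 0)"

lemma L2_inner: "L2_on {-1<..<1} u0" "L2_on {-1<..<1} u2" "L2_on {-1<..<1} w"
proof -
  have sub: "{-1<..<1} \<subseteq> {-2<..<2::real}" by auto
  show "L2_on {-1<..<1} u0" "L2_on {-1<..<1} u2" using rep_L2(1,3)[OF u_rep sub] by simp_all
  obtain B where "\<forall>x\<in>{-2..2}. \<bar>w x\<bar> \<le> B"
    using compact_imp_bounded[OF compact_continuous_image[OF w_cont]] by (auto simp: bounded_iff)
  then show "L2_on {-1<..<1} w" by (rule AI_bounded_L2[OF AI_cont[OF w_cont] _ sub]) simp
qed

lemma L2_k: "L2_on {-2<..<2} k"
proof -
  have 1: "L2_on {-1<..<1} (\<lambda>x. \<mu> * (1 * u0 x + (-1) * w x) + (- 1 / 2) * f x)"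
    by (intro L2_on_linear L2_inner f)
  have "L2_on {-2<..<2} (\<lambda>x. indicator {-1<..<1} x * (\<mu> * (1 * u0 x + (-1) * w x) + (- 1 / 2) * f x))"
    by (rule L2_on_zero_extend[OF 1]) auto
  moreover have "(\<lambda>x. indicator {-1<..<1} x * (\<mu> * (1 * u0 x + (-1) * w x) + (- 1 / 2) * f x)) = k"
    by (rule ext) (simp add: k_def)
  ultimately show ?thesis by simp
qed

text \<open>Without the jump part the energy is a quadratic polynomial in t along u + t \<psi>, and
  the jump part does not increase by assumption; so the linear coefficient is nonnegative. It is
  twice the integral in the conclusion, which is where the f/2 in \<open>k\<close> comes
  from.\<close>

lemma first_variation:
  assumes r: "rep T L0 L1 \<psi> \<psi>1 \<psi>2"
    and outer: "AE x in lebesgue. x \<in> {-2<..<-1} \<union> {1<..<2} \<longrightarrow> \<psi> x = 0"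
    and t0: "t0 > 0"
    and adm: "\<And>t. 0 < t \<Longrightarrow> t < t0 \<Longrightarrow> AE x in lebesgue. x \<in> {-1<..<1} \<longrightarrow> w x \<le> u0 x + t * \<psi> x"
    and jump: "\<And>t. 0 < t \<Longrightarrow> t < t0 \<Longrightarrow> jcost \<alpha> \<beta> {x. J0 x + t * L0 x \<noteq> 0} {x. J1 x + t * L1 x \<noteq> 0} \<le>
      jcost \<alpha> \<beta> {x. J0 x \<noteq> 0} {x. J1 x \<noteq> 0}"
  shows "0 \<le> (LINT x:{-1<..<1}|lebesgue. \<eta> * (u2 x * \<psi>2 x) + k x * \<psi> x)"
proof -
  let ?I = "{-1<..<1::real}"
  let ?R = "S \<union> T"
  have fin: "finite ?R" "?R \<subseteq> {-2<..<2}" using u_rep r by (simp_all add: rep_def)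
  have ur: "rep ?R J0 J1 u0 u1 u2" by (rule rep_superset[OF u_rep fin(1) _ fin(2)]) simp
  have pr: "rep ?R L0 L1 \<psi> \<psi>1 \<psi>2" by (rule rep_superset[OF r fin(1) _ fin(2)]) simp
  have sub: "?I \<subseteq> {-2<..<2}" by auto
  have L2: "L2_on ?I \<psi>" "L2_on ?I \<psi>2" using rep_L2(1,3)[OF r sub] by simp_all
  have uw: "L2_on ?I (\<lambda>x. 1 * u0 x + (-1) * w x)" by (intro L2_on_linear L2_inner)
  define a0 where "a0 x = \<eta> * (u2 x * u2 x) + (-1) * (f x * u0 x)" for x
  define a1 where "a1 x = (2 * \<eta>) * (u2 x * \<psi>2 x) + (-1) * (f x * \<psi> x)" for x
  define a2 where "a2 x = \<eta> * (\<psi>2 x * \<psi>2 x)" for x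
  define b0 where "b0 x = (1 * u0 x + (-1) * w x) * (1 * u0 x + (-1) * w x)" for x
  define b1 where "b1 x = 2 * ((1 * u0 x + (-1) * w x) * \<psi> x)" for x
  define b2 where "b2 x = \<psi> x * \<psi> x" for x
  have i: "set_integrable lebesgue ?I a0" "set_integrable lebesgue ?I a1" "set_integrable lebesgue ?I a2"
    "set_integrable lebesgue ?I b0" "set_integrable lebesgue ?I b1" "set_integrable lebesgue ?I b2"
    unfolding a0_def[abs_def] a1_def[abs_def] a2_def[abs_def] b0_def[abs_def] b1_def[abs_def] b2_def[abs_def]
    by (intro set_integral_add(1) set_integrable_mult_right L2_on_mult L2_inner f L2 uw)+
  define A where "A = (LINT x:?I|lebesgue. a1 x) + \<mu> * (LINT x:?I|lebesgue. b1 x)"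
  define Q where "Q = (LINT x:?I|lebesgue. a2 x) + \<mu> * (LINT x:?I|lebesgue. b2 x)"
  define C where "C = (LINT x:?I|lebesgue. a0 x) + \<mu> * (LINT x:?I|lebesgue. b0 x)"
  have E: "E1 \<alpha> \<beta> \<eta> \<mu> f w (\<lambda>x. 1 * u0 x + t * \<psi> x) =
      jcost \<alpha> \<beta> {x. J0 x + t * L0 x \<noteq> 0} {x. J1 x + t * L1 x \<noteq> 0} + C + t * A + t\<^sup>2 * Q" for t
  proof -
    let ?v = "\<lambda>x. 1 * u0 x + t * \<psi> x"
    have p: "prep ?v ?R (\<lambda>s. 1 * J0 s + t * L0 s) (\<lambda>s. 1 * J1 s + t * L1 s) ?v
        (\<lambda>x. 1 * u1 x + t * \<psi>1 x) (\<lambda>x. 1 * u2 x + t * \<psi>2 x)"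
      unfolding prep_def using rep_linear[OF ur pr, of 1 t] by simp
    have "(LINT x:?I|lebesgue. \<eta> * (D2 ?v x)\<^sup>2 - f x * ?v x) = (LINT x:?I|lebesgue. a0 x + t * a1 x + t\<^sup>2 * a2 x)"
    proof (rule set_integral_cong_lebesgue)
      show "AE x in lebesgue. x \<in> ?I \<longrightarrow> \<eta> * (D2 ?v x)\<^sup>2 - f x * ?v x = a0 x + t * a1 x + t\<^sup>2 * a2 x"
        using prep_D(2)[OF p]
        by eventually_elim (use sub in \<open>auto simp: a0_def a1_def a2_def power2_eq_square algebra_simps\<close>)
    qed
    also have "\<dots> = (LINT x:?I|lebesgue. a0 x) + t * (LINT x:?I|lebesgue. a1 x) + t\<^sup>2 * (LINT x:?I|lebesgue. a2 x)"
      by (rule LINT_quadratic[OF i(1-3)])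
    finally have 1: "(LINT x:?I|lebesgue. \<eta> * (D2 ?v x)\<^sup>2 - f x * ?v x) = \<dots>" .
    have "(LINT x:?I|lebesgue. (?v x - w x)\<^sup>2) = (LINT x:?I|lebesgue. b0 x + t * b1 x + t\<^sup>2 * b2 x)"
      by (rule set_integral_cong_lebesgue)
        (simp add: b0_def b1_def b2_def power2_eq_square algebra_simps)
    also have "\<dots> = (LINT x:?I|lebesgue. b0 x) + t * (LINT x:?I|lebesgue. b1 x) + t\<^sup>2 * (LINT x:?I|lebesgue. b2 x)"
      by (rule LINT_quadratic[OF i(4-6)])
    finally have 2: "(LINT x:?I|lebesgue. (?v x - w x)\<^sup>2) = \<dots>" .
    show ?thesis
      unfolding E1_def 1 2 prep_values(1)[OF p] prep_values(2)[OF p]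
      by (simp add: jcost_def A_def Q_def C_def algebra_simps)
  qed
  have Eu: "E1 \<alpha> \<beta> \<eta> \<mu> f w u = jcost \<alpha> \<beta> {x. J0 x \<noteq> 0} {x. J1 x \<noteq> 0} + C"
  proof -
    have "(LINT x:?I|lebesgue. \<eta> * (D2 u x)\<^sup>2 - f x * u x) = (LINT x:?I|lebesgue. a0 x)"
    proof (rule set_integral_cong_lebesgue)
      show "AE x in lebesgue. x \<in> ?I \<longrightarrow> \<eta> * (D2 u x)\<^sup>2 - f x * u x = a0 x"
        using prep_D(2)[OF u_prep] u_ae
        by eventually_elim (use sub in \<open>auto simp: a0_def power2_eq_square\<close>)
    qed
    moreover have "(LINT x:?I|lebesgue. (u x - w x)\<^sup>2) = (LINT x:?I|lebesgue. b0 x)"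
    proof (rule set_integral_cong_lebesgue)
      show "AE x in lebesgue. x \<in> ?I \<longrightarrow> (u x - w x)\<^sup>2 = b0 x"
        using u_ae by eventually_elim (use sub in \<open>auto simp: b0_def power2_eq_square\<close>)
    qed
    ultimately show ?thesis
      unfolding E1_def prep_values(1)[OF u_prep] prep_values(2)[OF u_prep] by (simp add: jcost_def C_def)
  qed
  have "0 \<le> A"
  proof (rule quadratic_nonneg_imp[OF t0])
    fix t assume t: "0 < t" "t < t0"
    let ?v = "\<lambda>x. 1 * u0 x + t * \<psi> x"
    have p: "prep ?v ?R (\<lambda>s. 1 * J0 s + t * L0 s) (\<lambda>s. 1 * J1 s + t * L1 s) ?v
        (\<lambda>x. 1 * u1 x + t * \<psi>1 x) (\<lambda>x. 1 * u2 x + t * \<psi>2 x)"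
      unfolding prep_def using rep_linear[OF ur pr, of 1 t] by simp
    have o: "AE x in lebesgue. x \<in> {-2<..<-1} \<union> {1<..<2} \<longrightarrow> ?v x = w x"
      using outer u_outer u_ae by eventually_elim auto
    have "AE x in lebesgue. x \<notin> {-1, 1::real}" by (rule AE_not_finite) simp
    with o adm[OF t] have "AE x in lebesgue. x \<in> {-2<..<2} \<longrightarrow> w x \<le> ?v x"
    proof eventually_elim
      case (elim x)
      show ?case
      proof
        assume "x \<in> {-2<..<2}"
        then consider "x \<in> {-2<..<-1} \<union> {1<..<2}" | "x \<in> {-1<..<1}" using elim(3) by force
        then show "w x \<le> ?v x" using elim by cases auto
      qed
    qed
    then have "?v \<in> K w" using o prep_K_iff[OF p w_cont] by blast
    from u_min[OF this] show "0 \<le> t * A + t\<^sup>2 * Q"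
      unfolding E Eu using jump[OF t] by linarith
  qed
  moreover have "A = 2 * (LINT x:?I|lebesgue. \<eta> * (u2 x * \<psi>2 x) + k x * \<psi> x)"
  proof -
    have "A = (LINT x:?I|lebesgue. a1 x + \<mu> * b1 x)"
      unfolding A_def using LINT_quadratic[OF i(2,5,5), of \<mu> 0] by simp
    also have "\<dots> = (LINT x:?I|lebesgue. 2 * (\<eta> * (u2 x * \<psi>2 x) + k x * \<psi> x))"
      by (rule set_integral_cong_lebesgue, rule AE_I2)
        (auto simp: a1_def b1_def k_def field_simps)
    also have "\<dots> = 2 * (LINT x:?I|lebesgue. \<eta> * (u2 x * \<psi>2 x) + k x * \<psi> x)"
      by (rule set_integral_mult_right)
    finally show ?thesis .
  qed
  ultimately show ?thesis by simp
qed

end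

text \<open>A second primitive of \<open>\<theta>\<close> that vanishes on both sides of the support of \<open>\<theta>\<close>; what is left over is
  absorbed in jumps of the function and of its slope at the single point \<open>x\<close>.\<close>

definition tp1 :: "real \<Rightarrow> (real \<Rightarrow> real) \<Rightarrow> real \<Rightarrow> real"
  where "tp1 x \<theta> y = prim \<theta> y + (if x < y then - prim \<theta> 2 else 0)"

definition tp :: "real \<Rightarrow> (real \<Rightarrow> real) \<Rightarrow> real \<Rightarrow> real"
  where "tp x \<theta> y = prim (tp1 x \<theta>) y + (if x < y then - prim (tp1 x \<theta>) 2 else 0)"

lemma tp_rep:
  assumes "x \<in> {-2<..<2}" "L2_on {-2<..<2} \<theta>"
  shows "rep {x} (\<lambda>s. if s = x then - prim (tp1 x \<theta>) 2 else 0) (\<lambda>s. if s = x then - prim \<theta> 2 else 0)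
    (tp x \<theta>) (tp1 x \<theta>) \<theta>"
  unfolding rep_def
proof (intro conjI)
  show "\<exists>c. \<forall>y\<in>{-2..2}. tp1 x \<theta> y = c + prim \<theta> y + stepf (\<lambda>s. if s = x then - prim \<theta> 2 else 0) {x} y"
    by (rule exI[of _ 0]) (simp add: tp1_def stepf_def)
  show "\<exists>c. \<forall>y\<in>{-2..2}. tp x \<theta> y = c + prim (tp1 x \<theta>) y + stepf (\<lambda>s. if s = x then - prim (tp1 x \<theta>) 2 else 0) {x} y"
    by (rule exI[of _ 0]) (simp add: tp_def stepf_def)
qed (use assms in auto)

lemma tp_end: "x < 2 \<Longrightarrow> tp1 x \<theta> 2 = 0" "x < 2 \<Longrightarrow> tp x \<theta> 2 = 0"
  by (simp_all add: tp1_def tp_def)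

lemma prim_eq_0: "(\<And>t. -2 \<le> t \<Longrightarrow> t \<le> x \<Longrightarrow> f t = 0) \<Longrightarrow> prim f x = 0"
  using prim_cong[of x f "\<lambda>_. 0"] by (simp add: prim_def)

lemma prim_eq_end:
  assumes "AI f" "-2 \<le> x" "x \<le> 2" "\<And>t. x < t \<Longrightarrow> t \<le> 2 \<Longrightarrow> f t = 0"
  shows "prim f x = prim f 2"
proof -
  have "integral {x..2} f = integral {x..2} (\<lambda>_. 0)"
    by (rule integral_spike[of "{x}"]) (use assms in auto)
  then show ?thesis using prim_diff[OF assms(1,2,3)] by simp
qed

lemma AI_tp1: "x \<in> {-2<..<2} \<Longrightarrow> L2_on {-2<..<2} \<theta> \<Longrightarrow> AI (tp1 x \<theta>)"
  using rep_AI(2)[OF tp_rep] by blast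

text \<open>Beyond x the corrections subtract the total integrals of \<open>\<theta>\<close> and of
  \<open>tp1\<close>, which is what the primitives have accumulated once the support is
  passed.\<close>

lemma tp_support:
  assumes x: "x \<in> {-2<..<2}" and \<theta>: "L2_on {-2<..<2} \<theta>" and pq: "-2 \<le> p" "p \<le> x" "x \<le> q" "q \<le> 2"
    and z: "\<And>y. y \<notin> {p<..<q} \<Longrightarrow> \<theta> y = 0"
  shows "-2 \<le> y \<Longrightarrow> y \<le> p \<Longrightarrow> tp1 x \<theta> y = 0"
    and "q < y \<Longrightarrow> y \<le> 2 \<Longrightarrow> tp1 x \<theta> y = 0"
    and "-2 \<le> y \<Longrightarrow> y \<le> p \<Longrightarrow> tp x \<theta> y = 0"
    and "q < y \<Longrightarrow> y \<le> 2 \<Longrightarrow> tp x \<theta> y = 0"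
proof -
  have A: "AI \<theta>" by (rule L2_on_Ioo_Icc[OF \<theta>])
  show lo: "tp1 x \<theta> y = 0" if "-2 \<le> y" "y \<le> p" for y
    using prim_eq_0[of y \<theta>] that pq z by (auto simp: tp1_def)
  show hi: "tp1 x \<theta> y = 0" if "q < y" "y \<le> 2" for y
    using prim_eq_end[OF A, of y] that pq z by (auto simp: tp1_def)
  show "tp x \<theta> y = 0" if "-2 \<le> y" "y \<le> p"
    using prim_eq_0[of y "tp1 x \<theta>"] that pq lo by (auto simp: tp_def)
  show "tp x \<theta> y = 0" if "q < y" "y \<le> 2"
    using prim_eq_end[OF AI_tp1[OF x \<theta>], of y] that pq hi by (auto simp: tp_def)
qed

lemma prim_one: "-2 \<le> x \<Longrightarrow> prim (\<lambda>_. 1) x = x + 2"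
  by (simp add: prim_def)

lemma AI_one: "AI (\<lambda>_. 1)" by (rule AI_cont) simp

text \<open>Integration by parts against the constant 1. The value jump at x thereby becomes a
  linear functional of \<open>\<theta>\<close>, represented by the L2 function s - x.\<close>

lemma tp_jump:
  assumes x: "x \<in> {-2<..<2}" and \<theta>: "L2_on {-2<..<2} \<theta>"
  shows "- prim (tp1 x \<theta>) 2 = integral {-2..2} (\<lambda>s. (s - x) * \<theta> s)"
    and "AI (\<lambda>s. (s - x) * \<theta> s)"
proof -
  have A: "AI \<theta>" by (rule L2_on_Ioo_Icc[OF \<theta>])
  show As: "AI (\<lambda>s. (s - x) * \<theta> s)" for x by (intro AI_mult A continuous_intros)
  have "prim (tp1 x \<theta>) 2 = integral {-2..2} (\<lambda>y. 1 * prim \<theta> y + (if x < y then - prim \<theta> 2 else 0) * 1)"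
    unfolding prim_def[of "tp1 x \<theta>"] by (rule Henstock_Kurzweil_Integration.integral_cong) (simp add: tp1_def)
  also have "\<dots> = integral {-2..2} (\<lambda>y. 1 * prim \<theta> y) + integral {-2..2} (\<lambda>y. (if x < y then - prim \<theta> 2 else 0) * 1)"
    by (rule Henstock_Kurzweil_Integration.integral_add; rule AI_integrable)
      (use x in \<open>auto intro!: AI_cont[OF prim_cont[OF A]] AI_indicator_mult(1)[OF AI_one, simplified]\<close>)
  also have "integral {-2..2} (\<lambda>y. 1 * prim \<theta> y) = 4 * prim \<theta> 2 - integral {-2..2} (\<lambda>y. prim (\<lambda>_. 1) y * \<theta> y)"
    using prim_by_parts[OF AI_one A] by (simp add: prim_one)
  also have "integral {-2..2} (\<lambda>y. prim (\<lambda>_. 1) y * \<theta> y) = integral {-2..2} (\<lambda>y. (y - x) * \<theta> y + (x + 2) * \<theta> y)"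
    by (rule Henstock_Kurzweil_Integration.integral_cong) (simp add: prim_one algebra_simps)
  also have "\<dots> = integral {-2..2} (\<lambda>y. (y - x) * \<theta> y) + integral {-2..2} (\<lambda>y. (x + 2) * \<theta> y)"
    by (rule Henstock_Kurzweil_Integration.integral_add; rule AI_integrable)
      (auto intro: As set_integrable_mult_right A)
  also have "integral {-2..2} (\<lambda>y. (x + 2) * \<theta> y) = (x + 2) * prim \<theta> 2" by (simp add: prim_def)
  also have "integral {-2..2} (\<lambda>y. (if x < y then - prim \<theta> 2 else 0) * 1) = - prim \<theta> 2 * (2 - x)"
    using AI_indicator_mult(2)[OF AI_one, of x "- prim \<theta> 2"] x by (simp add: prim_one)
  finally show "- prim (tp1 x \<theta>) 2 = integral {-2..2} (\<lambda>s. (s - x) * \<theta> s)" by (simp add: algebra_simps)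
qed

lemma prim_mono:
  assumes "AI f" "-2 \<le> a" "a \<le> b" "b \<le> 2" "\<And>t. a < t \<Longrightarrow> t < b \<Longrightarrow> 0 \<le> f t"
  shows "prim f a \<le> prim f b"
proof -
  have "integral {a..b} (\<lambda>t. if t = a \<or> t = b then 0 else f t) = integral {a..b} f"
    by (rule integral_spike[of "{a, b}"]) auto
  moreover have "0 \<le> integral {a..b} (\<lambda>t. if t = a \<or> t = b then 0 else f t)"
  proof (rule Henstock_Kurzweil_Integration.integral_nonneg)
    show "(\<lambda>t. if t = a \<or> t = b then 0 else f t) integrable_on {a..b}"
      by (rule integrable_spike[OF AI_integrable_sub[OF assms(1,2,4)], of "{a, b}"]) auto
  qed (use assms in auto)
  ultimately show ?thesis using prim_diff[OF assms(1-4)] by simp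
qed

lemma prim_antimono:
  assumes "AI f" "-2 \<le> a" "a \<le> b" "b \<le> 2" "\<And>t. a < t \<Longrightarrow> t \<le> b \<Longrightarrow> f t \<le> 0"
  shows "prim f b \<le> prim f a"
proof -
  have "prim (\<lambda>t. (-1) * f t + 0 * f t) a \<le> prim (\<lambda>t. (-1) * f t + 0 * f t) b"
  proof (rule prim_mono)
    show "AI (\<lambda>t. (-1) * f t + 0 * f t)"
      by (intro set_integral_add(1) set_integrable_mult_right assms(1))
  qed (use assms in auto)
  then show ?thesis
    using prim_linear[OF assms(1,1), of a "-1" 0] prim_linear[OF assms(1,1), of b "-1" 0] assms by simp
qed

lemma prim_lipschitz:
  assumes "AI f" "\<forall>t\<in>{-2..2}. \<bar>f t\<bar> \<le> B" "a \<in> {-2..2}" "b \<in> {-2..2}"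
  shows "\<bar>prim f b - prim f a\<bar> \<le> B * \<bar>b - a\<bar>"
proof -
  have *: "\<bar>prim f b - prim f a\<bar> \<le> B * (b - a)" if "a \<le> b" "-2 \<le> a" "b \<le> 2" for a b
  proof -
    have "norm (integral {a..b} f) \<le> integral {a..b} (\<lambda>_. B)"
      by (rule integral_norm_bound_integral[OF AI_integrable_sub[OF assms(1) that(2,3)]])
        (use assms(2) that in auto)
    then have "norm (integral {a..b} f) \<le> B * (b - a)" using that by (simp add: mult.commute)
    then show ?thesis using prim_diff[OF assms(1) that(2,1,3)] by simp
  qed
  show ?thesis using *[of a b] *[of b a] assms(3,4) by (cases "a \<le> b") (auto simp: abs_minus_commute)
qed

text \<open>The slope rises from 0 up to x, drops there by the total integral of
  \<open>\<theta>\<close>, and rises back to 0. So the function climbs from 0 before x and descends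
  to 0 after x, whatever its jump at x.\<close>

lemma tp_nonneg:
  assumes x: "x \<in> {-2<..<2}" and \<theta>: "L2_on {-2<..<2} \<theta>" and nn: "\<And>s. 0 \<le> \<theta> s" and y: "y \<in> {-2..2}"
  shows "0 \<le> tp x \<theta> y"
proof -
  have A: "AI \<theta>" by (rule L2_on_Ioo_Icc[OF \<theta>])
  have A1: "AI (tp1 x \<theta>)" by (rule AI_tp1[OF x \<theta>])
  have 1: "0 \<le> tp1 x \<theta> t" if "-2 \<le> t" "t \<le> x" for t
    using prim_mono[OF A, of "-2" t] that x nn by (simp add: tp1_def)
  have 2: "tp1 x \<theta> t \<le> 0" if "x < t" "t \<le> 2" for t
    using prim_mono[OF A, of t 2] that x nn by (simp add: tp1_def)
  show ?thesis
  proof (cases "y \<le> x")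
    case True
    then show ?thesis using prim_mono[OF A1, of "-2" y] 1 x y by (simp add: tp_def)
  next
    case False
    then show ?thesis using prim_antimono[OF A1, of y 2] 2 x y by (simp add: tp_def)
  qed
qed

lemma LINT_supported:
  assumes "{a<..<b} \<subseteq> {-2..2}" "\<And>y. y \<in> {-2..2} \<Longrightarrow> y \<notin> {a<..<b} \<Longrightarrow> h y = 0" "AI h"
  shows "(LINT y:{a<..<b}|lebesgue. h y) = integral {-2..2} h"
proof -
  have "(LINT y:{-2..2}|lebesgue. h y) = (LINT y:{a<..<b}|lebesgue. h y)"
    by (rule set_integral_zero_outside) (use assms(1,2) in auto)
  then show ?thesis using LINT_Icc[OF assms(3)] by simp
qed

text \<open>The part of \<open>G\<close> orthogonal to e1 and e2, cut off to (p,q), satisfies both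
  constraints and is itself an admissible \<theta>; so it is orthogonal to \<open>G\<close>, hence
  to itself, and vanishes. Zero functions are allowed for e1 and e2, so that one lemma covers two,
  one or no constraints.\<close>

lemma projection_AE:
  assumes pq: "-2 \<le> p" "q \<le> 2" and G: "L2_on {p<..<q} G"
    and e: "L2_on {p<..<q} e1" "L2_on {p<..<q} e2"
    and N: "(LINT s:{p<..<q}|lebesgue. e1 s * e1 s) \<noteq> 0 \<or> e1 = (\<lambda>_. 0)"
      "(LINT s:{p<..<q}|lebesgue. e2 s * e2 s) \<noteq> 0 \<or> e2 = (\<lambda>_. 0)"
    and o: "(LINT s:{p<..<q}|lebesgue. e1 s * e2 s) = 0"
    and van: "\<And>\<theta>. L2_on {-2<..<2} \<theta> \<Longrightarrow> (\<And>y. y \<notin> {p<..<q} \<Longrightarrow> \<theta> y = 0) \<Longrightarrow>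
      (LINT s:{p<..<q}|lebesgue. e1 s * \<theta> s) = 0 \<Longrightarrow> (LINT s:{p<..<q}|lebesgue. e2 s * \<theta> s) = 0 \<Longrightarrow>
      (LINT s:{p<..<q}|lebesgue. G s * \<theta> s) = 0"
  shows "\<exists>a b. AE s in lebesgue. s \<in> {p<..<q} \<longrightarrow> G s = a * e1 s + b * e2 s"
proof -
  let ?I = "{p<..<q}"
  define ip where "ip h h' = (LINT s:?I|lebesgue. h s * h' s)" for h h' :: "real \<Rightarrow> real"
  have lin: "ip h (\<lambda>s. G s + (- a) * e1 s + (- b) * e2 s) = ip h G + (- a) * ip h e1 + (- b) * ip h e2"
    if "L2_on ?I h" for h a b
  proof -
    have "ip h (\<lambda>s. G s + (- a) * e1 s + (- b) * e2 s) =
        (LINT s:?I|lebesgue. h s * G s + (- a) * (h s * e1 s) + (- b) * (h s * e2 s))"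
      unfolding ip_def by (simp add: algebra_simps)
    also have "\<dots> = ip h G + (- a) * ip h e1 + (- b) * ip h e2"
      unfolding ip_def by (intro LINT_quadratic L2_on_mult that G e)
    finally show ?thesis .
  qed
  \<comment> \<open>For e1 = 0 the coefficient is 0 by the convention for division by zero.\<close>
  define a where "a = ip e1 G / ip e1 e1"
  define b where "b = ip e2 G / ip e2 e2"
  define R where "R s = G s + (- a) * e1 s + (- b) * e2 s" for s
  define \<theta> where "\<theta> s = indicator ?I s * R s" for s
  have R: "L2_on ?I R"
    unfolding R_def[abs_def] using L2_on_linear[OF L2_on_linear[OF G e(1), of 1 "- a"] e(2), of 1 "- b"] by simp
  have sub: "?I \<subseteq> {-2<..<2}" using pq by auto
  have \<theta>: "L2_on {-2<..<2} \<theta>" unfolding \<theta>_def[abs_def] by (rule L2_on_zero_extend[OF R sub])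
  have ip\<theta>: "ip h \<theta> = ip h R" for h
    unfolding ip_def by (rule set_integral_cong_lebesgue, rule AE_I2) (simp add: \<theta>_def)
  have comm: "ip h h' = ip h' h" for h h' unfolding ip_def by (simp add: mult.commute)
  have o': "ip e1 e2 = 0" "ip e2 e1 = 0" using o comm[of e2 e1] by (simp_all add: ip_def)
  have z: "ip (\<lambda>_. 0) h = 0" for h by (simp add: ip_def set_lebesgue_integral_def)
  have linR: "ip h R = ip h G - a * ip h e1 - b * ip h e2" if "L2_on ?I h" for h
    using lin[OF that, of a b] unfolding R_def[abs_def] by simp
  have e1R: "ip e1 R = 0"
  proof (cases "e1 = (\<lambda>_. 0)")
    case False
    then have "ip e1 e1 \<noteq> 0" using N(1) by (simp add: ip_def)
    then show ?thesis using linR[OF e(1)] o' by (simp add: a_def)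
  qed (simp add: z)
  have e2R: "ip e2 R = 0"
  proof (cases "e2 = (\<lambda>_. 0)")
    case False
    then have "ip e2 e2 \<noteq> 0" using N(2) by (simp add: ip_def)
    then show ?thesis using linR[OF e(2)] o' by (simp add: b_def)
  qed (simp add: z)
  have "ip G \<theta> = 0"
    unfolding ip_def
  proof (rule van[OF \<theta>])
    show "\<theta> y = 0" if "y \<notin> ?I" for y using that by (simp add: \<theta>_def)
    show "(LINT s:?I|lebesgue. e1 s * \<theta> s) = 0" using e1R ip\<theta>[of e1] by (simp add: ip_def)
    show "(LINT s:?I|lebesgue. e2 s * \<theta> s) = 0" using e2R ip\<theta>[of e2] by (simp add: ip_def)
  qed
  then have "ip R G = 0" using ip\<theta>[of G] comm by metis
  then have "ip R R = 0"
    using linR[OF R] e1R e2R comm[of R e1] comm[of R e2] by simp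
  moreover have i: "integrable lebesgue (\<lambda>s. indicator ?I s *\<^sub>R (R s * R s))"
    using L2_on_mult[OF R R] by (simp add: set_integrable_def)
  ultimately have "AE s in lebesgue. indicator ?I s *\<^sub>R (R s * R s) = 0"
    using integral_nonneg_eq_0_iff_AE[OF i] by (simp add: ip_def set_lebesgue_integral_def)
  then have "AE s in lebesgue. s \<in> ?I \<longrightarrow> G s = a * e1 s + b * e2 s"
    by eventually_elim (auto simp: R_def)
  then show ?thesis by blast
qed

section \<open>The first variation expressed through \<open>g\<close>\<close>

context obstacle
begin

definition K1 :: "real \<Rightarrow> real" where "K1 = prim k"
definition K2 :: "real \<Rightarrow> real" where "K2 = prim K1"
definition g :: "real \<Rightarrow> real" where "g s = \<eta> * u2 s + K2 s"
text \<open>Does not depend on where the primitives \<open>K1\<close> and \<open>K2\<close> start: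
  another base point changes \<open>K2\<close> by an affine function, which coincides with its own
  Taylor polynomial.\<close>

definition gx :: "real \<Rightarrow> real \<Rightarrow> real" where "gx x s = g s - K2 x - K1 x * (s - x)"

lemma AI_k: "AI k" by (rule L2_on_Ioo_Icc[OF L2_k])
lemma K1_cont: "continuous_on {-2..2} K1" unfolding K1_def by (rule prim_cont[OF AI_k])
lemma K2_cont: "continuous_on {-2..2} K2" unfolding K2_def by (rule prim_cont[OF AI_cont[OF K1_cont]])

lemma L2_cont:
  assumes "continuous_on {-2..2} h" "open U" "U \<subseteq> {-2<..<2}"
  shows "L2_on U h"
proof -
  obtain B where "\<forall>x\<in>{-2..2}. \<bar>h x\<bar> \<le> B"
    using compact_imp_bounded[OF compact_continuous_image[OF assms(1)]] by (auto simp: bounded_iff)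
  then show ?thesis by (rule AI_bounded_L2[OF AI_cont[OF assms(1)] _ assms(3,2)])
qed

lemma L2_g: "L2_on {-2<..<2} g" and L2_gx: "L2_on {-2<..<2} (gx x)"
proof -
  have u: "L2_on {-2<..<2} u2" using u_rep by (simp add: rep_def)
  have "L2_on {-2<..<2} (\<lambda>s. \<eta> * u2 s + 1 * K2 s)"
    by (intro L2_on_linear u L2_cont K2_cont) auto
  then show g: "L2_on {-2<..<2} g" by (simp add: g_def[abs_def])
  have "L2_on {-2<..<2} (\<lambda>s. 1 * g s + (-1) * (K2 x + K1 x * (s - x)))"
    by (intro L2_on_linear g L2_cont continuous_intros) auto
  then show "L2_on {-2<..<2} (gx x)" by (simp add: gx_def[abs_def] algebra_simps)
qed

text \<open>Jumps of size \<open>a\<close> in the value and \<open>b\<close> in the slope at \<open>x\<close> do not increase the jump energy.\<close>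

definition jfree :: "real \<Rightarrow> real \<Rightarrow> real \<Rightarrow> bool"
  where "jfree x a b \<longleftrightarrow> (a = 0 \<and> b = 0) \<or> (a = 0 \<and> (J0 x \<noteq> 0 \<or> J1 x \<noteq> 0)) \<or> J0 x \<noteq> 0 \<or>
    (\<alpha> = \<beta> \<and> (J0 x \<noteq> 0 \<or> J1 x \<noteq> 0))"

text \<open>Where \<open>u\<close> pays \<alpha>, the largest possible cost, anything is allowed;
  where it pays \<beta> for a slope jump, the value may be touched only if \<alpha> = \<beta>. A
  jump that is cancelled only lowers the cost.\<close>

lemma jump_cost:
  assumes "jfree x a b"
  shows "jcost \<alpha> \<beta> {s. J0 s + t * (if s = x then a else 0) \<noteq> 0} {s. J1 s + t * (if s = x then b else 0) \<noteq> 0} \<le>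
    jcost \<alpha> \<beta> {s. J0 s \<noteq> 0} {s. J1 s \<noteq> 0}"
proof (rule jcost_le[where x = x])
  have S: "finite (S \<union> {x})" "\<And>s. s \<notin> S \<union> {x} \<Longrightarrow> J0 s = 0" "\<And>s. s \<notin> S \<union> {x} \<Longrightarrow> J1 s = 0"
    using u_rep by (simp_all add: rep_def)
  show "finite {s. J0 s \<noteq> 0}" "finite {s. J1 s \<noteq> 0}"
    by (rule finite_subset[OF _ S(1)], use S in blast)+
  show "finite {s. J0 s + t * (if s = x then a else 0) \<noteq> 0}" "finite {s. J1 s + t * (if s = x then b else 0) \<noteq> 0}"
    by (rule finite_subset[OF _ S(1)], use S in auto)+
  show "(if x \<in> {s. J0 s + t * (if s = x then a else 0) \<noteq> 0} then \<alpha>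
      else if x \<in> {s. J1 s + t * (if s = x then b else 0) \<noteq> 0} then \<beta> else 0) \<le>
    (if x \<in> {s. J0 s \<noteq> 0} then \<alpha> else if x \<in> {s. J1 s \<noteq> 0} then \<beta> else 0)"
    using assms pos unfolding jfree_def by auto
qed auto

text \<open>Two integrations by parts shift two primitives from \<open>tp\<close> to
  \<open>k\<close>. Nothing is left at 2, where \<open>tp\<close> and \<open>tp1\<close> vanish; the
  jumps at x leave -K2(x) times the integral of \<open>\<theta>\<close> and -K1(x) times its first
  moment about x, which are collected in \<open>gx\<close>.\<close>

lemma tp_variation:
  assumes x: "-1 \<le> p" "p \<le> x" "x \<le> q" "q \<le> 1" and \<theta>: "L2_on {-2<..<2} \<theta>"
    and z: "\<And>y. y \<notin> {p<..<q} \<Longrightarrow> \<theta> y = 0"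
    and j: "jfree x (integral {-2..2} (\<lambda>s. (s - x) * \<theta> s)) (- prim \<theta> 2)"
    and t0: "t0 > 0"
    and adm: "\<And>t. 0 < t \<Longrightarrow> t < t0 \<Longrightarrow> AE y in lebesgue. y \<in> {p<..<q} \<longrightarrow> w y \<le> u0 y + t * tp x \<theta> y"
  shows "0 \<le> integral {-2..2} (\<lambda>s. gx x s * \<theta> s)"
proof -
  have x2: "x \<in> {-2<..<2}" using x by auto
  let ?a = "- prim (tp1 x \<theta>) 2" and ?b = "- prim \<theta> 2"
  note r = tp_rep[OF x2 \<theta>] and a = tp_jump[OF x2 \<theta>]
  have A: "AI \<theta>" by (rule L2_on_Ioo_Icc[OF \<theta>])
  have supp: "tp x \<theta> y = 0" if "y \<in> {-2..2}" "y \<le> p \<or> q < y" for y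
    using tp_support(3,4)[OF x2 \<theta> _ x(2,3) _ z, of y] that x by auto
  have "0 \<le> (LINT y:{-1<..<1}|lebesgue. \<eta> * (u2 y * \<theta> y) + k y * tp x \<theta> y)"
  proof (rule first_variation[OF r _ t0])
    show "AE y in lebesgue. y \<in> {-2<..<-1} \<union> {1<..<2} \<longrightarrow> tp x \<theta> y = 0"
      by (rule AE_I2) (use supp x in auto)
    show "jcost \<alpha> \<beta> {s. J0 s + t * (if s = x then ?a else 0) \<noteq> 0} {s. J1 s + t * (if s = x then ?b else 0) \<noteq> 0} \<le>
        jcost \<alpha> \<beta> {s. J0 s \<noteq> 0} {s. J1 s \<noteq> 0}" for t
      by (rule jump_cost) (use j a(1) in simp)
    fix t assume t: "0 < t" "t < t0"
    have "AE y in lebesgue. y \<notin> {p, q}" by (rule AE_not_finite) simp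
    with adm[OF t] w_ge show "AE y in lebesgue. y \<in> {-1<..<1} \<longrightarrow> w y \<le> u0 y + t * tp x \<theta> y"
    proof eventually_elim
      case (elim y)
      show ?case
      proof
        assume y: "y \<in> {-1<..<1}"
        show "w y \<le> u0 y + t * tp x \<theta> y"
        proof (cases "y \<in> {p<..<q}")
          case False
          then have "tp x \<theta> y = 0" using supp[of y] y elim(3) by force
          then show ?thesis using elim(2) y by simp
        qed (use elim in blast)
      qed
    qed
  qed
  also have "(LINT y:{-1<..<1}|lebesgue. \<eta> * (u2 y * \<theta> y) + k y * tp x \<theta> y) =
      integral {-2..2} (\<lambda>y. \<eta> * (u2 y * \<theta> y) + k y * tp x \<theta> y)"
  proof (rule LINT_supported)
    have u2\<theta>: "AI (\<lambda>y. u2 y * \<theta> y)"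
      using L2_on_mult[of "{-2<..<2}" u2 \<theta>] \<theta> u_rep by (simp add: absolutely_integrable_on_Icc_iff_Ioo rep_def)
    have "AI (\<lambda>y. tp x \<theta> y * k y)" by (rule rep_by_parts(3)[OF r AI_k])
    then show "AI (\<lambda>y. \<eta> * (u2 y * \<theta> y) + k y * tp x \<theta> y)"
      by (intro set_integral_add(1) set_integrable_mult_right u2\<theta>) (simp add: mult.commute)
  qed (use z x in \<open>auto simp: k_def\<close>)
  also have "\<dots> = integral {-2..2} (\<lambda>s. gx x s * \<theta> s)"
  proof -
    have u2\<theta>: "AI (\<lambda>y. u2 y * \<theta> y)"
      using L2_on_mult[of "{-2<..<2}" u2 \<theta>] \<theta> u_rep by (simp add: absolutely_integrable_on_Icc_iff_Ioo rep_def)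
    have AK: "AI (\<lambda>y. K2 y * \<theta> y)" by (rule AI_mult[OF A K2_cont])
    have tk: "AI (\<lambda>y. tp x \<theta> y * k y)" by (rule rep_by_parts(3)[OF r AI_k])
    have "integral {-2..2} (\<lambda>y. tp x \<theta> y * k y) = - integral {-2..2} (\<lambda>y. tp1 x \<theta> y * K1 y) - ?a * K1 x"
      using rep_by_parts(1)[OF r AI_k] tp_end x by (simp add: K1_def)
    moreover have "integral {-2..2} (\<lambda>y. tp1 x \<theta> y * K1 y) = - integral {-2..2} (\<lambda>y. \<theta> y * K2 y) - ?b * K2 x"
      using rep_by_parts(2)[OF r AI_cont[OF K1_cont]] tp_end x by (simp add: K2_def)
    ultimately have kt: "integral {-2..2} (\<lambda>y. tp x \<theta> y * k y) =
        integral {-2..2} (\<lambda>y. K2 y * \<theta> y) + ?b * K2 x - ?a * K1 x" by (simp add: mult.commute)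
    have "((\<lambda>y. \<eta> * (u2 y * \<theta> y) + tp x \<theta> y * k y) has_integral
        \<eta> * integral {-2..2} (\<lambda>y. u2 y * \<theta> y) + integral {-2..2} (\<lambda>y. tp x \<theta> y * k y)) {-2..2}"
      by (intro has_integral_add has_integral_mult_right integrable_integral AI_integrable u2\<theta> tk)
    then have 1: "integral {-2..2} (\<lambda>y. \<eta> * (u2 y * \<theta> y) + k y * tp x \<theta> y) =
        \<eta> * integral {-2..2} (\<lambda>y. u2 y * \<theta> y) + integral {-2..2} (\<lambda>y. tp x \<theta> y * k y)"
      by (simp add: integral_unique mult.commute)
    have "((\<lambda>s. (\<eta> * (u2 s * \<theta> s) + K2 s * \<theta> s) - (K2 x * \<theta> s + K1 x * ((s - x) * \<theta> s))) has_integral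
        (\<eta> * integral {-2..2} (\<lambda>y. u2 y * \<theta> y) + integral {-2..2} (\<lambda>y. K2 y * \<theta> y)) -
        (K2 x * integral {-2..2} \<theta> + K1 x * integral {-2..2} (\<lambda>s. (s - x) * \<theta> s))) {-2..2}"
      by (intro has_integral_add has_integral_diff has_integral_mult_right integrable_integral AI_integrable u2\<theta> AK A a(2))
    moreover have "(\<lambda>s. (\<eta> * (u2 s * \<theta> s) + K2 s * \<theta> s) - (K2 x * \<theta> s + K1 x * ((s - x) * \<theta> s))) = (\<lambda>s. gx x s * \<theta> s)"
      by (rule ext) (simp add: gx_def g_def algebra_simps)
    ultimately have 2: "integral {-2..2} (\<lambda>s. gx x s * \<theta> s) =
        (\<eta> * integral {-2..2} (\<lambda>y. u2 y * \<theta> y) + integral {-2..2} (\<lambda>y. K2 y * \<theta> y)) -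
        (K2 x * integral {-2..2} \<theta> + K1 x * integral {-2..2} (\<lambda>s. (s - x) * \<theta> s))"
      by (simp add: integral_unique)
    show ?thesis unfolding 1 2 kt a(1) prim_def[of \<theta>] by (simp add: algebra_simps)
  qed
  finally show ?thesis .
qed

end

section \<open>Conditions away from contact\<close>

text \<open>The Gram entries for \<open>projection_AE\<close>: the spans used are generated by s - x
  alone, or by 1 and s - m with m the midpoint, the centre that makes these two orthogonal.\<close>

lemma LINT_shift_square:
  assumes "p < (q::real)"
  shows "(LINT s:{p<..<q}|lebesgue. (s - x) * (s - x)) \<noteq> 0"
    and "(LINT s:{p<..<q}|lebesgue. (1::real) * 1) \<noteq> 0"
    and "(LINT s:{p<..<q}|lebesgue. 1 * (s - (p + q) / 2)) = 0"
proof -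
  have c: "(LINT s:{p<..<q}|lebesgue. h s) = integral {p..q} h" if "continuous_on {p..q} h" for h :: "real \<Rightarrow> real"
    unfolding LINT_Ioo by (rule LINT_Icc[OF absolutely_integrable_continuous_real[OF that]])
  have ftc: "integral {p..q} h' = h q - h p" if "\<And>s. (h has_real_derivative h' s) (at s)" for h h' :: "real \<Rightarrow> real"
    by (rule integral_unique, rule fundamental_theorem_of_calculus)
      (use assms that in \<open>auto simp flip: has_real_derivative_iff_has_vector_derivative intro: has_field_derivative_at_within\<close>)
  have "integral {p..q} (\<lambda>s. (s - x) * (s - x)) = (q - x) ^ 3 / 3 - (p - x) ^ 3 / 3"
    by (rule ftc[of "\<lambda>s. (s - x) ^ 3 / 3"]) (auto intro!: derivative_eq_intros simp: power2_eq_square)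
  moreover have "(p - x) ^ 3 < (q - x) ^ 3"
  proof -
    \<comment> \<open>The quadratic factor of a difference of cubes, written as half a sum of
      squares to see that it is positive.\<close>
    have e: "(q - x) ^ 3 - (p - x) ^ 3 = (q - p) * (((q - x) + (p - x))\<^sup>2 + ((q - x)\<^sup>2 + (p - x)\<^sup>2)) / 2"
      by (simp add: power3_eq_cube power2_eq_square algebra_simps)
    have "q - x \<noteq> 0 \<or> p - x \<noteq> 0" using assms by auto
    then have "0 < (q - x)\<^sup>2 + (p - x)\<^sup>2" by (simp add: sum_power2_gt_zero_iff)
    then have "0 < ((q - x) + (p - x))\<^sup>2 + ((q - x)\<^sup>2 + (p - x)\<^sup>2)" by (simp add: add_nonneg_pos)
    then have "0 < (q - p) * (((q - x) + (p - x))\<^sup>2 + ((q - x)\<^sup>2 + (p - x)\<^sup>2)) / 2" using assms by simp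
    then show ?thesis unfolding e[symmetric] by simp
  qed
  ultimately show "(LINT s:{p<..<q}|lebesgue. (s - x) * (s - x)) \<noteq> 0"
    by (subst c) (auto intro!: continuous_intros)
  show "(LINT s:{p<..<q}|lebesgue. (1::real) * 1) \<noteq> 0"
    by (subst c) (use assms in \<open>auto intro!: continuous_intros\<close>)
  have "integral {p..q} (\<lambda>s. 1 * (s - (p + q) / 2)) = (q - (p + q) / 2) ^ 2 / 2 - (p - (p + q) / 2) ^ 2 / 2"
    by (rule ftc[of "\<lambda>s. (s - (p + q) / 2) ^ 2 / 2"]) (auto intro!: derivative_eq_intros)
  also have "\<dots> = 0" by (simp add: power2_eq_square field_simps)
  finally show "(LINT s:{p<..<q}|lebesgue. 1 * (s - (p + q) / 2)) = 0"
    by (subst c) (auto intro!: continuous_intros)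
qed

lemma AE_locally:
  assumes "\<And>x. x \<in> U \<Longrightarrow> \<exists>p q. p < x \<and> x < q \<and> (AE y in lebesgue. y \<in> {p<..<q} \<longrightarrow> P y)"
  shows "AE y in lebesgue. y \<in> U \<longrightarrow> P (y::real)"
proof -
  define F where "F = {{p<..<q} | p q. AE y in lebesgue. y \<in> {p<..<q} \<longrightarrow> P y}"
  have F: "open A" if "A \<in> F" for A using that by (auto simp: F_def)
  obtain F' where F': "F' \<subseteq> F" "countable F'" "\<Union>F' = \<Union>F"
    using Lindelof[of F] F by blast
  have "AE y in lebesgue. \<forall>A\<in>F'. y \<in> A \<longrightarrow> P y"
  proof (subst AE_ball_countable[OF F'(2)], intro ballI)
    fix A assume "A \<in> F'"
    then have "A \<in> F" using F' by blast
    then show "AE y in lebesgue. y \<in> A \<longrightarrow> P y" unfolding F_def by blast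
  qed
  moreover have "U \<subseteq> \<Union>F'"
  proof
    fix x assume "x \<in> U"
    then obtain p q where "p < x" "x < q" "AE y in lebesgue. y \<in> {p<..<q} \<longrightarrow> P y" using assms by blast
    then have "x \<in> {p<..<q}" "{p<..<q} \<in> F" unfolding F_def by auto
    then show "x \<in> \<Union>F'" unfolding F'(3) by blast
  qed
  ultimately show ?thesis
    by (elim eventually_mono) blast
qed

lemma continuous_loc_integrable:
  assumes "continuous_on U (h :: real \<Rightarrow> real)"
  shows "loc_integrable_on U h"
  unfolding loc_integrable_on_def
proof (intro allI impI)
  fix C assume C: "compact C \<and> C \<subseteq> U"
  then have "integrable lborel (\<lambda>x. indicator C x *\<^sub>R h x)"
    using continuous_on_subset[OF assms] by (intro borel_integrable_compact) auto
  then show "set_integrable lebesgue C h"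
    unfolding set_integrable_def by (subst integrable_completion) auto
qed

text \<open>The open set may have infinitely many components, so no summation over them is made: the
  product of G and the test function, extended by 0, is differentiable on the whole line, because it
  is 0 off the compact support.\<close>

lemma weak_deriv_C1:
  assumes U: "open U" "U \<subseteq> {-2<..<2}" and d: "\<And>x. x \<in> U \<Longrightarrow> (G has_real_derivative G1 x) (at x)"
    and c: "continuous_on U G1"
  shows "weak_deriv U G G1"
  unfolding weak_deriv_def
proof (intro conjI allI impI)
  have "continuous_on U G"
    by (rule DERIV_continuous_on) (rule has_field_derivative_at_within[OF d])
  then show lG: "loc_integrable_on U G" by (rule continuous_loc_integrable)
  show lG1: "loc_integrable_on U G1" by (rule continuous_loc_integrable[OF c])
  fix \<phi> assume \<phi>: "test_fun U \<phi>"
  obtain C where C: "compact C" "C \<subseteq> U" "\<forall>x. x \<notin> C \<longrightarrow> \<phi> x = 0" using \<phi> by (auto simp: test_fun_def)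
  define h where "h x = (if x \<in> U then G x * \<phi> x else 0)" for x
  define h' where "h' x = (if x \<in> U then G x * deriv \<phi> x + G1 x * \<phi> x else 0)" for x
  have D: "(h has_real_derivative h' x) (at x)" for x
  proof (cases "x \<in> U")
    case True
    have "((\<lambda>x. G x * \<phi> x) has_real_derivative G1 x * \<phi> x + deriv \<phi> x * G x) (at x)"
      by (rule DERIV_mult[OF d[OF True] smooth_has_deriv[OF test_fun_smooth[OF \<phi>]]])
    then have "(h has_real_derivative G1 x * \<phi> x + deriv \<phi> x * G x) (at x)"
      by (rule has_field_derivative_transform_within_open[OF _ U(1) True]) (simp add: h_def)
    then show ?thesis using True by (simp add: h'_def algebra_simps)
  next
    case False
    then have x: "x \<in> - C" using C by blast
    have "(h has_real_derivative 0) (at x)"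
      by (rule has_field_derivative_transform_within_open[where f = "\<lambda>_. 0" and S = "- C"])
        (use x C compact_imp_closed[OF C(1)] in \<open>auto simp: h_def\<close>)
    then show ?thesis using False by (simp add: h'_def)
  qed
  have i: "set_integrable lebesgue U (\<lambda>x. G x * deriv \<phi> x)" "set_integrable lebesgue U (\<lambda>x. G1 x * \<phi> x)"
    by (rule set_integrable_mult_test_fun[OF lG test_fun_deriv[OF \<phi>]], rule set_integrable_mult_test_fun[OF lG1 \<phi>])
  have s: "set_integrable lebesgue U (\<lambda>x. G x * deriv \<phi> x + G1 x * \<phi> x)"
    by (rule set_integral_add(1)[OF i])
  have e: "indicator U x *\<^sub>R (G x * deriv \<phi> x + G1 x * \<phi> x) = indicator {-2..2} x *\<^sub>R h' x" for x
    using U(2) by (auto simp: h'_def indicator_def)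
  have AI: "AI h'" using s unfolding set_integrable_def e .
  have "(LINT x:U|lebesgue. G x * deriv \<phi> x + G1 x * \<phi> x) = (LINT x:{-2..2}|lebesgue. h' x)"
    unfolding set_lebesgue_integral_def e ..
  also have "\<dots> = prim h' 2" unfolding prim_def by (rule LINT_Icc[OF AI])
  also have "\<dots> = h 2 - h (-2)" by (rule prim_deriv[OF D]) simp
  also have "\<dots> = 0"
  proof -
    have "2 \<notin> U" "-2 \<notin> U" using U(2) by auto
    then show ?thesis by (simp add: h_def)
  qed
  finally show "(LINT x:U|lebesgue. G x * deriv \<phi> x) = - (LINT x:U|lebesgue. G1 x * \<phi> x)"
    using set_integral_add(2)[OF i] by simp
qed

lemma weak_deriv_affine:
  assumes "U \<subseteq> {-2<..<2}" "open U"
  shows "weak_deriv U (\<lambda>s. a + b * s) (\<lambda>_. b)"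
  by (rule weak_deriv_C1[OF assms(2,1)]) (auto intro!: derivative_eq_intros)

lemma affine_AE_unique:
  assumes "p < q" "AE y in lebesgue. y \<in> {p<..<q} \<longrightarrow> a + b * y = a' + b' * (y::real)"
  shows "a = a' \<and> b = b'"
proof -
  have ev: "\<exists>y\<in>{p'<..<q'}. a + b * y = a' + b' * y" if "p \<le> p'" "p' < q'" "q' \<le> q" for p' q'
  proof (rule ccontr)
    assume n: "\<not> ?thesis"
    have "AE y in lebesgue. y \<notin> {p'<..<q'}"
      using assms(2) by eventually_elim (use n that in auto)
    then show False using Ioo_not_AE_empty[OF that(2)] by blast
  qed
  define m where "m = (p + q) / 2"
  have m: "p < m" "m < q" using assms(1) by (auto simp: m_def)
  obtain y where y: "p < y" "y < m" "a + b * y = a' + b' * y" using ev[of p m] m by auto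
  obtain z where z: "m < z" "z < q" "a + b * z = a' + b' * z" using ev[of m q] m by auto
  have "(b - b') * (z - y) = 0" using y(3) z(3) by (simp add: algebra_simps)
  then have "b = b'" using y z by simp
  then show ?thesis using y by simp
qed

section \<open>Two-sided variations and the traces they determine\<close>

context obstacle
begin

lemma jfree_minus: "jfree x a b \<Longrightarrow> jfree x (- a) (- b)"
  by (auto simp: jfree_def)

lemma AI_L2_mult: "L2_on {-2<..<2} h \<Longrightarrow> L2_on {-2<..<2} \<theta> \<Longrightarrow> AI (\<lambda>s. h s * \<theta> s)"
  using L2_on_mult[of "{-2<..<2}" h \<theta>] by (simp add: absolutely_integrable_on_Icc_iff_Ioo)

text \<open>Both \<open>\<theta>\<close> and its negative are tested. The admissibility hypothesis
  covers every \<theta>' whose first moment is that of \<open>\<theta>\<close> up to sign, so it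
  applies to both at once.\<close>

lemma variation_eq_gen:
  assumes x: "-1 \<le> p" "p \<le> x" "x \<le> q" "q \<le> 1" and \<theta>: "L2_on {-2<..<2} \<theta>"
    and z: "\<And>y. y \<notin> {p<..<q} \<Longrightarrow> \<theta> y = 0"
    and j: "jfree x (integral {-2..2} (\<lambda>s. (s - x) * \<theta> s)) (- prim \<theta> 2)"
    and adm: "\<And>\<theta>'. L2_on {-2<..<2} \<theta>' \<Longrightarrow> (\<And>y. y \<notin> {p<..<q} \<Longrightarrow> \<theta>' y = 0) \<Longrightarrow>
      integral {-2..2} (\<lambda>s. (s - x) * \<theta>' s) = integral {-2..2} (\<lambda>s. (s - x) * \<theta> s) \<or>
      integral {-2..2} (\<lambda>s. (s - x) * \<theta>' s) = - integral {-2..2} (\<lambda>s. (s - x) * \<theta> s) \<Longrightarrow>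
      \<exists>t0>0. \<forall>t. 0 < t \<and> t < t0 \<longrightarrow> (AE y in lebesgue. y \<in> {p<..<q} \<longrightarrow> w y \<le> u0 y + t * tp x \<theta>' y)"
  shows "integral {-2..2} (\<lambda>s. gx x s * \<theta> s) = 0"
proof (rule antisym)
  obtain t0 where t0: "t0 > 0" "\<And>t. 0 < t \<and> t < t0 \<longrightarrow> (AE y in lebesgue. y \<in> {p<..<q} \<longrightarrow> w y \<le> u0 y + t * tp x \<theta> y)"
    using adm[OF \<theta> z] by blast
  show "0 \<le> integral {-2..2} (\<lambda>s. gx x s * \<theta> s)"
    by (rule tp_variation[OF x \<theta> z j t0(1)]) (use t0(2) in auto)
  let ?m = "\<lambda>s. - \<theta> s"
  have m: "L2_on {-2<..<2} ?m" using L2_on_linear[OF \<theta> \<theta>, of "-1" 0] by simp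
  have zm: "\<And>y. y \<notin> {p<..<q} \<Longrightarrow> ?m y = 0" using z by simp
  have im: "integral {-2..2} (\<lambda>s. (s - x) * ?m s) = - integral {-2..2} (\<lambda>s. (s - x) * \<theta> s)" by simp
  have pm: "prim ?m 2 = - prim \<theta> 2" by (simp add: prim_def)
  obtain t1 where t1: "t1 > 0" "\<And>t. 0 < t \<and> t < t1 \<longrightarrow> (AE y in lebesgue. y \<in> {p<..<q} \<longrightarrow> w y \<le> u0 y + t * tp x ?m y)"
    using adm[OF m zm] im by blast
  have "0 \<le> integral {-2..2} (\<lambda>s. gx x s * ?m s)"
    by (rule tp_variation[OF x m zm _ t1(1)]) (use t1(2) jfree_minus[OF j] im pm in auto)
  then show "integral {-2..2} (\<lambda>s. gx x s * \<theta> s) \<le> 0" by simp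
qed

text \<open>Over a gap of height c any bounded competitor is admissible for small t, whatever its
  sign.\<close>

lemma variation_eq:
  assumes x: "-1 \<le> p" "p \<le> x" "x \<le> q" "q \<le> 1" and \<theta>: "L2_on {-2<..<2} \<theta>"
    and z: "\<And>y. y \<notin> {p<..<q} \<Longrightarrow> \<theta> y = 0"
    and j: "jfree x (integral {-2..2} (\<lambda>s. (s - x) * \<theta> s)) (- prim \<theta> 2)"
    and c: "c > 0" "AE y in lebesgue. y \<in> {p<..<q} \<longrightarrow> w y + c \<le> u0 y"
  shows "integral {-2..2} (\<lambda>s. gx x s * \<theta> s) = 0"
proof (rule variation_eq_gen[OF x \<theta> z j])
  fix \<theta>' assume \<theta>': "L2_on {-2<..<2} \<theta>'"
  have x2: "x \<in> {-2<..<2}" using x by auto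
  obtain B where B: "\<forall>y\<in>{-2..2}. \<bar>tp x \<theta>' y\<bar> \<le> B" using rep_bounded(1)[OF tp_rep[OF x2 \<theta>']] by blast
  then have B0: "0 \<le> B" using abs_ge_zero[of "tp x \<theta>' 0"] by (force intro: order_trans)
  show "\<exists>t0>0. \<forall>t. 0 < t \<and> t < t0 \<longrightarrow> (AE y in lebesgue. y \<in> {p<..<q} \<longrightarrow> w y \<le> u0 y + t * tp x \<theta>' y)"
  proof (intro exI conjI allI impI)
    show "c / (B + 1) > 0" using c B0 by simp
    fix t assume t: "0 < t \<and> t < c / (B + 1)"
    then have tB: "t * (B + 1) < c" using B0 by (simp add: pos_less_divide_eq)
    show "AE y in lebesgue. y \<in> {p<..<q} \<longrightarrow> w y \<le> u0 y + t * tp x \<theta>' y"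
      using c(2)
    proof eventually_elim
      case (elim y)
      show ?case
      proof
        assume y: "y \<in> {p<..<q}"
        then have "\<bar>tp x \<theta>' y\<bar> \<le> B" using B x by auto
        then have "t * \<bar>tp x \<theta>' y\<bar> \<le> t * B" using t by simp
        moreover have "\<bar>t * tp x \<theta>' y\<bar> = t * \<bar>tp x \<theta>' y\<bar>" using t by (simp add: abs_mult)
        moreover have "t * B + t < c" using tB by (simp add: distrib_left)
        moreover have "w y + c \<le> u0 y" using elim y by blast
        moreover have "0 < t" using t by blast
        ultimately show "w y \<le> u0 y + t * tp x \<theta>' y" by linarith
      qed
    qed
  qed
qed

text \<open>At an end point in contact there is no gap, only linear growth of u - w. A competitor
  whose value does not jump at x vanishes there and is Lipschitz, so t times it stays below c |y -
  x| for small t.\<close>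

lemma variation_eq_end:
  assumes x: "-1 \<le> p" "p \<le> x" "x \<le> q" "q \<le> 1" and xpq: "x = p \<or> x = q" and \<theta>: "L2_on {-2<..<2} \<theta>"
    and z: "\<And>y. y \<notin> {p<..<q} \<Longrightarrow> \<theta> y = 0"
    and j0: "integral {-2..2} (\<lambda>s. (s - x) * \<theta> s) = 0" and J: "J0 x \<noteq> 0 \<or> J1 x \<noteq> 0"
    and c: "c > 0" "AE y in lebesgue. y \<in> {p<..<q} \<longrightarrow> w y + c * \<bar>y - x\<bar> \<le> u0 y"
  shows "integral {-2..2} (\<lambda>s. gx x s * \<theta> s) = 0"
proof (rule variation_eq_gen[OF x \<theta> z])
  show "jfree x (integral {-2..2} (\<lambda>s. (s - x) * \<theta> s)) (- prim \<theta> 2)" using j0 J by (simp add: jfree_def)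
  fix \<theta>' assume \<theta>': "L2_on {-2<..<2} \<theta>'" and z': "\<And>y. y \<notin> {p<..<q} \<Longrightarrow> \<theta>' y = 0"
    and "integral {-2..2} (\<lambda>s. (s - x) * \<theta>' s) = integral {-2..2} (\<lambda>s. (s - x) * \<theta> s) \<or>
      integral {-2..2} (\<lambda>s. (s - x) * \<theta>' s) = - integral {-2..2} (\<lambda>s. (s - x) * \<theta> s)"
  then have "integral {-2..2} (\<lambda>s. (s - x) * \<theta>' s) = 0" using j0 by auto
  have x2: "x \<in> {-2<..<2}" using x by auto
  have e: "prim (tp1 x \<theta>') 2 = 0"
    using tp_jump(1)[OF x2 \<theta>'] \<open>integral {-2..2} (\<lambda>s. (s - x) * \<theta>' s) = 0\<close> by simp
  note A1 = AI_tp1[OF x2 \<theta>']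
  \<comment> \<open>Since x is an end of the support interval, \<open>tp1\<close> vanishes on one
    side of x; its primitive at x is either 0 or the total integral, which is 0 as well.\<close>
  have px: "prim (tp1 x \<theta>') x = 0"
    using xpq
  proof
    assume "x = p"
    then show ?thesis
      by (intro prim_eq_0) (use tp_support(1)[OF x2 \<theta>' _ x(2,3) _ z'] x in auto)
  next
    assume "x = q"
    then show ?thesis
      using prim_eq_end[OF A1, of x] tp_support(2)[OF x2 \<theta>' _ x(2,3) _ z'] x e by auto
  qed
  obtain B where B: "\<forall>y\<in>{-2..2}. \<bar>tp1 x \<theta>' y\<bar> \<le> B" using rep_bounded(2)[OF tp_rep[OF x2 \<theta>']] by blast
  then have B0: "0 \<le> B" using abs_ge_zero[of "tp1 x \<theta>' 0"] by (force intro: order_trans)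
  show "\<exists>t0>0. \<forall>t. 0 < t \<and> t < t0 \<longrightarrow> (AE y in lebesgue. y \<in> {p<..<q} \<longrightarrow> w y \<le> u0 y + t * tp x \<theta>' y)"
  proof (intro exI conjI allI impI)
    show "c / (B + 1) > 0" using c B0 by simp
    fix t assume t: "0 < t \<and> t < c / (B + 1)"
    then have tB: "t * (B + 1) < c" using B0 by (simp add: pos_less_divide_eq)
    show "AE y in lebesgue. y \<in> {p<..<q} \<longrightarrow> w y \<le> u0 y + t * tp x \<theta>' y"
      using c(2)
    proof eventually_elim
      case (elim y)
      show ?case
      proof
        assume y: "y \<in> {p<..<q}"
        have "tp x \<theta>' y = prim (tp1 x \<theta>') y - prim (tp1 x \<theta>') x" by (simp add: tp_def e px)
        then have "\<bar>tp x \<theta>' y\<bar> \<le> B * \<bar>y - x\<bar>"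
          using prim_lipschitz[OF A1 B, of x y] x y by auto
        then have "t * \<bar>tp x \<theta>' y\<bar> \<le> t * (B * \<bar>y - x\<bar>)" using t by (intro mult_left_mono) auto
        also have "\<dots> \<le> c * \<bar>y - x\<bar>"
        proof -
          have "t * B \<le> c" using tB t by (simp add: algebra_simps)
          then show ?thesis using mult_right_mono[of "t * B" c "\<bar>y - x\<bar>"] by (simp add: mult.assoc)
        qed
        finally have "t * \<bar>tp x \<theta>' y\<bar> \<le> c * \<bar>y - x\<bar>" .
        moreover have "\<bar>t * tp x \<theta>' y\<bar> = t * \<bar>tp x \<theta>' y\<bar>" using t by (simp add: abs_mult)
        ultimately show "w y \<le> u0 y + t * tp x \<theta>' y" using elim y by linarith
      qed
    qed
  qed
qed

lemma LINT_gx: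
  assumes "-1 \<le> p" "q \<le> 1" "L2_on {-2<..<2} \<theta>" "\<And>y. y \<notin> {p<..<q} \<Longrightarrow> \<theta> y = 0" "L2_on {-2<..<2} h"
  shows "(LINT s:{p<..<q}|lebesgue. h s * \<theta> s) = integral {-2..2} (\<lambda>s. h s * \<theta> s)"
  by (rule LINT_supported[OF _ _ AI_L2_mult[OF assms(5,3)]]) (use assms in auto)

lemma L2_shift: "L2_on {-2<..<2} (\<lambda>s. s - (x::real))"
  by (intro L2_cont continuous_intros) auto

text \<open>Only the first moment constrains \<theta>, and the functions orthogonal to all such
  \<theta> are the multiples of s - x. The slope b stays undetermined: it will be the common value
  of \<open>u'''\<close> on both sides, up to the factor \<eta>.\<close>

lemma gx_linear:
  assumes x: "-1 \<le> p" "p \<le> x" "x \<le> q" "q \<le> 1" "p < q"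
    and van: "\<And>\<theta>. L2_on {-2<..<2} \<theta> \<Longrightarrow> (\<And>y. y \<notin> {p<..<q} \<Longrightarrow> \<theta> y = 0) \<Longrightarrow>
      integral {-2..2} (\<lambda>s. (s - x) * \<theta> s) = 0 \<Longrightarrow> integral {-2..2} (\<lambda>s. gx x s * \<theta> s) = 0"
  shows "\<exists>b. AE s in lebesgue. s \<in> {p<..<q} \<longrightarrow> gx x s = b * (s - x)"
proof -
  have sub: "{p<..<q} \<subseteq> {-2<..<2}" using x by auto
  have m: "{p<..<q} \<in> sets lebesgue" by simp
  have "\<exists>a b. AE s in lebesgue. s \<in> {p<..<q} \<longrightarrow> gx x s = a * (s - x) + b * (\<lambda>_. 0) s"
  proof (rule projection_AE)
    fix \<theta> assume \<theta>: "L2_on {-2<..<2} \<theta>" "\<And>y. y \<notin> {p<..<q} \<Longrightarrow> \<theta> y = 0"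
      "(LINT s:{p<..<q}|lebesgue. (s - x) * \<theta> s) = 0"
    show "(LINT s:{p<..<q}|lebesgue. gx x s * \<theta> s) = 0"
      using van[OF \<theta>(1,2)] \<theta>(3) LINT_gx[OF x(1,4) \<theta>(1,2) L2_gx] LINT_gx[OF x(1,4) \<theta>(1,2) L2_shift] by simp
  qed (use x LINT_shift_square(1)[OF x(5)] L2_on_subset[OF L2_gx sub m] L2_on_subset[OF L2_shift sub m] L2_on_const
    in auto)
  then show ?thesis by simp
qed

lemma gx_slope:
  assumes "-1 \<le> p" "p \<le> x" "x \<le> q" "q \<le> 1" "p < q" "J0 x \<noteq> 0 \<or> J1 x \<noteq> 0"
    and c: "c > 0" "AE y in lebesgue. y \<in> {p<..<q} \<longrightarrow> w y + c \<le> u0 y"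
  shows "\<exists>b. AE s in lebesgue. s \<in> {p<..<q} \<longrightarrow> gx x s = b * (s - x)"
  by (rule gx_linear[OF assms(1-5)], rule variation_eq[OF assms(1-4) _ _ _ c])
    (use assms(6) in \<open>auto simp: jfree_def\<close>)

lemma gx_slope_end:
  assumes "-1 \<le> p" "p \<le> x" "x \<le> q" "q \<le> 1" "p < q" "x = p \<or> x = q" "J0 x \<noteq> 0 \<or> J1 x \<noteq> 0"
    and c: "c > 0" "AE y in lebesgue. y \<in> {p<..<q} \<longrightarrow> w y + c * \<bar>y - x\<bar> \<le> u0 y"
  shows "\<exists>b. AE s in lebesgue. s \<in> {p<..<q} \<longrightarrow> gx x s = b * (s - x)"
  by (rule gx_linear[OF assms(1-5)], rule variation_eq_end[OF assms(1-4,6) _ _ _ assms(7) c])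

text \<open>No constraint remains, so \<open>gx\<close> is orthogonal to itself. The conclusion is
  written with slope 0 to match the hypothesis of \<open>gx_linear_traces\<close>.\<close>

lemma gx_free:
  assumes x: "-1 \<le> p" "p \<le> x" "x \<le> q" "q \<le> 1" "p < q"
    and J: "J0 x \<noteq> 0 \<or> \<alpha> = \<beta> \<and> (J0 x \<noteq> 0 \<or> J1 x \<noteq> 0)"
    and c: "c > 0" "AE y in lebesgue. y \<in> {p<..<q} \<longrightarrow> w y + c \<le> u0 y"
  shows "AE s in lebesgue. s \<in> {p<..<q} \<longrightarrow> gx x s = 0 * (s - x)"
proof -
  have sub: "{p<..<q} \<subseteq> {-2<..<2}" using x by auto
  have m: "{p<..<q} \<in> sets lebesgue" by simp
  have "\<exists>a b. AE s in lebesgue. s \<in> {p<..<q} \<longrightarrow> gx x s = a * (\<lambda>_. 0) s + b * (\<lambda>_. 0) s"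
  proof (rule projection_AE)
    fix \<theta> assume \<theta>: "L2_on {-2<..<2} \<theta>" "\<And>y. y \<notin> {p<..<q} \<Longrightarrow> \<theta> y = 0"
    have "jfree x (integral {-2..2} (\<lambda>s. (s - x) * \<theta> s)) (- prim \<theta> 2)" using J unfolding jfree_def by blast
    from variation_eq[OF x(1-4) \<theta> this c]
    show "(LINT s:{p<..<q}|lebesgue. gx x s * \<theta> s) = 0"
      using LINT_gx[OF x(1,4) \<theta> L2_gx] by simp
  qed (use x L2_on_subset[OF L2_gx sub m] L2_on_const in auto)
  then show ?thesis by simp
qed

text \<open>At a point where \<open>u\<close> may be regular no jump is free, so both the integral
  and the first moment of \<theta> must vanish, and what is orthogonal to all such \<theta> is
  affine. The base point is the midpoint for the sake of orthogonality.\<close>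

lemma g_affine:
  assumes x: "-1 \<le> p" "q \<le> 1" "p < q"
    and c: "c > 0" "AE y in lebesgue. y \<in> {p<..<q} \<longrightarrow> w y + c \<le> u0 y"
  shows "\<exists>a b. AE s in lebesgue. s \<in> {p<..<q} \<longrightarrow> g s = a + b * s"
proof -
  define m where "m = (p + q) / 2"
  have xm: "-1 \<le> p" "p \<le> m" "m \<le> q" "q \<le> 1" using x by (auto simp: m_def)
  have sub: "{p<..<q} \<subseteq> {-2<..<2}" using x by auto
  have ms: "{p<..<q} \<in> sets lebesgue" by simp
  have "\<exists>a b. AE s in lebesgue. s \<in> {p<..<q} \<longrightarrow> gx m s = a * (\<lambda>_. 1) s + b * (s - m)"
  proof (rule projection_AE)
    fix \<theta> assume \<theta>: "L2_on {-2<..<2} \<theta>" "\<And>y. y \<notin> {p<..<q} \<Longrightarrow> \<theta> y = 0"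
      and 0: "(LINT s:{p<..<q}|lebesgue. 1 * \<theta> s) = 0" "(LINT s:{p<..<q}|lebesgue. (s - m) * \<theta> s) = 0"
    have one: "L2_on {-2<..<2} (\<lambda>_. 1)" by (rule L2_on_const) simp
    have "integral {-2..2} (\<lambda>s. (s - m) * \<theta> s) = 0" "prim \<theta> 2 = 0"
      using 0 LINT_gx[OF x(1,2) \<theta> L2_shift] LINT_gx[OF x(1,2) \<theta> one] by (simp_all add: prim_def)
    then have "jfree m (integral {-2..2} (\<lambda>s. (s - m) * \<theta> s)) (- prim \<theta> 2)" by (simp add: jfree_def)
    from variation_eq[OF xm \<theta> this c]
    show "(LINT s:{p<..<q}|lebesgue. gx m s * \<theta> s) = 0"
      using LINT_gx[OF x(1,2) \<theta> L2_gx] by simp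
  next
    show "(LINT s:{p<..<q}|lebesgue. 1 * (s - m)) = 0" unfolding m_def by (rule LINT_shift_square(3)[OF x(3)])
    show "(LINT s:{p<..<q}|lebesgue. 1 * 1) \<noteq> (0::real) \<or> (\<lambda>_. 1) = (\<lambda>_. 0 :: real)"
      using LINT_shift_square(2)[OF x(3)] by blast
    show "(LINT s:{p<..<q}|lebesgue. (s - m) * (s - m)) \<noteq> 0 \<or> (\<lambda>s. s - m) = (\<lambda>_. 0)"
      using LINT_shift_square(1)[OF x(3)] by blast
  qed (use x L2_on_subset[OF L2_gx sub ms] L2_on_subset[OF L2_shift sub ms] L2_on_const in auto)
  then obtain a b where ab: "AE s in lebesgue. s \<in> {p<..<q} \<longrightarrow> gx m s = a * 1 + b * (s - m)" by blast
  have "AE s in lebesgue. s \<in> {p<..<q} \<longrightarrow> g s = (a - b * m + K2 m - K1 m * m) + (b + K1 m) * s"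
    using ab by eventually_elim (auto simp: gx_def algebra_simps)
  then show ?thesis by blast
qed

lemma u2_D2: "AE s in lebesgue. s \<in> {-2<..<2} \<longrightarrow> D2 u s = u2 s"
  by (rule prep_D(2)[OF u_prep])

text \<open>Solving for \<open>u''\<close> gives a continuous function \<open>R\<close> with
  continuous derivative \<open>R1\<close>. At x the subtracted Taylor polynomial cancels
  \<open>K2\<close> and \<open>K1\<close>, leaving 0 for \<open>u''\<close> and b / \<eta> for
  \<open>u'''\<close>.\<close>

lemma gx_linear_traces:
  assumes pq: "-2 < p" "p \<le> x" "x \<le> q" "q < 2"
    and b: "AE s in lebesgue. s \<in> {p<..<q} \<longrightarrow> gx x s = b * (s - x)"
  shows "x < q \<Longrightarrow> has_rtrace (D2 u) x 0 \<and> has_rtrace (D3 u) x (b / \<eta>)"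
    and "p < x \<Longrightarrow> has_ltrace (D2 u) x 0 \<and> has_ltrace (D3 u) x (b / \<eta>)"
proof -
  define R where "R s = (1 / \<eta>) * ((K2 x - (b + K1 x) * x) + (b + K1 x) * s) + (- 1 / \<eta>) * K2 s" for s
  define R1 where "R1 s = (1 / \<eta>) * (b + K1 x) + (- 1 / \<eta>) * K1 s" for s
  have sub: "{p<..<q} \<subseteq> {-2<..<2}" using pq by auto
  have R: "AE s in lebesgue. s \<in> {p<..<q} \<longrightarrow> R s = D2 u s"
    using b u2_D2
  proof eventually_elim
    case (elim s)
    show ?case
    proof
      assume s: "s \<in> {p<..<q}"
      then have "D2 u s = u2 s" using elim sub by blast
      have e: "\<eta> * u2 s = b * (s - x) + K2 x + K1 x * (s - x) - K2 s"
        using elim s by (simp add: gx_def g_def)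
      have "R s = (1 / \<eta>) * (b * (s - x) + K2 x + K1 x * (s - x) - K2 s)"
        by (simp add: R_def algebra_simps)
      also have "\<dots> = u2 s" unfolding e[symmetric] using pos(1) by simp
      finally show "R s = D2 u s" using \<open>D2 u s = u2 s\<close> by simp
    qed
  qed
  have wK2: "weak_deriv {p<..<q} K2 K1" unfolding K2_def by (rule weak_deriv_prim[OF AI_cont[OF K1_cont] sub])
  have wR: "weak_deriv {p<..<q} R R1"
    unfolding R_def[abs_def] R1_def[abs_def]
    by (rule weak_deriv_linear[OF weak_deriv_affine[OF sub open_greaterThanLessThan] wK2])
  have w: "weak_deriv {p<..<q} (D2 u) R1"
    by (rule weak_deriv_cong[OF wR R]) simp
  have "AE s in lebesgue. s \<in> {p<..<q} \<longrightarrow> D3 u s = R1 s"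
    by (rule ac_deriv_eq[OF open_greaterThanLessThan sub weak_deriv_imp_ac_part[OF w]])
  then have R1: "AE s in lebesgue. s \<in> {p<..<q} \<longrightarrow> R1 s = D3 u s" by eventually_elim simp
  have cR: "continuous_on {-2..2} R" "continuous_on {-2..2} R1"
    unfolding R_def[abs_def] R1_def[abs_def] by (intro continuous_intros K1_cont K2_cont)+
  have v: "R x = 0" "R1 x = b / \<eta>" using pos(1) by (simp_all add: R_def R1_def field_simps)
  show "x < q \<Longrightarrow> has_rtrace (D2 u) x 0 \<and> has_rtrace (D3 u) x (b / \<eta>)"
  proof -
    assume xq: "x < q"
    have "AE s in lebesgue. s \<in> {x<..<q} \<longrightarrow> R s = D2 u s" using R by eventually_elim (use pq in auto)
    moreover have "AE s in lebesgue. s \<in> {x<..<q} \<longrightarrow> R1 s = D3 u s" using R1 by eventually_elim (use pq in auto)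
    ultimately show ?thesis
      using has_rtraceI[OF xq _ cont_Icc_tendsto(1)[OF cR(1)]] has_rtraceI[OF xq _ cont_Icc_tendsto(1)[OF cR(2)]]
        v pq xq by auto
  qed
  show "p < x \<Longrightarrow> has_ltrace (D2 u) x 0 \<and> has_ltrace (D3 u) x (b / \<eta>)"
  proof -
    assume xq: "p < x"
    have "AE s in lebesgue. s \<in> {p<..<x} \<longrightarrow> R s = D2 u s" using R by eventually_elim (use pq in auto)
    moreover have "AE s in lebesgue. s \<in> {p<..<x} \<longrightarrow> R1 s = D3 u s" using R1 by eventually_elim (use pq in auto)
    ultimately show ?thesis
      using has_ltraceI[OF xq _ cont_Icc_tendsto(2)[OF cR(1)]] has_ltraceI[OF xq _ cont_Icc_tendsto(2)[OF cR(2)]]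
        v pq xq by auto
  qed
qed

section \<open>The gap off contact and the structure of the noncontact set\<close>

lemma u_traces:
  "-2 \<le> x \<Longrightarrow> x < 2 \<Longrightarrow> rtrace u x = u0 x + J0 x" "-2 < x \<Longrightarrow> x \<le> 2 \<Longrightarrow> ltrace u x = u0 x"
  "-2 \<le> x \<Longrightarrow> x < 2 \<Longrightarrow> w x \<le> u0 x + J0 x" "-2 < x \<Longrightarrow> x \<le> 2 \<Longrightarrow> w x \<le> u0 x"
  using prep_values(3,4)[OF u_prep] prep_ge[OF u_prep w_cont w_ge] by blast+

text \<open>Half of the gap at x survives on a right neighbourhood. The second inequality concerns
  the right trace at y and is inherited from points further right; both traces are needed to know
  that y is off contact.\<close>

lemma gap_right:
  assumes "-1 \<le> x" "x < 1" "w x < u0 x + J0 x"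
  shows "\<exists>q c. x < q \<and> q \<le> 1 \<and> c > 0 \<and> (\<forall>y\<in>{x<..<q}. w y + c \<le> u0 y \<and> w y < u0 y + J0 y)"
proof -
  define c where "c = (u0 x + J0 x - w x) / 2"
  have c: "c > 0" "c < u0 x + J0 x - w x" using assms by (auto simp: c_def)
  have "((\<lambda>y. u0 y - w y) \<longlongrightarrow> u0 x + J0 x - w x) (at_right x)"
    by (intro tendsto_diff rep_tendsto(1)[OF u_rep] cont_Icc_tendsto(1)[OF w_cont]) (use assms in auto)
  then have "\<forall>\<^sub>F y in at_right x. c < u0 y - w y" using c(2) by (rule order_tendstoD(1))
  then obtain q' where q': "q' > x" "\<forall>y>x. y < q' \<longrightarrow> c < u0 y - w y"
    unfolding eventually_at_right_field by blast
  define q where "q = min q' 1"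
  have q: "x < q" "q \<le> 1" "q \<le> q'" using q' assms by (auto simp: q_def)
  have "w y + c \<le> u0 y \<and> w y < u0 y + J0 y" if y: "y \<in> {x<..<q}" for y
  proof -
    have 1: "w z + c \<le> u0 z" if "z \<in> {x<..<q}" for z
    proof -
      have "c < u0 z - w z" using q'(2) that q(3) by auto
      then show ?thesis by simp
    qed
    have "w y + c \<le> u0 y + J0 y"
    proof (rule ess_right_le[of "\<lambda>y. w y + c" _ y u0 _ q])
      show "((\<lambda>y. w y + c) \<longlongrightarrow> w y + c) (at_right y)"
        by (intro tendsto_add tendsto_const cont_Icc_tendsto(1)[OF w_cont]) (use y q assms in auto)
      show "(u0 \<longlongrightarrow> u0 y + J0 y) (at_right y)" by (rule rep_tendsto(1)[OF u_rep]) (use y q assms in auto)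
      show "AE z in lebesgue. z \<in> {y<..<q} \<longrightarrow> w z + c \<le> u0 z"
        by (rule AE_I2) (use 1 y in auto)
    qed (use y in auto)
    then show ?thesis using 1[OF y] c(1) by linarith
  qed
  then show ?thesis using q c(1) by blast
qed

lemma gap_left:
  assumes "-1 < x" "x \<le> 1" "w x < u0 x"
  shows "\<exists>p c. -1 \<le> p \<and> p < x \<and> c > 0 \<and> (\<forall>y\<in>{p<..<x}. w y + c \<le> u0 y \<and> w y < u0 y + J0 y)"
proof -
  define c where "c = (u0 x - w x) / 2"
  have c: "c > 0" "c < u0 x - w x" using assms by (auto simp: c_def)
  have "((\<lambda>y. u0 y - w y) \<longlongrightarrow> u0 x - w x) (at_left x)"
    by (intro tendsto_diff rep_tendsto(2)[OF u_rep] cont_Icc_tendsto(2)[OF w_cont]) (use assms in auto)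
  then have "\<forall>\<^sub>F y in at_left x. c < u0 y - w y" using c(2) by (rule order_tendstoD(1))
  then obtain q' where q': "q' < x" "\<forall>y>q'. y < x \<longrightarrow> c < u0 y - w y"
    unfolding eventually_at_left_field by blast
  define q where "q = max q' (-1)"
  have q: "q < x" "-1 \<le> q" "q' \<le> q" using q' assms by (auto simp: q_def)
  have "w y + c \<le> u0 y \<and> w y < u0 y + J0 y" if y: "y \<in> {q<..<x}" for y
  proof -
    have 1: "w z + c \<le> u0 z" if "z \<in> {q<..<x}" for z
    proof -
      have "c < u0 z - w z" using q'(2) that q(3) by auto
      then show ?thesis by simp
    qed
    have "w y + c \<le> u0 y + J0 y"
    proof (rule ess_right_le[of "\<lambda>y. w y + c" _ y u0 _ x])
      show "((\<lambda>y. w y + c) \<longlongrightarrow> w y + c) (at_right y)"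
        by (intro tendsto_add tendsto_const cont_Icc_tendsto(1)[OF w_cont]) (use y q assms in auto)
      show "(u0 \<longlongrightarrow> u0 y + J0 y) (at_right y)" by (rule rep_tendsto(1)[OF u_rep]) (use y q assms in auto)
      show "AE z in lebesgue. z \<in> {y<..<x} \<longrightarrow> w z + c \<le> u0 z"
        by (rule AE_I2) (use 1 y in auto)
    qed (use y in auto)
    then show ?thesis using 1[OF y] c(1) by linarith
  qed
  then show ?thesis using q c(1) by blast
qed

lemma noncontact_iff:
  "x \<in> noncontact w u \<longleftrightarrow> -1 < x \<and> x < 1 \<and> w x < u0 x \<and> w x < u0 x + J0 x"
  unfolding noncontact_def using u_traces[of x] by auto

lemma gap_both:
  assumes "x \<in> noncontact w u"
  shows "\<exists>p q c. -1 \<le> p \<and> p < x \<and> x < q \<and> q \<le> 1 \<and> c > 0 \<and> {p<..<q} \<subseteq> noncontact w u \<and>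
    (AE y in lebesgue. y \<in> {p<..<q} \<longrightarrow> w y + c \<le> u0 y)"
proof -
  have x: "-1 < x" "x < 1" "w x < u0 x" "w x < u0 x + J0 x" using assms noncontact_iff by auto
  obtain q c where q: "x < q" "q \<le> 1" "c > 0" "\<forall>y\<in>{x<..<q}. w y + c \<le> u0 y \<and> w y < u0 y + J0 y"
    using gap_right[of x] x by auto
  obtain p d where p: "-1 \<le> p" "p < x" "d > 0" "\<forall>y\<in>{p<..<x}. w y + d \<le> u0 y \<and> w y < u0 y + J0 y"
    using gap_left[of x] x by auto
  have *: "w y + min c d \<le> u0 y \<and> w y < u0 y + J0 y" if "y \<in> {p<..<q}" "y \<noteq> x" for y
  proof (cases "x < y")
    case True
    then have "y \<in> {x<..<q}" using that by auto
    then have "w y + c \<le> u0 y \<and> w y < u0 y + J0 y" using q(4) by blast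
    then show ?thesis by linarith
  next
    case False
    then have "y \<in> {p<..<x}" using that by auto
    then have "w y + d \<le> u0 y \<and> w y < u0 y + J0 y" using p(4) by blast
    then show ?thesis by linarith
  qed
  have "{p<..<q} \<subseteq> noncontact w u"
  proof
    fix y assume y: "y \<in> {p<..<q}"
    show "y \<in> noncontact w u"
    proof (cases "y = x")
      case False
      have "w y < u0 y" "w y < u0 y + J0 y" using *[OF y False] p(3) q(3) by auto
      then show ?thesis using y p q by (simp add: noncontact_iff)
    qed (use assms in simp)
  qed
  moreover have "AE y in lebesgue. y \<in> {p<..<q} \<longrightarrow> w y + min c d \<le> u0 y"
  proof -
    have "AE y in lebesgue. y \<notin> {x}" by (rule AE_not_finite) simp
    then show ?thesis by eventually_elim (use * in auto)
  qed
  ultimately show ?thesis using p q by (intro exI[of _ p] exI[of _ q] exI[of _ "min c d"]) auto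
qed

lemma open_noncontact: "open (noncontact w u)"
proof (subst open_subopen, intro ballI)
  fix x assume "x \<in> noncontact w u"
  then obtain p q where "p < x" "x < q" "{p<..<q} \<subseteq> noncontact w u" using gap_both by blast
  then show "\<exists>T. open T \<and> x \<in> T \<and> T \<subseteq> noncontact w u" by (intro exI[of _ "{p<..<q}"]) auto
qed

text \<open>Around each point \<open>g\<close> is affine, and two affine representations agree
  wherever their intervals overlap, so the coefficients are locally constant functions of the point
  and the slope is constant on each component.\<close>

lemma noncontact_structure:
  "\<exists>b. weak_deriv (noncontact w u) g b \<and> weak_deriv (noncontact w u) b (\<lambda>_. 0) \<and>
    (\<forall>I\<in>components (noncontact w u). \<exists>c. \<forall>s\<in>I. b s = c)"
proof -
  let ?U = "noncontact w u"
  have U: "open ?U" "?U \<subseteq> {-2<..<2}" using open_noncontact by (auto simp: noncontact_def)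
  define Q where "Q x p q a b \<longleftrightarrow> p < x \<and> x < q \<and> {p<..<q} \<subseteq> ?U \<and>
      (AE s in lebesgue. s \<in> {p<..<q} \<longrightarrow> g s = a + b * s)" for x p q a b
  have "\<exists>p q a b. Q x p q a b" if x: "x \<in> ?U" for x
  proof -
    obtain p q c where pq: "-1 \<le> p" "p < x" "x < q" "q \<le> 1" "c > 0" "{p<..<q} \<subseteq> ?U"
      "AE y in lebesgue. y \<in> {p<..<q} \<longrightarrow> w y + c \<le> u0 y" using gap_both[OF x] by blast
    then have "p < q" by simp
    then obtain a b where "AE s in lebesgue. s \<in> {p<..<q} \<longrightarrow> g s = a + b * s"
      using g_affine[OF pq(1,4) _ pq(5,7)] by blast
    then have "Q x p q a b" unfolding Q_def using pq by blast
    then show ?thesis by blast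
  qed
  then have "\<forall>x. \<exists>p q a b. x \<in> ?U \<longrightarrow> Q x p q a b" by blast
  then obtain p q a b where Q: "\<And>x. x \<in> ?U \<Longrightarrow> Q x (p x) (q x) (a x) (b x)" by metis
  have P: "p x < x" "x < q x" "{p x<..<q x} \<subseteq> ?U" "AE s in lebesgue. s \<in> {p x<..<q x} \<longrightarrow> g s = a x + b x * s"
    if "x \<in> ?U" for x
    using Q[OF that] unfolding Q_def by blast+
  have loc: "a y = a x" "b y = b x" if x: "x \<in> ?U" and y: "y \<in> {p x<..<q x}" for x y
  proof -
    have yU: "y \<in> ?U" using P(3)[OF x] y by blast
    have "max (p x) (p y) < min (q x) (q y)" using y P(1,2)[OF yU] by auto
    moreover have "AE s in lebesgue. s \<in> {max (p x) (p y)<..<min (q x) (q y)} \<longrightarrow> a y + b y * s = a x + b x * s"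
      using P(4)[OF x] P(4)[OF yU] by eventually_elim auto
    ultimately have "a y = a x \<and> b y = b x" by (rule affine_AE_unique)
    then show "a y = a x" "b y = b x" by auto
  qed
  \<comment> \<open>The coefficients found at s are evaluated at s itself; being locally constant,
    they make this a differentiable representative of \<open>g\<close>.\<close>
  define G where "G s = a s + b s * s" for s
  have near: "open {p x<..<q x}" "x \<in> {p x<..<q x}" if "x \<in> ?U" for x using P(1,2)[OF that] by auto
  have dG: "(G has_real_derivative b x) (at x)" if x: "x \<in> ?U" for x
  proof (rule has_field_derivative_transform_within_open[OF _ near[OF x]])
    show "((\<lambda>s. a x + b x * s) has_real_derivative b x) (at x)" by (auto intro!: derivative_eq_intros)
  qed (simp add: G_def loc[OF x])
  have db: "(b has_real_derivative 0) (at x)" if x: "x \<in> ?U" for x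
  proof (rule has_field_derivative_transform_within_open[OF _ near[OF x]])
    show "((\<lambda>s. b x) has_real_derivative 0) (at x)" by simp
  qed (simp add: loc[OF x])
  have cb: "continuous_on ?U b"
    by (rule DERIV_continuous_on) (rule has_field_derivative_at_within[OF db])
  have w1: "weak_deriv ?U G b" by (rule weak_deriv_C1[OF U dG cb])
  have w2: "weak_deriv ?U b (\<lambda>_. 0)" by (rule weak_deriv_C1[OF U db]) auto
  have "AE s in lebesgue. s \<in> ?U \<longrightarrow> G s = g s"
  proof (rule AE_locally)
    fix x assume x: "x \<in> ?U"
    have "AE s in lebesgue. s \<in> {p x<..<q x} \<longrightarrow> G s = g s"
      using P(4)[OF x] by eventually_elim (auto simp: G_def loc[OF x])
    then show "\<exists>p q. p < x \<and> x < q \<and> (AE y in lebesgue. y \<in> {p<..<q} \<longrightarrow> G y = g y)"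
      using P(1,2)[OF x] by blast
  qed
  then have "weak_deriv ?U g b" by (rule weak_deriv_cong[OF w1]) simp
  moreover have "\<exists>c. \<forall>s\<in>I. b s = c" if I: "I \<in> components ?U" for I
  proof -
    have oI: "open I" and cI: "connected I" and sI: "I \<subseteq> ?U"
      using I open_components[OF U(1)] in_components_connected[of I ?U] in_components_subset[of I ?U] by blast+
    show ?thesis
    proof (rule DERIV_zero_connected_constant[OF cI oI])
      show "finite ({} :: real set)" by simp
      show "continuous_on I b" by (rule continuous_on_subset[OF cb sI])
      show "\<forall>x\<in>I - {}. (b has_real_derivative 0) (at x)" using db sI by blast
      show "\<exists>c. \<forall>s\<in>I. b s = c" if "\<And>x. x \<in> I \<Longrightarrow> b x = c" for c using that by blast
    qed
  qed
  ultimately show ?thesis using w2 by blast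
qed

text \<open>\<open>h1\<close> represents \<open>u'''\<close>. On one component it is a constant plus
  a multiple of the bounded function \<open>K1\<close>; the constants of different components are
  not compared, which is why square integrability is claimed on each component only.\<close>

lemma D2_noncontact:
  "\<exists>h1. weak_deriv (noncontact w u) (D2 u) h1 \<and> weak_deriv (noncontact w u) h1 (\<lambda>s. (- 1 / \<eta>) * k s) \<and>
    (\<forall>I\<in>components (noncontact w u). L2_on I h1)"
proof -
  let ?U = "noncontact w u"
  have U: "open ?U" "?U \<subseteq> {-2<..<2}" using open_noncontact by (auto simp: noncontact_def)
  obtain b where b: "weak_deriv ?U g b" "weak_deriv ?U b (\<lambda>_. 0)"
    "\<And>I. I \<in> components ?U \<Longrightarrow> \<exists>c. \<forall>s\<in>I. b s = c" using noncontact_structure by blast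
  have wK2: "weak_deriv ?U K2 K1" unfolding K2_def by (rule weak_deriv_prim[OF AI_cont[OF K1_cont] U(2)])
  have wK1: "weak_deriv ?U K1 k" unfolding K1_def by (rule weak_deriv_prim[OF AI_k U(2)])
  define h1 where "h1 s = (1 / \<eta>) * b s + (- 1 / \<eta>) * K1 s" for s
  have "weak_deriv ?U (\<lambda>s. (1 / \<eta>) * g s + (- 1 / \<eta>) * K2 s) h1"
    unfolding h1_def[abs_def] by (rule weak_deriv_linear[OF b(1) wK2])
  then have "weak_deriv ?U (D2 u) h1"
  proof (rule weak_deriv_cong)
    show "AE s in lebesgue. s \<in> ?U \<longrightarrow> (1 / \<eta>) * g s + (- 1 / \<eta>) * K2 s = D2 u s"
      using u2_D2 by eventually_elim (use U(2) pos(1) in \<open>auto simp: g_def field_simps\<close>)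
  qed simp
  moreover have "weak_deriv ?U h1 (\<lambda>s. (- 1 / \<eta>) * k s)"
    using weak_deriv_linear[OF b(2) wK1, of "1 / \<eta>" "- 1 / \<eta>"] by (simp add: h1_def[abs_def])
  moreover have "L2_on I h1" if I: "I \<in> components ?U" for I
  proof -
    have I': "open I" "I \<subseteq> {-2<..<2}" using I open_components[OF U(1)] in_components_subset U(2) by blast+
    obtain c where c: "\<forall>s\<in>I. b s = c" using b(3)[OF I] by blast
    have "L2_on I (\<lambda>s. (1 / \<eta>) * c + (- 1 / \<eta>) * K1 s)"
      by (intro L2_cont continuous_intros K1_cont I')
    then show ?thesis
      by (rule L2_on_cong) (use c in \<open>simp add: h1_def\<close>)
  qed
  ultimately show ?thesis by blast
qed

lemma H2_noncontact: "H2_on (noncontact w u) (D2 u)"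
proof -
  let ?U = "noncontact w u"
  have U: "open ?U" "?U \<subseteq> {-2<..<2}" using open_noncontact by (auto simp: noncontact_def)
  have Us: "?U \<in> sets lebesgue" using U(1) by auto
  have "L2_on ?U (D2 u)"
  proof (rule L2_on_cong[OF rep_L2(3)[OF u_rep U(2,1)]])
    show "AE s in lebesgue. s \<in> ?U \<longrightarrow> u2 s = D2 u s" using u2_D2 by eventually_elim (use U(2) in auto)
  qed
  moreover have "L2_on ?U (\<lambda>s. (- 1 / \<eta>) * k s)"
    using L2_on_linear[OF L2_on_subset[OF L2_k U(2) Us] L2_on_subset[OF L2_k U(2) Us], of "- 1 / \<eta>" 0] by simp
  ultimately show ?thesis unfolding H2_on_def using D2_noncontact by blast
qed

lemma noncontact_equation:
  assumes \<phi>: "test_fun (noncontact w u) \<phi>"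
  shows "(LINT x:noncontact w u|lebesgue. \<eta> * D2 u x * (deriv ^^ 2) \<phi> x + \<mu> * (u x - w x) * \<phi> x) =
    (LINT x:noncontact w u|lebesgue. f x / 2 * \<phi> x)"
proof -
  let ?U = "noncontact w u"
  have U: "open ?U" "?U \<subseteq> {-2<..<2}" "?U \<subseteq> {-1<..<1}" using open_noncontact by (auto simp: noncontact_def)
  obtain h1 where h1: "weak_deriv ?U (D2 u) h1" "weak_deriv ?U h1 (\<lambda>s. (- 1 / \<eta>) * k s)"
    using D2_noncontact by blast
  have eq: "(LINT x:?U|lebesgue. D2 u x * deriv (deriv \<phi>) x) = (LINT x:?U|lebesgue. (- 1 / \<eta>) * k x * \<phi> x)"
    using h1 \<phi> test_fun_deriv[OF \<phi>] by (simp add: weak_deriv_def)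
  have li: "loc_integrable_on ?U (D2 u)" using h1 by (simp add: weak_deriv_def)
  have lk: "loc_integrable_on ?U k" by (rule AI_loc_integrable[OF AI_k]) (use U in force)
  have fi: "loc_integrable_on ?U f"
    unfolding loc_integrable_on_def
  proof (intro allI impI)
    fix C assume C: "compact C \<and> C \<subseteq> ?U"
    have "f absolutely_integrable_on {-1<..<1}" by (rule L2_on_integrable[OF f]) simp
    then show "set_integrable lebesgue C f"
      by (rule set_integrable_subset) (use C U in \<open>auto simp: borel_compact\<close>)
  qed
  have 1: "set_integrable lebesgue ?U (\<lambda>x. \<eta> * (D2 u x * deriv (deriv \<phi>) x))"
    by (intro set_integrable_mult_right set_integrable_mult_test_fun[OF li] test_fun_deriv \<phi>)
  have 2: "set_integrable lebesgue ?U (\<lambda>x. k x * \<phi> x)" by (rule set_integrable_mult_test_fun[OF lk \<phi>])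
  have 3: "set_integrable lebesgue ?U (\<lambda>x. (1/2) * (f x * \<phi> x))"
    by (intro set_integrable_mult_right set_integrable_mult_test_fun[OF fi \<phi>])
  have "(LINT x:?U|lebesgue. \<eta> * D2 u x * (deriv ^^ 2) \<phi> x + \<mu> * (u x - w x) * \<phi> x) =
      (LINT x:?U|lebesgue. (\<eta> * (D2 u x * deriv (deriv \<phi>) x) + k x * \<phi> x) + (1/2) * (f x * \<phi> x))"
  proof (rule set_integral_cong_lebesgue)
    show "AE x in lebesgue. x \<in> ?U \<longrightarrow> \<eta> * D2 u x * (deriv ^^ 2) \<phi> x + \<mu> * (u x - w x) * \<phi> x =
        (\<eta> * (D2 u x * deriv (deriv \<phi>) x) + k x * \<phi> x) + (1/2) * (f x * \<phi> x)"
      using u_ae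
    proof eventually_elim
      case (elim x)
      show ?case
      proof
        assume x: "x \<in> ?U"
        then have "k x = \<mu> * (u x - w x) - f x / 2" using elim U by (auto simp: k_def)
        then show "\<eta> * D2 u x * (deriv ^^ 2) \<phi> x + \<mu> * (u x - w x) * \<phi> x =
            (\<eta> * (D2 u x * deriv (deriv \<phi>) x) + k x * \<phi> x) + (1/2) * (f x * \<phi> x)"
        proof -
          have "\<mu> * (u x - w x) = k x + f x / 2" using \<open>k x = \<mu> * (u x - w x) - f x / 2\<close> by simp
          then have "\<mu> * (u x - w x) * \<phi> x = (k x + f x / 2) * \<phi> x" by simp
          then show ?thesis by (simp add: numeral_2_eq_2 distrib_right)
        qed
      qed
    qed
  qed
  also have "\<dots> = (LINT x:?U|lebesgue. \<eta> * (D2 u x * deriv (deriv \<phi>) x)) + (LINT x:?U|lebesgue. k x * \<phi> x) +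
      (LINT x:?U|lebesgue. (1/2) * (f x * \<phi> x))"
    using set_integral_add(2)[OF set_integral_add(1)[OF 1 2] 3] set_integral_add(2)[OF 1 2] by simp
  also have "(LINT x:?U|lebesgue. \<eta> * (D2 u x * deriv (deriv \<phi>) x)) = - (LINT x:?U|lebesgue. k x * \<phi> x)"
  proof -
    have "(LINT x:?U|lebesgue. (- 1 / \<eta>) * k x * \<phi> x) = (LINT x:?U|lebesgue. (- 1 / \<eta>) * (k x * \<phi> x))"
      by (simp add: mult.assoc)
    also have "\<dots> = (- 1 / \<eta>) * (LINT x:?U|lebesgue. k x * \<phi> x)" by (rule set_integral_mult_right)
    finally show ?thesis unfolding set_integral_mult_right eq using pos(1) by simp
  qed
  also have "- (LINT x:?U|lebesgue. k x * \<phi> x) + (LINT x:?U|lebesgue. k x * \<phi> x) +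
      (LINT x:?U|lebesgue. (1/2) * (f x * \<phi> x)) = (LINT x:?U|lebesgue. f x / 2 * \<phi> x)"
    by (simp add: mult.commute mult.left_commute)
  finally show ?thesis .
qed

end

lemma mono_absolutely_integrable:
  fixes F :: "real \<Rightarrow> real"
  assumes "mono_on {a..b} F"
  shows "F absolutely_integrable_on {a..b}"
  using integrable_mono_on[OF assms] by (simp add: set_integrable_def integrable_restrict_space)

section \<open>Convexity and conditions at contact\<close>

lemma negligible_dense:
  assumes "negligible N" "a < (b::real)"
  shows "\<exists>d. a < d \<and> d < b \<and> d \<notin> N"
proof (rule ccontr)
  assume "\<not> ?thesis"
  then have "{a<..<b} \<subseteq> N" by auto
  then have "negligible {a<..<b}" using assms(1) negligible_subset by blast
  then show False using open_not_negligible[of "{a<..<b}"] assms(2) by auto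
qed

lemma L2_indicator:
  assumes "-2 \<le> a" "b \<le> 2"
  shows "L2_on {-2<..<2} (indicator {a..b} :: real \<Rightarrow> real)"
proof -
  have "{a..b} \<inter> {-2<..<2} \<in> lmeasurable"
    by (rule bounded_set_imp_lmeasurable) (auto intro: bounded_subset[OF bounded_closed_interval])
  then have "L2_on ({a..b} \<inter> {-2<..<2}) (\<lambda>_. 1)" by (rule L2_on_const)
  then have "L2_on {-2<..<2} (\<lambda>x. indicator ({a..b} \<inter> {-2<..<2}) x * 1)"
    by (rule L2_on_zero_extend) simp
  then show ?thesis by (rule L2_on_cong) (rule AE_I2, simp add: indicator_def)
qed

lemma convex_slopes:
  fixes g :: "real \<Rightarrow> real"
  assumes "a < b" "b < c" "0 \<le> (c - b) * g a - (c - a) * g b + (b - a) * g c"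
  shows "(g b - g a) / (b - a) \<le> (g c - g b) / (c - b)"
proof -
  have "(g b - g a) * (c - b) \<le> (g c - g b) * (b - a)"
    using assms(3) by (simp add: algebra_simps)
  then show ?thesis using assms(1,2) by (simp add: divide_le_eq pos_le_divide_eq mult.commute)
qed

text \<open>Convexity of an L2 class can only be asked of points outside a null set, and
  \<open>N\<close> is fixed so that all later choices of points can avoid it. The three-point
  inequality is written without denominators.\<close>

locale ae_convex =
  fixes g :: "real \<Rightarrow> real" and N :: "real set"
  assumes N: "negligible N"
    and conv: "\<And>a b c. -1 < a \<Longrightarrow> a < b \<Longrightarrow> b < c \<Longrightarrow> c < 1 \<Longrightarrow> a \<notin> N \<Longrightarrow> b \<notin> N \<Longrightarrow> c \<notin> N \<Longrightarrow>
      0 \<le> (c - b) * g a - (c - a) * g b + (b - a) * g c"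
begin

definition D :: "real set" where "D = {-1<..<1} - N"

definition sl :: "real \<Rightarrow> real \<Rightarrow> real" where "sl a b = (g b - g a) / (b - a)"

text \<open>Slopes of chords increase from left to right, so the supremum over the chords to the
  left of y is the left derivative at y of the convex function that \<open>g\<close>
  represents.\<close>

definition F :: "real \<Rightarrow> real" where "F y = Sup {sl a b | a b. a \<in> D \<and> b \<in> D \<and> a < b \<and> b \<le> y}"

lemma D_dense: "-1 \<le> a \<Longrightarrow> a < b \<Longrightarrow> b \<le> 1 \<Longrightarrow> \<exists>d\<in>D. a < d \<and> d < b"
  using negligible_dense[OF N, of a b] by (auto simp: D_def)

lemma sl_adj: "a \<in> D \<Longrightarrow> b \<in> D \<Longrightarrow> c \<in> D \<Longrightarrow> a < b \<Longrightarrow> b < c \<Longrightarrow> sl a b \<le> sl b c"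
  unfolding sl_def by (rule convex_slopes) (auto simp: D_def intro: conv)

lemma sl_mono:
  assumes "a \<in> D" "b \<in> D" "c \<in> D" "d \<in> D" "a < b" "b \<le> c" "c < d"
  shows "sl a b \<le> sl c d"
proof (cases "b = c")
  case True
  then show ?thesis using sl_adj[of a b d] assms by simp
next
  case False
  then have "sl a b \<le> sl b c" "sl b c \<le> sl c d"
    using sl_adj[of a b c] sl_adj[of b c d] assms by auto
  then show ?thesis by simp
qed

lemma F_le:
  assumes "-1 < y" "y \<le> c" "c \<in> D" "d \<in> D" "c < d"
  shows "F y \<le> sl c d"
  unfolding F_def
proof (rule cSup_least)
  obtain b where b: "b \<in> D" "-1 < b" "b < y" using D_dense[of "-1" y] assms by (auto simp: D_def)
  obtain a where a: "a \<in> D" "a < b" using D_dense[of "-1" b] b by (auto simp: D_def)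
  show "{sl a b | a b. a \<in> D \<and> b \<in> D \<and> a < b \<and> b \<le> y} \<noteq> {}" using a b by fastforce
  fix s assume "s \<in> {sl a b | a b. a \<in> D \<and> b \<in> D \<and> a < b \<and> b \<le> y}"
  then obtain a b where "s = sl a b" "a \<in> D" "b \<in> D" "a < b" "b \<le> y" by blast
  then show "s \<le> sl c d" using sl_mono[of a b c d] assms by simp
qed

lemma le_F:
  assumes "y < 1" "b \<le> y" "a \<in> D" "b \<in> D" "a < b"
  shows "sl a b \<le> F y"
  unfolding F_def
proof (rule cSup_upper)
  show "sl a b \<in> {sl a b | a b. a \<in> D \<and> b \<in> D \<and> a < b \<and> b \<le> y}" using assms by blast
  have y: "-1 < y" using assms by (auto simp: D_def)
  obtain c where c: "c \<in> D" "y < c" "c < 1" using D_dense[of y 1] assms y by (auto simp: D_def)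
  obtain d where d: "d \<in> D" "c < d" using D_dense[of c 1] c by (auto simp: D_def)
  show "bdd_above {sl a b | a b. a \<in> D \<and> b \<in> D \<and> a < b \<and> b \<le> y}"
  proof (rule bdd_aboveI)
    fix s assume "s \<in> {sl a b | a b. a \<in> D \<and> b \<in> D \<and> a < b \<and> b \<le> y}"
    then obtain a b where "s = sl a b" "a \<in> D" "b \<in> D" "a < b" "b \<le> y" by blast
    then show "s \<le> sl c d" using sl_mono[of a b c d] c d by simp
  qed
qed

lemma F_mono:
  assumes "-1 < x" "x \<le> y" "y < 1"
  shows "F x \<le> F y"
  unfolding F_def[of x]
proof (rule cSup_least)
  obtain b where b: "b \<in> D" "-1 < b" "b < x" using D_dense[of "-1" x] assms by (auto simp: D_def)
  obtain a where a: "a \<in> D" "a < b" using D_dense[of "-1" b] b by (auto simp: D_def)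
  show "{sl a b | a b. a \<in> D \<and> b \<in> D \<and> a < b \<and> b \<le> x} \<noteq> {}" using a b by fastforce
  fix s assume "s \<in> {sl a b | a b. a \<in> D \<and> b \<in> D \<and> a < b \<and> b \<le> x}"
  then obtain a b where "s = sl a b" "a \<in> D" "b \<in> D" "a < b" "b \<le> x" by blast
  then show "s \<le> F y" using le_F[of y b a] assms by simp
qed

lemma F_int: "-1 < a \<Longrightarrow> b < 1 \<Longrightarrow> F absolutely_integrable_on {a..b}"
  by (intro mono_absolutely_integrable mono_onI) (auto intro: F_mono)

lemma F_int': "-1 < a \<Longrightarrow> b < 1 \<Longrightarrow> F integrable_on {a..b}"
  using F_int set_lebesgue_integral_eq_integral(1) by blast

text \<open>The increment of \<open>g\<close> and the integral of \<open>F\<close> both lie between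
  F a (b - a) and F b (b - a), which bounds their difference for n = 0. The difference is additive,
  and splitting inside the middle third leaves each part at most 2/3 of the length. The midpoint
  itself might lie in \<open>N\<close>.\<close>

lemma defect_bound:
  assumes "a \<in> D" "b \<in> D" "a < b"
  shows "\<bar>g b - g a - integral {a..b} F\<bar> \<le> (2 / 3) ^ n * ((F b - F a) * (b - a))"
  using assms
proof (induction n arbitrary: a b)
  case 0
  have ab: "-1 < a" "a < 1" "-1 < b" "b < 1" using 0 by (auto simp: D_def)
  have "F a \<le> sl a b" by (rule F_le) (use 0 ab in auto)
  moreover have "sl a b \<le> F b" by (rule le_F) (use 0 ab in auto)
  ultimately have s: "F a * (b - a) \<le> g b - g a" "g b - g a \<le> F b * (b - a)"
    using 0 by (simp_all add: sl_def pos_le_divide_eq pos_divide_le_eq)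
  have i: "F integrable_on {a..b}" by (rule F_int'[OF ab(1,4)])
  have "integral {a..b} (\<lambda>_. F a) \<le> integral {a..b} F"
    by (rule integral_le) (use i ab in \<open>auto intro: F_mono\<close>)
  moreover have "integral {a..b} F \<le> integral {a..b} (\<lambda>_. F b)"
    by (rule integral_le) (use i ab in \<open>auto intro: F_mono\<close>)
  ultimately have "F a * (b - a) \<le> integral {a..b} F" "integral {a..b} F \<le> F b * (b - a)"
    using 0 by (simp_all add: mult.commute)
  then show ?case using s by (simp add: algebra_simps abs_le_iff)
next
  case (Suc n)
  have ab: "-1 < a" "a < 1" "-1 < b" "b < 1" using Suc.prems by (auto simp: D_def)
  obtain m where m: "m \<in> D" "(2 * a + b) / 3 < m" "m < (a + 2 * b) / 3"
    using D_dense[of "(2 * a + b) / 3" "(a + 2 * b) / 3"] Suc.prems ab by auto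
  have am: "a < m" "m < b" using m Suc.prems by (auto simp: field_simps)
  have F: "F a \<le> F m" "F m \<le> F b" using am ab by (auto intro!: F_mono)
  have "integral {a..m} F + integral {m..b} F = integral {a..b} F"
    by (rule Henstock_Kurzweil_Integration.integral_combine) (use am F_int'[OF ab(1,4)] in auto)
  then have "\<bar>g b - g a - integral {a..b} F\<bar> \<le>
      \<bar>g m - g a - integral {a..m} F\<bar> + \<bar>g b - g m - integral {m..b} F\<bar>" by linarith
  also have "\<dots> \<le> (2 / 3) ^ n * ((F m - F a) * (m - a)) + (2 / 3) ^ n * ((F b - F m) * (b - m))"
    by (intro add_mono Suc.IH Suc.prems m am)
  also have "\<dots> = (2 / 3) ^ n * ((F m - F a) * (m - a) + (F b - F m) * (b - m))" by (simp add: distrib_left)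
  also have "\<dots> \<le> (2 / 3) ^ n * ((F m - F a) * (2 / 3 * (b - a)) + (F b - F m) * (2 / 3 * (b - a)))"
    using F m by (intro mult_left_mono add_mono) (auto simp: field_simps)
  also have "(F m - F a) * (2 / 3 * (b - a)) + (F b - F m) * (2 / 3 * (b - a)) = 2 / 3 * ((F b - F a) * (b - a))"
  proof -
    have "X * (2 / 3 * E) + Y * (2 / 3 * E) = 2 / 3 * ((X + Y) * E)" for X Y E :: real
      by (simp add: field_simps)
    from this[of "F m - F a" "b - a" "F b - F m"] show ?thesis by simp
  qed
  also have "(2 / 3) ^ n * (2 / 3 * ((F b - F a) * (b - a))) = (2 / 3) ^ Suc n * ((F b - F a) * (b - a))"
    by simp
  finally show ?case .
qed

lemma g_eq_integral:
  assumes "a \<in> D" "b \<in> D" "a \<le> b"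
  shows "g b - g a = integral {a..b} F"
proof (cases "a = b")
  case False
  have "(\<lambda>n. (2 / 3) ^ n * ((F b - F a) * (b - a))) \<longlonglongrightarrow> 0 * ((F b - F a) * (b - a))"
    by (intro tendsto_mult tendsto_const LIMSEQ_realpow_zero) auto
  then have "\<bar>g b - g a - integral {a..b} F\<bar> \<le> 0"
    using defect_bound[OF assms(1,2)] False assms(3) by (intro LIMSEQ_le_const) auto
  then show ?thesis by simp
qed simp

text \<open>\<open>F\<close> may be unbounded near -1 and 1, so it is cut off to a compact
  subinterval before primitives starting at -2 are taken.\<close>

definition Fr :: "real \<Rightarrow> real \<Rightarrow> real \<Rightarrow> real"
  where "Fr c d t = indicator {c..d} t *\<^sub>R F t"

lemma AI_Fr:
  assumes "-1 < c" "d < 1"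
  shows "AI (Fr c d)"
proof -
  have "integrable lebesgue (\<lambda>t. indicator {c..d} t *\<^sub>R F t)"
    using F_int[OF assms] by (simp add: set_integrable_def)
  moreover have "(\<lambda>t. indicator {c..d} t *\<^sub>R F t) = (\<lambda>t. indicator {-2..2} t *\<^sub>R Fr c d t)"
    using assms by (auto simp: Fr_def indicator_def fun_eq_iff)
  ultimately show ?thesis unfolding set_integrable_def by simp
qed

lemma prim_Fr_diff:
  assumes "-1 < c" "d < 1" "c \<le> a" "a \<le> b" "b \<le> d"
  shows "prim (Fr c d) b - prim (Fr c d) a = integral {a..b} F"
proof -
  have "prim (Fr c d) b - prim (Fr c d) a = integral {a..b} (Fr c d)"
    by (rule prim_diff[OF AI_Fr[OF assms(1,2)]]) (use assms in auto)
  also have "\<dots> = integral {a..b} F"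
    by (rule Henstock_Kurzweil_Integration.integral_cong) (use assms in \<open>auto simp: Fr_def\<close>)
  finally show ?thesis .
qed

lemma g_local:
  assumes "-1 < c" "c < d" "d < 1"
  shows "\<exists>e. AE y in lebesgue. y \<in> {c<..<d} \<longrightarrow> g y = e + prim (Fr c d) y"
proof -
  obtain m where m: "m \<in> D" "c < m" "m < d" using D_dense[of c d] assms by auto
  have "g y = (g m - prim (Fr c d) m) + prim (Fr c d) y" if y: "y \<in> {c<..<d}" "y \<notin> N" for y
  proof -
    have yD: "y \<in> D" using y assms by (auto simp: D_def)
    show ?thesis
    proof (cases "m \<le> y")
      case True
      then show ?thesis using g_eq_integral[OF m(1) yD] prim_Fr_diff[of c d m y] m y assms by simp
    next
      case False
      then show ?thesis using g_eq_integral[OF yD m(1)] prim_Fr_diff[of c d y m] m y assms by simp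
    qed
  qed
  moreover have "AE y in lebesgue. y \<notin> N" using N by (intro AE_not_in) (simp add: negligible_iff_null_sets)
  ultimately have "AE y in lebesgue. y \<in> {c<..<d} \<longrightarrow> g y = (g m - prim (Fr c d) m) + prim (Fr c d) y"
    by (elim eventually_mono) blast
  then show ?thesis by blast
qed

text \<open>Chords on either side of y have slope b, and \<open>F y\<close> lies between such
  slopes.\<close>

lemma F_const:
  assumes "-1 \<le> p" "q \<le> 1" "AE s in lebesgue. s \<in> {p<..<q} \<longrightarrow> g s = a + b * s" "y \<in> {p<..<q}"
  shows "F y = b"
proof -
  have "p < q" using assms by auto
  obtain M where M: "negligible M" "\<forall>s. s \<notin> M \<longrightarrow> s \<in> {p<..<q} \<longrightarrow> g s = a + b * s"
    using AE_lebesgueD[OF assms(3)] by blast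
  have NM: "negligible (N \<union> M)" by (rule negligible_Un[OF N M(1)])
  have sl: "sl c d = b" if "c \<notin> N \<union> M" "d \<notin> N \<union> M" "c \<in> {p<..<q}" "d \<in> {p<..<q}" "c < d" for c d
  proof -
    have "g d - g c = b * (d - c)" using M(2) that by (simp add: algebra_simps)
    then show ?thesis using that by (simp add: sl_def)
  qed
  have inD: "c \<in> D" if "c \<notin> N \<union> M" "c \<in> {p<..<q}" for c using that assms by (auto simp: D_def)
  obtain c where c: "y < c" "c < q" "c \<notin> N \<union> M" using negligible_dense[OF NM, of y q] assms by auto
  obtain d where d: "c < d" "d < q" "d \<notin> N \<union> M" using negligible_dense[OF NM, of c q] c by auto
  obtain a2 where a2: "p < a2" "a2 < y" "a2 \<notin> N \<union> M" using negligible_dense[OF NM, of p y] assms by auto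
  obtain a1 where a1: "p < a1" "a1 < a2" "a1 \<notin> N \<union> M" using negligible_dense[OF NM, of p a2] a2 by auto
  have "F y \<le> sl c d" by (rule F_le) (use c d assms inD in auto)
  moreover have "sl a1 a2 \<le> F y" by (rule le_F) (use a1 a2 assms inD in auto)
  moreover have "sl c d = b" "sl a1 a2 = b" by (rule sl; use c d a1 a2 assms in auto)+
  ultimately show ?thesis by simp
qed

lemma weak_deriv_g:
  assumes "loc_integrable_on {-1<..<1} g"
  shows "weak_deriv {-1<..<1} g F"
  unfolding weak_deriv_def
proof (intro conjI allI impI assms)
  have rng: "\<exists>c d. -1 < c \<and> c < d \<and> d < 1 \<and> C \<subseteq> {c<..<d}" if C: "compact C" "C \<subseteq> {-1<..<1}" for C :: "real set"
  proof (cases "C = {}")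
    case False
    obtain a where a: "a \<in> C" "\<And>x. x \<in> C \<Longrightarrow> a \<le> x" using compact_attains_inf[OF C(1) False] by blast
    obtain b where b: "b \<in> C" "\<And>x. x \<in> C \<Longrightarrow> x \<le> b" using compact_attains_sup[OF C(1) False] by blast
    have ab: "-1 < a" "b < 1" "a \<le> b" using a b C by auto
    have "C \<subseteq> {(a - 1) / 2<..<(b + 1) / 2}"
    proof
      fix x assume "x \<in> C"
      then have "a \<le> x" "x \<le> b" using a b by auto
      then show "x \<in> {(a - 1) / 2<..<(b + 1) / 2}" using ab by auto
    qed
    then show ?thesis using ab by (intro exI[of _ "(a - 1) / 2"] exI[of _ "(b + 1) / 2"]) auto
  qed (intro exI[of _ 0] exI[of _ "1/2"], auto)
  show "loc_integrable_on {-1<..<1} F"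
    unfolding loc_integrable_on_def
  proof (intro allI impI)
    fix C :: "real set" assume C: "compact C \<and> C \<subseteq> {-1<..<1}"
    then obtain c d where cd: "-1 < c" "d < 1" "C \<subseteq> {c<..<d}" using rng[of C] by blast
    show "set_integrable lebesgue C F"
      by (rule set_integrable_subset[OF F_int[OF cd(1,2)]]) (use C cd in \<open>auto simp: borel_compact\<close>)
  qed
  fix \<phi> assume \<phi>: "test_fun {-1<..<1} \<phi>"
  then obtain C where C: "compact C" "C \<subseteq> {-1<..<1}" "\<forall>x. x \<notin> C \<longrightarrow> \<phi> x = 0" by (auto simp: test_fun_def)
  obtain c d where cd: "-1 < c" "c < d" "d < 1" "C \<subseteq> {c<..<d}" using rng[OF C(1,2)] by blast
  have \<phi>': "test_fun {c<..<d} \<phi>" using test_fun_smooth[OF \<phi>] C cd(4) unfolding test_fun_iff by blast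
  have sub: "{c<..<d} \<subseteq> {-2<..<2}" "{c<..<d} \<subseteq> {-1<..<1}" using cd by auto
  obtain e where e: "AE y in lebesgue. y \<in> {c<..<d} \<longrightarrow> g y = e + prim (Fr c d) y"
    using g_local[OF cd(1-3)] by blast
  have "weak_deriv {c<..<d} g (Fr c d)"
    by (rule weak_deriv_const_prim[OF AI_Fr[OF cd(1,3)] sub(1) e])
  then have "weak_deriv {c<..<d} g F"
    by (rule weak_deriv_cong) (auto simp: Fr_def)
  then have "(LINT x:{c<..<d}|lebesgue. g x * deriv \<phi> x) = - (LINT x:{c<..<d}|lebesgue. F x * \<phi> x)"
    using \<phi>' by (simp add: weak_deriv_def)
  moreover have "(LINT x:{-1<..<1}|lebesgue. g x * deriv \<phi> x) = (LINT x:{c<..<d}|lebesgue. g x * deriv \<phi> x)"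
    by (rule set_integral_zero_outside[OF sub(2)]) (use test_fun_eq_0[OF test_fun_deriv[OF \<phi>']] in simp)
  moreover have "(LINT x:{-1<..<1}|lebesgue. F x * \<phi> x) = (LINT x:{c<..<d}|lebesgue. F x * \<phi> x)"
    by (rule set_integral_zero_outside[OF sub(2)]) (use test_fun_eq_0[OF \<phi>'] in simp)
  ultimately show "(LINT x:{-1<..<1}|lebesgue. g x * deriv \<phi> x) = - (LINT x:{-1<..<1}|lebesgue. F x * \<phi> x)" by simp
qed

end

section \<open>Convexity of \<open>g\<close> and the sign of the second derivative at jumps\<close>

context obstacle
begin

lemma nonneg_variation:
  assumes x: "x \<in> {-1..1}" and \<theta>: "L2_on {-2<..<2} \<theta>" and z: "\<And>y. y \<notin> {-1<..<1} \<Longrightarrow> \<theta> y = 0"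
    and j: "jfree x (integral {-2..2} (\<lambda>s. (s - x) * \<theta> s)) (- prim \<theta> 2)"
    and nn: "\<And>y. y \<in> {-2..2} \<Longrightarrow> 0 \<le> tp x \<theta> y"
  shows "0 \<le> integral {-2..2} (\<lambda>s. gx x s * \<theta> s)"
proof (rule tp_variation[OF _ _ _ _ \<theta> z j, where ?t0.0 = 1])
  fix t :: real assume t: "0 < t"
  show "AE y in lebesgue. y \<in> {-1<..<1} \<longrightarrow> w y \<le> u0 y + t * tp x \<theta> y"
    using w_ge
  proof eventually_elim
    case (elim y)
    show ?case
    proof
      assume y: "y \<in> {-1<..<1}"
      then have "0 \<le> t * tp x \<theta> y" using nn[of y] t by simp
      then show "w y \<le> u0 y + t * tp x \<theta> y" using elim y by simp
    qed
  qed
qed (use x in auto)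

lemma integral_ind:
  assumes "AI h" "-2 \<le> a" "b \<le> 2"
  shows "AI (\<lambda>s. indicator {a..b} s * h s)" "integral {-2..2} (\<lambda>s. indicator {a..b} s * h s) = integral {a..b} h"
proof -
  have e: "indicator {a..b} s *\<^sub>R h s = indicator {-2..2} s *\<^sub>R (indicator {a..b} s * h s)" for s
    using assms by (auto simp: indicator_def)
  have h: "h absolutely_integrable_on {a..b}" by (rule AI_sub[OF assms])
  then show A: "AI (\<lambda>s. indicator {a..b} s * h s)" unfolding set_integrable_def e .
  have "integral {-2..2} (\<lambda>s. indicator {a..b} s * h s) = (LINT s:{-2..2}|lebesgue. indicator {a..b} s * h s)"
    by (rule LINT_Icc[OF A, symmetric])
  also have "\<dots> = (LINT s:{a..b}|lebesgue. h s)" unfolding set_lebesgue_integral_def e ..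
  also have "\<dots> = integral {a..b} h" by (rule LINT_Icc[OF h])
  finally show "integral {-2..2} (\<lambda>s. indicator {a..b} s * h s) = integral {a..b} h" .
qed

lemma AI_g: "AI g" by (rule L2_on_Ioo_Icc[OF L2_g])

text \<open>
  The test function is the smoothed hat with kinks at \<open>a\<close>, \<open>b\<close>, \<open>c\<close>; it is nonnegative because its
  derivative changes sign only once, from plus to minus.
\<close>

lemma hat_inequality:
  assumes abc: "-1 < a" "a + h < b" "b + h < c" "c + h < 1" "0 < h"
  shows "0 \<le> (c - b) * (integral {a..a + h} g / h) - (c - a) * (integral {b..b + h} g / h) +
    (b - a) * (integral {c..c + h} g / h)"
proof -
  let ?i = "\<lambda>a s. indicator {a..a + h} s :: real"
  \<comment> \<open>The weights balance: A + C = B makes the total integral 0, and with the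
    positions a, b, c the first moment about b is 0 too. So the competitor has no jump at all and
    may be used whatever \<open>u\<close> does at b.\<close>
  define A B C where "A = (c - b) / h" and "B = (c - a) / h" and "C = (b - a) / h"
  have ABC: "0 \<le> A" "0 \<le> B" "0 \<le> C" using abc by (auto simp: A_def B_def C_def)
  define \<theta> where "\<theta> s = A * ?i a s + (- B) * ?i b s + C * ?i c s" for s
  have L: "L2_on {-2<..<2} (?i r)" if "-1 < r" "r + h < 1" for r by (rule L2_indicator) (use that in auto)
  have \<theta>: "L2_on {-2<..<2} \<theta>"
    using L2_on_linear[OF L2_on_linear[OF L[of a] L[of b], of A "- B"] L[of c], of 1 C] abc
    by (simp add: \<theta>_def[abs_def])
  have z: "\<theta> y = 0" if "y \<notin> {-1<..<1}" for y using that abc by (auto simp: \<theta>_def indicator_def)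
  have int: "AI (\<lambda>s. f s * \<theta> s) \<and> integral {-2..2} (\<lambda>s. f s * \<theta> s) =
      A * integral {a..a + h} f - B * integral {b..b + h} f + C * integral {c..c + h} f" if f: "AI f" for f
  proof -
    have i: "AI (\<lambda>s. ?i r s * f s)" "integral {-2..2} (\<lambda>s. ?i r s * f s) = integral {r..r + h} f"
      if "-1 < r" "r + h < 1" for r
      using integral_ind[OF f, of r "r + h"] that by auto
    have e: "(\<lambda>s. f s * \<theta> s) = (\<lambda>s. (A * (?i a s * f s) + (- B) * (?i b s * f s)) + C * (?i c s * f s))"
      by (rule ext) (simp add: \<theta>_def algebra_simps)
    have "((\<lambda>s. (A * (?i a s * f s) + (- B) * (?i b s * f s)) + C * (?i c s * f s)) has_integral
        (A * integral {-2..2} (\<lambda>s. ?i a s * f s) + (- B) * integral {-2..2} (\<lambda>s. ?i b s * f s)) +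
        C * integral {-2..2} (\<lambda>s. ?i c s * f s)) {-2..2}"
      by (intro has_integral_add has_integral_mult_right integrable_integral AI_integrable i) (use abc in auto)
    moreover have "AI (\<lambda>s. (A * (?i a s * f s) + (- B) * (?i b s * f s)) + C * (?i c s * f s))"
      by (intro set_integral_add(1) set_integrable_mult_right i) (use abc in auto)
    ultimately show ?thesis
      unfolding e using i(2)[of a] i(2)[of b] i(2)[of c] abc by (simp add: integral_unique)
  qed
  have one: "integral {r..r + h} (\<lambda>_. 1::real) = h" for r using abc(5) by simp
  have lin: "integral {r..r + h} (\<lambda>s. s - b) = h * (r - b) + h\<^sup>2 / 2" for r
  proof -
    have "((\<lambda>s. s - b) has_integral (r + h - b)\<^sup>2 / 2 - (r - b)\<^sup>2 / 2) {r..r + h}"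
      by (rule fundamental_theorem_of_calculus)
        (use abc(5) in \<open>auto simp flip: has_real_derivative_iff_has_vector_derivative intro!: derivative_eq_intros\<close>)
    then have "integral {r..r + h} (\<lambda>s. s - b) = (r + h - b)\<^sup>2 / 2 - (r - b)\<^sup>2 / 2" by (rule integral_unique)
    then show ?thesis by (simp add: power2_eq_square field_simps)
  qed
  have P0: "prim \<theta> 2 = 0"
  proof -
    have "prim \<theta> 2 = A * h - B * h + C * h" using int[OF AI_one] less_imp_le[OF abc(5)] by (simp add: prim_def)
    also have "\<dots> = 0" using abc(5) by (simp add: A_def B_def C_def)
    finally show ?thesis .
  qed
  have M0: "integral {-2..2} (\<lambda>s. (s - b) * \<theta> s) = 0"
  proof -
    have sb: "AI (\<lambda>s. s - b)" by (intro AI_cont continuous_intros)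
    have "integral {-2..2} (\<lambda>s. (s - b) * \<theta> s) = A * integral {a..a + h} (\<lambda>s. s - b) -
        B * integral {b..b + h} (\<lambda>s. s - b) + C * integral {c..c + h} (\<lambda>s. s - b)"
      by (rule conjunct2[OF int[OF sb]])
    also have "\<dots> = A * (h * (a - b) + h\<^sup>2 / 2) - B * (h * (b - b) + h\<^sup>2 / 2) + C * (h * (c - b) + h\<^sup>2 / 2)"
      unfolding lin ..
    also have "\<dots> = (c - b) * ((a - b) + h / 2) - (c - a) * (h / 2) + (b - a) * ((c - b) + h / 2)"
    proof -
      have gen: "X / h * (h * Y + h\<^sup>2 / 2) = X * (Y + h / 2)" for X Y
        using abc(5) by (simp add: power2_eq_square field_simps)
      show ?thesis unfolding A_def B_def C_def gen by simp
    qed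
    also have "\<dots> = 0" by (simp add: field_simps)
    finally show ?thesis .
  qed
  have b2: "b \<in> {-2<..<2}" using abc by auto
  have AIt: "AI \<theta>" by (rule L2_on_Ioo_Icc[OF \<theta>])
  have t1: "tp1 b \<theta> y = prim \<theta> y" for y by (simp add: tp1_def P0)
  have e1: "prim (tp1 b \<theta>) 2 = 0" using tp_jump(1)[OF b2 \<theta>] M0 by simp
  have t0: "tp b \<theta> y = prim (prim \<theta>) y" for y
    unfolding tp_def e1 using ext[of "tp1 b \<theta>" "prim \<theta>", OF t1] by simp
  have AIp: "AI (prim \<theta>)" by (rule AI_cont[OF prim_cont[OF AIt]])
  have left: "0 \<le> prim \<theta> y" if "-2 \<le> y" "y \<le> b" for y
  proof -
    have "prim \<theta> (-2) \<le> prim \<theta> y"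
      by (rule prim_mono[OF AIt]) (use that abc ABC in \<open>auto simp: \<theta>_def indicator_def\<close>)
    then show ?thesis by simp
  qed
  have right: "prim \<theta> y \<le> 0" if "b + h \<le> y" "y \<le> 2" for y
  proof -
    have "prim \<theta> y \<le> prim \<theta> 2"
      by (rule prim_mono[OF AIt]) (use that abc ABC in \<open>auto simp: \<theta>_def indicator_def\<close>)
    then show ?thesis using P0 by simp
  qed
  have mid: "prim \<theta> y' \<le> prim \<theta> y" if "b \<le> y" "y \<le> y'" "y' \<le> b + h" for y y'
    by (rule prim_antimono[OF AIt]) (use that abc ABC in \<open>auto simp: \<theta>_def indicator_def\<close>)
  have nn: "0 \<le> tp b \<theta> y" if y: "y \<in> {-2..2}" for y
  \<comment> \<open>If the slope is still nonnegative at y, it was so all the way from -2, and the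
    value is at least the initial value 0; otherwise it is nonpositive from y on, and the value is
    at least the final value 0.\<close>
  proof (cases "0 \<le> prim \<theta> y \<and> y \<le> b + h")
    case True
    have "0 \<le> prim \<theta> t" if "-2 < t" "t \<le> y" for t
    proof (cases "t \<le> b")
      case False
      then show ?thesis using mid[of t y] True that by simp
    qed (use left that in auto)
    then have "prim (prim \<theta>) (-2) \<le> prim (prim \<theta>) y"
      by (intro prim_mono[OF AIp]) (use y in auto)
    then show ?thesis unfolding t0 by simp
  next
    case False
    have yb: "b < y" using left[of y] False abc y by (cases "y \<le> b") auto
    have "prim \<theta> t \<le> 0" if t: "y < t" "t \<le> 2" for t
    proof (cases "b + h \<le> t")
      case False
      then have "prim \<theta> t \<le> prim \<theta> y" using mid[of y t] yb t by simp
      moreover have "prim \<theta> y < 0" using \<open>\<not> (0 \<le> prim \<theta> y \<and> y \<le> b + h)\<close> False t by auto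
      ultimately show ?thesis by simp
    qed (use right t in auto)
    then have "prim (prim \<theta>) 2 \<le> prim (prim \<theta>) y"
      by (intro prim_antimono[OF AIp]) (use y in auto)
    moreover have "prim (prim \<theta>) 2 = 0" using t0[of 2] tp_end(2)[of b \<theta>] b2 by simp
    ultimately show ?thesis unfolding t0 by simp
  qed
  have "0 \<le> integral {-2..2} (\<lambda>s. gx b s * \<theta> s)"
    by (rule nonneg_variation[OF _ \<theta> z _ nn]) (use abc M0 P0 in \<open>auto simp: jfree_def\<close>)
  also have "\<dots> = integral {-2..2} (\<lambda>s. g s * \<theta> s)"
  proof -
    have i: "AI (\<lambda>s. g s * \<theta> s)" using int[OF AI_g] by blast
    have j: "AI (\<lambda>s. (s - b) * \<theta> s)" by (rule tp_jump(2)[OF b2 \<theta>])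
    have "((\<lambda>s. g s * \<theta> s - (K2 b * \<theta> s + K1 b * ((s - b) * \<theta> s))) has_integral
        integral {-2..2} (\<lambda>s. g s * \<theta> s) - (K2 b * integral {-2..2} \<theta> + K1 b * integral {-2..2} (\<lambda>s. (s - b) * \<theta> s))) {-2..2}"
      by (intro has_integral_diff has_integral_add has_integral_mult_right integrable_integral AI_integrable i AIt j)
    moreover have "(\<lambda>s. g s * \<theta> s - (K2 b * \<theta> s + K1 b * ((s - b) * \<theta> s))) = (\<lambda>s. gx b s * \<theta> s)"
      by (rule ext) (simp add: gx_def algebra_simps)
    ultimately show ?thesis using P0 M0 by (simp add: integral_unique prim_def)
  qed
  also have "\<dots> = A * integral {a..a + h} g - B * integral {b..b + h} g + C * integral {c..c + h} g"
    using int[OF AI_g] by blast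
  also have "\<dots> = (c - b) * (integral {a..a + h} g / h) - (c - a) * (integral {b..b + h} g / h) +
      (b - a) * (integral {c..c + h} g / h)" by (simp add: A_def B_def C_def)
  finally show ?thesis .
qed

text \<open>By Lebesgue differentiation the averages over [x, x + h] tend to \<open>g x\<close> off
  a null set; the hat inequality passes to the limit as h tends to 0 at any three such
  points.\<close>

lemma g_ae_convex: "\<exists>N. ae_convex g N"
proof -
  define G where "G s = (if s \<in> {-2..2} then g s else 0)" for s
  have "G absolutely_integrable_on UNIV"
    unfolding G_def[abs_def] using AI_g by (subst absolutely_integrable_restrict_UNIV)
  then have Gi: "G integrable_on cbox a b" for a b
    using integrable_on_subcbox set_lebesgue_integral_eq_integral(1) by blast
  have rf: "integral (cbox x (x + h *\<^sub>R One)) G /\<^sub>R h ^ DIM(real) = integral {x..x + h} G / h" for x h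
    by (simp add: divide_inverse mult.commute)
  define leb where "leb x e \<longleftrightarrow> (\<exists>d>0. \<forall>h. 0 < h \<and> h < d \<longrightarrow> norm (integral {x..x + h} G / h - G x) < e)" for x e
  have "\<exists>N. negligible N \<and> (\<forall>x e. x \<notin> N \<longrightarrow> 0 < e \<longrightarrow> leb x e)"
  proof (rule integrable_ccontinuous_explicit[OF Gi, unfolded rf])
    fix N assume N: "negligible N" "\<And>x e. x \<notin> N \<Longrightarrow> 0 < e \<Longrightarrow>
      \<exists>d>0. \<forall>h. 0 < h \<and> h < d \<longrightarrow> norm (integral {x..x + h} G / h - G x) < e"
    show ?thesis
      by (intro exI[of _ N] conjI allI impI N(1)) (unfold leb_def, rule N(2))
  qed
  then obtain N where N: "negligible N" and lim: "\<And>x e. x \<notin> N \<Longrightarrow> 0 < e \<Longrightarrow> leb x e" by blast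
  have T: "((\<lambda>h. integral {x..x + h} g / h) \<longlongrightarrow> g x) (at_right 0)" if x: "x \<notin> N" "-1 < x" "x < 1" for x
  proof (rule tendstoI)
    fix e :: real assume "0 < e"
    from lim[OF x(1) this] obtain d where d: "d > 0"
      "\<forall>h. 0 < h \<and> h < d \<longrightarrow> norm (integral {x..x + h} G / h - G x) < e"
      unfolding leb_def by (elim exE conjE) blast
    have dl: "dist (integral {x..x + h} g / h) (g x) < e" if h: "0 < h" "h < min d 1" for h
    proof -
      have "integral {x..x + h} G = integral {x..x + h} g"
        by (rule Henstock_Kurzweil_Integration.integral_cong) (use x h in \<open>auto simp: G_def\<close>)
      moreover have "G x = g x" using x by (simp add: G_def)
      moreover have "norm (integral {x..x + h} G / h - G x) < e" using d(2) h by simp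
      ultimately show ?thesis unfolding dist_norm by metis
    qed
    show "\<forall>\<^sub>F h in at_right 0. dist (integral {x..x + h} g / h) (g x) < e"
    proof (rule eventually_at_rightI[of 0 "min d 1"])
      show "0 < min d 1" using d(1) by simp
      show "dist (integral {x..x + h} g / h) (g x) < e" if "h \<in> {0<..<min d 1}" for h
        by (rule dl) (use that in simp_all)
    qed
  qed
  have "ae_convex g N"
  proof
    fix a b c :: real assume abc: "-1 < a" "a < b" "b < c" "c < 1" and n: "a \<notin> N" "b \<notin> N" "c \<notin> N"
    define h0 where "h0 = min (b - a) (min (c - b) (1 - c))"
    have h0: "0 < h0" "h0 \<le> b - a" "h0 \<le> c - b" "h0 \<le> 1 - c" using abc by (auto simp: h0_def)
    have "((\<lambda>h. (c - b) * (integral {a..a + h} g / h) - (c - a) * (integral {b..b + h} g / h) +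
        (b - a) * (integral {c..c + h} g / h)) \<longlongrightarrow> (c - b) * g a - (c - a) * g b + (b - a) * g c) (at_right 0)"
      by (intro tendsto_intros T n) (use abc in auto)
    moreover have "\<forall>\<^sub>F h in at_right 0. 0 \<le> (c - b) * (integral {a..a + h} g / h) -
        (c - a) * (integral {b..b + h} g / h) + (b - a) * (integral {c..c + h} g / h)"
    proof (rule eventually_at_rightI[OF _ h0(1)])
      fix h assume "h \<in> {0<..<h0}"
      then show "0 \<le> (c - b) * (integral {a..a + h} g / h) - (c - a) * (integral {b..b + h} g / h) +
        (b - a) * (integral {c..c + h} g / h)"
        by (intro hat_inequality) (use abc h0 in auto)
    qed
    ultimately show "0 \<le> (c - b) * g a - (c - a) * g b + (b - a) * g c"
      by (rule tendsto_lowerbound) simp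
  qed (rule N)
  then show ?thesis by blast
qed

lemma AI_gx: "AI (gx x)" by (rule L2_on_Ioo_Icc[OF L2_gx])

text \<open>The indicator of an interval symmetric about x has first moment 0, so only the slope of
  the competitor jumps, which is free where \<open>u\<close> already jumps. The competitor is
  nonnegative, so it is admissible even in contact.\<close>

lemma kink_nonneg:
  assumes x: "-1 < x" "x < 1" and J: "J0 x \<noteq> 0 \<or> J1 x \<noteq> 0" and r: "0 < r" "-1 < x - r" "x + r < 1"
  shows "0 \<le> integral {x - r..x + r} (gx x)"
proof -
  let ?\<theta> = "indicator {x - r..x + r} :: real \<Rightarrow> real"
  have \<theta>: "L2_on {-2<..<2} ?\<theta>" by (rule L2_indicator) (use r in auto)
  have x2: "x \<in> {-2<..<2}" using x by auto
  have i: "integral {-2..2} (\<lambda>s. h s * ?\<theta> s) = integral {x - r..x + r} h" if "AI h" for h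
    using integral_ind(2)[OF that, of "x - r" "x + r"] r by (simp add: mult.commute)
  have "AI (\<lambda>s. s - x)" by (intro AI_cont continuous_intros)
  then have "integral {-2..2} (\<lambda>s. (s - x) * ?\<theta> s) = integral {x - r..x + r} (\<lambda>s. s - x)" by (rule i)
  also have "\<dots> = (x + r - x)\<^sup>2 / 2 - (x - r - x)\<^sup>2 / 2"
    by (rule integral_unique, rule fundamental_theorem_of_calculus)
      (use r in \<open>auto simp flip: has_real_derivative_iff_has_vector_derivative intro!: derivative_eq_intros\<close>)
  finally have "integral {-2..2} (\<lambda>s. (s - x) * ?\<theta> s) = 0" by simp
  then have "0 \<le> integral {-2..2} (\<lambda>s. gx x s * ?\<theta> s)"
    by (intro nonneg_variation[OF _ \<theta>] tp_nonneg[OF x2 \<theta>]) (use J x r in \<open>auto simp: jfree_def indicator_def\<close>)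
  then show ?thesis unfolding i[OF AI_gx] .
qed

text \<open>Convexity gives \<open>gx\<close> a representative \<open>G\<close> continuous at x, so
  the one-sided limits of \<open>u''\<close> exist and coincide; they equal G x / \<eta> because
  \<open>K2\<close> cancels at x. A negative G x would contradict the averages over small symmetric
  intervals.\<close>

lemma kink_traces:
  assumes x: "-1 < x" "x < 1" and J: "J0 x \<noteq> 0 \<or> J1 x \<noteq> 0"
  shows "\<exists>l\<ge>0. has_rtrace (D2 u) x l \<and> has_ltrace (D2 u) x l"
proof -
  obtain N where "ae_convex g N" using g_ae_convex by blast
  then interpret ae_convex g N .
  define c d where "c = (x - 1) / 2" and "d = (x + 1) / 2"
  have cd: "-1 < c" "c < x" "x < d" "d < 1" using x by (auto simp: c_def d_def)
  obtain e where e: "AE y in lebesgue. y \<in> {c<..<d} \<longrightarrow> g y = e + prim (Fr c d) y"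
    using g_local[of c d] cd by auto
  define G where "G s = e + prim (Fr c d) s - K2 x - K1 x * (s - x)" for s
  have Gc: "continuous_on {-2..2} G"
    unfolding G_def[abs_def] by (intro continuous_intros prim_cont AI_Fr cd)
  have Gg: "AE y in lebesgue. y \<in> {c<..<d} \<longrightarrow> gx x y = G y"
    using e by eventually_elim (simp add: gx_def G_def)
  have nn: "0 \<le> G x"
  proof (rule ccontr)
    assume "\<not> 0 \<le> G x"
    then have neg: "G x < 0" by simp
    have "isCont G x"
      by (rule continuous_on_interior[OF Gc]) (use x in \<open>simp add: interior_atLeastAtMost_real\<close>)
    then have "\<forall>\<^sub>F y in at x. G y < G x / 2"
      using neg by (intro order_tendstoD(2)[of G "G x"]) (auto simp: isCont_def)
    then obtain r0 where r0: "r0 > 0" "\<And>y. y \<noteq> x \<Longrightarrow> \<bar>y - x\<bar> < r0 \<Longrightarrow> G y < G x / 2"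
      unfolding eventually_at dist_real_def by blast
    define r where "r = min (r0 / 2) (min ((x - c) / 2) ((d - x) / 2))"
    have "0 < r" using r0 cd by (simp add: r_def)
    moreover have "r \<le> r0 / 2" "r \<le> (x - c) / 2" "r \<le> (d - x) / 2"
      unfolding r_def by (meson min.cobounded1 min.cobounded2 order_trans)+
    moreover have "c < x" "x < d" by (fact cd)+
    ultimately have r: "0 < r" "r < r0" "c < x - r" "x + r < d" using r0(1) by (simp_all add: field_simps)
    have le: "G y \<le> G x / 2" if "y \<in> {x - r..x + r}" for y
    proof (cases "y = x")
      case False
      then show ?thesis using r0(2)[of y] that r by force
    qed (use neg in simp)
    have "integral {x - r..x + r} (gx x) = integral {x - r..x + r} G"
    proof -
      obtain M where M: "negligible M" "\<forall>y. y \<notin> M \<longrightarrow> y \<in> {c<..<d} \<longrightarrow> gx x y = G y"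
        using AE_lebesgueD[OF Gg] by blast
      show ?thesis by (rule integral_spike[OF M(1)]) (use M(2) r in auto)
    qed
    also have "\<dots> \<le> integral {x - r..x + r} (\<lambda>_. G x / 2)"
      by (rule integral_le) (use le r cd x in \<open>auto intro!: integrable_continuous_real continuous_on_subset[OF Gc]\<close>)
    also have "\<dots> < 0" using r neg by (simp add: mult_pos_neg)
    finally show False using kink_nonneg[OF x J, of r] r cd by simp
  qed
  define R where "R s = (1 / \<eta>) * (G s + K2 x + K1 x * (s - x) - K2 s)" for s
  have Rc: "continuous_on {-2..2} R"
    unfolding R_def[abs_def] by (intro continuous_intros Gc K2_cont)
  have RD: "AE y in lebesgue. y \<in> {c<..<d} \<longrightarrow> R y = D2 u y"
    using e u2_D2
  proof eventually_elim
    case (elim y)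
    show ?case
    proof
      assume y: "y \<in> {c<..<d}"
      then have 1: "D2 u y = u2 y" using elim cd by auto
      have "G y + K2 x + K1 x * (y - x) - K2 y = \<eta> * u2 y"
        using elim y by (simp add: G_def g_def)
      then have "R y = (1 / \<eta>) * (\<eta> * u2 y)" by (simp only: R_def)
      then show "R y = D2 u y" using 1 pos(1) by simp
    qed
  qed
  have "AE y in lebesgue. y \<in> {x<..<d} \<longrightarrow> R y = D2 u y" "AE y in lebesgue. y \<in> {c<..<x} \<longrightarrow> R y = D2 u y"
    using RD by (eventually_elim, use cd in auto)+
  then have "has_rtrace (D2 u) x (R x)" "has_ltrace (D2 u) x (R x)"
    using has_rtraceI[OF cd(3) _ cont_Icc_tendsto(1)[OF Rc]] has_ltraceI[OF cd(2) _ cont_Icc_tendsto(2)[OF Rc]] x by auto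
  moreover have "0 \<le> R x" using nn pos(1) by (simp add: R_def)
  ultimately show ?thesis by blast
qed

end

section \<open>The fourth derivative as a measure\<close>

locale monotone_density =
  fixes F :: "real \<Rightarrow> real"
  assumes mono: "\<And>x y. -1 < x \<Longrightarrow> x \<le> y \<Longrightarrow> y < 1 \<Longrightarrow> F x \<le> F y"
begin

text \<open>The heights that the graph of \<open>F\<close> crosses inside (-1,1), its jumps
  included; for these the generalised inverse lands in the open interval.\<close>

definition R :: "real set"
  where "R = {y. (\<exists>x\<in>{-1<..<1}. F x < y) \<and> (\<exists>x\<in>{-1<..<1}. y \<le> F x)}"

text \<open>The generalised inverse of \<open>F\<close>; the value \<open>2\<close> lies outside the interval under consideration.\<close>

definition Q :: "real \<Rightarrow> real"
  where "Q y = Inf {x \<in> {-1<..<1}. y \<le> F x}"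

definition QQ :: "real \<Rightarrow> real"
  where "QQ y = (if y \<in> R then Q y else 2)"

text \<open>The Stieltjes measure of \<open>F\<close> as an image of Lebesgue measure: a set
  receives the length of the heights at which the graph crosses it. This asks for no one-sided
  continuity of \<open>F\<close> and for no bound near -1 or 1.\<close>

definition dF :: "real measure"
  where "dF = distr lebesgue borel QQ"

lemma Q_range:
  assumes "y \<in> R"
  shows "-1 < Q y" "Q y < 1"
proof -
  obtain x0 x1 where x: "x0 \<in> {-1<..<1}" "F x0 < y" "x1 \<in> {-1<..<1}" "y \<le> F x1" using assms by (auto simp: R_def)
  have "x0 \<le> Q y"
    unfolding Q_def
  proof (rule cInf_greatest)
    show "{x \<in> {-1<..<1}. y \<le> F x} \<noteq> {}" using x by blast
    fix x' assume "x' \<in> {x \<in> {-1<..<1}. y \<le> F x}"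
    then show "x0 \<le> x'" using x mono[of x' x0] by force
  qed
  moreover have "Q y \<le> x1"
    unfolding Q_def by (rule cInf_lower) (use x in \<open>auto intro!: bdd_belowI[of _ "-1"]\<close>)
  ultimately show "-1 < Q y" "Q y < 1" using x by auto
qed

lemma F_less: "x \<in> {-1<..<1} \<Longrightarrow> x < Q y \<Longrightarrow> F x < y"
proof (rule ccontr)
  assume x: "x \<in> {-1<..<1}" "x < Q y" "\<not> F x < y"
  then have "Q y \<le> x"
    unfolding Q_def by (intro cInf_lower) (auto intro!: bdd_belowI[of _ "-1"])
  then show False using x by simp
qed

lemma le_F:
  assumes "y \<in> R" "x \<in> {-1<..<1}" "Q y < x"
  shows "y \<le> F x"
proof (rule ccontr)
  assume n: "\<not> y \<le> F x"
  have "x \<le> Q y"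
    unfolding Q_def
  proof (rule cInf_greatest)
    show "{x \<in> {-1<..<1}. y \<le> F x} \<noteq> {}" using assms by (auto simp: R_def)
    fix x' assume "x' \<in> {x \<in> {-1<..<1}. y \<le> F x}"
    then show "x \<le> x'" using n assms mono[of x' x] by force
  qed
  then show False using assms by simp
qed

lemma R_borel: "R \<in> sets borel"
proof -
  \<comment> \<open>The first union consists of open rays and may be uncountable; the rays of the
    second are closed, so monotonicity is used to reduce it to rational points.\<close>
  have eq: "R = (\<Union>x\<in>{-1<..<1}. {F x<..}) \<inter> (\<Union>x\<in>\<rat> \<inter> {-1<..<1}. {..F x})"
  proof (intro set_eqI iffI)
    fix y assume "y \<in> R"
    then obtain x0 x1 where x: "x0 \<in> {-1<..<1}" "F x0 < y" "x1 \<in> {-1<..<1}" "y \<le> F x1" by (auto simp: R_def)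
    obtain r where r: "r \<in> \<rat>" "x1 < r" "r < 1" using Rats_dense_in_real[of x1 1] x by auto
    then have "F x1 \<le> F r" using x by (intro mono) auto
    then have "y \<in> {..F r}" "r \<in> \<rat> \<inter> {-1<..<1}" using x r by auto
    then show "y \<in> (\<Union>x\<in>{-1<..<1}. {F x<..}) \<inter> (\<Union>x\<in>\<rat> \<inter> {-1<..<1}. {..F x})" using x by blast
  next
    fix y assume "y \<in> (\<Union>x\<in>{-1<..<1}. {F x<..}) \<inter> (\<Union>x\<in>\<rat> \<inter> {-1<..<1}. {..F x})"
    then show "y \<in> R" unfolding R_def by blast
  qed
  have o: "open (\<Union>x\<in>{-1<..<1}. {F x<..})" by (intro open_UN ballI open_greaterThan)
  have "countable (\<rat> \<inter> {-1<..<1::real})" by (rule countable_Int1[OF countable_rat])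
  then have c: "(\<Union>x\<in>\<rat> \<inter> {-1<..<1}. {..F x}) \<in> sets borel"
    by (rule sets.countable_UN'') simp
  show ?thesis unfolding eq by (rule sets.Int[OF borel_open[OF o] c])
qed

lemma QQ_measurable: "QQ \<in> measurable lebesgue borel"
proof -
  have "mono_on R Q"
  proof (rule mono_onI)
    fix y y' assume y: "y \<in> R" "y' \<in> R" "y \<le> y'"
    show "Q y \<le> Q y'"
      unfolding Q_def
    proof (rule cInf_superset_mono)
      show "{x \<in> {-1<..<1}. y' \<le> F x} \<noteq> {}" using y by (auto simp: R_def)
      show "bdd_below {x \<in> {-1<..<1}. y \<le> F x}" by (auto intro!: bdd_belowI[of _ "-1"])
      show "{x \<in> {-1<..<1}. y' \<le> F x} \<subseteq> {x \<in> {-1<..<1}. y \<le> F x}" using y by auto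
    qed
  qed
  then have m: "Q \<in> borel_measurable (restrict_space borel R)" by (rule borel_measurable_mono_on_fnc)
  have R': "R \<inter> space borel \<in> sets borel" using R_borel by simp
  have "(\<lambda>y. if y \<in> R then Q y else 2) \<in> borel_measurable borel"
    using m by (subst (asm) measurable_restrict_space_iff[OF R']) auto
  then have "QQ \<in> borel_measurable lborel" by (simp add: QQ_def[abs_def])
  then show ?thesis by (rule measurable_completion)
qed

lemma emeasure_dF: "A \<in> sets borel \<Longrightarrow> emeasure dF A = emeasure lebesgue (QQ -` A)"
  unfolding dF_def by (subst emeasure_distr[OF QQ_measurable]) simp_all

lemma radon_dF: "radon_on {-1<..<1} dF"
  unfolding radon_on_def
proof (intro conjI allI impI)
  show "sets dF = sets borel" by (simp add: dF_def)
  fix C :: "real set" assume C: "compact C \<and> C \<subseteq> {-1<..<1}"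
  show "emeasure dF C < \<infinity>"
  proof (cases "C = {}")
    case False
    obtain a where a: "a \<in> C" "\<And>x. x \<in> C \<Longrightarrow> a \<le> x" using compact_attains_inf[of C] C False by blast
    obtain b where b: "b \<in> C" "\<And>x. x \<in> C \<Longrightarrow> x \<le> b" using compact_attains_sup[of C] C False by blast
    have ab: "-1 < a" "a < 1" "-1 < b" "b < 1" using a b C by auto
    have "QQ -` C \<subseteq> {F ((a - 1) / 2)..F ((b + 1) / 2)}"
    proof
      fix y assume "y \<in> QQ -` C"
      then have q: "QQ y \<in> C" by simp
      have y: "y \<in> R"
      proof (rule ccontr)
        assume "y \<notin> R"
        then have "2 \<in> C" using q by (simp add: QQ_def)
        then show False using C by auto
      qed
      then have "Q y \<in> C" using q by (simp add: QQ_def)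
      then have "a \<le> Q y" "Q y \<le> b" using a b by auto
      then have "F ((a - 1) / 2) < y" "y \<le> F ((b + 1) / 2)"
        using F_less[of "(a - 1) / 2" y] le_F[OF y, of "(b + 1) / 2"] ab by auto
      then show "y \<in> {F ((a - 1) / 2)..F ((b + 1) / 2)}" by simp
    qed
    then have "emeasure lebesgue (QQ -` C) \<le> emeasure lebesgue {F ((a - 1) / 2)..F ((b + 1) / 2)}"
      by (rule emeasure_mono) simp
    also have "\<dots> < \<infinity>" by (simp add: emeasure_lborel_Icc_eq)
    finally show ?thesis using emeasure_dF[of C] C by (simp add: borel_compact)
  qed (simp add: emeasure_dF)
qed

lemma dF_null:
  assumes "-1 \<le> p" "q \<le> 1" "\<And>y. y \<in> {p<..<q} \<Longrightarrow> F y = b"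
  shows "emeasure dF {p<..<q} = 0"
proof -
  have "QQ -` {p<..<q} = {}"
  proof (rule ccontr)
    assume "QQ -` {p<..<q} \<noteq> {}"
    then obtain y where "y \<in> QQ -` {p<..<q}" by blast
    then have q: "QQ y \<in> {p<..<q}" by simp
    have y: "y \<in> R"
    proof (rule ccontr)
      assume "y \<notin> R"
      then have "2 < q" using q by (simp add: QQ_def)
      then show False using assms by auto
    qed
    then have Qy: "p < Q y" "Q y < q" using q by (simp_all add: QQ_def)
    have "F ((p + Q y) / 2) < y" by (rule F_less) (use Qy assms Q_range[OF y] in auto)
    moreover have "y \<le> F ((Q y + q) / 2)" by (rule le_F[OF y]) (use Qy assms Q_range[OF y] in auto)
    moreover have "F ((p + Q y) / 2) = b" "F ((Q y + q) / 2) = b" by (rule assms(3), use Qy in auto)+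
    ultimately show False by simp
  qed
  then show ?thesis by (simp add: emeasure_dF)
qed

text \<open>For a crossed height y, the value of \<open>\<phi>\<close> at the generalised inverse is
  the integral of its derivative over the part of [c,d] where F < y. Exchanging the two integrations
  gives the integral of the derivative times F d - F x, and the constant F d drops out because
  \<open>\<phi>\<close> vanishes at c and d.\<close>

lemma integral_dF:
  assumes \<phi>: "test_fun {-1<..<1} \<phi>"
  shows "(LINT x:{-1<..<1}|dF. \<phi> x) = - (LINT x:{-1<..<1}|lebesgue. F x * deriv \<phi> x)"
proof -
  obtain C where C: "compact C" "C \<subseteq> {-1<..<1}" "\<forall>x. x \<notin> C \<longrightarrow> \<phi> x = 0" using \<phi> by (auto simp: test_fun_def)
  define c where "c = (if C = {} then 0 else (Inf C - 1) / 2)"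
  define d where "d = (if C = {} then 1/2 else (Sup C + 1) / 2)"
  have cd: "-1 < c" "c < d" "d < 1" "\<And>x. x \<notin> {c<..<d} \<Longrightarrow> \<phi> x = 0"
  proof -
    have "-1 < c \<and> c < d \<and> d < 1 \<and> C \<subseteq> {c<..<d}"
    proof (cases "C = {}")
      case False
      have "Inf C \<in> C" "Sup C \<in> C"
        using closed_contains_Inf[OF False] closed_contains_Sup[OF False] C(1)
        by (auto simp: compact_imp_closed compact_imp_bounded bounded_imp_bdd_below bounded_imp_bdd_above)
      moreover have "Inf C \<le> x" "x \<le> Sup C" if "x \<in> C" for x
        using that C(1) by (auto intro!: cInf_lower cSup_upper
            simp: compact_imp_bounded bounded_imp_bdd_below bounded_imp_bdd_above)
      ultimately show ?thesis using C(2) False by (fastforce simp: c_def d_def)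
    qed (simp add: c_def d_def)
    then show "-1 < c" "c < d" "d < 1" "\<And>x. x \<notin> {c<..<d} \<Longrightarrow> \<phi> x = 0" using C(3) by auto
  qed
  have sub: "{c..d} \<subseteq> {-1<..<1}" using cd by auto
  have \<phi>cd: "\<phi> c = 0" "\<phi> d = 0" using cd by auto
  have sm: "smooth \<phi>" "smooth (deriv \<phi>)" using \<phi> by (auto simp: test_fun_iff intro: smooth_deriv)
  have d0: "deriv \<phi> x = 0" if "x \<notin> {c..d}" for x
    by (rule deriv_zero_outside[of "{c..d}"]) (use that cd(4) in auto)
  \<comment> \<open>Clamping the argument to [c,d] makes the function monotone on the whole line and
    hence Borel.\<close>
  define F0 where "F0 x = F (max c (min d x))" for x
  have F0: "F0 x = F x" if "x \<in> {c..d}" for x using that by (simp add: F0_def)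
  have mF0: "mono F0"
    unfolding F0_def by (rule monoI, rule mono) (use cd in \<open>auto simp: max_def min_def\<close>)
  define p where "p x = indicator {c..d} x * deriv \<phi> x" for x
  \<comment> \<open>Restricting the heights to a bounded interval makes the integrand integrable on
    the product; the discarded heights contribute 0.\<close>
  define q :: "real \<Rightarrow> real" where "q y = indicator {F c<..F d} y" for y
  have ftc: "(LINT x:{a..b}|lebesgue. deriv \<phi> x) = \<phi> b - \<phi> a" if "a \<le> b" for a b
  proof -
    have "(LINT x:{a..b}|lebesgue. deriv \<phi> x) = integral {a..b} (deriv \<phi>)"
      by (intro LINT_Icc absolutely_integrable_continuous_real smooth_continuous sm)
    also have "\<dots> = \<phi> b - \<phi> a"
      by (rule integral_unique, rule fundamental_theorem_of_calculus[OF that])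
        (use smooth_has_deriv[OF sm(1)] in \<open>auto simp flip: has_real_derivative_iff_has_vector_derivative
          intro: has_field_derivative_at_within\<close>)
    finally show ?thesis .
  qed
  define \<Phi> where "\<Phi> y = (LINT x|lebesgue. p x * (if F0 x < y then 1 else 0))" for y
  have \<Phi>_R: "\<Phi> y = \<phi> (Q y)" if y: "y \<in> R" for y
  proof -
    let ?e = "max c (min d (Q y))"
    have "\<Phi> y = (LINT x:{c..?e}|lebesgue. deriv \<phi> x)"
      unfolding \<Phi>_def
    proof -
      \<comment> \<open>At Q y itself \<open>F\<close> may lie on either side of y, and for Q y
        \<le> c the interval on the right degenerates to the point c.\<close>
      have "AE x in lebesgue. x \<notin> {Q y, c}" by (rule AE_not_finite) simp
      then have "AE x in lebesgue. p x * (if F0 x < y then 1 else 0) = indicator {c..?e} x *\<^sub>R deriv \<phi> x"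
      proof eventually_elim
        case (elim x)
        show ?case
        proof (cases "x \<in> {c..d}")
          case True
          then have xI: "x \<in> {-1<..<1}" using cd by auto
          show ?thesis
          proof (cases "x < Q y")
            case True
            then have "F0 x < y" using F_less[OF xI] F0 \<open>x \<in> {c..d}\<close> by simp
            then show ?thesis using True \<open>x \<in> {c..d}\<close> by (simp add: p_def indicator_def)
          next
            case False
            then have "Q y < x" using elim by simp
            then have "\<not> F0 x < y" using le_F[OF y xI] F0 \<open>x \<in> {c..d}\<close> by simp
            moreover have "x \<notin> {c..?e}" using \<open>Q y < x\<close> \<open>x \<in> {c..d}\<close> elim by (auto simp: max_def min_def)
            ultimately show ?thesis by (simp add: indicator_def)
          qed
        next
          case False
          have "?e \<le> d" using cd(2) by simp
          then have "x \<notin> {c..?e}" using False by auto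
          moreover have "p x = 0" using False by (simp add: p_def)
          ultimately show ?thesis by (simp only: indicator_simps simp_thms mult_zero_left scaleR_zero_left)
        qed
      qed
      then show "(LINT x|lebesgue. p x * (if F0 x < y then 1 else 0)) = (LINT x:{c..?e}|lebesgue. deriv \<phi> x)"
        using set_integral_cong_lebesgue[of UNIV "\<lambda>x. p x * (if F0 x < y then 1 else 0)" "\<lambda>x. indicator {c..?e} x *\<^sub>R deriv \<phi> x"]
        by (simp add: set_lebesgue_integral_def)
    qed
    also have "\<dots> = \<phi> ?e - \<phi> c" by (rule ftc) simp
    also have "\<dots> = \<phi> (Q y)" using \<phi>cd cd(4)[of "Q y"] by (auto simp: max_def min_def)
    finally show ?thesis .
  qed
  have \<Phi>_full: "\<Phi> y = 0" if "\<And>x. x \<in> {c..d} \<Longrightarrow> F x < y" for y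
  proof -
    have "\<Phi> y = (LINT x:{c..d}|lebesgue. deriv \<phi> x)"
      unfolding \<Phi>_def set_lebesgue_integral_def
      by (rule Bochner_Integration.integral_cong) (use that F0 in \<open>auto simp: p_def indicator_def\<close>)
    then show ?thesis using ftc[of c d] cd \<phi>cd by simp
  qed
  have \<Phi>_empty: "\<Phi> y = 0" if "\<And>x. x \<in> {c..d} \<Longrightarrow> y \<le> F x" for y
  proof -
    have "\<Phi> y = (LINT x|(lebesgue :: real measure). 0 :: real)"
      unfolding \<Phi>_def
    proof (rule Bochner_Integration.integral_cong[OF refl])
      fix x
      show "p x * (if F0 x < y then 1 else 0) = 0"
      proof (cases "x \<in> {c..d}")
        case True
        then show ?thesis using that[OF True] F0[OF True] by simp
      qed (simp add: p_def)
    qed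
    then show ?thesis by simp
  qed
  have "(LINT x:{-1<..<1}|dF. \<phi> x) = (LINT x|dF. indicator {-1<..<1} x *\<^sub>R \<phi> x)"
    by (simp add: set_lebesgue_integral_def)
  also have "\<dots> = (LINT y|lebesgue. indicator {-1<..<1} (QQ y) *\<^sub>R \<phi> (QQ y))"
    unfolding dF_def
    by (rule integral_distr[OF QQ_measurable])
      (intro borel_measurable_scaleR borel_measurable_indicator borel_measurable_continuous_onI smooth_continuous sm, simp)
  also have "\<dots> = (LINT y|lebesgue. q y * \<Phi> y)"
  proof (rule Bochner_Integration.integral_cong[OF refl])
    fix y
    have "indicator {-1<..<1} (QQ y) *\<^sub>R \<phi> (QQ y) = \<Phi> y"
    proof (cases "y \<in> R")
      case True
      then show ?thesis using Q_range[OF True] \<Phi>_R[OF True] by (simp add: QQ_def)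
    next
      case False
      then consider "\<forall>x\<in>{-1<..<1}. \<not> F x < y" | "\<forall>x\<in>{-1<..<1}. \<not> y \<le> F x" unfolding R_def by blast
      then have "\<Phi> y = 0"
      proof cases
        case 1
        have "y \<le> F x" if "x \<in> {c..d}" for x using 1 sub that by (meson not_less subsetD)
        then show ?thesis by (rule \<Phi>_empty)
      next
        case 2
        have "F x < y" if "x \<in> {c..d}" for x using 2 sub that by (meson not_le subsetD)
        then show ?thesis by (rule \<Phi>_full)
      qed
      then show ?thesis using False by (simp add: QQ_def)
    qed
    also have "\<Phi> y = q y * \<Phi> y"
    proof (cases "y \<in> {F c<..F d}")
      case False
      then consider "y \<le> F c" | "F d < y" by force
      then have "\<Phi> y = 0"
      proof cases
        case 1
        have "y \<le> F x" if "x \<in> {c..d}" for x using that cd by (intro order_trans[OF 1 mono]) auto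
        then show ?thesis by (rule \<Phi>_empty)
      next
        case 2
        have "F x < y" if "x \<in> {c..d}" for x using that cd by (intro le_less_trans[OF mono 2]) auto
        then show ?thesis by (rule \<Phi>_full)
      qed
      then show ?thesis by simp
    qed (simp add: q_def)
    finally show "indicator {-1<..<1} (QQ y) *\<^sub>R \<phi> (QQ y) = q y * \<Phi> y" .
  qed
  also have "\<dots> = (LINT y|lebesgue. LINT x|lebesgue. (if F0 x < y then 1 else 0) *\<^sub>R (p x * q y))"
  proof (rule Bochner_Integration.integral_cong[OF refl])
    fix y
    have "(LINT x|lebesgue. (if F0 x < y then 1 else 0) *\<^sub>R (p x * q y)) =
        (LINT x|lebesgue. q y * (p x * (if F0 x < y then 1 else 0)))"
      by (rule Bochner_Integration.integral_cong) auto
    then show "q y * \<Phi> y = (LINT x|lebesgue. (if F0 x < y then 1 else 0) *\<^sub>R (p x * q y))"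
      by (simp add: \<Phi>_def)
  qed
  also have "\<dots> = (LINT x|lebesgue. LINT y|lebesgue. (if F0 x < y then 1 else 0) *\<^sub>R (p x * q y))"
  proof -
    interpret pair_sigma_finite "lebesgue :: real measure" "lebesgue :: real measure"
      by (rule pair_sigma_finite_lebesgue)
    have p: "integrable lebesgue p"
    proof -
      have "deriv \<phi> absolutely_integrable_on {c..d}"
        by (intro absolutely_integrable_continuous_real smooth_continuous sm)
      then show ?thesis by (simp add: set_integrable_def p_def[abs_def])
    qed
    have q: "integrable lebesgue q"
      unfolding q_def[abs_def] using mono[of c d] cd by (intro integrable_real_indicator) auto
    have "F0 \<in> borel_measurable lborel" using borel_measurable_mono[OF mF0] by simp
    then have F0m: "F0 \<in> borel_measurable lebesgue" by (rule measurable_completion)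
    have idm: "(\<lambda>y::real. y) \<in> borel_measurable lebesgue" by (rule measurable_completion) simp
    have "(\<lambda>z. F0 (fst z)) \<in> borel_measurable (lebesgue \<Otimes>\<^sub>M (lebesgue :: real measure))"
      by (rule measurable_compose[OF measurable_fst F0m])
    moreover have "(\<lambda>z. snd z) \<in> borel_measurable ((lebesgue :: real measure) \<Otimes>\<^sub>M (lebesgue :: real measure))"
      by (rule measurable_compose[OF measurable_snd idm])
    ultimately have "{z \<in> space (lebesgue \<Otimes>\<^sub>M lebesgue). F0 (fst z) < snd z} \<in> sets (lebesgue \<Otimes>\<^sub>M lebesgue)"
      by (rule borel_measurable_less)
    then have T: "{z :: real \<times> real. F0 (fst z) < snd z} \<in> sets (lebesgue \<Otimes>\<^sub>M lebesgue)"
      by (simp add: space_pair_measure)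
    have i: "integrable (lebesgue \<Otimes>\<^sub>M lebesgue) (\<lambda>z. indicator {z. F0 (fst z) < snd z} z *\<^sub>R (case z of (x, y) \<Rightarrow> p x * q y))"
      by (rule integrable_mult_indicator[OF T integrable_tensor[OF p q]])
    have "(\<lambda>z. indicator {z. F0 (fst z) < snd z} z *\<^sub>R (case z of (x, y) \<Rightarrow> p x * q y)) =
        (\<lambda>(x, y). (if F0 x < y then 1 else 0) *\<^sub>R (p x * q y))"
      by (auto simp: fun_eq_iff indicator_def)
    with i have "integrable (lebesgue \<Otimes>\<^sub>M lebesgue) (\<lambda>(x, y). (if F0 x < y then 1 else 0) *\<^sub>R (p x * q y))" by simp
    then show ?thesis by (rule Fubini_integral)
  qed
  also have "\<dots> = (LINT x:{c..d}|lebesgue. F d * deriv \<phi> x - F x * deriv \<phi> x)"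
    unfolding set_lebesgue_integral_def
  proof (rule Bochner_Integration.integral_cong[OF refl])
    fix x
    show "(LINT y|lebesgue. (if F0 x < y then 1 else 0) *\<^sub>R (p x * q y)) =
        indicat_real {c..d} x *\<^sub>R (F d * deriv \<phi> x - F x * deriv \<phi> x)"
    proof (cases "x \<in> {c..d}")
      case True
      have Fx: "F c \<le> F x" "F x \<le> F d" using True cd by (auto intro!: mono)
      have "(LINT y|lebesgue. (if F0 x < y then 1 else 0) *\<^sub>R (p x * q y)) =
          (LINT y|lebesgue. p x * indicator {F x<..F d} y)"
        by (rule Bochner_Integration.integral_cong) (use True Fx in \<open>auto simp: F0 q_def indicator_def\<close>)
      also have "\<dots> = p x * measure lebesgue {F x<..F d}" by simp
      also have "measure lebesgue {F x<..F d} = F d - F x" using Fx by simp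
      finally show ?thesis using True by (simp add: p_def algebra_simps)
    qed (simp add: p_def)
  qed
  also have "\<dots> = F d * (LINT x:{c..d}|lebesgue. deriv \<phi> x) - (LINT x:{c..d}|lebesgue. F x * deriv \<phi> x)"
  proof -
    have d: "deriv \<phi> absolutely_integrable_on {c..d}"
      by (intro absolutely_integrable_continuous_real smooth_continuous sm)
    have "mono_on {c..d} F" by (rule mono_onI) (use cd in \<open>auto intro: mono\<close>)
    then have F: "F absolutely_integrable_on {c..d}" by (rule mono_absolutely_integrable)
    have "(\<lambda>x. deriv \<phi> x * F x) absolutely_integrable_on {c..d}"
    proof (rule absolutely_integrable_bounded_measurable_product_real[OF _ _ _ F])
      have co: "continuous_on {c..d} (deriv \<phi>)" by (rule smooth_continuous[OF sm(2)])
      show "deriv \<phi> \<in> borel_measurable (lebesgue_on {c..d})"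
        by (rule continuous_imp_measurable_on_sets_lebesgue[OF co]) simp
      show "bounded (deriv \<phi> ` {c..d})" by (rule compact_imp_bounded[OF compact_continuous_image[OF co]]) simp
    qed simp
    then have i: "(\<lambda>x. F x * deriv \<phi> x) absolutely_integrable_on {c..d}" by (simp add: mult.commute)
    have "(LINT x:{c..d}|lebesgue. F d * deriv \<phi> x - F x * deriv \<phi> x) =
        (LINT x:{c..d}|lebesgue. F d * deriv \<phi> x) - (LINT x:{c..d}|lebesgue. F x * deriv \<phi> x)"
      by (rule set_integral_diff(2)[OF set_integrable_mult_right i]) (rule d)
    then show ?thesis unfolding set_integral_mult_right .
  qed
  also have "(LINT x:{c..d}|lebesgue. deriv \<phi> x) = 0" using ftc[of c d] cd \<phi>cd by simp
  also have "(LINT x:{c..d}|lebesgue. F x * deriv \<phi> x) = (LINT x:{-1<..<1}|lebesgue. F x * deriv \<phi> x)"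
    by (rule set_integral_zero_outside[symmetric]) (use cd d0 in auto)
  finally show ?thesis by simp
qed

end

lemma null_locally:
  assumes M: "sets M = sets borel" and U: "open (U :: real set)"
    and l: "\<And>x. x \<in> U \<Longrightarrow> \<exists>p q. p < x \<and> x < q \<and> emeasure M {p<..<q} = 0"
  shows "AE x in M. x \<notin> U"
proof -
  define A where "A = {{p<..<q} | p q. emeasure M {p<..<q} = 0}"
  have A: "open B" if "B \<in> A" for B using that by (auto simp: A_def)
  obtain A' where A': "A' \<subseteq> A" "countable A'" "\<Union>A' = \<Union>A" using Lindelof[of A] A by blast
  have "B \<in> null_sets M" if "B \<in> A'" for B
    using that A' A[of B] M unfolding A_def null_sets_def by auto
  then have "(\<Union>B\<in>A'. B) \<in> null_sets M" using A'(2) by (intro null_sets_UN') auto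
  then have "AE x in M. x \<notin> \<Union>A'" by (intro AE_not_in) simp
  moreover have "U \<subseteq> \<Union>A'"
  proof
    fix x assume "x \<in> U"
    then obtain p q where pq: "p < x" "x < q" "emeasure M {p<..<q} = 0" using l by blast
    then have "x \<in> {p<..<q}" "{p<..<q} \<in> A" unfolding A_def by auto
    then show "x \<in> \<Union>A'" unfolding A'(3) by blast
  qed
  ultimately show ?thesis by (elim eventually_mono) blast
qed

section \<open>The variational inequality\<close>

context obstacle
begin

text \<open>The measure is \<open>dF\<close> for the derivative \<open>F\<close> of the convex
  function. Off contact \<open>g\<close> is locally affine, so \<open>F\<close> is locally constant
  and no mass lies there.\<close>

lemma variation_measure:
  "\<exists>M. radon_on {-1<..<1} M \<and> (AE x in M. x \<notin> noncontact w u) \<and>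
    (\<forall>\<phi>. test_fun {-1<..<1} \<phi> \<longrightarrow> (LINT x:{-1<..<1}|M. \<phi> x) = integral {-2..2} (\<lambda>x. g x * deriv (deriv \<phi>) x))"
proof -
  obtain N where "ae_convex g N" using g_ae_convex by blast
  then interpret ae_convex g N .
  interpret monotone_density F by unfold_locales (rule F_mono)
  have "AE x in dF. x \<notin> noncontact w u"
  proof (rule null_locally[OF _ open_noncontact])
    show "sets dF = sets borel" using radon_dF by (simp add: radon_on_def)
    fix x assume "x \<in> noncontact w u"
    then obtain p q c where pq: "-1 \<le> p" "p < x" "x < q" "q \<le> 1" "c > 0"
      "AE y in lebesgue. y \<in> {p<..<q} \<longrightarrow> w y + c \<le> u0 y" using gap_both by blast
    then have "p < q" by simp
    then obtain a b where ab: "AE s in lebesgue. s \<in> {p<..<q} \<longrightarrow> g s = a + b * s"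
      using g_affine[OF pq(1,4) _ pq(5,6)] by blast
    have "emeasure dF {p<..<q} = 0"
      by (rule dF_null[OF pq(1,4)]) (rule F_const[OF pq(1,4) ab])
    then show "\<exists>p q. p < x \<and> x < q \<and> emeasure dF {p<..<q} = 0" using pq by blast
  qed
  moreover have "(LINT x:{-1<..<1}|dF. \<phi> x) = integral {-2..2} (\<lambda>x. g x * deriv (deriv \<phi>) x)"
    if \<phi>: "test_fun {-1<..<1} \<phi>" for \<phi>
  proof -
    have sub: "{-1<..<1} \<subseteq> {-2<..<2::real}" "{-1<..<1} \<subseteq> {-2..2::real}" by auto
    have "weak_deriv {-1<..<1} g F" by (rule weak_deriv_g[OF AI_loc_integrable[OF AI_g sub(2)]])
    then have "(LINT x:{-1<..<1}|lebesgue. g x * deriv (deriv \<phi>) x) = - (LINT x:{-1<..<1}|lebesgue. F x * deriv \<phi> x)"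
      using test_fun_deriv[OF \<phi>] by (simp add: weak_deriv_def)
    moreover have "(LINT x:{-1<..<1}|lebesgue. g x * deriv (deriv \<phi>) x) = integral {-2..2} (\<lambda>x. g x * deriv (deriv \<phi>) x)"
    proof (rule LINT_test_eq_integral[OF test_fun_deriv[OF test_fun_deriv[OF \<phi>]] sub(1)])
      show "AI (\<lambda>x. g x * deriv (deriv \<phi>) x)"
        using AI_mult[OF AI_g smooth_continuous[OF test_fun_smooth[OF test_fun_deriv[OF test_fun_deriv[OF \<phi>]]]]]
        by (simp add: mult.commute)
    qed
    ultimately show ?thesis using integral_dF[OF \<phi>] by simp
  qed
  ultimately show ?thesis using radon_dF by blast
qed

text \<open>Two integrations by parts starting from \<open>u\<close> and two starting from
  \<open>k\<close> meet in the integral of \<open>g\<close> against the second derivative of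
  \<open>\<phi>\<close>. The jumps of \<open>u\<close> contribute nothing because the support of
  \<open>\<phi>\<close> avoids both discontinuity sets.\<close>

lemma fourth_derivative:
  assumes \<phi>: "test_fun ({-1<..<1} - (disc u \<union> disc (D1 u))) \<phi>"
  shows "(LINT x:{-1<..<1} - (disc u \<union> disc (D1 u))|lebesgue.
      \<eta> * u x * (deriv ^^ 4) \<phi> x + (\<mu> * (u x - w x) - f x / 2) * \<phi> x) =
    integral {-2..2} (\<lambda>x. g x * deriv (deriv \<phi>) x)"
proof -
  let ?O = "{-1<..<1} - (disc u \<union> disc (D1 u))"
  have sub: "?O \<subseteq> {-2<..<2}" by auto
  define \<phi>1 \<phi>2 \<phi>3 \<phi>4 where "\<phi>1 = deriv \<phi>" and "\<phi>2 = deriv \<phi>1" and "\<phi>3 = deriv \<phi>2" and "\<phi>4 = deriv \<phi>3"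
  have t: "test_fun ?O \<phi>1" "test_fun ?O \<phi>2" "test_fun ?O \<phi>3" "test_fun ?O \<phi>4"
    unfolding \<phi>4_def \<phi>3_def \<phi>2_def \<phi>1_def by (intro test_fun_deriv \<phi>)+
  have p: "prim \<phi>1 x = \<phi> x" "prim \<phi>2 x = \<phi>1 x" "prim \<phi>3 x = \<phi>2 x" "prim \<phi>4 x = \<phi>3 x" if "-2 \<le> x" for x
    using test_fun_bounds(3)[OF \<phi> sub that] test_fun_bounds(3)[OF t(1) sub that]
      test_fun_bounds(3)[OF t(2) sub that] test_fun_bounds(3)[OF t(3) sub that]
    by (simp_all add: \<phi>1_def \<phi>2_def \<phi>3_def \<phi>4_def)
  have z: "\<phi> 2 = 0" "\<phi>1 2 = 0" "\<phi>2 2 = 0" "\<phi>3 2 = 0"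
    using test_fun_bounds(2)[OF \<phi> sub] test_fun_bounds(2)[OF t(1) sub] test_fun_bounds(2)[OF t(2) sub]
      test_fun_bounds(2)[OF t(3) sub] by simp_all
  have AIt: "AI \<phi>" "AI \<phi>1" "AI \<phi>2" "AI \<phi>3" "AI \<phi>4" by (rule AI_test_fun, fact \<phi> t)+
  have co: "continuous_on {-2..2} \<phi>" "continuous_on {-2..2} \<phi>2"
    by (intro smooth_continuous test_fun_smooth[OF \<phi>] test_fun_smooth[OF t(2)])+
  have S: "S \<subseteq> {-2..2}" using u_rep by (auto simp: rep_def)
  have c: "integral {-2..2} (\<lambda>x. v x * prim q x) = integral {-2..2} (\<lambda>x. v x * q' x)"
    if "\<And>x. -2 \<le> x \<Longrightarrow> prim q x = q' x" for v q q'
    by (rule Henstock_Kurzweil_Integration.integral_cong) (use that in simp)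
  have sum0: "(\<Sum>s\<in>S. J s * prim q s) = 0"
    if "\<And>x. -2 \<le> x \<Longrightarrow> prim q x = q' x" "test_fun ?O q'" "{x. J x \<noteq> 0} \<subseteq> disc u \<union> disc (D1 u)" for J q q'
  proof (rule sum.neutral, rule ballI)
    fix s assume s: "s \<in> S"
    have "J s = 0 \<or> q' s = 0" using test_fun_eq_0[OF that(2), of s] that(3) by blast
    then show "J s * prim q s = 0" using that(1)[of s] s S by auto
  qed
  have Jd: "{x. J0 x \<noteq> 0} \<subseteq> disc u \<union> disc (D1 u)" "{x. J1 x \<noteq> 0} \<subseteq> disc u \<union> disc (D1 u)"
    using prep_values(1,2)[OF u_prep] by auto
  have "integral {-2..2} (\<lambda>x. u0 x * \<phi>4 x) = - integral {-2..2} (\<lambda>x. u1 x * \<phi>3 x)"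
    using rep_by_parts(1)[OF u_rep AIt(5)] c[OF p(4), of u1] sum0[OF p(4) t(3) Jd(1)] p(4)[of 2] z(4) by simp
  also have "integral {-2..2} (\<lambda>x. u1 x * \<phi>3 x) = - integral {-2..2} (\<lambda>x. u2 x * \<phi>2 x)"
    using rep_by_parts(2)[OF u_rep AIt(4)] c[OF p(3), of u2] sum0[OF p(3) t(2) Jd(2)] p(3)[of 2] z(3) by simp
  finally have u4: "integral {-2..2} (\<lambda>x. u0 x * \<phi>4 x) = integral {-2..2} (\<lambda>x. u2 x * \<phi>2 x)" by simp
  have "integral {-2..2} (\<lambda>x. k x * \<phi> x) = - integral {-2..2} (\<lambda>x. K1 x * \<phi>1 x)"
    using prim_by_parts[OF AI_k AIt(2)] c[OF p(1), of k] p(1)[of 2] z(1) by (simp add: K1_def)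
  also have "integral {-2..2} (\<lambda>x. K1 x * \<phi>1 x) = - integral {-2..2} (\<lambda>x. K2 x * \<phi>2 x)"
    using prim_by_parts[OF AI_cont[OF K1_cont] AIt(3)] c[OF p(2), of K1] p(2)[of 2] z(2) by (simp add: K2_def)
  finally have k2: "integral {-2..2} (\<lambda>x. k x * \<phi> x) = integral {-2..2} (\<lambda>x. K2 x * \<phi>2 x)" by simp
  have i: "AI (\<lambda>x. u0 x * \<phi>4 x)" "AI (\<lambda>x. k x * \<phi> x)" "AI (\<lambda>x. u2 x * \<phi>2 x)" "AI (\<lambda>x. K2 x * \<phi>2 x)"
    using rep_by_parts(3)[OF u_rep AIt(5)] AI_mult[OF AI_k co(1)] AI_mult[OF rep_AI(1)[OF u_rep] co(2)]
      AI_mult[OF AIt(3) K2_cont] by (simp_all add: mult.commute)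
  have "(LINT x:?O|lebesgue. \<eta> * u x * (deriv ^^ 4) \<phi> x + (\<mu> * (u x - w x) - f x / 2) * \<phi> x) =
      (LINT x:?O|lebesgue. \<eta> * (u0 x * \<phi>4 x) + k x * \<phi> x)"
  proof (rule set_integral_cong_lebesgue)
    have d4: "(deriv ^^ 4) \<phi> = \<phi>4" by (simp add: \<phi>1_def \<phi>2_def \<phi>3_def \<phi>4_def eval_nat_numeral)
    show "AE x in lebesgue. x \<in> ?O \<longrightarrow> \<eta> * u x * (deriv ^^ 4) \<phi> x + (\<mu> * (u x - w x) - f x / 2) * \<phi> x =
        \<eta> * (u0 x * \<phi>4 x) + k x * \<phi> x"
      using u_ae by eventually_elim (auto simp: d4 k_def)
  qed
  also have "\<dots> = (LINT x:{-2..2}|lebesgue. \<eta> * (u0 x * \<phi>4 x) + k x * \<phi> x)"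
    by (rule set_integral_zero_outside[symmetric])
      (use sub test_fun_eq_0[OF \<phi>] test_fun_eq_0[OF t(4)] in auto)
  also have "\<dots> = integral {-2..2} (\<lambda>x. \<eta> * (u0 x * \<phi>4 x) + k x * \<phi> x)"
    by (intro LINT_Icc set_integral_add(1) set_integrable_mult_right i)
  also have "\<dots> = \<eta> * integral {-2..2} (\<lambda>x. u0 x * \<phi>4 x) + integral {-2..2} (\<lambda>x. k x * \<phi> x)"
    by (intro integral_unique has_integral_add has_integral_mult_right integrable_integral AI_integrable i)
  also have "\<dots> = \<eta> * integral {-2..2} (\<lambda>x. u2 x * \<phi>2 x) + integral {-2..2} (\<lambda>x. K2 x * \<phi>2 x)"
    unfolding u4 k2 ..
  also have "\<dots> = integral {-2..2} (\<lambda>x. \<eta> * (u2 x * \<phi>2 x) + K2 x * \<phi>2 x)"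
    by (intro integral_unique[symmetric] has_integral_add has_integral_mult_right integrable_integral AI_integrable i)
  also have "\<dots> = integral {-2..2} (\<lambda>x. g x * deriv (deriv \<phi>) x)"
    by (rule Henstock_Kurzweil_Integration.integral_cong) (simp add: g_def \<phi>1_def \<phi>2_def algebra_simps)
  finally show ?thesis .
qed

lemma K_trace_ge:
  assumes "v \<in> K w" "-2 < x" "x < 2"
  shows "w x \<le> rtrace v x" "w x \<le> ltrace v x"
proof -
  have "piecewise_H2 v" using assms(1) by (simp add: K_def)
  then obtain T L0 L1 v0 v1 v2 where p: "prep v T L0 L1 v0 v1 v2" using piecewise_H2_imp_prep by blast
  have "AE x in lebesgue. x \<in> {-2<..<2} \<longrightarrow> w x \<le> v0 x" using prep_K_iff[OF p w_cont] assms(1) by blast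
  note ge = prep_ge[OF p w_cont this]
  show "w x \<le> rtrace v x" "w x \<le> ltrace v x"
    using ge[of x] prep_values(3,4)[OF p, of x] assms by auto
qed

text \<open>The Jordan decomposition has no negative part. On the domain the measure lives where u =
  w, and there u \<le> v for every admissible v, so the positive part of the integral is 0; the
  negative part may be infinite without affecting the sign.\<close>

lemma variational: "variational_inequality \<eta> \<mu> f w u"
proof -
  let ?O = "{-1<..<1} - (disc u \<union> disc (D1 u))"
  obtain M where M: "radon_on {-1<..<1} M" "AE x in M. x \<notin> noncontact w u"
    and int: "\<And>\<phi>. test_fun {-1<..<1} \<phi> \<Longrightarrow> (LINT x:{-1<..<1}|M. \<phi> x) = integral {-2..2} (\<lambda>x. g x * deriv (deriv \<phi>) x)"
    using variation_measure by blast
  have sub: "?O \<subseteq> {-1<..<1}" by blast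
  let ?N = "null_measure borel :: real measure"
  have eq: "(LINT x:?O|lebesgue. \<eta> * u x * (deriv ^^ 4) \<phi> x + (\<mu> * (u x - w x) - f x / 2) * \<phi> x) =
      (LINT x:?O|M. \<phi> x) - (LINT x:?O|?N. \<phi> x)" if \<phi>: "test_fun ?O \<phi>" for \<phi>
  proof -
    have "(LINT x:{-1<..<1}|M. \<phi> x) = (LINT x:?O|M. \<phi> x)"
      by (rule set_integral_zero_outside[OF sub]) (use test_fun_eq_0[OF \<phi>] in blast)
    moreover have "(LINT x:?O|?N. \<phi> x) = 0" by (simp add: set_lebesgue_integral_def)
    ultimately show ?thesis
      using fourth_derivative[OF \<phi>] int[OF test_fun_mono[OF \<phi> sub]] by simp
  qed
  have ineq: "signed_integral ?O M ?N (\<lambda>x. ess_value u x - v' x) \<le> 0"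
    if v: "v \<in> K w" and v': "\<And>x. x \<in> ?O \<Longrightarrow> v' x = rtrace v x \<or> v' x = ltrace v x" for v v'
  proof -
    have "AE x in M. ennreal (ess_value u x - v' x) * indicator ?O x = 0"
      using M(2)
    proof eventually_elim
      case (elim x)
      show ?case
      proof (cases "x \<in> ?O")
        case True
        then have x: "-1 < x" "x < 1" "x \<notin> disc u" by auto
        have J: "J0 x = 0" using x(3) prep_values(1)[OF u_prep] by blast
        have "u0 x \<le> w x" using elim x J by (auto simp: noncontact_iff)
        moreover have "ess_value u x = u0 x" using prep_values(5)[OF u_prep, of x] x by auto
        moreover have "w x \<le> v' x" using v'[OF True] K_trace_ge[OF v, of x] x by auto
        ultimately show ?thesis by (simp add: ennreal_neg)
      qed simp
    qed
    then have "(\<integral>\<^sup>+x\<in>?O. ennreal (ess_value u x - v' x) \<partial>M) = (\<integral>\<^sup>+x. 0 \<partial>M)" by (rule nn_integral_cong_AE)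
    then have 0: "(\<integral>\<^sup>+x\<in>?O. ennreal (ess_value u x - v' x) \<partial>M) = 0" by simp
    show ?thesis
      unfolding signed_integral_def 0 by (simp add: zero_ennreal.rep_eq)
  qed
  show ?thesis
    unfolding variational_inequality_def Let_def
    by (intro exI[of _ M] exI[of _ ?N] conjI allI ballI impI radon_on_subset[OF M(1) sub]
      radon_on_null_measure singular_on_null_measure eq ineq) blast+
qed

end

section \<open>The end points\<close>

lemma AE_imp: "(\<forall>y\<in>A. P y) \<Longrightarrow> AE y in lebesgue. y \<in> A \<longrightarrow> P y"
  by (rule AE_I2) blast

section \<open>Traces inherited from \<open>w\<close> outside, and the end points\<close>

context obstacle
begin

lemma AI_w': "AI w'" by (rule AI_cont[OF w'_cont])

lemma w_prim:
  assumes "-2 \<le> x" "x \<le> 2"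
  shows "w x = w (-2) + prim w' x"
proof -
  have "(w' has_integral w x - w (-2)) {-2..x}"
  proof (rule fundamental_theorem_of_calculus[OF assms(1)])
    fix y assume "y \<in> {-2..x}"
    then have "(w has_real_derivative w' y) (at y within {-2..x})"
      using DERIV_subset[OF w_deriv, of y "{-2..x}"] assms by auto
    then show "(w has_vector_derivative w' y) (at y within {-2..x})"
      by (simp add: has_real_derivative_iff_has_vector_derivative)
  qed
  then show ?thesis by (simp add: prim_def integral_unique)
qed

lemma outer_u0:
  assumes "a = -2 \<and> b = -1 \<or> a = 1 \<and> b = (2::real)"
  shows "AE x in lebesgue. x \<in> {a<..<b} \<longrightarrow> u0 x = w x"
  using u_outer u_ae
proof eventually_elim
  case (elim x)
  then show ?case using assms by auto
qed

text \<open>On an outer interval \<open>u\<close> is a constant plus the primitive of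
  \<open>w'\<close>, and uniqueness of the absolutely continuous part carries this over to the
  slope.\<close>

lemma outer_u1:
  assumes "a = -2 \<and> b = -1 \<or> a = 1 \<and> b = (2::real)"
  shows "AE x in lebesgue. x \<in> {a<..<b} \<longrightarrow> u1 x = w' x"
proof -
  have sub: "{a<..<b} \<subseteq> {-2<..<2}" using assms by auto
  have "AE x in lebesgue. x \<in> {a<..<b} \<longrightarrow> u x = w (-2) + prim w' x"
    using u_outer
  proof eventually_elim
    case (elim x)
    then show ?case using assms w_prim[of x] by auto
  qed
  then have "weak_deriv {a<..<b} u w'" by (rule weak_deriv_const_prim[OF AI_w' sub])
  then have "ac_part_on {a<..<b} u w'" by (rule weak_deriv_imp_ac_part)
  then have "AE x in lebesgue. x \<in> {a<..<b} \<longrightarrow> D1 u x = w' x" by (rule ac_deriv_eq[OF open_greaterThanLessThan sub])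
  with prep_D(1)[OF u_prep] show ?thesis
  proof eventually_elim
    case (elim x)
    then show ?case using sub by auto
  qed
qed

lemma outer_u0_eq:
  assumes "a = -2 \<and> b = -1 \<or> a = 1 \<and> b = (2::real)"
  shows "a \<le> x \<Longrightarrow> x < b \<Longrightarrow> u0 x + J0 x = w x" and "a < x \<Longrightarrow> x \<le> b \<Longrightarrow> u0 x = w x"
proof -
  have ab: "-2 \<le> a" "b \<le> 2" using assms by auto
  note * = one_sided_eq[OF w_cont ab outer_u0[OF assms] rep_tendsto(1,2)[OF u_rep]]
  show "a \<le> x \<Longrightarrow> x < b \<Longrightarrow> u0 x + J0 x = w x" and "a < x \<Longrightarrow> x \<le> b \<Longrightarrow> u0 x = w x"
    using * by blast+
qed

lemma outer_u1_eq:
  assumes "a = -2 \<and> b = -1 \<or> a = 1 \<and> b = (2::real)"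
  shows "a \<le> x \<Longrightarrow> x < b \<Longrightarrow> u1 x + J1 x = w' x" and "a < x \<Longrightarrow> x \<le> b \<Longrightarrow> u1 x = w' x"
proof -
  have ab: "-2 \<le> a" "b \<le> 2" using assms by auto
  note * = one_sided_eq[OF w'_cont ab outer_u1[OF assms] rep_tendsto(3,4)[OF u_rep]]
  show "a \<le> x \<Longrightarrow> x < b \<Longrightarrow> u1 x + J1 x = w' x" and "a < x \<Longrightarrow> x \<le> b \<Longrightarrow> u1 x = w' x"
    using * by blast+
qed

text \<open>From outside, \<open>u\<close> and its slope take the values of \<open>w\<close> and
  \<open>w'\<close> at the end points. With left-continuous representatives the outer limit at -1 is
  the value itself, whereas at 1 it is the value plus the jump.\<close>

lemma boundary_values:
  "u0 (-1) = w (-1)" "u1 (-1) = w' (-1)" "u0 1 + J0 1 = w 1" "u1 1 + J1 1 = w' 1"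
  using outer_u0_eq[of "-2" "-1" "-1"] outer_u1_eq[of "-2" "-1" "-1"] outer_u0_eq[of 1 2 1] outer_u1_eq[of 1 2 1]
  by auto

lemma jump_inside:
  assumes "J0 x \<noteq> 0 \<or> J1 x \<noteq> 0"
  shows "-1 \<le> x" "x \<le> 1"
proof -
  have "x \<in> S" using assms u_rep by (auto simp: rep_def)
  then have x: "-2 < x" "x < 2" using u_rep by (auto simp: rep_def)
  have "J0 x = 0 \<and> J1 x = 0" if "x < -1"
    using outer_u0_eq[of "-2" "-1" x] outer_u1_eq[of "-2" "-1" x] x that by auto
  moreover have "J0 x = 0 \<and> J1 x = 0" if "1 < x"
    using outer_u0_eq[of 1 2 x] outer_u1_eq[of 1 2 x] x that by auto
  ultimately show "-1 \<le> x" "x \<le> 1" using assms by force+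
qed

lemma disc_iff: "x \<in> disc u \<longleftrightarrow> J0 x \<noteq> 0" "x \<in> disc (D1 u) \<longleftrightarrow> J1 x \<noteq> 0"
  using prep_values(1,2)[OF u_prep] by auto

lemma jump_free:
  assumes x: "x \<in> noncontact w u" and J: "J0 x \<noteq> 0 \<or> \<alpha> = \<beta> \<and> (J0 x \<noteq> 0 \<or> J1 x \<noteq> 0)"
  shows "has_rtrace (D2 u) x 0 \<and> has_rtrace (D3 u) x 0 \<and> has_ltrace (D2 u) x 0 \<and> has_ltrace (D3 u) x 0"
proof -
  obtain p q c where pq: "-1 \<le> p" "p < x" "x < q" "q \<le> 1" "c > 0"
    "AE y in lebesgue. y \<in> {p<..<q} \<longrightarrow> w y + c \<le> u0 y" using gap_both[OF x] by blast
  have "AE s in lebesgue. s \<in> {p<..<q} \<longrightarrow> gx x s = 0 * (s - x)"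
    by (rule gx_free[OF pq(1) _ _ pq(4) _ J pq(5,6)]) (use pq in auto)
  then show ?thesis using gx_linear_traces[of p x q 0] pq by auto
qed

text \<open>One slope b serves both sides of x, because a single \<theta> is tested across x; hence
  the two limits of \<open>u'''\<close> agree.\<close>

lemma jump_slope:
  assumes x: "x \<in> noncontact w u" and J: "J0 x \<noteq> 0 \<or> J1 x \<noteq> 0"
  shows "\<exists>l. has_rtrace (D2 u) x 0 \<and> has_rtrace (D3 u) x l \<and> has_ltrace (D2 u) x 0 \<and> has_ltrace (D3 u) x l"
proof -
  obtain p q c where pq: "-1 \<le> p" "p < x" "x < q" "q \<le> 1" "c > 0"
    "AE y in lebesgue. y \<in> {p<..<q} \<longrightarrow> w y + c \<le> u0 y" using gap_both[OF x] by blast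
  obtain b where "AE s in lebesgue. s \<in> {p<..<q} \<longrightarrow> gx x s = b * (s - x)"
    using gx_slope[OF pq(1) _ _ pq(4) _ J pq(5,6)] pq by auto
  then show ?thesis using gx_linear_traces[of p x q b] pq by auto
qed

text \<open>Off contact the inner trace differs from the outer value w(-1), so the value jumps at -1
  and both value and slope are free. In particular a detached end point never has a slope jump
  alone.\<close>

lemma left_end_free:
  assumes "w (-1) < rtrace u (-1)"
  shows "J0 (-1) \<noteq> 0" "has_rtrace (D2 u) (-1) 0 \<and> has_rtrace (D3 u) (-1) 0"
proof -
  have gt: "w (-1) < u0 (-1) + J0 (-1)" using assms u_traces(1)[of "-1"] by simp
  then show J: "J0 (-1) \<noteq> 0" using boundary_values(1) by auto
  obtain q c where q: "-1 < q" "q \<le> 1" "c > 0" "\<forall>y\<in>{-1<..<q}. w y + c \<le> u0 y \<and> w y < u0 y + J0 y"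
    using gap_right[of "-1"] gt by auto
  have "\<forall>y\<in>{-1<..<q}. w y + c \<le> u0 y" using q(4) by blast
  note ae = AE_imp[OF this]
  have "AE s in lebesgue. s \<in> {-1<..<q} \<longrightarrow> gx (-1) s = 0 * (s - (-1))"
    by (rule gx_free[OF _ _ _ q(2) _ _ q(3) ae]) (use q J in auto)
  then show "has_rtrace (D2 u) (-1) 0 \<and> has_rtrace (D3 u) (-1) 0"
    using gx_linear_traces(1)[of "-1" "-1" q 0] q by auto
qed

lemma right_end_free:
  assumes "w 1 < ltrace u 1"
  shows "J0 1 \<noteq> 0" "has_ltrace (D2 u) 1 0 \<and> has_ltrace (D3 u) 1 0"
proof -
  have gt: "w 1 < u0 1" using assms u_traces(2)[of 1] by simp
  then show J: "J0 1 \<noteq> 0" using boundary_values(3) by auto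
  obtain p c where p: "-1 \<le> p" "p < 1" "c > 0" "\<forall>y\<in>{p<..<1}. w y + c \<le> u0 y \<and> w y < u0 y + J0 y"
    using gap_left[of 1] gt by auto
  have "\<forall>y\<in>{p<..<1}. w y + c \<le> u0 y" using p(4) by blast
  note ae = AE_imp[OF this]
  have "AE s in lebesgue. s \<in> {p<..<1} \<longrightarrow> gx 1 s = 0 * (s - 1)"
    by (rule gx_free[OF p(1) _ _ _ p(2) _ p(3) ae]) (use p J in auto)
  then show "has_ltrace (D2 u) 1 0 \<and> has_ltrace (D3 u) 1 0"
    using gx_linear_traces(2)[of p 1 1 0] p by auto
qed

lemma u0_minus_w:
  assumes "-2 \<le> a" "a < b" "b \<le> 2" "S \<inter> {a<..<b} = {}" "a < x" "x \<le> y" "y \<le> b"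
  shows "(u0 y - w y) - (u0 x - w x) = integral {x..y} (\<lambda>t. u1 t - w' t)"
proof -
  obtain c where c: "\<forall>x\<in>{a<..b}. u0 x = c + prim u1 x" using rep_piece(1)[OF u_rep assms(1,3,4)] by blast
  have i: "u1 integrable_on {x..y}" "w' integrable_on {x..y}"
    using AI_integrable_sub[OF rep_AI(2)[OF u_rep], of x y] AI_integrable_sub[OF AI_w', of x y] assms by auto
  have "prim u1 y - prim u1 x = integral {x..y} u1" "prim w' y - prim w' x = integral {x..y} w'"
    using prim_diff[OF rep_AI(2)[OF u_rep], of x y] prim_diff[OF AI_w', of x y] assms by auto
  moreover have "u0 y - u0 x = prim u1 y - prim u1 x" using c assms by auto
  moreover have "w y - w x = prim w' y - prim w' x" using w_prim[of x] w_prim[of y] assms by auto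
  ultimately show ?thesis
    unfolding Henstock_Kurzweil_Integration.integral_diff[OF i] by simp
qed

text \<open>At an end point in contact only the slope jumps; since \<open>u \<ge> w\<close>, the slope of \<open>u - w\<close>
  points upwards, so that \<open>u\<close> leaves the obstacle linearly and the end point is free to turn.\<close>

lemma left_end_contact:
  assumes tr: "rtrace u (-1) = w (-1)" and J: "J0 (-1) \<noteq> 0 \<or> J1 (-1) \<noteq> 0"
  shows "has_rtrace (D2 u) (-1) 0"
proof -
  have "u0 (-1) + J0 (-1) = w (-1)" using tr u_traces(1)[of "-1"] by simp
  then have J0: "J0 (-1) = 0" using boundary_values(1) by simp
  define L where "L = J1 (-1)"
  have L0: "L \<noteq> 0" using J J0 by (simp add: L_def)
  have "((\<lambda>y. u1 y - w' y) \<longlongrightarrow> u1 (-1) + J1 (-1) - w' (-1)) (at_right (-1))"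
    by (intro tendsto_diff rep_tendsto(3)[OF u_rep] cont_Icc_tendsto(1)[OF w'_cont]) auto
  then have lim: "((\<lambda>y. u1 y - w' y) \<longlongrightarrow> L) (at_right (-1))" by (simp add: L_def boundary_values(2))
  have "((\<lambda>y. u0 y - w y) \<longlongrightarrow> u0 (-1) + J0 (-1) - w (-1)) (at_right (-1))"
    by (intro tendsto_diff rep_tendsto(1)[OF u_rep] cont_Icc_tendsto(1)[OF w_cont]) auto
  then have lim0: "((\<lambda>y. u0 y - w y) \<longlongrightarrow> 0) (at_right (-1))" by (simp add: J0 boundary_values(1))
  have "finite S" using u_rep by (simp add: rep_def)
  have "eventually (\<lambda>y. y \<notin> S) (at_right (-1))"
  proof -
    have "open (- (S - {-1}))" by (intro open_Compl finite_imp_closed finite_Diff \<open>finite S\<close>)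
    then have "eventually (\<lambda>y. y \<in> - (S - {-1})) (nhds (-1))" by (rule eventually_nhds_in_open) simp
    then show ?thesis unfolding eventually_at_filter by eventually_elim auto
  qed
  moreover have "eventually (\<lambda>y. \<bar>u1 y - w' y - L\<bar> < \<bar>L\<bar> / 2) (at_right (-1))"
    using lim[unfolded tendsto_iff, rule_format, of "\<bar>L\<bar> / 2"] L0 by (simp add: dist_real_def)
  ultimately have "eventually (\<lambda>y. y \<notin> S \<and> \<bar>u1 y - w' y - L\<bar> < \<bar>L\<bar> / 2) (at_right (-1))" by (rule eventually_conj)
  then obtain q' where q': "-1 < q'" "\<forall>y>-1. y < q' \<longrightarrow> y \<notin> S \<and> \<bar>u1 y - w' y - L\<bar> < \<bar>L\<bar> / 2"
    unfolding eventually_at_right_field by auto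
  define q where "q = min q' 1"
  have q: "-1 < q" "q \<le> 1" "\<And>y. -1 < y \<Longrightarrow> y < q \<Longrightarrow> y \<notin> S \<and> \<bar>u1 y - w' y - L\<bar> < \<bar>L\<bar> / 2"
    using q' by (auto simp: q_def)
  have Sq: "S \<inter> {-1<..<q} = {}" using q(3) by auto
  have int: "integral {x..y} (\<lambda>t. u1 t - w' t) \<in> {(L - \<bar>L\<bar> / 2) * (y - x)..(L + \<bar>L\<bar> / 2) * (y - x)}"
    if xy: "-1 < x" "x \<le> y" "y < q" for x y
  proof -
    have i: "(\<lambda>t. u1 t - w' t) integrable_on {x..y}"
      using AI_integrable_sub[OF rep_AI(2)[OF u_rep], of x y] AI_integrable_sub[OF AI_w', of x y] xy q(2)
      by (intro integrable_diff) auto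
    have b: "L - \<bar>L\<bar> / 2 \<le> u1 t - w' t" "u1 t - w' t \<le> L + \<bar>L\<bar> / 2" if "t \<in> {x..y}" for t
    proof -
      have "\<bar>u1 t - w' t - L\<bar> < \<bar>L\<bar> / 2" using q(3)[of t] that xy by simp
      then show "L - \<bar>L\<bar> / 2 \<le> u1 t - w' t" "u1 t - w' t \<le> L + \<bar>L\<bar> / 2"
        unfolding abs_less_iff by linarith+
    qed
    have "integral {x..y} (\<lambda>t. L - \<bar>L\<bar> / 2) \<le> integral {x..y} (\<lambda>t. u1 t - w' t)"
      by (rule integral_le) (use i b in auto)
    moreover have "integral {x..y} (\<lambda>t. u1 t - w' t) \<le> integral {x..y} (\<lambda>t. L + \<bar>L\<bar> / 2)"
      by (rule integral_le) (use i b in auto)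
    ultimately show ?thesis using xy by (simp add: mult.commute)
  qed
  have diff: "(u0 y - w y) - (u0 x - w x) = integral {x..y} (\<lambda>t. u1 t - w' t)"
    if "-1 < x" "x \<le> y" "y < q" for x y
    by (rule u0_minus_w[of "-1" q]) (use that q Sq in auto)
  have ev: "eventually (\<lambda>x. -1 < x \<and> x < y) (at_right (-1))" if "-1 < y" for y :: real
    using eventually_at_right_real[OF that] by eventually_elim simp
  \<comment> \<open>The integral formula holds only strictly to the right of -1, since the piece is
    open at its left end; the end point is reached by letting x tend to -1.\<close>
  have low: "(L - \<bar>L\<bar> / 2) * (y - (-1)) \<le> u0 y - w y" and up: "u0 y - w y \<le> (L + \<bar>L\<bar> / 2) * (y - (-1))"
    if y: "-1 < y" "y < q" for y
  proof -
    have l: "((\<lambda>x. (u0 y - w y) - (u0 x - w x)) \<longlongrightarrow> (u0 y - w y) - 0) (at_right (-1))"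
      by (intro tendsto_diff tendsto_const lim0)
    have r: "((\<lambda>x. k * (y - x)) \<longlongrightarrow> k * (y - (-1))) (at_right (-1))" for k :: real
      by (intro tendsto_intros)
    have e: "eventually (\<lambda>x. (u0 y - w y) - (u0 x - w x) \<in> {(L - \<bar>L\<bar> / 2) * (y - x)..(L + \<bar>L\<bar> / 2) * (y - x)}) (at_right (-1))"
      using ev[OF y(1)] by eventually_elim (use diff[of _ y] int[of _ y] y in auto)
    have "eventually (\<lambda>x. (L - \<bar>L\<bar> / 2) * (y - x) \<le> (u0 y - w y) - (u0 x - w x)) (at_right (-1))"
      using e by eventually_elim simp
    then have "(L - \<bar>L\<bar> / 2) * (y - (-1)) \<le> (u0 y - w y) - 0"
      by (rule tendsto_le[OF trivial_limit_at_right_real l r])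
    moreover have "eventually (\<lambda>x. (u0 y - w y) - (u0 x - w x) \<le> (L + \<bar>L\<bar> / 2) * (y - x)) (at_right (-1))"
      using e by eventually_elim simp
    then have "(u0 y - w y) - 0 \<le> (L + \<bar>L\<bar> / 2) * (y - (-1))"
      by (rule tendsto_le[OF trivial_limit_at_right_real r l])
    ultimately show "(L - \<bar>L\<bar> / 2) * (y - (-1)) \<le> u0 y - w y" "u0 y - w y \<le> (L + \<bar>L\<bar> / 2) * (y - (-1))" by simp_all
  qed
  have "L > 0"
  proof (rule ccontr)
    assume "\<not> L > 0"
    then have "L < 0" using L0 by simp
    define y where "y = (q - 1) / 2"
    have y: "-1 < y" "y < q" using q by (auto simp: y_def)
    have "(L + \<bar>L\<bar> / 2) * (y - (-1)) < 0" using y \<open>L < 0\<close> by (intro mult_neg_pos) auto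
    then have "u0 y < w y" using up[OF y] by simp
    moreover have "w y \<le> u0 y" using u_traces(4)[of y] y q by simp
    ultimately show False by simp
  qed
  \<comment> \<open>For L > 0 the lower bound L - |L|/2 is L/2, the rate at which \<open>u\<close>
    leaves the obstacle.\<close>
  then have "\<forall>y\<in>{-1<..<q}. w y + L / 2 * \<bar>y - (-1)\<bar> \<le> u0 y" using low by force
  note ae = AE_imp[OF this]
  obtain b where "AE s in lebesgue. s \<in> {-1<..<q} \<longrightarrow> gx (-1) s = b * (s - (-1))"
    using gx_slope_end[OF _ _ _ q(2) _ _ J _ ae] q \<open>L > 0\<close> by auto
  then show ?thesis using gx_linear_traces(1)[of "-1" "-1" q b] q by auto
qed

text \<open>At 1 the inner slope of u - w is -L, so for L > 0 the function leaves the obstacle when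
  going to the left. The pieces are closed on the right, so the end point can be inserted directly,
  without the limit needed at -1.\<close>

lemma right_end_contact:
  assumes tr: "ltrace u 1 = w 1" and J: "J0 1 \<noteq> 0 \<or> J1 1 \<noteq> 0"
  shows "has_ltrace (D2 u) 1 0"
proof -
  have u01: "u0 1 = w 1" using tr u_traces(2)[of 1] by simp
  then have J0: "J0 1 = 0" using boundary_values(3) by simp
  define L where "L = J1 1"
  have L0: "L \<noteq> 0" using J J0 by (simp add: L_def)
  have w'1: "u1 1 - w' 1 = - L" using boundary_values(4) by (simp add: L_def)
  have "((\<lambda>y. u1 y - w' y) \<longlongrightarrow> u1 1 - w' 1) (at_left 1)"
    by (intro tendsto_diff rep_tendsto(4)[OF u_rep] cont_Icc_tendsto(2)[OF w'_cont]) auto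
  then have lim: "((\<lambda>y. u1 y - w' y) \<longlongrightarrow> - L) (at_left 1)" unfolding w'1 .
  have "finite S" using u_rep by (simp add: rep_def)
  have "eventually (\<lambda>y. y \<notin> S) (at_left 1)"
  proof -
    have "open (- (S - {1}))" by (intro open_Compl finite_imp_closed finite_Diff \<open>finite S\<close>)
    then have "eventually (\<lambda>y. y \<in> - (S - {1})) (nhds (1))" by (rule eventually_nhds_in_open) simp
    then show ?thesis unfolding eventually_at_filter by eventually_elim auto
  qed
  moreover have "eventually (\<lambda>y. \<bar>u1 y - w' y + L\<bar> < \<bar>L\<bar> / 2) (at_left 1)"
    using lim[unfolded tendsto_iff, rule_format, of "\<bar>L\<bar> / 2"] L0 by (simp add: dist_real_def)
  ultimately have "eventually (\<lambda>y. y \<notin> S \<and> \<bar>u1 y - w' y + L\<bar> < \<bar>L\<bar> / 2) (at_left 1)" by (rule eventually_conj)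
  then obtain p' where p': "p' < 1" "\<forall>y>p'. y < 1 \<longrightarrow> y \<notin> S \<and> \<bar>u1 y - w' y + L\<bar> < \<bar>L\<bar> / 2"
    unfolding eventually_at_left_field by auto
  define p where "p = max p' (-1)"
  have p: "p < 1" "-1 \<le> p" "\<And>y. p < y \<Longrightarrow> y < 1 \<Longrightarrow> y \<notin> S \<and> \<bar>u1 y - w' y + L\<bar> < \<bar>L\<bar> / 2"
    using p' by (auto simp: p_def)
  have Sp: "S \<inter> {p<..<1} = {}" using p(3) by auto
  have bd: "w y - u0 y \<in> {(- L - \<bar>L\<bar> / 2) * (1 - y)..(- L + \<bar>L\<bar> / 2) * (1 - y)}"
    if y: "p < y" "y < 1" for y
  proof -
    have "(u0 1 - w 1) - (u0 y - w y) = integral {y..1} (\<lambda>t. u1 t - w' t)"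
      by (rule u0_minus_w[of p 1]) (use y p Sp in auto)
    then have eq: "w y - u0 y = integral {y..1} (\<lambda>t. u1 t - w' t)" using u01 by simp
    have i: "(\<lambda>t. u1 t - w' t) integrable_on {y..1}"
      using AI_integrable_sub[OF rep_AI(2)[OF u_rep], of y 1] AI_integrable_sub[OF AI_w', of y 1] y p(2)
      by (intro integrable_diff) auto
    have b: "- L - \<bar>L\<bar> / 2 \<le> u1 t - w' t" "u1 t - w' t \<le> - L + \<bar>L\<bar> / 2" if "t \<in> {y..1}" for t
    proof -
      have "\<bar>u1 t - w' t + L\<bar> \<le> \<bar>L\<bar> / 2"
      proof (cases "t = 1")
        case False
        then show ?thesis using p(3)[of t] that y by auto
      qed (use w'1 in simp)
      then show "- L - \<bar>L\<bar> / 2 \<le> u1 t - w' t" "u1 t - w' t \<le> - L + \<bar>L\<bar> / 2"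
        unfolding abs_le_iff by linarith+
    qed
    have "integral {y..1} (\<lambda>t. - L - \<bar>L\<bar> / 2) \<le> integral {y..1} (\<lambda>t. u1 t - w' t)"
      by (rule integral_le) (use i b in auto)
    moreover have "integral {y..1} (\<lambda>t. u1 t - w' t) \<le> integral {y..1} (\<lambda>t. - L + \<bar>L\<bar> / 2)"
      by (rule integral_le) (use i b in auto)
    ultimately show ?thesis using y unfolding eq by (simp add: mult.commute)
  qed
  have "L > 0"
  proof (rule ccontr)
    assume "\<not> L > 0"
    then have "L < 0" using L0 by simp
    define y where "y = (p + 1) / 2"
    have y: "p < y" "y < 1" using p by (auto simp: y_def)
    have "(- L - \<bar>L\<bar> / 2) * (1 - y) > 0" using y \<open>L < 0\<close> by (intro mult_pos_pos) auto
    then have "u0 y < w y" using bd[OF y] by simp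
    moreover have "w y \<le> u0 y" using u_traces(4)[of y] y p by simp
    ultimately show False by simp
  qed
  then have "\<forall>y\<in>{p<..<1}. w y + L / 2 * \<bar>y - 1\<bar> \<le> u0 y" using bd by (force simp: algebra_simps)
  note ae = AE_imp[OF this]
  obtain b where "AE s in lebesgue. s \<in> {p<..<1} \<longrightarrow> gx 1 s = b * (s - 1)"
    using gx_slope_end[OF p(2) _ _ _ p(1) _ J _ ae] p \<open>L > 0\<close> by auto
  then show ?thesis using gx_linear_traces(2)[of p 1 1 b] p by auto
qed

section \<open>The conditions at all jump points\<close>

lemma interior_noncontact:
  assumes "J0 x \<noteq> 0 \<or> J1 x \<noteq> 0" "x \<noteq> -1" "x \<noteq> 1" "rtrace u x > w x" "ltrace u x > w x"
  shows "x \<in> noncontact w u"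
  using jump_inside[OF assms(1)] assms(2-5) by (auto simp: noncontact_def)

lemma contact_right:
  assumes "J0 x \<noteq> 0 \<or> J1 x \<noteq> 0" "x \<noteq> 1" "rtrace u x = w x"
  shows "\<exists>l\<ge>0. has_rtrace (D2 u) x l"
proof (cases "x = -1")
  case True
  then show ?thesis using left_end_contact assms by (intro exI[of _ 0]) auto
next
  case False
  then have "-1 < x" "x < 1" using jump_inside[OF assms(1)] assms(2) by auto
  then show ?thesis using kink_traces[OF _ _ assms(1)] by blast
qed

lemma contact_left:
  assumes "J0 x \<noteq> 0 \<or> J1 x \<noteq> 0" "x \<noteq> -1" "ltrace u x = w x"
  shows "\<exists>l\<ge>0. has_ltrace (D2 u) x l"
proof (cases "x = 1")
  case True
  then show ?thesis using right_end_contact assms by (intro exI[of _ 0]) auto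
next
  case False
  then have "-1 < x" "x < 1" using jump_inside[OF assms(1)] assms(2) by auto
  then show ?thesis using kink_traces[OF _ _ assms(1)] by blast
qed

end

theorem proposition3p11:
  fixes w f u :: "real \<Rightarrow> real" and \<alpha> \<beta> \<eta> \<mu> :: real
  assumes "C2_on_Icc (-2) 2 w" and "\<eta> > 0" and "\<mu> > 0" and "L2_on {-1<..<1} f"
    and "0 < \<beta>" and "\<beta> \<le> \<alpha>" and "\<alpha> \<le> 2 * \<beta>"
    and "u \<in> K w" and "\<forall>v \<in> K w. E1 \<alpha> \<beta> \<eta> \<mu> f w u \<le> E1 \<alpha> \<beta> \<eta> \<mu> f w v"
  shows "u \<in> K w \<and> variational_inequality \<eta> \<mu> f w u \<and>
    (\<forall>x \<in> disc u - {-1, 1}. rtrace u x > w x \<and> ltrace u x > w x \<longrightarrow>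
      has_rtrace (D2 u) x 0 \<and> has_ltrace (D2 u) x 0 \<and>
      has_rtrace (D3 u) x 0 \<and> has_ltrace (D3 u) x 0) \<and>
    (\<forall>x \<in> disc (D1 u) - (disc u \<union> {-1, 1}). rtrace u x > w x \<and> ltrace u x > w x \<longrightarrow>
      has_rtrace (D2 u) x 0 \<and> has_ltrace (D2 u) x 0 \<and>
      (\<exists>l. has_rtrace (D3 u) x l \<and> has_ltrace (D3 u) x l)) \<and>
    H2_on (noncontact w u) (D2 u) \<and>
    (\<forall>\<phi>. test_fun (noncontact w u) \<phi> \<longrightarrow>
      (LINT x:noncontact w u|lebesgue.
        \<eta> * D2 u x * (deriv ^^ 2) \<phi> x + \<mu> * (u x - w x) * \<phi> x) =
      (LINT x:noncontact w u|lebesgue. f x / 2 * \<phi> x)) \<and>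
    (- 1 \<notin> disc (D1 u) - disc u \<and> rtrace u (- 1) > w (- 1) \<longrightarrow>
      has_rtrace (D2 u) (- 1) 0 \<and> has_rtrace (D3 u) (- 1) 0) \<and>
    (1 \<notin> disc (D1 u) - disc u \<and> ltrace u 1 > w 1 \<longrightarrow>
      has_ltrace (D2 u) 1 0 \<and> has_ltrace (D3 u) 1 0) \<and>
    (- 1 \<in> disc (D1 u) - disc u \<and> rtrace u (- 1) > w (- 1) \<longrightarrow> has_rtrace (D2 u) (- 1) 0) \<and>
    (1 \<in> disc (D1 u) - disc u \<and> ltrace u 1 > w 1 \<longrightarrow> has_ltrace (D2 u) 1 0) \<and>
    (\<alpha> = \<beta> \<longrightarrow>
      (\<forall>x \<in> (disc u \<union> disc (D1 u)) - {-1, 1}. rtrace u x > w x \<and> ltrace u x > w x \<longrightarrow>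
        has_rtrace (D3 u) x 0 \<and> has_ltrace (D3 u) x 0) \<and>
      (- 1 \<in> disc u \<union> disc (D1 u) \<and> rtrace u (- 1) > w (- 1) \<longrightarrow> has_rtrace (D3 u) (- 1) 0) \<and>
      (1 \<in> disc u \<union> disc (D1 u) \<and> ltrace u 1 > w 1 \<longrightarrow> has_ltrace (D3 u) 1 0)) \<and>
    (\<forall>x \<in> (disc u \<union> disc (D1 u)) - {1}. rtrace u x = w x \<longrightarrow>
      (\<exists>l\<ge>0. has_rtrace (D2 u) x l)) \<and>
    (\<forall>x \<in> (disc u \<union> disc (D1 u)) - {-1}. ltrace u x = w x \<longrightarrow>
      (\<exists>l\<ge>0. has_ltrace (D2 u) x l))"
proof -
  obtain w' w'' where w': "\<forall>x\<in>{-2..2}. (w has_real_derivative w' x) (at x within {-2..2})"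
    and w'': "\<forall>x\<in>{-2..2}. (w' has_real_derivative w'' x) (at x within {-2..2})"
    using assms(1) unfolding C2_on_Icc_def by blast
  have w'c: "continuous_on {-2..2} w'"
    unfolding continuous_on_eq_continuous_within using w'' by (blast intro: DERIV_continuous)
  have "piecewise_H2 u" using assms(8) by (simp add: K_def)
  then obtain S J0 J1 u0 u1 u2 where p: "prep u S J0 J1 u0 u1 u2" using piecewise_H2_imp_prep by blast
  interpret obstacle w w' f u \<alpha> \<beta> \<eta> \<mu> S J0 J1 u0 u1 u2
    by unfold_locales (use w' w'c assms p in auto)
  have a: "has_rtrace (D2 u) x 0 \<and> has_ltrace (D2 u) x 0 \<and> has_rtrace (D3 u) x 0 \<and> has_ltrace (D3 u) x 0"
    if x: "x \<in> disc u - {-1, 1}" "rtrace u x > w x \<and> ltrace u x > w x" for x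
    using jump_free[OF interior_noncontact[of x]] x by (simp add: disc_iff)
  have b: "has_rtrace (D2 u) x 0 \<and> has_ltrace (D2 u) x 0 \<and> (\<exists>l. has_rtrace (D3 u) x l \<and> has_ltrace (D3 u) x l)"
    if x: "x \<in> disc (D1 u) - (disc u \<union> {-1, 1})" "rtrace u x > w x \<and> ltrace u x > w x" for x
    using jump_slope[OF interior_noncontact[of x]] x by (auto simp: disc_iff)
  have f1: "has_rtrace (D3 u) x 0 \<and> has_ltrace (D3 u) x 0"
    if x: "\<alpha> = \<beta>" "x \<in> disc u \<union> disc (D1 u) - {-1, 1}" "rtrace u x > w x \<and> ltrace u x > w x" for x
    using jump_free[OF interior_noncontact[of x]] x by (auto simp: disc_iff)
  have g: "\<exists>l\<ge>0. has_rtrace (D2 u) x l" if "x \<in> disc u \<union> disc (D1 u) - {1}" "rtrace u x = w x" for x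
    using contact_right[of x] that by (auto simp: disc_iff)
  have h: "\<exists>l\<ge>0. has_ltrace (D2 u) x l" if "x \<in> disc u \<union> disc (D1 u) - {-1}" "ltrace u x = w x" for x
    using contact_left[of x] that by (auto simp: disc_iff)
  show ?thesis
    \<comment> \<open>An end point off contact always has a value jump, so
      \<open>left_end_free\<close> and \<open>right_end_free\<close> settle (d), (e) and the end
      point clauses of (f) together.\<close>
    by (intro conjI ballI allI impI uK variational H2_noncontact noncontact_equation; (elim conjE)?)
      (use a b f1 g h left_end_free(2) right_end_free(2) in blast)+
qed

end
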